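(* The following is provable in $\mathbf{ACA}_0$. The following three statements are equivalent: (1) If $T$ is a normal dilator, then $D^{\partial T}_X$ is well-founded for any well-order $X$. (2) Any normal dilator $T$ has an upper derivative $(S,\xi)$ such that $X\mapsto D^S_X$ preserves well-foundedness, i.e. $D^S_X$ is well-founded for every well-order $X$ (which means that $S$ is again a normal dilator). (3) The principle of $\Pi^1_1$-bar induction is valid, i.e. for every well-order $X=(X,<_X)$ and every $\Pi^1_1$-formula $\varphi(x)$ (with parameters) we have $\forall_{x\in X}(\forall_{y<_Xx}\varphi(y)\rightarrow\varphi(x))\rightarrow\forall_{x\in X}\varphi(x)$.
   Context: We work in second order arithmetic; all orders have fields contained in $\mathbb N$, and finite objects are coded by natural numbers. Statements (1) and (2) are single formulas; (3) is expressed by a single formula via a truth definition for $\Pi^1_1$-sentences. Basic notation. Morphisms of linear orders are strictly increasing maps (embeddings). $[X]^{<\omega}$ is the set of finite subsets of $X$, and $[f]^{<\omega}(a)=\{f(x)\mid x\in a\}$. Write $n=\{0,\dots,n-1\}$ with the usual order; the category of natural numbers has these finite orders as objects and strictly increasing maps as morphisms. For a finite linear order $a$, $|a|$ is its cardinality (also viewed as the order $\{0,\dots,|a|-1\}$) and $\mathrm{en}_a:|a|\to a$ is the increasing enumeration. For an embedding $f:a\to b$ of finite orders, $|f|:|a|\to|b|$ is the unique increasing map with $\mathrm{en}_b\circ|f|=f\circ\mathrm{en}_a$. For $a\subseteq c$, $\iota_a^c:a\hookrightarrow c$ is the inclusion. For $a\in[X]^{<\omega}$ and $x\in X$, $a<^{\mathrm{fin}}_X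 x$ means $y<_Xx$ for all $y\in a$. Prae-dilators. A (coded) prae-dilator consists of a functor $T$ from the category of natural numbers to linear orders with fields $T_n\subseteq\mathbb N$ (action on morphisms written $T_f$) and a natural transformation $\mathrm{supp}^T:T\Rightarrow[\cdot]^{<\omega}$ such that any $\sigma\in T_n$ lies in the range of $T_{\iota\circ\mathrm{en}_a}$, where $a=\mathrm{supp}^T_n(\sigma)$ and $\iota:a\hookrightarrow n$ is the inclusion. For a linear order $X$ put $D^T_X=D^T(X)=\{\langle a,\sigma\rangle\mid a\in[X]^{<\omega},\ \sigma\in T_{|a|},\ \mathrm{supp}^T_{|a|}(\sigma)=|a|\}$, ordered by $\langle a,\sigma\rangle<\langle b,\tau\rangle$ iff $T_{|\iota_a^{a\cup b}|}(\sigma)<_{T_{|a\cup b|}}T_{|\iota_b^{a\cup b}|}(\tau)$; for an embedding $f:X\to Y$ put $D^T_f(\langle a,\sigma\rangle)=D^T(f)(\langle a,\sigma\rangle)=\langle[f]^{<\omega}(a),\sigma\rangle$. $T$ is a dilator if $D^T_X$ is well-founded for every well-order $X$. A normal prae-dilator is a prae-dilator $T$ with a natural family of order embeddings $\mu^T_n:n\to T_n$ such that $\sigma<_{T_n}\mu^T_n(m)\Leftrightarrow\mathrm{supp}^T_n(\sigma)<^{\mathrm{fin}}m$ for all $m<n$ and $\sigma\in T_n$; a normal dilator is a normal prae-dilator that is a dilator. Upper derivatives. For normal prae-dilators $T,S$, the composition $T\circ S$ is given by $(T\circ S)_n=D^T(S_n)$, $(T\circ S)_f=D^T(S_f)$,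 $\mathrm{supp}^{T\circ S}_n(\langle a,\tau\rangle)=\bigcup_{\sigma\in a}\mathrm{supp}^S_n(\sigma)$, $\mu^{T\circ S}_n(m)=\langle\{\mu^S_n(m)\},\mu^T_1(0)\rangle$. A morphism $T\Rightarrow S$ of normal prae-dilators is a natural transformation $\nu$ (with order embeddings $\nu_n:T_n\to S_n$) such that $\nu_n\circ\mu^T_n=\mu^S_n$ for all $n$. An upper derivative of a normal prae-dilator $T$ is a pair $(S,\xi)$ of a normal prae-dilator $S$ and a morphism $\xi:T\circ S\Rightarrow S$ of normal prae-dilators. The normal prae-dilator $\partial T$. Given a normal prae-dilator $T$, the term systems $\partial T_n$ are defined inductively: (i) there is a term $\mu_m\in\partial T_n$ for each $m<n$; (ii) for each finite set $a\subseteq\partial T_n$ of terms and each $\sigma\in T_{|a|}$ with $\mathrm{supp}^T_{|a|}(\sigma)=|a|$ there is a term $\xi\langle a,\sigma\rangle\in\partial T_n$, provided that if $a=\{\mu_m\}$ for some $m<n$ then $\sigma\neq\mu^T_1(0)$. With $\ulcorner s\urcorner$ the Gödel number of $s$, put $L_n(\mu_m)=\ulcorner\mu_m\urcorner$ and $L_n(\xi\langle a,\sigma\rangle)=\max\{\ulcorner\xi\langle a,\sigma\rangle\urcorner,1+\sum_{t\in a}2\cdot L_n(t)\}$. By recursion on $L_n(s)+L_n(t)$, $s<_{\partial T_n}t$ holds iff one of the following does: $s=\mu_m$, $t=\mu_k$ and $m<k$; or $s=\mu_m$, $t=\xi\langle b,\tau\rangle$ and $s\leq_{\partial T_n}r$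 for some $r\in b$ ($\leq$ means $<$ or equality of terms); or $s=\xi\langle a,\sigma\rangle$, $t=\mu_k$ and $r<_{\partial T_n}t$ for all $r\in a$; or $s=\xi\langle a,\sigma\rangle$, $t=\xi\langle b,\tau\rangle$, the restriction of $<_{\partial T_n}$ to $a\cup b$ is linear, and $T_{|\iota_a^{a\cup b}|}(\sigma)<_{T_{|a\cup b|}}T_{|\iota_b^{a\cup b}|}(\tau)$. For strictly increasing $f:n\to l$ put $\partial T_f(\mu_m)=\mu_{f(m)}$, $\partial T_f(\xi\langle a,\sigma\rangle)=\xi\langle[\partial T_f]^{<\omega}(a),\sigma\rangle$. Put $\mathrm{supp}^{\partial T}_n(\mu_m)=\{m\}$, $\mathrm{supp}^{\partial T}_n(\xi\langle a,\sigma\rangle)=\bigcup_{t\in a}\mathrm{supp}^{\partial T}_n(t)$ and $\mu^{\partial T}_n(m)=\mu_m$. These data form a normal prae-dilator $\partial T$, so that $D^{\partial T}_X$ is defined. *)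

theory Defs
  imports Main
begin

section \<open>The two-sorted language of second order arithmetic\<close>

text \<open>Both sorts use de Bruijn indices, counted separately: \<open>All0\<close> binds the number variable 0,
  \<open>All1\<close> binds the set variable 0. Equality of sets is not primitive.\<close>

datatype tm = Var nat | Zero | One | Add tm tm | Mul tm tm

datatype fm =
    Fls
  | Eq tm tm
  | Less tm tm
  | Mem tm nat
  | Imp fm fm
  | All0 fm
  | All1 fm

primrec lift_tm :: "nat \<Rightarrow> tm \<Rightarrow> tm" where
  "lift_tm k (Var i) = Var (if i < k then i else Suc i)"
| "lift_tm k Zero = Zero"
| "lift_tm k One = One"
| "lift_tm k (Add s t) = Add (lift_tm k s) (lift_tm k t)"
| "lift_tm k (Mul s t) = Mul (lift_tm k s) (lift_tm k t)"

primrec subst_tm :: "nat \<Rightarrow> tm \<Rightarrow> tm \<Rightarrow> tm" where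
  "subst_tm k u (Var i) = (if i < k then Var i else if i = k then u else Var (i - 1))"
| "subst_tm k u Zero = Zero"
| "subst_tm k u One = One"
| "subst_tm k u (Add s t) = Add (subst_tm k u s) (subst_tm k u t)"
| "subst_tm k u (Mul s t) = Mul (subst_tm k u s) (subst_tm k u t)"

primrec lift0 :: "nat \<Rightarrow> fm \<Rightarrow> fm" where
  "lift0 k Fls = Fls"
| "lift0 k (Eq s t) = Eq (lift_tm k s) (lift_tm k t)"
| "lift0 k (Less s t) = Less (lift_tm k s) (lift_tm k t)"
| "lift0 k (Mem t X) = Mem (lift_tm k t) X"
| "lift0 k (Imp p q) = Imp (lift0 k p) (lift0 k q)"
| "lift0 k (All0 p) = All0 (lift0 (Suc k) p)"
| "lift0 k (All1 p) = All1 (lift0 k p)"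

primrec lift1 :: "nat \<Rightarrow> fm \<Rightarrow> fm" where
  "lift1 k Fls = Fls"
| "lift1 k (Eq s t) = Eq s t"
| "lift1 k (Less s t) = Less s t"
| "lift1 k (Mem t X) = Mem t (if X < k then X else Suc X)"
| "lift1 k (Imp p q) = Imp (lift1 k p) (lift1 k q)"
| "lift1 k (All0 p) = All0 (lift1 k p)"
| "lift1 k (All1 p) = All1 (lift1 (Suc k) p)"

primrec subst0 :: "nat \<Rightarrow> tm \<Rightarrow> fm \<Rightarrow> fm" where
  "subst0 k u Fls = Fls"
| "subst0 k u (Eq s t) = Eq (subst_tm k u s) (subst_tm k u t)"
| "subst0 k u (Less s t) = Less (subst_tm k u s) (subst_tm k u t)"
| "subst0 k u (Mem t X) = Mem (subst_tm k u t) X"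
| "subst0 k u (Imp p q) = Imp (subst0 k u p) (subst0 k u q)"
| "subst0 k u (All0 p) = All0 (subst0 (Suc k) (lift_tm 0 u) p)"
| "subst0 k u (All1 p) = All1 (subst0 k u p)"

primrec subst1 :: "nat \<Rightarrow> nat \<Rightarrow> fm \<Rightarrow> fm" where
  "subst1 k Y Fls = Fls"
| "subst1 k Y (Eq s t) = Eq s t"
| "subst1 k Y (Less s t) = Less s t"
| "subst1 k Y (Mem t X) = Mem t (if X < k then X else if X = k then Y else X - 1)"
| "subst1 k Y (Imp p q) = Imp (subst1 k Y p) (subst1 k Y q)"
| "subst1 k Y (All0 p) = All0 (subst1 k Y p)"
| "subst1 k Y (All1 p) = All1 (subst1 (Suc k) (Suc Y) p)"

text \<open>Classical natural deduction for two-sorted first order logic with equality. Lifting the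
  context in the two introduction rules for quantifiers is the eigenvariable condition.\<close>

inductive derives :: "fm set \<Rightarrow> fm \<Rightarrow> bool" (infix "\<turnstile>" 20) where
  Assm: "p \<in> \<Gamma> \<Longrightarrow> \<Gamma> \<turnstile> p"
| ImpI: "insert p \<Gamma> \<turnstile> q \<Longrightarrow> \<Gamma> \<turnstile> Imp p q"
| ImpE: "\<Gamma> \<turnstile> Imp p q \<Longrightarrow> \<Gamma> \<turnstile> p \<Longrightarrow> \<Gamma> \<turnstile> q"
| Contr: "insert (Imp p Fls) \<Gamma> \<turnstile> Fls \<Longrightarrow> \<Gamma> \<turnstile> p"
| All0I: "lift0 0 ` \<Gamma> \<turnstile> p \<Longrightarrow> \<Gamma> \<turnstile> All0 p"
| All0E: "\<Gamma> \<turnstile> All0 p \<Longrightarrow> \<Gamma> \<turnstile> subst0 0 t p"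
| All1I: "lift1 0 ` \<Gamma> \<turnstile> p \<Longrightarrow> \<Gamma> \<turnstile> All1 p"
| All1E: "\<Gamma> \<turnstile> All1 p \<Longrightarrow> \<Gamma> \<turnstile> subst1 0 Y p"
| EqRefl: "\<Gamma> \<turnstile> Eq t t"
| EqSubst: "\<Gamma> \<turnstile> Eq s t \<Longrightarrow> \<Gamma> \<turnstile> subst0 0 s p \<Longrightarrow> \<Gamma> \<turnstile> subst0 0 t p"

section \<open>Writing formulas with named variables\<close>

text \<open>A \<open>form\<close> is a formula in the scope of a given number of number and set quantifiers. A variable
  is represented by the depth at which it was bound, from which its index at any larger depth is
  computed; so formulas can be written in higher order abstract syntax. The quantifiers
  \<open>\<forall>\<^sub>0\<close>, \<open>\<exists>\<^sub>0\<close> range over numbers and \<open>\<forall>\<^sub>1\<close>, \<open>\<exists>\<^sub>1\<close> over sets.\<close>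

type_synonym nterm = "nat \<Rightarrow> tm"
type_synonym sterm = "nat \<Rightarrow> nat"
type_synonym form = "nat \<Rightarrow> nat \<Rightarrow> fm"

definition sentence :: "form \<Rightarrow> fm" where
  "sentence F = F 0 0"

definition num_all :: "(nterm \<Rightarrow> form) \<Rightarrow> form" (binder "\<forall>\<^sub>0" 10) where
  "(\<forall>\<^sub>0 x. F x) = (\<lambda>d e. All0 (F (\<lambda>d'. Var (d' - Suc d)) (Suc d) e))"

definition set_all :: "(sterm \<Rightarrow> form) \<Rightarrow> form" (binder "\<forall>\<^sub>1" 10) where
  "(\<forall>\<^sub>1 X. F X) = (\<lambda>d e. All1 (F (\<lambda>e'. e' - Suc e) d (Suc e)))"

definition f_imp :: "form \<Rightarrow> form \<Rightarrow> form" (infixr "\<^bold>\<longrightarrow>" 25) where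
  "(F \<^bold>\<longrightarrow> G) = (\<lambda>d e. Imp (F d e) (G d e))"

definition f_not :: "form \<Rightarrow> form" ("\<^bold>\<not> _" [40] 40) where
  "(\<^bold>\<not> F) = (\<lambda>d e. Imp (F d e) Fls)"

definition f_or :: "form \<Rightarrow> form \<Rightarrow> form" (infixr "\<^bold>\<or>" 30) where
  "(F \<^bold>\<or> G) = (\<^bold>\<not> F \<^bold>\<longrightarrow> G)"

definition f_and :: "form \<Rightarrow> form \<Rightarrow> form" (infixr "\<^bold>\<and>" 35) where
  "(F \<^bold>\<and> G) = (\<^bold>\<not> (F \<^bold>\<longrightarrow> \<^bold>\<not> G))"

definition f_iff :: "form \<Rightarrow> form \<Rightarrow> form" (infixr "\<^bold>\<longleftrightarrow>" 25) where
  "(F \<^bold>\<longleftrightarrow> G) = ((F \<^bold>\<longrightarrow> G) \<^bold>\<and> (G \<^bold>\<longrightarrow> F))"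

definition num_ex :: "(nterm \<Rightarrow> form) \<Rightarrow> form" (binder "\<exists>\<^sub>0" 10) where
  "(\<exists>\<^sub>0 x. F x) = (\<^bold>\<not> (\<forall>\<^sub>0 x. \<^bold>\<not> F x))"

definition set_ex :: "(sterm \<Rightarrow> form) \<Rightarrow> form" (binder "\<exists>\<^sub>1" 10) where
  "(\<exists>\<^sub>1 X. F X) = (\<^bold>\<not> (\<forall>\<^sub>1 X. \<^bold>\<not> F X))"

definition f_eq :: "nterm \<Rightarrow> nterm \<Rightarrow> form" (infix "\<^bold>=" 50) where
  "(s \<^bold>= t) = (\<lambda>d e. Eq (s d) (t d))"

definition f_less :: "nterm \<Rightarrow> nterm \<Rightarrow> form" (infix "\<^bold><" 50) where
  "(s \<^bold>< t) = (\<lambda>d e. Less (s d) (t d))"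

definition f_mem :: "nterm \<Rightarrow> sterm \<Rightarrow> form" (infix "\<^bold>\<in>" 50) where
  "(t \<^bold>\<in> X) = (\<lambda>d e. Mem (t d) (X e))"

definition n_add :: "nterm \<Rightarrow> nterm \<Rightarrow> nterm" (infixl "\<^bold>+" 65) where
  "s \<^bold>+ t = (\<lambda>d. Add (s d) (t d))"

definition n_mul :: "nterm \<Rightarrow> nterm \<Rightarrow> nterm" (infixl "\<^bold>*" 70) where
  "s \<^bold>* t = (\<lambda>d. Mul (s d) (t d))"

primrec num :: "nat \<Rightarrow> nterm" where
  "num 0 = (\<lambda>d. Zero)"
| "num (Suc n) = num n \<^bold>+ (\<lambda>d. One)"

abbreviation n_zero :: nterm ("\<^bold>0") where "\<^bold>0 \<equiv> \<lambda>d. Zero"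
abbreviation n_one :: nterm ("\<^bold>1") where "\<^bold>1 \<equiv> \<lambda>d. One"

section \<open>The theory ACA0\<close>

definition basic_axioms :: "fm set" where
  "basic_axioms = sentence `
    {\<forall>\<^sub>0 m. \<^bold>\<not> m \<^bold>+ \<^bold>1 \<^bold>= \<^bold>0,
     \<forall>\<^sub>0 m n. m \<^bold>+ \<^bold>1 \<^bold>= n \<^bold>+ \<^bold>1 \<^bold>\<longrightarrow> m \<^bold>= n,
     \<forall>\<^sub>0 m. m \<^bold>+ \<^bold>0 \<^bold>= m,
     \<forall>\<^sub>0 m n. m \<^bold>+ (n \<^bold>+ \<^bold>1) \<^bold>= (m \<^bold>+ n) \<^bold>+ \<^bold>1,
     \<forall>\<^sub>0 m. m \<^bold>* \<^bold>0 \<^bold>= \<^bold>0,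
     \<forall>\<^sub>0 m n. m \<^bold>* (n \<^bold>+ \<^bold>1) \<^bold>= m \<^bold>* n \<^bold>+ m,
     \<forall>\<^sub>0 m. \<^bold>\<not> m \<^bold>< \<^bold>0,
     \<forall>\<^sub>0 m n. m \<^bold>< n \<^bold>+ \<^bold>1 \<^bold>\<longleftrightarrow> (m \<^bold>< n \<^bold>\<or> m \<^bold>= n)}"

definition induction_axiom :: fm where
  "induction_axiom = sentence
    (\<forall>\<^sub>1 X. \<^bold>0 \<^bold>\<in> X \<^bold>\<and> (\<forall>\<^sub>0 n. n \<^bold>\<in> X \<^bold>\<longrightarrow> n \<^bold>+ \<^bold>1 \<^bold>\<in> X) \<^bold>\<longrightarrow> (\<forall>\<^sub>0 n. n \<^bold>\<in> X))"

primrec arithmetical :: "fm \<Rightarrow> bool" where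
  "arithmetical Fls \<longleftrightarrow> True"
| "arithmetical (Eq s t) \<longleftrightarrow> True"
| "arithmetical (Less s t) \<longleftrightarrow> True"
| "arithmetical (Mem t X) \<longleftrightarrow> True"
| "arithmetical (Imp p q) \<longleftrightarrow> arithmetical p \<and> arithmetical q"
| "arithmetical (All0 p) \<longleftrightarrow> arithmetical p"
| "arithmetical (All1 p) \<longleftrightarrow> False"

primrec tm_below :: "nat \<Rightarrow> tm \<Rightarrow> bool" where
  "tm_below k (Var i) \<longleftrightarrow> i < k"
| "tm_below k Zero \<longleftrightarrow> True"
| "tm_below k One \<longleftrightarrow> True"
| "tm_below k (Add s t) \<longleftrightarrow> tm_below k s \<and> tm_below k t"
| "tm_below k (Mul s t) \<longleftrightarrow> tm_below k s \<and> tm_below k t"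

text \<open>\<open>fm_below k l p\<close>: the free number variables of \<open>p\<close> are below \<open>k\<close>, its free set variables
  below \<open>l\<close>.\<close>

primrec fm_below :: "nat \<Rightarrow> nat \<Rightarrow> fm \<Rightarrow> bool" where
  "fm_below k l Fls \<longleftrightarrow> True"
| "fm_below k l (Eq s t) \<longleftrightarrow> tm_below k s \<and> tm_below k t"
| "fm_below k l (Less s t) \<longleftrightarrow> tm_below k s \<and> tm_below k t"
| "fm_below k l (Mem t X) \<longleftrightarrow> tm_below k t \<and> X < l"
| "fm_below k l (Imp p q) \<longleftrightarrow> fm_below k l p \<and> fm_below k l q"
| "fm_below k l (All0 p) \<longleftrightarrow> fm_below (Suc k) l p"
| "fm_below k l (All1 p) \<longleftrightarrow> fm_below k (Suc l) p"

text \<open>The instance for \<open>p(n)\<close>, where \<open>n\<close> is the number variable 0 of \<open>p\<close>, the remaining free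
  variables are parameters, and lifting ensures that the set asserted to exist is not among
  them.\<close>

definition comprehension :: "fm \<Rightarrow> fm" where
  "comprehension p =
    (let ex = (\<lambda>q. Imp (All1 (Imp q Fls)) Fls);
         iff = (\<lambda>q r. Imp (Imp (Imp q r) (Imp (Imp r q) Fls)) Fls)
     in ex (All0 (iff (Mem (Var 0) 0) (lift1 0 p))))"

definition ACA0 :: "fm set" where
  "ACA0 = basic_axioms \<union> {induction_axiom} \<union>
    {(All0 ^^ k) ((All1 ^^ l) (comprehension p)) | p k l.
       arithmetical p \<and> fm_below k l (comprehension p)}"

section \<open>Coding of finite objects\<close>

definition n_pair :: "nterm \<Rightarrow> nterm \<Rightarrow> nterm" ("\<langle>_,/ _\<rangle>") where
  "\<langle>s, t\<rangle> = (s \<^bold>+ t) \<^bold>* (s \<^bold>+ t) \<^bold>+ s"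

text \<open>Membership in the finite set with code \<open>a\<close>: a triple \<open>(k, m, n)\<close> codes the set of all \<open>x < k\<close>
  such that \<open>m(x+1)+1\<close> divides \<open>n\<close>. Every finite set has such a code; the official code, singled
  out by \<open>finset\<close>, is the least number with the given elements, so that finite sets are equal iff
  their codes are. Elements are smaller than codes.\<close>

definition in_fin :: "nterm \<Rightarrow> nterm \<Rightarrow> form" (infix "\<^bold>\<in>\<^sub>f" 50) where
  "(x \<^bold>\<in>\<^sub>f a) = (\<exists>\<^sub>0 k m n. a \<^bold>= \<langle>k, \<langle>m, n\<rangle>\<rangle> \<^bold>\<and> x \<^bold>< k \<^bold>\<and> (\<exists>\<^sub>0 q. n \<^bold>= q \<^bold>* (m \<^bold>* (x \<^bold>+ \<^bold>1) \<^bold>+ \<^bold>1)))"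

definition finset :: "nterm \<Rightarrow> form" where
  "finset a = (\<forall>\<^sub>0 b. b \<^bold>< a \<^bold>\<longrightarrow> \<^bold>\<not> (\<forall>\<^sub>0 x. x \<^bold>\<in>\<^sub>f b \<^bold>\<longleftrightarrow> x \<^bold>\<in>\<^sub>f a))"

text \<open>\<open>a\<close> is the code of the set of all \<open>x\<close> with \<open>F x\<close>.\<close>

definition codes :: "nterm \<Rightarrow> (nterm \<Rightarrow> form) \<Rightarrow> form" where
  "codes a F = (finset a \<^bold>\<and> (\<forall>\<^sub>0 x. x \<^bold>\<in>\<^sub>f a \<^bold>\<longleftrightarrow> F x))"

definition fin_subset :: "nterm \<Rightarrow> (nterm \<Rightarrow> form) \<Rightarrow> form" where
  "fin_subset a F = (finset a \<^bold>\<and> (\<forall>\<^sub>0 x. x \<^bold>\<in>\<^sub>f a \<^bold>\<longrightarrow> F x))"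

text \<open>\<open>b = [F]\<^sup><\<^sup>\<omega>(a)\<close>, for a function given by its graph.\<close>

definition image_fin :: "(nterm \<Rightarrow> nterm \<Rightarrow> form) \<Rightarrow> nterm \<Rightarrow> nterm \<Rightarrow> form" where
  "image_fin F a b = codes b (\<lambda>y. \<exists>\<^sub>0 x. x \<^bold>\<in>\<^sub>f a \<^bold>\<and> F x y)"

text \<open>\<open>f\<close> codes (the graph of) a strictly increasing function from \<open>{0,\<dots>,n-1}\<close> to
  \<open>{0,\<dots>,l-1}\<close>.\<close>

definition mor :: "nterm \<Rightarrow> nterm \<Rightarrow> nterm \<Rightarrow> form" where
  "mor f n l = (fin_subset f (\<lambda>p. \<exists>\<^sub>0 i j. p \<^bold>= \<langle>i, j\<rangle> \<^bold>\<and> i \<^bold>< n \<^bold>\<and> j \<^bold>< l)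
     \<^bold>\<and> (\<forall>\<^sub>0 i. i \<^bold>< n \<^bold>\<longrightarrow> (\<exists>\<^sub>0 j. \<langle>i, j\<rangle> \<^bold>\<in>\<^sub>f f))
     \<^bold>\<and> (\<forall>\<^sub>0 i j i' j'. \<langle>i, j\<rangle> \<^bold>\<in>\<^sub>f f \<^bold>\<and> \<langle>i', j'\<rangle> \<^bold>\<in>\<^sub>f f \<^bold>\<longrightarrow>
          (i \<^bold>= i' \<^bold>\<longrightarrow> j \<^bold>= j') \<^bold>\<and> (i \<^bold>< i' \<^bold>\<longrightarrow> j \<^bold>< j')))"

text \<open>\<open>n = |a|\<close>, and \<open>e\<close> codes (the graph of) the increasing enumeration \<open>en\<^sub>a : n \<rightarrow> a\<close> of the
  finite set \<open>a\<close> with respect to the order \<open>L\<close>.\<close>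

definition enumerates ::
  "(nterm \<Rightarrow> nterm \<Rightarrow> form) \<Rightarrow> nterm \<Rightarrow> nterm \<Rightarrow> nterm \<Rightarrow> form" where
  "enumerates L a n e =
    (fin_subset e (\<lambda>p. \<exists>\<^sub>0 i x. p \<^bold>= \<langle>i, x\<rangle> \<^bold>\<and> i \<^bold>< n \<^bold>\<and> x \<^bold>\<in>\<^sub>f a)
     \<^bold>\<and> (\<forall>\<^sub>0 i. i \<^bold>< n \<^bold>\<longrightarrow> (\<exists>\<^sub>0 x. \<langle>i, x\<rangle> \<^bold>\<in>\<^sub>f e))
     \<^bold>\<and> (\<forall>\<^sub>0 x. x \<^bold>\<in>\<^sub>f a \<^bold>\<longrightarrow> (\<exists>\<^sub>0 i. \<langle>i, x\<rangle> \<^bold>\<in>\<^sub>f e))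
     \<^bold>\<and> (\<forall>\<^sub>0 i x j y. \<langle>i, x\<rangle> \<^bold>\<in>\<^sub>f e \<^bold>\<and> \<langle>j, y\<rangle> \<^bold>\<in>\<^sub>f e \<^bold>\<longrightarrow>
          (i \<^bold>= j \<^bold>\<longrightarrow> x \<^bold>= y) \<^bold>\<and> (i \<^bold>< j \<^bold>\<longrightarrow> L x y)))"

definition card_fin :: "nterm \<Rightarrow> nterm \<Rightarrow> form" where
  "card_fin a n = (\<exists>\<^sub>0 e. enumerates (\<^bold><) a n e)"

text \<open>For \<open>a \<subseteq> c\<close>: \<open>k = |a|\<close>, \<open>l = |c|\<close> and \<open>f = |\<iota>\<^sub>a\<^sup>c|\<close>, with respect to the order \<open>L\<close>.\<close>

definition inclusion_mor ::
  "(nterm \<Rightarrow> nterm \<Rightarrow> form) \<Rightarrow> nterm \<Rightarrow> nterm \<Rightarrow> nterm \<Rightarrow> nterm \<Rightarrow> nterm \<Rightarrow> form" where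
  "inclusion_mor L a c k l f =
    (\<exists>\<^sub>0 u v. enumerates L a k u \<^bold>\<and> enumerates L c l v \<^bold>\<and> mor f k l
      \<^bold>\<and> (\<forall>\<^sub>0 i j x. \<langle>i, j\<rangle> \<^bold>\<in>\<^sub>f f \<^bold>\<and> \<langle>i, x\<rangle> \<^bold>\<in>\<^sub>f u \<^bold>\<longrightarrow> \<langle>j, x\<rangle> \<^bold>\<in>\<^sub>f v))"

section \<open>Orders\<close>

text \<open>An order is given by its field \<open>A\<close> and a strict relation \<open>L\<close>, of which only the restriction to
  \<open>A\<close> is relevant. Both may be definable classes.\<close>

definition linear_order :: "(nterm \<Rightarrow> form) \<Rightarrow> (nterm \<Rightarrow> nterm \<Rightarrow> form) \<Rightarrow> form" where
  "linear_order A L =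
    ((\<forall>\<^sub>0 x. A x \<^bold>\<longrightarrow> \<^bold>\<not> L x x)
     \<^bold>\<and> (\<forall>\<^sub>0 x y z. A x \<^bold>\<and> A y \<^bold>\<and> A z \<^bold>\<and> L x y \<^bold>\<and> L y z \<^bold>\<longrightarrow> L x z)
     \<^bold>\<and> (\<forall>\<^sub>0 x y. A x \<^bold>\<and> A y \<^bold>\<longrightarrow> L x y \<^bold>\<or> x \<^bold>= y \<^bold>\<or> L y x))"

definition well_founded :: "(nterm \<Rightarrow> form) \<Rightarrow> (nterm \<Rightarrow> nterm \<Rightarrow> form) \<Rightarrow> form" where
  "well_founded A L =
    (\<^bold>\<not> (\<exists>\<^sub>1 G. (\<forall>\<^sub>0 n. \<exists>\<^sub>0 x. \<langle>n, x\<rangle> \<^bold>\<in> G)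
        \<^bold>\<and> (\<forall>\<^sub>0 n x. \<langle>n, x\<rangle> \<^bold>\<in> G \<^bold>\<longrightarrow> A x)
        \<^bold>\<and> (\<forall>\<^sub>0 n x y. \<langle>n, x\<rangle> \<^bold>\<in> G \<^bold>\<and> \<langle>n, y\<rangle> \<^bold>\<in> G \<^bold>\<longrightarrow> x \<^bold>= y)
        \<^bold>\<and> (\<forall>\<^sub>0 n x y. \<langle>n, x\<rangle> \<^bold>\<in> G \<^bold>\<and> \<langle>n \<^bold>+ \<^bold>1, y\<rangle> \<^bold>\<in> G \<^bold>\<longrightarrow> L y x)))"

abbreviation set_field :: "sterm \<Rightarrow> nterm \<Rightarrow> form" where
  "set_field X \<equiv> \<lambda>x. x \<^bold>\<in> X"

abbreviation set_rel :: "sterm \<Rightarrow> nterm \<Rightarrow> nterm \<Rightarrow> form" where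
  "set_rel R \<equiv> \<lambda>x y. \<langle>x, y\<rangle> \<^bold>\<in> R"

definition well_order :: "sterm \<Rightarrow> sterm \<Rightarrow> form" where
  "well_order X R =
    (linear_order (set_field X) (set_rel R) \<^bold>\<and> well_founded (set_field X) (set_rel R))"

section \<open>Normal prae-dilators\<close>

text \<open>The data of a normal prae-dilator:
  \<open>fld T n s\<close> is \<open>s \<in> T\<^sub>n\<close>,
  \<open>lss T n s t\<close> is \<open>s < t\<close> in \<open>T\<^sub>n\<close>,
  \<open>act T n l f s t\<close> is \<open>T\<^sub>f(s) = t\<close> for \<open>f : n \<rightarrow> l\<close>,
  \<open>spp T n s a\<close> is \<open>supp\<^sub>n(s) = a\<close>, and
  \<open>mu T n m s\<close> is \<open>\<mu>\<^sub>n(m) = s\<close>.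
  Each component matters only for arguments from the appropriate domains.\<close>

record praedil =
  fld :: "nterm \<Rightarrow> nterm \<Rightarrow> form"
  lss :: "nterm \<Rightarrow> nterm \<Rightarrow> nterm \<Rightarrow> form"
  act :: "nterm \<Rightarrow> nterm \<Rightarrow> nterm \<Rightarrow> nterm \<Rightarrow> nterm \<Rightarrow> form"
  spp :: "nterm \<Rightarrow> nterm \<Rightarrow> nterm \<Rightarrow> form"
  mu :: "nterm \<Rightarrow> nterm \<Rightarrow> nterm \<Rightarrow> form"

definition coded :: "sterm \<Rightarrow> praedil" where
  "coded T = \<lparr>
     fld = (\<lambda>n s. \<langle>num 0, \<langle>n, s\<rangle>\<rangle> \<^bold>\<in> T),
     lss = (\<lambda>n s t. \<langle>num 1, \<langle>n, \<langle>s, t\<rangle>\<rangle>\<rangle> \<^bold>\<in> T),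
     act = (\<lambda>n l f s t. \<langle>num 2, \<langle>n, \<langle>l, \<langle>f, \<langle>s, t\<rangle>\<rangle>\<rangle>\<rangle>\<rangle> \<^bold>\<in> T),
     spp = (\<lambda>n s a. \<langle>num 3, \<langle>n, \<langle>s, a\<rangle>\<rangle>\<rangle> \<^bold>\<in> T),
     mu = (\<lambda>n m s. \<langle>num 4, \<langle>n, \<langle>m, s\<rangle>\<rangle>\<rangle> \<^bold>\<in> T)\<rparr>"

definition functor_LO :: "praedil \<Rightarrow> form" where
  "functor_LO T =
    ((\<forall>\<^sub>0 n. linear_order (fld T n) (lss T n))
     \<^bold>\<and> (\<forall>\<^sub>0 n l f s. mor f n l \<^bold>\<and> fld T n s \<^bold>\<longrightarrow>
          (\<exists>\<^sub>0 t. act T n l f s t \<^bold>\<and> fld T l t)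
          \<^bold>\<and> (\<forall>\<^sub>0 t t'. act T n l f s t \<^bold>\<and> act T n l f s t' \<^bold>\<longrightarrow> t \<^bold>= t'))
     \<^bold>\<and> (\<forall>\<^sub>0 n l f s s' t t'. mor f n l \<^bold>\<and> fld T n s \<^bold>\<and> fld T n s'
          \<^bold>\<and> act T n l f s t \<^bold>\<and> act T n l f s' t' \<^bold>\<and> lss T n s s' \<^bold>\<longrightarrow> lss T l t t')
     \<^bold>\<and> (\<forall>\<^sub>0 n f s. mor f n n \<^bold>\<and> (\<forall>\<^sub>0 i. i \<^bold>< n \<^bold>\<longrightarrow> \<langle>i, i\<rangle> \<^bold>\<in>\<^sub>f f) \<^bold>\<and> fld T n s \<^bold>\<longrightarrow> act T n n f s s)
     \<^bold>\<and> (\<forall>\<^sub>0 n l k f g h s t r. mor f n l \<^bold>\<and> mor g l k \<^bold>\<and> mor h n k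
          \<^bold>\<and> (\<forall>\<^sub>0 i j j'. \<langle>i, j\<rangle> \<^bold>\<in>\<^sub>f f \<^bold>\<and> \<langle>j, j'\<rangle> \<^bold>\<in>\<^sub>f g \<^bold>\<longrightarrow> \<langle>i, j'\<rangle> \<^bold>\<in>\<^sub>f h)
          \<^bold>\<and> fld T n s \<^bold>\<and> act T n l f s t \<^bold>\<and> act T l k g t r \<^bold>\<longrightarrow> act T n k h s r))"

definition prae_dilator :: "praedil \<Rightarrow> form" where
  "prae_dilator T =
    (functor_LO T
     \<^bold>\<and> (\<forall>\<^sub>0 n s. fld T n s \<^bold>\<longrightarrow>
          (\<exists>\<^sub>0 a. spp T n s a \<^bold>\<and> fin_subset a (\<lambda>i. i \<^bold>< n))
          \<^bold>\<and> (\<forall>\<^sub>0 a a'. spp T n s a \<^bold>\<and> spp T n s a' \<^bold>\<longrightarrow> a \<^bold>= a'))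
     \<^bold>\<and> (\<forall>\<^sub>0 n l f s t a b. mor f n l \<^bold>\<and> fld T n s \<^bold>\<and> act T n l f s t \<^bold>\<and> spp T n s a \<^bold>\<and> spp T l t b \<^bold>\<longrightarrow>
          image_fin (\<lambda>i j. \<langle>i, j\<rangle> \<^bold>\<in>\<^sub>f f) a b)
     \<^bold>\<and> (\<forall>\<^sub>0 n s a k e. fld T n s \<^bold>\<and> spp T n s a \<^bold>\<and> enumerates (\<^bold><) a k e \<^bold>\<longrightarrow>
          (\<exists>\<^sub>0 t. fld T k t \<^bold>\<and> act T k n e t s)))"

definition normal_prae_dilator :: "praedil \<Rightarrow> form" where
  "normal_prae_dilator T =
    (prae_dilator T
     \<^bold>\<and> (\<forall>\<^sub>0 n m. m \<^bold>< n \<^bold>\<longrightarrow>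
          (\<exists>\<^sub>0 s. mu T n m s \<^bold>\<and> fld T n s)
          \<^bold>\<and> (\<forall>\<^sub>0 s s'. mu T n m s \<^bold>\<and> mu T n m s' \<^bold>\<longrightarrow> s \<^bold>= s'))
     \<^bold>\<and> (\<forall>\<^sub>0 n m m' s s'. m \<^bold>< m' \<^bold>\<and> m' \<^bold>< n \<^bold>\<and> mu T n m s \<^bold>\<and> mu T n m' s' \<^bold>\<longrightarrow> lss T n s s')
     \<^bold>\<and> (\<forall>\<^sub>0 n l f m m' s t. mor f n l \<^bold>\<and> \<langle>m, m'\<rangle> \<^bold>\<in>\<^sub>f f \<^bold>\<and> mu T n m s \<^bold>\<and> mu T l m' t \<^bold>\<longrightarrow>
          act T n l f s t)
     \<^bold>\<and> (\<forall>\<^sub>0 n m t s a. m \<^bold>< n \<^bold>\<and> mu T n m t \<^bold>\<and> fld T n s \<^bold>\<and> spp T n s a \<^bold>\<longrightarrow>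
          (lss T n s t \<^bold>\<longleftrightarrow> (\<forall>\<^sub>0 i. i \<^bold>\<in>\<^sub>f a \<^bold>\<longrightarrow> i \<^bold>< m))))"

text \<open>\<open>s \<in> T\<^sub>|\<^sub>a\<^sub>|\<close> and \<open>supp(s) = |a|\<close>, where \<open>|a| = {0,\<dots>,|a|-1}\<close>.\<close>

definition full_supp :: "praedil \<Rightarrow> nterm \<Rightarrow> nterm \<Rightarrow> form" where
  "full_supp T a s =
    (\<exists>\<^sub>0 k b. card_fin a k \<^bold>\<and> fld T k s \<^bold>\<and> spp T k s b \<^bold>\<and> codes b (\<lambda>i. i \<^bold>< k))"

text \<open>Field and order of \<open>D\<^sup>T(A, L)\<close>.\<close>

definition D_field :: "praedil \<Rightarrow> (nterm \<Rightarrow> form) \<Rightarrow> nterm \<Rightarrow> form" where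
  "D_field T A p = (\<exists>\<^sub>0 a s. p \<^bold>= \<langle>a, s\<rangle> \<^bold>\<and> fin_subset a A \<^bold>\<and> full_supp T a s)"

definition D_less :: "praedil \<Rightarrow> (nterm \<Rightarrow> nterm \<Rightarrow> form) \<Rightarrow> nterm \<Rightarrow> nterm \<Rightarrow> form" where
  "D_less T L p q =
    (\<exists>\<^sub>0 a s b t c. p \<^bold>= \<langle>a, s\<rangle> \<^bold>\<and> q \<^bold>= \<langle>b, t\<rangle> \<^bold>\<and> codes c (\<lambda>x. x \<^bold>\<in>\<^sub>f a \<^bold>\<or> x \<^bold>\<in>\<^sub>f b)
      \<^bold>\<and> (\<exists>\<^sub>0 k l m f g s' t'. inclusion_mor L a c k m f \<^bold>\<and> inclusion_mor L b c l m g
           \<^bold>\<and> act T k m f s s' \<^bold>\<and> act T l m g t t' \<^bold>\<and> lss T m s' t'))"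

definition D_well_founded :: "praedil \<Rightarrow> sterm \<Rightarrow> sterm \<Rightarrow> form" where
  "D_well_founded T X R = well_founded (D_field T (set_field X)) (D_less T (set_rel R))"

definition preserves_well_foundedness :: "praedil \<Rightarrow> form" where
  "preserves_well_foundedness T = (\<forall>\<^sub>1 X R. well_order X R \<^bold>\<longrightarrow> D_well_founded T X R)"

definition normal_dilator :: "praedil \<Rightarrow> form" where
  "normal_dilator T = (normal_prae_dilator T \<^bold>\<and> preserves_well_foundedness T)"

section \<open>Upper derivatives\<close>

text \<open>The composition \<open>T \<circ> S\<close>.\<close>

definition compose :: "praedil \<Rightarrow> praedil \<Rightarrow> praedil" where
  "compose T S = \<lparr>
     fld = (\<lambda>n. D_field T (fld S n)),
     lss = (\<lambda>n. D_less T (lss S n)),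
     act = (\<lambda>n l f p q. \<exists>\<^sub>0 a b t. p \<^bold>= \<langle>a, t\<rangle> \<^bold>\<and> q \<^bold>= \<langle>b, t\<rangle> \<^bold>\<and> image_fin (act S n l f) a b),
     spp = (\<lambda>n p c. \<exists>\<^sub>0 a t. p \<^bold>= \<langle>a, t\<rangle>
              \<^bold>\<and> codes c (\<lambda>i. \<exists>\<^sub>0 s b. s \<^bold>\<in>\<^sub>f a \<^bold>\<and> spp S n s b \<^bold>\<and> i \<^bold>\<in>\<^sub>f b)),
     mu = (\<lambda>n m p. \<exists>\<^sub>0 s a t. mu S n m s \<^bold>\<and> codes a (\<lambda>x. x \<^bold>= s) \<^bold>\<and> mu T \<^bold>1 \<^bold>0 t \<^bold>\<and> p \<^bold>= \<langle>a, t\<rangle>)\<rparr>"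

text \<open>\<open>Z\<close> codes a morphism \<open>T \<Rightarrow> S\<close> of normal prae-dilators, as the set of all
  \<open>\<langle>n, x, \<nu>\<^sub>n(x)\<rangle>\<close>.\<close>

definition normal_morphism :: "praedil \<Rightarrow> praedil \<Rightarrow> sterm \<Rightarrow> form" where
  "normal_morphism T S Z =
    ((\<forall>\<^sub>0 n x. fld T n x \<^bold>\<longrightarrow>
        (\<exists>\<^sub>0 y. \<langle>n, \<langle>x, y\<rangle>\<rangle> \<^bold>\<in> Z \<^bold>\<and> fld S n y)
        \<^bold>\<and> (\<forall>\<^sub>0 y y'. \<langle>n, \<langle>x, y\<rangle>\<rangle> \<^bold>\<in> Z \<^bold>\<and> \<langle>n, \<langle>x, y'\<rangle>\<rangle> \<^bold>\<in> Z \<^bold>\<longrightarrow> y \<^bold>= y'))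
     \<^bold>\<and> (\<forall>\<^sub>0 n x x' y y'. fld T n x \<^bold>\<and> fld T n x' \<^bold>\<and> \<langle>n, \<langle>x, y\<rangle>\<rangle> \<^bold>\<in> Z \<^bold>\<and> \<langle>n, \<langle>x', y'\<rangle>\<rangle> \<^bold>\<in> Z
          \<^bold>\<and> lss T n x x' \<^bold>\<longrightarrow> lss S n y y')
     \<^bold>\<and> (\<forall>\<^sub>0 n l f x x' y y'. mor f n l \<^bold>\<and> fld T n x \<^bold>\<and> act T n l f x x'
          \<^bold>\<and> \<langle>n, \<langle>x, y\<rangle>\<rangle> \<^bold>\<in> Z \<^bold>\<and> \<langle>l, \<langle>x', y'\<rangle>\<rangle> \<^bold>\<in> Z \<^bold>\<longrightarrow> act S n l f y y')
     \<^bold>\<and> (\<forall>\<^sub>0 n m x y. m \<^bold>< n \<^bold>\<and> mu T n m x \<^bold>\<and> \<langle>n, \<langle>x, y\<rangle>\<rangle> \<^bold>\<in> Z \<^bold>\<longrightarrow> mu S n m y))"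

definition upper_derivative :: "praedil \<Rightarrow> praedil \<Rightarrow> sterm \<Rightarrow> form" where
  "upper_derivative T S Z = (normal_prae_dilator S \<^bold>\<and> normal_morphism (compose T S) S Z)"

section \<open>The normal prae-dilator \<open>\<partial>T\<close>\<close>

definition mu_term :: "nterm \<Rightarrow> nterm" where
  "mu_term m = \<langle>num 0, m\<rangle>"

definition xi_term :: "nterm \<Rightarrow> nterm \<Rightarrow> nterm" where
  "xi_term a s = \<langle>num 1, \<langle>a, s\<rangle>\<rangle>"

text \<open>\<open>is_partial T P\<close>: the data of \<open>P\<close> agree with those of \<open>\<partial>T\<close>. The recursive clauses determine
  them: elements of \<open>a\<close> have smaller codes than \<open>xi_term a s\<close>, and the clauses for the order refer
  only to pairs of terms with smaller \<open>L\<^sub>n(s) + L\<^sub>n(t)\<close> (the only role of \<open>L\<^sub>n\<close>). In particular the biconditional for the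
  field characterizes the inductively generated set of terms.\<close>

definition partial_field :: "praedil \<Rightarrow> praedil \<Rightarrow> form" where
  "partial_field T P =
    (\<forall>\<^sub>0 n t. fld P n t \<^bold>\<longleftrightarrow>
      (\<exists>\<^sub>0 m. m \<^bold>< n \<^bold>\<and> t \<^bold>= mu_term m)
      \<^bold>\<or> (\<exists>\<^sub>0 a s. t \<^bold>= xi_term a s \<^bold>\<and> fin_subset a (fld P n) \<^bold>\<and> full_supp T a s
           \<^bold>\<and> \<^bold>\<not> (\<exists>\<^sub>0 m. m \<^bold>< n \<^bold>\<and> codes a (\<lambda>r. r \<^bold>= mu_term m) \<^bold>\<and> mu T \<^bold>1 \<^bold>0 s)))"

definition partial_less :: "praedil \<Rightarrow> praedil \<Rightarrow> form" where
  "partial_less T P =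
    (\<forall>\<^sub>0 n s t. fld P n s \<^bold>\<and> fld P n t \<^bold>\<longrightarrow> (lss P n s t \<^bold>\<longleftrightarrow>
      (\<exists>\<^sub>0 m k. s \<^bold>= mu_term m \<^bold>\<and> t \<^bold>= mu_term k \<^bold>\<and> m \<^bold>< k)
      \<^bold>\<or> (\<exists>\<^sub>0 m b v. s \<^bold>= mu_term m \<^bold>\<and> t \<^bold>= xi_term b v
           \<^bold>\<and> (\<exists>\<^sub>0 r. r \<^bold>\<in>\<^sub>f b \<^bold>\<and> (lss P n s r \<^bold>\<or> s \<^bold>= r)))
      \<^bold>\<or> (\<exists>\<^sub>0 a u k. s \<^bold>= xi_term a u \<^bold>\<and> t \<^bold>= mu_term k \<^bold>\<and> (\<forall>\<^sub>0 r. r \<^bold>\<in>\<^sub>f a \<^bold>\<longrightarrow> lss P n r t))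
      \<^bold>\<or> (\<exists>\<^sub>0 a u b v. s \<^bold>= xi_term a u \<^bold>\<and> t \<^bold>= xi_term b v
           \<^bold>\<and> linear_order (\<lambda>r. r \<^bold>\<in>\<^sub>f a \<^bold>\<or> r \<^bold>\<in>\<^sub>f b) (lss P n)
           \<^bold>\<and> D_less T (lss P n) \<langle>a, u\<rangle> \<langle>b, v\<rangle>)))"

definition partial_act :: "praedil \<Rightarrow> form" where
  "partial_act P =
    (\<forall>\<^sub>0 n l f s t. mor f n l \<^bold>\<and> fld P n s \<^bold>\<longrightarrow> (act P n l f s t \<^bold>\<longleftrightarrow>
      (\<exists>\<^sub>0 m m'. s \<^bold>= mu_term m \<^bold>\<and> \<langle>m, m'\<rangle> \<^bold>\<in>\<^sub>f f \<^bold>\<and> t \<^bold>= mu_term m')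
      \<^bold>\<or> (\<exists>\<^sub>0 a b u. s \<^bold>= xi_term a u \<^bold>\<and> t \<^bold>= xi_term b u \<^bold>\<and> image_fin (act P n l f) a b)))"

definition partial_supp :: "praedil \<Rightarrow> form" where
  "partial_supp P =
    (\<forall>\<^sub>0 n s c. fld P n s \<^bold>\<longrightarrow> (spp P n s c \<^bold>\<longleftrightarrow>
      (\<exists>\<^sub>0 m. s \<^bold>= mu_term m \<^bold>\<and> codes c (\<lambda>i. i \<^bold>= m))
      \<^bold>\<or> (\<exists>\<^sub>0 a u. s \<^bold>= xi_term a u
           \<^bold>\<and> codes c (\<lambda>i. \<exists>\<^sub>0 t b. t \<^bold>\<in>\<^sub>f a \<^bold>\<and> spp P n t b \<^bold>\<and> i \<^bold>\<in>\<^sub>f b))))"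

definition partial_mu :: "praedil \<Rightarrow> form" where
  "partial_mu P = (\<forall>\<^sub>0 n m s. m \<^bold>< n \<^bold>\<longrightarrow> (mu P n m s \<^bold>\<longleftrightarrow> s \<^bold>= mu_term m))"

definition is_partial :: "praedil \<Rightarrow> praedil \<Rightarrow> form" where
  "is_partial T P =
    (partial_field T P \<^bold>\<and> partial_less T P \<^bold>\<and> partial_act P \<^bold>\<and> partial_supp P \<^bold>\<and> partial_mu P)"

section \<open>A truth definition for \<open>\<Pi>\<^sup>1\<^sub>1\<close>-formulas\<close>

text \<open>Within arithmetic, the formulas of type \<open>fm\<close> are coded as follows (and \<open>s, t, p, q\<close> stand for
  their own codes).
    \<open>Var i\<close> is \<open>\<langle>0, i\<rangle>\<close>, \<open>Zero\<close> is \<open>\<langle>1, 0\<rangle>\<close>, \<open>One\<close> is \<open>\<langle>2, 0\<rangle>\<close>, \<open>Add s t\<close> is \<open>\<langle>3, \<langle>s, t\<rangle>\<rangle>\<close>,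
    \<open>Mul s t\<close> is \<open>\<langle>4, \<langle>s, t\<rangle>\<rangle>\<close>;
    \<open>Fls\<close> is \<open>\<langle>0, 0\<rangle>\<close>, \<open>Eq s t\<close> is \<open>\<langle>1, \<langle>s, t\<rangle>\<rangle>\<close>, \<open>Less s t\<close> is \<open>\<langle>2, \<langle>s, t\<rangle>\<rangle>\<close>,
    \<open>Mem t X\<close> is \<open>\<langle>3, \<langle>t, X\<rangle>\<rangle>\<close>, \<open>Imp p q\<close> is \<open>\<langle>4, \<langle>p, q\<rangle>\<rangle>\<close>, \<open>All0 p\<close> is \<open>\<langle>5, p\<rangle>\<close>,
    \<open>All1 p\<close> is \<open>\<langle>6, p\<rangle>\<close>.\<close>

definition tm_code :: "nterm \<Rightarrow> form" where
  "tm_code t = (\<exists>\<^sub>1 E. t \<^bold>\<in> E \<^bold>\<and> (\<forall>\<^sub>0 u. u \<^bold>\<in> E \<^bold>\<longrightarrow>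
     (\<exists>\<^sub>0 i. u \<^bold>= \<langle>num 0, i\<rangle>) \<^bold>\<or> u \<^bold>= \<langle>num 1, \<^bold>0\<rangle> \<^bold>\<or> u \<^bold>= \<langle>num 2, \<^bold>0\<rangle>
     \<^bold>\<or> (\<exists>\<^sub>0 v w. (u \<^bold>= \<langle>num 3, \<langle>v, w\<rangle>\<rangle> \<^bold>\<or> u \<^bold>= \<langle>num 4, \<langle>v, w\<rangle>\<rangle>) \<^bold>\<and> v \<^bold>\<in> E \<^bold>\<and> w \<^bold>\<in> E)))"

definition arithmetical_code :: "nterm \<Rightarrow> form" where
  "arithmetical_code p = (\<exists>\<^sub>1 C. p \<^bold>\<in> C \<^bold>\<and> (\<forall>\<^sub>0 q. q \<^bold>\<in> C \<^bold>\<longrightarrow>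
     q \<^bold>= \<langle>num 0, \<^bold>0\<rangle>
     \<^bold>\<or> (\<exists>\<^sub>0 t u. (q \<^bold>= \<langle>num 1, \<langle>t, u\<rangle>\<rangle> \<^bold>\<or> q \<^bold>= \<langle>num 2, \<langle>t, u\<rangle>\<rangle>) \<^bold>\<and> tm_code t \<^bold>\<and> tm_code u)
     \<^bold>\<or> (\<exists>\<^sub>0 t j. q \<^bold>= \<langle>num 3, \<langle>t, j\<rangle>\<rangle> \<^bold>\<and> tm_code t)
     \<^bold>\<or> (\<exists>\<^sub>0 r r'. q \<^bold>= \<langle>num 4, \<langle>r, r'\<rangle>\<rangle> \<^bold>\<and> r \<^bold>\<in> C \<^bold>\<and> r' \<^bold>\<in> C)
     \<^bold>\<or> (\<exists>\<^sub>0 r. q \<^bold>= \<langle>num 5, r\<rangle> \<^bold>\<and> r \<^bold>\<in> C)))"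

definition Pi11_code :: "nterm \<Rightarrow> form" where
  "Pi11_code p = (\<exists>\<^sub>0 q. p \<^bold>= \<langle>num 6, q\<rangle> \<^bold>\<and> arithmetical_code q)"

text \<open>Assignments to number variables are coded finite partial functions; variables outside of the
  domain get the value 0. \<open>push_assignment x s s'\<close> says that \<open>s'\<close> assigns \<open>x\<close> to the variable 0 and
  the values of \<open>s\<close>, with indices shifted, to the others.\<close>

definition assignment :: "nterm \<Rightarrow> form" where
  "assignment s = (finset s \<^bold>\<and> (\<forall>\<^sub>0 i x y. \<langle>i, x\<rangle> \<^bold>\<in>\<^sub>f s \<^bold>\<and> \<langle>i, y\<rangle> \<^bold>\<in>\<^sub>f s \<^bold>\<longrightarrow> x \<^bold>= y))"

definition lookup :: "nterm \<Rightarrow> nterm \<Rightarrow> nterm \<Rightarrow> form" where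
  "lookup s i x = (\<langle>i, x\<rangle> \<^bold>\<in>\<^sub>f s \<^bold>\<or> (\<^bold>\<not> (\<exists>\<^sub>0 y. \<langle>i, y\<rangle> \<^bold>\<in>\<^sub>f s) \<^bold>\<and> x \<^bold>= \<^bold>0))"

definition push_assignment :: "nterm \<Rightarrow> nterm \<Rightarrow> nterm \<Rightarrow> form" where
  "push_assignment x s s' =
    codes s' (\<lambda>p. p \<^bold>= \<langle>\<^bold>0, x\<rangle> \<^bold>\<or> (\<exists>\<^sub>0 i y. p \<^bold>= \<langle>i \<^bold>+ \<^bold>1, y\<rangle> \<^bold>\<and> \<langle>i, y\<rangle> \<^bold>\<in>\<^sub>f s))"

text \<open>\<open>V\<close> is the set of all \<open>\<langle>t, s, x\<rangle>\<close> such that the term \<open>t\<close> has value \<open>x\<close> under the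
  assignment \<open>s\<close>.\<close>

definition evaluation :: "sterm \<Rightarrow> form" where
  "evaluation V = (\<forall>\<^sub>0 t s x. assignment s \<^bold>\<longrightarrow> (\<langle>t, \<langle>s, x\<rangle>\<rangle> \<^bold>\<in> V \<^bold>\<longleftrightarrow>
     (\<exists>\<^sub>0 i. t \<^bold>= \<langle>num 0, i\<rangle> \<^bold>\<and> lookup s i x)
     \<^bold>\<or> (t \<^bold>= \<langle>num 1, \<^bold>0\<rangle> \<^bold>\<and> x \<^bold>= \<^bold>0)
     \<^bold>\<or> (t \<^bold>= \<langle>num 2, \<^bold>0\<rangle> \<^bold>\<and> x \<^bold>= \<^bold>1)
     \<^bold>\<or> (\<exists>\<^sub>0 u v y z. \<langle>u, \<langle>s, y\<rangle>\<rangle> \<^bold>\<in> V \<^bold>\<and> \<langle>v, \<langle>s, z\<rangle>\<rangle> \<^bold>\<in> V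
          \<^bold>\<and> ((t \<^bold>= \<langle>num 3, \<langle>u, v\<rangle>\<rangle> \<^bold>\<and> x \<^bold>= y \<^bold>+ z) \<^bold>\<or> (t \<^bold>= \<langle>num 4, \<langle>u, v\<rangle>\<rangle> \<^bold>\<and> x \<^bold>= y \<^bold>* z)))))"

text \<open>\<open>S\<close> satisfies Tarski's clauses for all arithmetical formulas with code at most \<open>p\<close>, hence for
  all subformulas of \<open>p\<close>. The set variable 0 is interpreted by \<open>Y\<close> and the set variable \<open>i + 1\<close> by
  the section \<open>(A)\<^sub>i\<close>. For each concrete \<open>p\<close> such an \<open>S\<close> exists by arithmetical comprehension. The code of
  \<open>Fls\<close> satisfies none of the clauses, so it is not in \<open>S\<close>.\<close>

definition satisfaction :: "nterm \<Rightarrow> sterm \<Rightarrow> sterm \<Rightarrow> sterm \<Rightarrow> sterm \<Rightarrow> form" where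
  "satisfaction p Y A V S = (\<forall>\<^sub>0 q s. (q \<^bold>< p \<^bold>\<or> q \<^bold>= p) \<^bold>\<and> assignment s \<^bold>\<longrightarrow> (\<langle>q, s\<rangle> \<^bold>\<in> S \<^bold>\<longleftrightarrow>
     (\<exists>\<^sub>0 t u x y. \<langle>t, \<langle>s, x\<rangle>\<rangle> \<^bold>\<in> V \<^bold>\<and> \<langle>u, \<langle>s, y\<rangle>\<rangle> \<^bold>\<in> V
        \<^bold>\<and> ((q \<^bold>= \<langle>num 1, \<langle>t, u\<rangle>\<rangle> \<^bold>\<and> x \<^bold>= y) \<^bold>\<or> (q \<^bold>= \<langle>num 2, \<langle>t, u\<rangle>\<rangle> \<^bold>\<and> x \<^bold>< y)))
     \<^bold>\<or> (\<exists>\<^sub>0 t j x. q \<^bold>= \<langle>num 3, \<langle>t, j\<rangle>\<rangle> \<^bold>\<and> \<langle>t, \<langle>s, x\<rangle>\<rangle> \<^bold>\<in> V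
        \<^bold>\<and> ((j \<^bold>= \<^bold>0 \<^bold>\<and> x \<^bold>\<in> Y) \<^bold>\<or> (\<exists>\<^sub>0 i. j \<^bold>= i \<^bold>+ \<^bold>1 \<^bold>\<and> \<langle>i, x\<rangle> \<^bold>\<in> A)))
     \<^bold>\<or> (\<exists>\<^sub>0 r r'. q \<^bold>= \<langle>num 4, \<langle>r, r'\<rangle>\<rangle> \<^bold>\<and> (\<langle>r, s\<rangle> \<^bold>\<in> S \<^bold>\<longrightarrow> \<langle>r', s\<rangle> \<^bold>\<in> S))
     \<^bold>\<or> (\<exists>\<^sub>0 r. q \<^bold>= \<langle>num 5, r\<rangle> \<^bold>\<and> (\<forall>\<^sub>0 x s'. push_assignment x s s' \<^bold>\<longrightarrow> \<langle>r, s'\<rangle> \<^bold>\<in> S))))"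

text \<open>Truth of the \<open>\<Pi>\<^sup>1\<^sub>1\<close>-formula with code \<open>p\<close>, with number parameters \<open>s\<close> and set parameters \<open>A\<close>.
  This is itself \<open>\<Pi>\<^sup>1\<^sub>1\<close>, and ACA0 proves that it agrees with each concrete \<open>\<Pi>\<^sup>1\<^sub>1\<close>-formula.\<close>

definition Pi11_true :: "nterm \<Rightarrow> nterm \<Rightarrow> sterm \<Rightarrow> form" where
  "Pi11_true p s A = (\<exists>\<^sub>0 q. p \<^bold>= \<langle>num 6, q\<rangle>
     \<^bold>\<and> (\<forall>\<^sub>1 Y V S. evaluation V \<^bold>\<and> satisfaction q Y A V S \<^bold>\<longrightarrow> \<langle>q, s\<rangle> \<^bold>\<in> S))"

section \<open>The three statements\<close>

text \<open>In the first statement \<open>\<partial>T\<close> is introduced by an existential quantifier, so that its existence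
  is not left as a hypothesis; ACA0 proves that it exists and is unique.\<close>

definition derivative_statement :: form where
  "derivative_statement =
    (\<forall>\<^sub>1 T. normal_dilator (coded T) \<^bold>\<longrightarrow>
      (\<exists>\<^sub>1 P. is_partial (coded T) (coded P) \<^bold>\<and> preserves_well_foundedness (coded P)))"

definition upper_derivative_statement :: form where
  "upper_derivative_statement =
    (\<forall>\<^sub>1 T. normal_dilator (coded T) \<^bold>\<longrightarrow>
      (\<exists>\<^sub>1 S Z. upper_derivative (coded T) (coded S) Z \<^bold>\<and> preserves_well_foundedness (coded S)))"

text \<open>The induction variable \<open>x\<close> of \<open>\<phi>(x)\<close> is the number variable 0.\<close>

definition Pi11_bar_induction :: form where
  "Pi11_bar_induction =
    (\<forall>\<^sub>1 X R. well_order X R \<^bold>\<longrightarrow>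
      (\<forall>\<^sub>0 p s. \<forall>\<^sub>1 A. Pi11_code p \<^bold>\<and> assignment s \<^bold>\<longrightarrow>
        (let phi = (\<lambda>x. \<forall>\<^sub>0 s'. push_assignment x s s' \<^bold>\<longrightarrow> Pi11_true p s' A)
         in (\<forall>\<^sub>0 x. x \<^bold>\<in> X \<^bold>\<longrightarrow> (\<forall>\<^sub>0 y. y \<^bold>\<in> X \<^bold>\<and> \<langle>y, x\<rangle> \<^bold>\<in> R \<^bold>\<longrightarrow> phi y) \<^bold>\<longrightarrow> phi x)
            \<^bold>\<longrightarrow> (\<forall>\<^sub>0 x. x \<^bold>\<in> X \<^bold>\<longrightarrow> phi x))))"

end

theory Submission
  imports Defs "HOL-Library.Countable_Set"
begin

text \<open>By completeness it suffices to show that the three statements are equivalent in every model of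
  \<open>ACA\<^sub>0\<close>, which may be non-standard; an induction is thus admissible only for arithmetical properties with
  parameters from the model. Bar induction for \<open>\<Pi>\<^sup>1\<^sub>1\<close>-formulas is equivalent to its restriction to properties
  of the form ``the relation \<open>Q\<^sub>x\<close> is well-founded'', by the Kleene normal form.

  From (1) to (2): since \<open>\<mu>\<^sub>m\<close> takes the place of \<open>\<xi>\<langle>{\<mu>\<^sub>m}, \<mu>\<^sub>1(0)\<rangle>\<close>, the map \<open>\<xi>\<close> is an isomorphism
  from \<open>T \<circ> \<partial>T\<close> to \<open>\<partial>T\<close>, which makes \<open>\<partial>T\<close> an upper derivative of \<open>T\<close>.

  From bar induction to (1): the part of \<open>D\<^sup>\<partial>\<^sup>T(X)\<close> below \<open>\<mu>\<^sub>x\<close> is well-founded by bar induction on \<open>x\<close>. For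
  this one shows by a second bar induction, on the code of \<open>t\<close>, that the terms below \<open>t < \<mu>\<^sub>x\<close> are well-founded:
  the terms below \<open>\<xi>\<langle>a, \<sigma>\<rangle>\<close> embed into \<open>D\<^sup>T(C)\<close>, where \<open>C\<close> consists of the terms that are at most
  equal to some element of \<open>a\<close>.

  From (2) to bar induction: let ``\<open>Q\<^sub>x\<close> is well-founded'' be progressive in \<open>x \<in> X\<close>. Consider the normal prae-dilator
  that maps \<open>A\<close> to the finite approximations to a descending sequence in some \<open>Q\<^sub>x\<close> together with rankings in
  \<open>A\<close> of the trees of descending sequences in \<open>Q\<^sub>y\<close> for all \<open>y\<close> below \<open>x\<close>. It is a dilator, since a branch
  would contradict the progressiveness at \<open>x\<close>. If \<open>(S, \<xi>)\<close> is an upper derivative and \<open>W = D\<^sup>S(X)\<close> is well-founded,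
  then the collapse of \<open>D\<^sup>T(W)\<close> into \<open>W\<close> assigns to each descending sequence, together with the ranks
  already assigned, a rank in \<open>W\<close>. Hence all the \<open>Q\<^sub>x\<close> are well-founded.\<close>

text \<open>In a non-standard model every recursion, every minimum and every induction concerns
  arithmetical predicates only. For this reason notions come with closure rules for
  \<open>dfm\<close> or \<open>dtm\<close>, and functions are definite descriptions with a default
  value. To make the usual algebra available, the numbers of the model have to form a type; so one
  countermodel is fixed, if there is any.

  Satisfaction sets need not exist for non-standard codes. This is harmless: truth is \<Pi>^1_1
  uniformly in the code when bar induction is derived from its restricted form, and the converse
  uses one formula, whose code is standard.

  Normality is what makes the passage from (2) work. The collapse maps the value of
  \<open>mct\<close> at \<open>S.Dmu x\<close> to \<open>S.Dmu x\<close> itself. An approximation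
  for an index \<open>y\<close> below \<open>x\<close> has leading value \<open>S.Dmu y\<close>, so
  its rank falls below \<open>S.Dmu x\<close>, as the approximations for \<open>x\<close> require.
  Hence all sequences for all indices are ranked in \<open>W\<close> by one arithmetical recursion
  on codes, where a bar induction along \<open>X\<close> would be circular.\<close>

notation (ASCII) iff (infixr "<->" 25)

section \<open>Completeness of the calculus\<close>

instance tm :: countable by countable_datatype
instance fm :: countable by countable_datatype

section \<open>Simultaneous substitution\<close>

primrec tsub :: "(nat => tm) => tm => tm" where
  "tsub \<sigma> (Var i) = \<sigma> i"
| "tsub \<sigma> Zero = Zero"
| "tsub \<sigma> One = One"
| "tsub \<sigma> (Add s t) = Add (tsub \<sigma> s) (tsub \<sigma> t)"
| "tsub \<sigma> (Mul s t) = Mul (tsub \<sigma> s) (tsub \<sigma> t)"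

definition up0 :: "(nat => tm) => nat => tm" where
  "up0 \<sigma> = case_nat (Var 0) (%j. lift_tm 0 (\<sigma> j))"

definition up1 :: "(nat => nat) => nat => nat" where
  "up1 \<tau> = case_nat 0 (%j. Suc (\<tau> j))"

text \<open>Lifting and substitution for both sorts are instances of this one operation, so that all
  their commutation laws reduce to \<open>psub_psub\<close>.\<close>

primrec psub :: "(nat => tm) => (nat => nat) => fm => fm" where
  "psub \<sigma> \<tau> Fls = Fls"
| "psub \<sigma> \<tau> (Eq s t) = Eq (tsub \<sigma> s) (tsub \<sigma> t)"
| "psub \<sigma> \<tau> (Less s t) = Less (tsub \<sigma> s) (tsub \<sigma> t)"
| "psub \<sigma> \<tau> (Mem t X) = Mem (tsub \<sigma> t) (\<tau> X)"
| "psub \<sigma> \<tau> (Imp p q) = Imp (psub \<sigma> \<tau> p) (psub \<sigma> \<tau> q)"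
| "psub \<sigma> \<tau> (All0 p) = All0 (psub (up0 \<sigma>) \<tau> p)"
| "psub \<sigma> \<tau> (All1 p) = All1 (psub \<sigma> (up1 \<tau>) p)"

lemma tsub_Var [simp]: "tsub Var t = t"
  by (induction t) auto

lemma tsub_tsub: "tsub \<sigma> (tsub \<sigma>' t) = tsub (%i. tsub \<sigma> (\<sigma>' i)) t"
  by (induction t) auto

lemma lift_tm_tsub: "lift_tm k t = tsub (%i. Var (if i < k then i else Suc i)) t"
  by (induction t) auto

lemma lift_tm0_tsub: "lift_tm 0 t = tsub (%i. Var (Suc i)) t"
  by (simp add: lift_tm_tsub)

lemma subst_tm_tsub: "subst_tm k u t = tsub (%i. if i < k then Var i else if i = k then u else Var (i - 1)) t"
  by (induction t) auto

lemma up0_Var [simp]: "up0 Var = Var"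
  by (auto simp: up0_def fun_eq_iff split: nat.split)

lemma up1_id [simp]: "up1 (%i. i) = (%i. i)"
  by (auto simp: up1_def fun_eq_iff split: nat.split)

lemma psub_Var [simp]: "psub Var (%i. i) p = p"
  by (induction p) auto

lemma up0_comp: "up0 (%i. tsub \<sigma> (\<sigma>' i)) = (%i. tsub (up0 \<sigma>) (up0 \<sigma>' i))"
  by (auto simp: up0_def fun_eq_iff lift_tm0_tsub tsub_tsub split: nat.split)

lemma up1_comp: "up1 (%i. \<tau> (\<tau>' i)) = (%i. up1 \<tau> (up1 \<tau>' i))"
  by (auto simp: up1_def fun_eq_iff split: nat.split)

lemma psub_psub: "psub \<sigma> \<tau> (psub \<sigma>' \<tau>' p) = psub (%i. tsub \<sigma> (\<sigma>' i)) (%i. \<tau> (\<tau>' i)) p"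
  by (induction p arbitrary: \<sigma> \<tau> \<sigma>' \<tau>') (auto simp: tsub_tsub up0_comp up1_comp)

lemma lift0_psub: "lift0 k p = psub (%i. Var (if i < k then i else Suc i)) (%i. i) p"
proof (induction p arbitrary: k)
  case (All0 p)
  have "up0 (%i. Var (if i < k then i else Suc i)) = (%i. Var (if i < Suc k then i else Suc i))"
    by (auto simp: up0_def fun_eq_iff split: nat.split)
  with All0 show ?case by simp
qed (auto simp: lift_tm_tsub)

lemma lift1_psub: "lift1 k p = psub Var (%X. if X < k then X else Suc X) p"
proof (induction p arbitrary: k)
  case (All1 p)
  have "up1 (%X. if X < k then X else Suc X) = (%X. if X < Suc k then X else Suc X)"
    by (auto simp: up1_def fun_eq_iff split: nat.split)
  with All1 show ?case by simp
qed auto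

lemma subst0_psub:
  "subst0 k u p = psub (%i. if i < k then Var i else if i = k then u else Var (i - 1)) (%i. i) p"
proof (induction p arbitrary: k u)
  case (All0 p)
  have "up0 (%i. if i < k then Var i else if i = k then u else Var (i - 1)) =
    (%i. if i < Suc k then Var i else if i = Suc k then lift_tm 0 u else Var (i - 1))"
    by (auto simp: up0_def fun_eq_iff split: nat.split)
  with All0 show ?case by simp
qed (auto simp: subst_tm_tsub)

lemma subst1_psub: "subst1 k Y p = psub Var (%X. if X < k then X else if X = k then Y else X - 1) p"
proof (induction p arbitrary: k Y)
  case (All1 p)
  have "up1 (%X. if X < k then X else if X = k then Y else X - 1) =
    (%X. if X < Suc k then X else if X = Suc k then Suc Y else X - 1)"
    by (auto simp: up1_def fun_eq_iff split: nat.split)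
  with All1 show ?case by simp
qed auto

lemma subst0_0: "subst0 0 u p = psub (case_nat u Var) (%i. i) p"
  unfolding subst0_psub by (rule arg_cong[where f="%s. psub s _ p"]) (auto simp: fun_eq_iff split: nat.split)

lemma subst1_0: "subst1 0 Y p = psub Var (case_nat Y (%i. i)) p"
  unfolding subst1_psub by (rule arg_cong[where f="%s. psub _ s p"]) (auto simp: fun_eq_iff split: nat.split)

lemma lift0_0: "lift0 0 p = psub (%i. Var (Suc i)) (%i. i) p"
  by (simp add: lift0_psub)

lemma lift1_0: "lift1 0 p = psub Var Suc p"
  by (simp add: lift1_psub)

lemma psub_lift0: "psub (up0 \<sigma>) \<tau> (lift0 0 p) = lift0 0 (psub \<sigma> \<tau> p)"
  by (simp add: lift0_0 psub_psub up0_def lift_tm0_tsub)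

lemma psub_lift1: "psub \<sigma> (up1 \<tau>) (lift1 0 p) = lift1 0 (psub \<sigma> \<tau> p)"
  by (simp add: lift1_0 psub_psub up1_def)

lemma psub_subst0: "psub \<sigma> \<tau> (subst0 0 t p) = subst0 0 (tsub \<sigma> t) (psub (up0 \<sigma>) \<tau> p)"
proof -
  have "(%i. tsub \<sigma> (case_nat t Var i)) = (%i. tsub (case_nat (tsub \<sigma> t) Var) (up0 \<sigma> i))"
    by (auto simp: fun_eq_iff up0_def lift_tm0_tsub tsub_tsub split: nat.split)
  then show ?thesis by (simp add: subst0_0 psub_psub)
qed

lemma psub_subst1: "psub \<sigma> \<tau> (subst1 0 Y p) = subst1 0 (\<tau> Y) (psub \<sigma> (up1 \<tau>) p)"
proof -
  have "(%i. \<tau> (case_nat Y (%i. i) i)) = (%i. case_nat (\<tau> Y) (%i. i) (up1 \<tau> i))"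
    by (auto simp: fun_eq_iff up1_def split: nat.split)
  then show ?thesis by (simp add: subst1_0 psub_psub)
qed

lemma psub_cong:
  "fm_below k l p ==> (!!i. i < k ==> \<sigma> i = \<sigma>' i) ==> (!!i. i < l ==> \<tau> i = \<tau>' i) ==> psub \<sigma> \<tau> p = psub \<sigma>' \<tau>' p"
proof (induction p arbitrary: k l \<sigma> \<sigma>' \<tau> \<tau>')
  case (All0 p)
  have "up0 \<sigma> i = up0 \<sigma>' i" if "i < Suc k" for i
    using that All0.prems(2) by (cases i) (auto simp: up0_def)
  then show ?case using All0.IH[of "Suc k" l "up0 \<sigma>" "up0 \<sigma>'" \<tau> \<tau>'] All0.prems by auto
next
  case (All1 p)
  have "up1 \<tau> i = up1 \<tau>' i" if "i < Suc l" for i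
    using that All1.prems(3) by (cases i) (auto simp: up1_def)
  then show ?case using All1.IH[of k "Suc l" \<sigma> \<sigma>' "up1 \<tau>" "up1 \<tau>'"] All1.prems by auto
next
  case (Eq s t)
  have "tm_below k t ==> tsub \<sigma> t = tsub \<sigma>' t" for t using Eq by (induction t) auto
  with Eq show ?case by auto
next
  case (Less s t)
  have "tm_below k t ==> tsub \<sigma> t = tsub \<sigma>' t" for t using Less by (induction t) auto
  with Less show ?case by auto
next
  case (Mem s X)
  have "tm_below k t ==> tsub \<sigma> t = tsub \<sigma>' t" for t using Mem by (induction t) auto
  with Mem show ?case by auto
next
  case (Imp p q)
  then show ?case by (metis fm_below.simps(5) psub.simps(5))
qed auto

lemma psub_closed: "fm_below 0 0 p ==> psub \<sigma> \<tau> p = p"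
  using psub_cong[of 0 0 p \<sigma> Var \<tau> "%i. i"] by simp

lemma tm_below_mono: "tm_below k t ==> k <= k' ==> tm_below k' t"
  by (induction t) auto

lemma fm_below_mono: "fm_below k l p ==> k <= k' ==> l <= l' ==> fm_below k' l' p"
  by (induction p arbitrary: k l k' l') (auto intro: tm_below_mono)

lemma ex_tm_below: "EX k. tm_below k t"
proof (induction t)
  case (Var x) then show ?case by (auto intro: exI[of _ "Suc x"])
next
  case (Add s t)
  then obtain k k' where "tm_below k s" "tm_below k' t" by auto
  then have "tm_below (max k k') (Add s t)" by (auto intro: tm_below_mono)
  then show ?case by blast
next
  case (Mul s t)
  then obtain k k' where "tm_below k s" "tm_below k' t" by auto
  then have "tm_below (max k k') (Mul s t)" by (auto intro: tm_below_mono)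
  then show ?case by blast
qed auto

lemma ex_fm_below: "EX k. fm_below k k p"
proof (induction p)
  case (Eq s t)
  obtain k k' where "tm_below k s" "tm_below k' t" using ex_tm_below by blast
  then have "fm_below (max k k') (max k k') (Eq s t)" by (auto intro: tm_below_mono)
  then show ?case by blast
next
  case (Less s t)
  obtain k k' where "tm_below k s" "tm_below k' t" using ex_tm_below by blast
  then have "fm_below (max k k') (max k k') (Less s t)" by (auto intro: tm_below_mono)
  then show ?case by blast
next
  case (Mem t X)
  obtain k where "tm_below k t" using ex_tm_below by blast
  then have "fm_below (max k (Suc X)) (max k (Suc X)) (Mem t X)" by (auto intro: tm_below_mono)
  then show ?case by blast
next
  case (Imp p q)
  then obtain k k' where "fm_below k k p" "fm_below k' k' q" by auto
  then have "fm_below (max k k') (max k k') (Imp p q)" by (auto intro: fm_below_mono)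
  then show ?case by blast
next
  case (All0 p)
  then obtain k where "fm_below k k p" by auto
  then have "fm_below k k (All0 p)" by (auto intro: fm_below_mono)
  then show ?case by blast
next
  case (All1 p)
  then obtain k where "fm_below k k p" by auto
  then have "fm_below k k (All1 p)" by (auto intro: fm_below_mono)
  then show ?case by blast
qed auto

lemma ex_fm_below_finite: "finite D ==> EX k. ALL p:D. fm_below k k p"
proof (induction D rule: finite_induct)
  case (insert p D)
  then obtain k k' where "ALL p:D. fm_below k k p" "fm_below k' k' p" using ex_fm_below by blast
  then have "ALL p:insert p D. fm_below (max k k') (max k k') p" by (auto intro: fm_below_mono)
  then show ?case by blast
qed auto

lemma derives_psub: "\<Gamma> \<turnstile> p ==> psub \<sigma> \<tau> ` \<Gamma> \<turnstile> psub \<sigma> \<tau> p"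
proof (induction arbitrary: \<sigma> \<tau> rule: derives.induct)
  case (All0I \<Gamma> p)
  have "psub (up0 \<sigma>) \<tau> ` lift0 0 ` \<Gamma> = lift0 0 ` psub \<sigma> \<tau> ` \<Gamma>"
    by (auto simp: image_image psub_lift0)
  with All0I.IH[of "up0 \<sigma>" \<tau>] show ?case by (auto intro: derives.All0I)
next
  case (All1I \<Gamma> p)
  have "psub \<sigma> (up1 \<tau>) ` lift1 0 ` \<Gamma> = lift1 0 ` psub \<sigma> \<tau> ` \<Gamma>"
    by (auto simp: image_image psub_lift1)
  with All1I.IH[of \<sigma> "up1 \<tau>"] show ?case by (auto intro: derives.All1I)
next
  case (All0E \<Gamma> p t)
  then show ?case by (auto simp: psub_subst0 intro: derives.All0E)
next
  case (All1E \<Gamma> p Y)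
  then show ?case by (auto simp: psub_subst1 intro: derives.All1E)
next
  case (EqSubst \<Gamma> s t p)
  then show ?case by (simp add: psub_subst0) (metis derives.EqSubst)
next
  case (Assm p \<Gamma>)
  then show ?case by (simp add: derives.Assm)
next
  case (ImpI p \<Gamma> q)
  then show ?case by (auto intro: derives.ImpI)
next
  case (ImpE \<Gamma> p q)
  then show ?case by (metis derives.ImpE psub.simps(5))
next
  case (Contr p \<Gamma>)
  then show ?case by (auto intro: derives.Contr)
next
  case (EqRefl \<Gamma> t)
  then show ?case by (auto intro: derives.EqRefl)
qed

lemma derives_mono: "\<Gamma> \<turnstile> p ==> \<Gamma> \<subseteq> \<Delta> ==> \<Delta> \<turnstile> p"
proof (induction arbitrary: \<Delta> rule: derives.induct)
  case (ImpI p \<Gamma> q)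
  then show ?case by (meson derives.ImpI insert_mono)
next
  case (Contr p \<Gamma>)
  then show ?case by (meson derives.Contr insert_mono)
next
  case (All0I \<Gamma> p)
  then show ?case by (meson derives.All0I image_mono)
next
  case (All1I \<Gamma> p)
  then show ?case by (meson derives.All1I image_mono)
qed (blast intro: derives.intros)+

lemma derives_finite: "\<Gamma> \<turnstile> p ==> \<exists>\<Delta>\<subseteq>\<Gamma>. finite \<Delta> & (\<Delta> \<turnstile> p)"
proof (induction rule: derives.induct)
  case (Assm p \<Gamma>)
  then show ?case by (intro exI[of _ "{p}"]) (auto intro: derives.Assm)
next
  case (ImpI p \<Gamma> q)
  then obtain D where D: "D \<subseteq> insert p \<Gamma>" "finite D" "D \<turnstile> q" by blast
  then have "insert p (D - {p}) \<turnstile> q" by (auto intro: derives_mono)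
  then have "D - {p} \<turnstile> Imp p q" by (rule derives.ImpI)
  with D show ?case by (intro exI[of _ "D - {p}"]) auto
next
  case (ImpE \<Gamma> p q)
  then obtain D D' where D: "D \<subseteq> \<Gamma>" "finite D" "D \<turnstile> Imp p q" "D' \<subseteq> \<Gamma>" "finite D'" "D' \<turnstile> p" by blast
  have "D \<union> D' \<turnstile> q" by (rule derives.ImpE[of _ p]) (use D in \<open>auto intro: derives_mono\<close>)
  with D show ?case by (intro exI[of _ "D \<union> D'"]) auto
next
  case (Contr p \<Gamma>)
  then obtain D where D: "D \<subseteq> insert (Imp p Fls) \<Gamma>" "finite D" "D \<turnstile> Fls" by blast
  then have "insert (Imp p Fls) (D - {Imp p Fls}) \<turnstile> Fls" by (auto intro: derives_mono)
  then have "D - {Imp p Fls} \<turnstile> p" by (rule derives.Contr)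
  with D show ?case by (intro exI[of _ "D - {Imp p Fls}"]) auto
next
  case (All0I \<Gamma> p)
  then obtain D where "D \<subseteq> lift0 0 ` \<Gamma>" "finite D" "D \<turnstile> p" by blast
  then obtain C where "C \<subseteq> \<Gamma>" "finite C" "D = lift0 0 ` C" by (meson finite_subset_image)
  with \<open>D \<turnstile> p\<close> show ?case by (auto intro: derives.All0I)
next
  case (All1I \<Gamma> p)
  then obtain D where "D \<subseteq> lift1 0 ` \<Gamma>" "finite D" "D \<turnstile> p" by blast
  then obtain C where "C \<subseteq> \<Gamma>" "finite C" "D = lift1 0 ` C" by (meson finite_subset_image)
  with \<open>D \<turnstile> p\<close> show ?case by (auto intro: derives.All1I)
next
  case (EqSubst \<Gamma> s t p)
  then obtain D D' where D: "D \<subseteq> \<Gamma>" "finite D" "D \<turnstile> Eq s t" "D' \<subseteq> \<Gamma>" "finite D'" "D' \<turnstile> subst0 0 s p" by blast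
  have "D \<union> D' \<turnstile> subst0 0 t p" by (rule derives.EqSubst[of _ s]) (use D in \<open>auto intro: derives_mono\<close>)
  with D show ?case by (intro exI[of _ "D \<union> D'"]) auto
next
  case (EqRefl \<Gamma> t)
  then show ?case by (intro exI[of _ "{}"]) (auto intro: derives.EqRefl)
qed (blast intro: derives.intros)+

section \<open>Henkin extensions\<close>

definition consistent :: "fm set => bool" where
  "consistent \<Gamma> <-> ~ (\<Gamma> \<turnstile> Fls)"

lemma consistent_insert_not: "consistent (insert (Imp p Fls) \<Gamma>) <-> ~ (\<Gamma> \<turnstile> p)"
  unfolding consistent_def
  by (meson Assm Contr ImpE derives_mono insertI1 subset_insertI)

text \<open>The substitution that sends the fresh variable \<open>k\<close> to 0 and shifts all
  others acts on \<Gamma> like \<open>lift0 0\<close> and undoes the instantiation of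
  \<open>p\<close>, so that \<open>All0I\<close> becomes applicable.\<close>

lemma fresh_witness0:
  assumes "!!q. q \<in> \<Gamma> ==> fm_below k l q" and "fm_below (Suc k) l p" and "\<Gamma> \<turnstile> subst0 0 (Var k) p"
  shows "\<Gamma> \<turnstile> All0 p"
proof -
  define \<sigma> where "\<sigma> = (%i. Var (if i = k then 0 else Suc i))"
  have 1: "psub \<sigma> (%i. i) q = lift0 0 q" if "q \<in> \<Gamma>" for q
    unfolding lift0_0 by (rule psub_cong[OF assms(1)[OF that]]) (auto simp: \<sigma>_def)
  have 2: "psub \<sigma> (%i. i) (subst0 0 (Var k) p) = psub Var (%i. i) p"
    unfolding subst0_0 psub_psub by (rule psub_cong[OF assms(2)]) (auto simp: \<sigma>_def split: nat.split)
  have "psub \<sigma> (%i. i) ` \<Gamma> = lift0 0 ` \<Gamma>" using 1 by (rule image_cong[OF refl])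
  with derives_psub[OF assms(3), of \<sigma> "%i. i"] 2 have "lift0 0 ` \<Gamma> \<turnstile> p" by simp
  then show ?thesis by (rule derives.All0I)
qed

lemma fresh_witness1:
  assumes "!!q. q \<in> \<Gamma> ==> fm_below k l q" and "fm_below k (Suc l) p" and "\<Gamma> \<turnstile> subst1 0 l p"
  shows "\<Gamma> \<turnstile> All1 p"
proof -
  define \<tau> where "\<tau> = (%i. if i = l then 0 else Suc i)"
  have 1: "psub Var \<tau> q = lift1 0 q" if "q \<in> \<Gamma>" for q
    unfolding lift1_0 by (rule psub_cong[OF assms(1)[OF that]]) (auto simp: \<tau>_def)
  have 2: "psub Var \<tau> (subst1 0 l p) = psub Var (%i. i) p"
    unfolding subst1_0 psub_psub by (rule psub_cong[OF assms(2)]) (auto simp: \<tau>_def split: nat.split)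
  have "psub Var \<tau> ` \<Gamma> = lift1 0 ` \<Gamma>" using 1 by (rule image_cong[OF refl])
  with derives_psub[OF assms(3), of Var \<tau>] 2 have "lift1 0 ` \<Gamma> \<turnstile> p" by simp
  then show ?thesis by (rule derives.All1I)
qed

definition witnessed :: "fm set => fm => bool" where
  "witnessed H \<phi> <->
    (ALL p. \<phi> = Imp (All0 p) Fls --> (EX t. Imp (subst0 0 t p) Fls \<in> H))
    & (ALL p. \<phi> = Imp (All1 p) Fls --> (EX Y. Imp (subst1 0 Y p) Fls \<in> H))"

text \<open>Variables serve as witnesses: the formulas of \<Gamma> are closed and \<Delta> is
  finite, so some variable of each sort is still fresh.\<close>

lemma Henkin_step:
  assumes closed: "ALL q:\<Gamma>. fm_below 0 0 q" and fin: "finite \<Delta>" and cons: "consistent (\<Gamma> \<union> \<Delta>)"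
  shows "EX \<Delta>'. finite \<Delta>' & \<Delta> \<subseteq> \<Delta>' & consistent (\<Gamma> \<union> \<Delta>') &
    (consistent (insert \<phi> (\<Gamma> \<union> \<Delta>)) --> \<phi> \<in> \<Delta>' & witnessed \<Delta>' \<phi>)"
proof (cases "consistent (insert \<phi> (\<Gamma> \<union> \<Delta>))")
  case False
  then show ?thesis using fin cons by (intro exI[of _ \<Delta>]) auto
next
  case True
  obtain k where k: "ALL q:insert \<phi> \<Delta>. fm_below k k q"
    using ex_fm_below_finite[of "insert \<phi> \<Delta>"] fin by auto
  let ?G = "insert \<phi> (\<Gamma> \<union> \<Delta>)"
  have below: "fm_below k k q" if "q \<in> ?G" for q
    using that k closed fm_below_mono[of 0 0 q k k] by auto
  have der: "?G \<turnstile> \<phi>" by (simp add: derives.Assm)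
  consider (0) p where "\<phi> = Imp (All0 p) Fls" | (1) p where "\<phi> = Imp (All1 p) Fls"
    | (2) "witnessed {} \<phi>" by (auto simp: witnessed_def)
  then show ?thesis
  proof cases
    case 0
    have "~ (?G \<turnstile> All0 p)" using True der 0 unfolding consistent_def by (blast intro: derives.ImpE)
    moreover have "fm_below (Suc k) k p" using below[of \<phi>] 0 by auto
    ultimately have "~ (?G \<turnstile> subst0 0 (Var k) p)" using fresh_witness0[of ?G, OF below] by blast
    then have "consistent (insert (Imp (subst0 0 (Var k) p) Fls) ?G)" by (simp add: consistent_insert_not)
    then show ?thesis using fin 0
      by (intro exI[of _ "{Imp (subst0 0 (Var k) p) Fls, \<phi>} \<union> \<Delta>"])
         (auto simp: witnessed_def insert_commute)
  next
    case 1
    have "~ (?G \<turnstile> All1 p)" using True der 1 unfolding consistent_def by (blast intro: derives.ImpE)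
    moreover have "fm_below k (Suc k) p" using below[of \<phi>] 1 by auto
    ultimately have "~ (?G \<turnstile> subst1 0 k p)" using fresh_witness1[of ?G, OF below] by blast
    then have "consistent (insert (Imp (subst1 0 k p) Fls) ?G)" by (simp add: consistent_insert_not)
    then show ?thesis using fin 1
      by (intro exI[of _ "{Imp (subst1 0 k p) Fls, \<phi>} \<union> \<Delta>"])
         (auto simp: witnessed_def insert_commute)
  next
    case 2
    then show ?thesis using fin True
      by (intro exI[of _ "insert \<phi> \<Delta>"]) (auto simp: witnessed_def)
  qed
qed

text \<open>Each formula is considered at the stage given by its number. A formula that is
  consistent with the final set \<open>H\<close> was consistent with the smaller set of that stage,
  hence was added there together with a witness.\<close>

lemma Henkin_extension:
  assumes closed: "ALL q:\<Gamma>. fm_below 0 0 q" and cons: "consistent (insert \<psi> \<Gamma>)"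
  obtains H where "\<Gamma> \<subseteq> H" "\<psi> \<in> H" "consistent H"
    "!!\<phi>. consistent (insert \<phi> H) ==> \<phi> \<in> H & witnessed H \<phi>"
proof -
  define Q where "Q = (%\<Delta>. finite \<Delta> & \<psi> \<in> \<Delta> & consistent (\<Gamma> \<union> \<Delta>))"
  have "EX D. ALL n::nat. Q (D n) & (D n \<subseteq> D (Suc n) &
    (consistent (insert (from_nat n) (\<Gamma> \<union> D n)) --> from_nat n \<in> D (Suc n) & witnessed (D (Suc n)) (from_nat n)))"
  proof (rule dependent_nat_choice)
    show "EX x. Q x" using cons by (intro exI[of _ "{\<psi>}"]) (auto simp: Q_def)
  next
    fix x :: "fm set" and n :: nat
    assume "Q x"
    then show "EX y. Q y & x \<subseteq> y & (consistent (insert (from_nat n) (\<Gamma> \<union> x)) -->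
      from_nat n \<in> y & witnessed y (from_nat n))"
      using Henkin_step[OF closed, of x "from_nat n"] unfolding Q_def by blast
  qed
  then obtain D where D: "!!n. Q (D n)" "!!n. D n \<subseteq> D (Suc n)"
    "!!n. consistent (insert (from_nat n) (\<Gamma> \<union> D n)) ==> from_nat n \<in> D (Suc n) & witnessed (D (Suc n)) (from_nat n)"
    by blast
  have mono: "D m \<subseteq> D n" if "m <= n" for m n using D(2) that by (rule lift_Suc_mono_le)
  define H where "H = \<Gamma> \<union> (\<Union>n. D n)"
  have "consistent H"
    unfolding consistent_def
  proof
    assume "H \<turnstile> Fls"
    then obtain F where F: "F \<subseteq> H" "finite F" "F \<turnstile> Fls" using derives_finite by blast
    have "EX n. F \<subseteq> \<Gamma> \<union> D n"
      using F(2,1)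
    proof (induction F rule: finite_induct)
      case (insert x F)
      then obtain n where n: "F \<subseteq> \<Gamma> \<union> D n" by auto
      from insert have "x \<in> \<Gamma> | (EX m. x \<in> D m)" by (auto simp: H_def)
      then obtain m where "x \<in> \<Gamma> \<union> D m" by auto
      with n mono[of n "max n m"] mono[of m "max n m"] have "insert x F \<subseteq> \<Gamma> \<union> D (max n m)" by auto
      then show ?case by blast
    qed auto
    with F D(1) show False unfolding Q_def consistent_def by (meson derives_mono)
  qed
  moreover have "\<phi> \<in> H & witnessed H \<phi>" if "consistent (insert \<phi> H)" for \<phi>
  proof -
    have "consistent (insert \<phi> (\<Gamma> \<union> D (to_nat \<phi>)))"
      using that derives_mono[of "insert \<phi> (\<Gamma> \<union> D (to_nat \<phi>))" Fls "insert \<phi> H"]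
      unfolding consistent_def H_def by blast
    with D(3)[of "to_nat \<phi>"] show ?thesis unfolding H_def witnessed_def from_nat_to_nat by blast
  qed
  moreover have "\<psi> \<in> H" using D(1)[of 0] by (auto simp: Q_def H_def)
  ultimately show ?thesis using that[of H] by (auto simp: H_def)
qed

section \<open>Structures and the term model\<close>

record 'a struct =
  szero :: 'a
  sone :: 'a
  sadd :: "'a => 'a => 'a"
  smul :: "'a => 'a => 'a"
  sless :: "'a => 'a => bool"
  ssets :: "'a set set"

primrec tval :: "'a struct => (nat => 'a) => tm => 'a" where
  "tval M e (Var i) = e i"
| "tval M e Zero = szero M"
| "tval M e One = sone M"
| "tval M e (Add s t) = sadd M (tval M e s) (tval M e t)"
| "tval M e (Mul s t) = smul M (tval M e s) (tval M e t)"

text \<open>Sets are actual subsets of the domain. The sets of the term model can be represented by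
  their extensions because equality of sets is not primitive.\<close>

primrec sat :: "'a struct => (nat => 'a) => (nat => 'a set) => fm => bool" where
  "sat M e E Fls <-> False"
| "sat M e E (Eq s t) <-> tval M e s = tval M e t"
| "sat M e E (Less s t) <-> sless M (tval M e s) (tval M e t)"
| "sat M e E (Mem t X) <-> tval M e t \<in> E X"
| "sat M e E (Imp p q) <-> (sat M e E p --> sat M e E q)"
| "sat M e E (All0 p) <-> (ALL a. sat M (case_nat a e) E p)"
| "sat M e E (All1 p) <-> (ALL A:ssets M. sat M e (case_nat A E) p)"

definition is_model :: "'a struct => bool" where
  "is_model M <-> (ALL p:ACA0. ALL e E. (ALL i. E i \<in> ssets M) --> sat M e E p)"

lemma fm_below_All1_pow: "fm_below k l ((All1 ^^ m) p) <-> fm_below k (l + m) p"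
  by (induction m arbitrary: l) auto

lemma fm_below_All0_pow: "fm_below k l ((All0 ^^ m) p) <-> fm_below (k + m) l p"
  by (induction m arbitrary: k) auto

lemmas form_defs = num_all_def set_all_def f_imp_def f_not_def f_or_def f_and_def f_iff_def num_ex_def
  set_ex_def f_eq_def f_less_def f_mem_def n_add_def n_mul_def

lemma ACA0_closed: "p \<in> ACA0 ==> fm_below 0 0 p"
  unfolding ACA0_def basic_axioms_def induction_axiom_def sentence_def
  by (auto simp: form_defs fm_below_All0_pow fm_below_All1_pow)

text \<open>The countermodel consists of the terms modulo equality in \<open>H\<close>. There are
  countably many classes, and infinitely many because the numerals are distinct by the first two
  axioms; hence \<open>nat\<close> can be taken as the domain.\<close>

theorem completeness:
  assumes sem: "!!M :: nat struct. is_model M ==> (!!e E. (ALL i. E i \<in> ssets M) ==> sat M e E \<phi>)"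
  shows "ACA0 \<turnstile> \<phi>"
proof (rule ccontr)
  assume "~ (ACA0 \<turnstile> \<phi>)"
  then have "consistent (insert (Imp \<phi> Fls) ACA0)" by (simp add: consistent_insert_not)
  then obtain H where H: "ACA0 \<subseteq> H" "Imp \<phi> Fls \<in> H" "consistent H"
    "!!\<phi>. consistent (insert \<phi> H) ==> \<phi> \<in> H & witnessed H \<phi>"
    using ACA0_closed by (metis Henkin_extension)
  have der: "p \<in> H" if "H \<turnstile> p" for p
  proof -
    have "consistent (insert p H)" unfolding consistent_def
      using that H(3) derives.ImpE derives.ImpI unfolding consistent_def by blast
    with H(4) show ?thesis by blast
  qed
  have ass: "H \<turnstile> p" if "p \<in> H" for p using that by (rule derives.Assm)
  have Fls: "Fls \<notin> H" using H(3) ass unfolding consistent_def by blast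
  have neg: "Imp p Fls \<in> H <-> p \<notin> H" for p
    using Fls H(4)[of "Imp p Fls"] consistent_insert_not[of p H] ass der by (metis derives.ImpE)
  have Imp: "Imp p q \<in> H <-> (p \<in> H --> q \<in> H)" for p q
  proof
    assume "Imp p q \<in> H" then show "p \<in> H --> q \<in> H" using ass der by (metis derives.ImpE)
  next
    assume r: "p \<in> H --> q \<in> H"
    show "Imp p q \<in> H"
    proof (cases "p \<in> H")
      case True
      with r have "H \<turnstile> q" using ass by blast
      then show ?thesis using der by (meson derives.ImpI derives_mono subset_insertI)
    next
      case False
      then have "Imp p Fls \<in> H" using neg by blast
      then have "insert p H \<turnstile> Fls"
        by (meson derives.Assm derives.ImpE insertCI insertI1)
      then have "insert p H \<turnstile> q" by (meson derives.Contr derives_mono subset_insertI)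
      then show ?thesis using der derives.ImpI by blast
    qed
  qed
  have All0: "All0 p \<in> H <-> (ALL t. subst0 0 t p \<in> H)" for p
  proof
    assume "All0 p \<in> H" then show "ALL t. subst0 0 t p \<in> H" using ass der derives.All0E by blast
  next
    assume r: "ALL t. subst0 0 t p \<in> H"
    show "All0 p \<in> H"
    proof (rule ccontr)
      assume "All0 p \<notin> H"
      then have "witnessed H (Imp (All0 p) Fls)"
        using H(4) consistent_insert_not der by blast
      then show False using r neg by (auto simp: witnessed_def)
    qed
  qed
  have All1: "All1 p \<in> H <-> (ALL t. subst1 0 t p \<in> H)" for p
  proof
    assume "All1 p \<in> H" then show "ALL t. subst1 0 t p \<in> H" using ass der derives.All1E by blast
  next
    assume r: "ALL t. subst1 0 t p \<in> H"
    show "All1 p \<in> H"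
    proof (rule ccontr)
      assume "All1 p \<notin> H"
      then have "witnessed H (Imp (All1 p) Fls)"
        using H(4) consistent_insert_not der by blast
      then show False using r neg by (auto simp: witnessed_def)
    qed
  qed
  have Eqsub: "subst0 0 s p \<in> H ==> subst0 0 t p \<in> H" if "Eq s t \<in> H" for s t p
    using that ass der derives.EqSubst by blast
  have refl: "Eq t t \<in> H" for t using der derives.EqRefl by blast
  have sbl: "subst_tm 0 u (lift_tm 0 t) = t" for u t
    by (induction t) auto
  have sym: "Eq t s \<in> H" if "Eq s t \<in> H" for s t
    using Eqsub[OF that, of "Eq (Var 0) (lift_tm 0 s)"] refl by (simp add: sbl)
  have trans: "Eq r t \<in> H" if "Eq r s \<in> H" "Eq s t \<in> H" for r s t
    using Eqsub[OF that(2), of "Eq (lift_tm 0 r) (Var 0)"] that(1) by (simp add: sbl)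
  have congr: "Eq (f s u) (f t v) \<in> H" if "Eq s t \<in> H" "Eq u v \<in> H" and f: "f = Add | f = Mul" for s t u v f
  proof -
    have "Eq (f s u) (f t u) \<in> H"
      using f Eqsub[OF that(1), of "Eq (f (lift_tm 0 s) (lift_tm 0 u)) (f (Var 0) (lift_tm 0 u))"] refl
      by (auto simp: sbl)
    moreover have "Eq (f t u) (f t v) \<in> H"
      using f Eqsub[OF that(2), of "Eq (f (lift_tm 0 t) (lift_tm 0 u)) (f (lift_tm 0 t) (Var 0))"] refl
      by (auto simp: sbl)
    ultimately show ?thesis using trans by blast
  qed
  have lessc: "Less t v \<in> H" if "Eq s t \<in> H" "Eq u v \<in> H" "Less s u \<in> H" for s t u v
    using Eqsub[OF that(1), of "Less (Var 0) (lift_tm 0 u)"] Eqsub[OF that(2), of "Less (lift_tm 0 t) (Var 0)"] that(3)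
    by (simp add: sbl)
  have memc: "Mem t X \<in> H" if "Eq s t \<in> H" "Mem s X \<in> H" for s t X
    using Eqsub[OF that(1), of "Mem (Var 0) X"] that(2) by simp
  define cl where "cl t = {s. Eq t s \<in> H}" for t
  have cl_eq: "cl s = cl t <-> Eq s t \<in> H" for s t
    using refl sym trans unfolding cl_def by blast
  define nu where "nu = rec_nat Zero (%_ t. Add t One)"
  have inj: "inj (%i. cl (nu i))"
  proof -
    have b: "sentence (\<forall>\<^sub>0 m. \<^bold>\<not> m \<^bold>+ \<^bold>1 \<^bold>= \<^bold>0) \<in> H" "sentence (\<forall>\<^sub>0 m n. m \<^bold>+ \<^bold>1 \<^bold>= n \<^bold>+ \<^bold>1 \<^bold>\<longrightarrow> m \<^bold>= n) \<in> H"
      using H(1) unfolding ACA0_def basic_axioms_def by auto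
    have z: "Eq (Add t One) Zero \<notin> H" for t
      using b(1) by (auto simp: sentence_def form_defs All0 neg)
    have "subst_tm 0 v (lift_tm 0 u) = u" for u v by (rule sbl)
    then have s: "Eq (Add t One) (Add u One) \<in> H ==> Eq t u \<in> H" for t u
      using b(2) by (auto simp: sentence_def form_defs All0 Imp)
    have "Eq (nu i) (nu j) \<in> H ==> i = j" for i j
    proof (induction i arbitrary: j)
      case 0 then show ?case using z sym by (cases j) (auto simp: nu_def)
    next
      case (Suc i) then show ?case using z s by (cases j) (auto simp: nu_def)
    qed
    then show ?thesis by (auto simp: inj_def cl_eq)
  qed
  have "infinite (range cl)"
    using inj by (metis finite_imageD finite_subset image_subsetI infinite_UNIV_nat rangeI)
  moreover have "countable (range cl)" by auto
  ultimately obtain g :: "nat => tm set" where g: "bij_betw g UNIV (range cl)"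
    by (metis countableE_infinite bij_betw_inv)
  \<comment> \<open>\<open>c\<close> numbers the equivalence classes and \<open>r\<close> will
    choose representatives; the two are inverse to each other up to equality in
    \<open>H\<close>.\<close>
  define c where "c t = inv g (cl t)" for t
  have gc: "g (c t) = cl t" for t
    unfolding c_def using g by (metis bij_betw_def f_inv_into_f rangeI)
  have c_eq: "c s = c t <-> Eq s t \<in> H" for s t
    using gc cl_eq by (metis c_def)
  have c_surj: "EX t. c t = n" for n
    using g gc by (metis bij_betw_def imageE injD rangeI)
  define r where "r n = (SOME t. c t = n)" for n
  have cr: "c (r n) = n" for n unfolding r_def using someI_ex[OF c_surj] .
  have rc: "Eq (r (c t)) t \<in> H" "Eq t (r (c t)) \<in> H" for t using cr c_eq sym by blast+
  define ext where "ext X = {n. Mem (r n) X \<in> H}" for X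
  define M where "M = \<lparr>szero = c Zero, sone = c One, sadd = %a b. c (Add (r a) (r b)),
    smul = %a b. c (Mul (r a) (r b)), sless = %a b. Less (r a) (r b) \<in> H, ssets = range ext\<rparr>"
  have tv: "tval M (%i. c (\<sigma> i)) t = c (tsub \<sigma> t)" for \<sigma> t
  proof (induction t)
    case (Add s t)
    have "sadd M a b = c (Add (r a) (r b))" for a b by (simp add: M_def)
    moreover have "c (Add (r (c u)) (r (c v))) = c (Add u v)" for u v
      using congr[of "r (c u)" u "r (c v)" v Add] rc by (auto simp: c_eq)
    ultimately show ?case using Add by simp
  next
    case (Mul s t)
    have "smul M a b = c (Mul (r a) (r b))" for a b by (simp add: M_def)
    moreover have "c (Mul (r (c u)) (r (c v))) = c (Mul u v)" for u v
      using congr[of "r (c u)" u "r (c v)" v Mul] rc by (auto simp: c_eq)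
    ultimately show ?case using Mul by simp
  qed (auto simp: M_def)
  \<comment> \<open>Assignments are written as substitutions, so that the value of a quantified
    variable is absorbed by \<open>case_nat\<close> in the induction.\<close>
  have truth: "sat M (%i. c (\<sigma> i)) (%i. ext (\<tau> i)) p <-> psub \<sigma> \<tau> p \<in> H" for \<sigma> \<tau> p
  proof (induction p arbitrary: \<sigma> \<tau>)
    case (All0 p)
    have e: "case_nat (c t) (%i. c (\<sigma> i)) = (%i. c (case_nat t \<sigma> i))" for t
      by (auto simp: fun_eq_iff split: nat.split)
    have s: "subst0 0 t (psub (up0 \<sigma>) \<tau> p) = psub (case_nat t \<sigma>) \<tau> p" for t
    proof -
      have "(%i. tsub (case_nat t Var) (up0 \<sigma> i)) = case_nat t \<sigma>"
        by (auto simp: fun_eq_iff up0_def lift_tm0_tsub tsub_tsub split: nat.split)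
      then show ?thesis by (simp add: subst0_0 psub_psub)
    qed
    have "sat M (%i. c (\<sigma> i)) (%i. ext (\<tau> i)) (fm.All0 p) <-> (ALL t. psub (case_nat t \<sigma>) \<tau> p \<in> H)"
      using c_surj e All0.IH by (metis sat.simps(6))
    then show ?case by (simp add: \<open>!!p. (fm.All0 p \<in> H) = (ALL t. subst0 0 t p \<in> H)\<close> s)
  next
    case (All1 p)
    have e: "case_nat (ext t) (%i. ext (\<tau> i)) = (%i. ext (case_nat t \<tau> i))" for t
      by (auto simp: fun_eq_iff split: nat.split)
    have s: "subst1 0 t (psub \<sigma> (up1 \<tau>) p) = psub \<sigma> (case_nat t \<tau>) p" for t
    proof -
      have "(%i. case_nat t (%i. i) (up1 \<tau> i)) = case_nat t \<tau>"
        by (auto simp: fun_eq_iff up1_def split: nat.split)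
      then show ?thesis by (simp add: subst1_0 psub_psub)
    qed
    have "ssets M = range ext" by (simp add: M_def)
    then have "sat M (%i. c (\<sigma> i)) (%i. ext (\<tau> i)) (fm.All1 p) <-> (ALL t. psub \<sigma> (case_nat t \<tau>) p \<in> H)"
      using e All1.IH by simp
    then show ?case by (simp add: \<open>!!p. (fm.All1 p \<in> H) = (ALL t. subst1 0 t p \<in> H)\<close> s)
  next
    case (Less s t)
    have "Less (r (c u)) (r (c v)) \<in> H <-> Less u v \<in> H" for u v using lessc rc by blast
    then show ?case by (simp add: tv) (simp add: M_def)
  next
    case (Mem t X)
    have "Mem (r (c u)) X \<in> H <-> Mem u X \<in> H" for u X using memc rc by blast
    then show ?case by (simp add: tv ext_def)
  qed (auto simp: tv c_eq Fls Imp)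
  have sets: "ssets M = range ext" by (simp add: M_def)
  have "is_model M" unfolding is_model_def
  proof (intro ballI allI impI)
    fix p and e :: "nat => nat" and E :: "nat => nat set" assume p: "p \<in> ACA0" and E: "ALL i. E i \<in> ssets M"
    from E sets have "ALL i. EX X. E i = ext X" by (metis imageE)
    then obtain \<tau> where \<tau>: "E = (%i. ext (\<tau> i))" by metis
    have "e = (%i. c (r (e i)))" by (simp add: cr)
    then have "sat M e E p <-> psub (%i. r (e i)) \<tau> p \<in> H" using truth \<tau> by metis
    then show "sat M e E p" using psub_closed[OF ACA0_closed[OF p]] p H(1) by auto
  qed
  then have "sat M (%i. c (Var i)) (%i. ext i) \<phi>" using sem[of M "%i. ext i"] sets by auto
  then have "\<phi> \<in> H" using truth[of Var "%i. i" \<phi>] by simp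
  with H(2) neg show False by blast
qed

section \<open>A model of arithmetical comprehension\<close>

lemma tval_tsub: "tval M e (tsub \<sigma> t) = tval M (%i. tval M e (\<sigma> i)) t"
  by (induction t) auto

lemma sat_psub: "sat M e E (psub \<sigma> \<tau> p) <-> sat M (%i. tval M e (\<sigma> i)) (%i. E (\<tau> i)) p"
proof (induction p arbitrary: e E \<sigma> \<tau>)
  case (All0 p)
  have "(%i. tval M (case_nat a e) (up0 \<sigma> i)) = case_nat a (%i. tval M e (\<sigma> i))" for a
    by (auto simp: fun_eq_iff up0_def lift_tm0_tsub tval_tsub split: nat.split)
  then show ?case using All0 by simp
next
  case (All1 p)
  have "(%i. case_nat A E (up1 \<tau> i)) = case_nat A (%i. E (\<tau> i))" for A
    by (auto simp: fun_eq_iff up1_def split: nat.split)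
  then show ?case using All1 by simp
qed (auto simp: tval_tsub)

lemma sat_comprehension:
  "sat M e E (comprehension p) <-> (EX A:ssets M. ALL a. a \<in> A <-> sat M (case_nat a e) E p)"
  by (simp add: comprehension_def lift1_0 sat_psub) blast

definition statement :: fm where
  "statement = sentence ((derivative_statement \<^bold>\<longleftrightarrow> upper_derivative_statement)
     \<^bold>\<and> (upper_derivative_statement \<^bold>\<longleftrightarrow> Pi11_bar_induction))"

text \<open>The value of \<open>chosen\<close> if there is no countermodel, so that
  \<open>chosen\<close> is a model in any case.\<close>

definition standard :: "nat struct" where
  "standard = \<lparr>szero = 0, sone = 1, sadd = (+), smul = (*), sless = (<), ssets = UNIV\<rparr>"

lemma sat_All0_pow: "(ALL e. sat M e E p) ==> sat M e E ((All0 ^^ k) p)"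
  by (induction k arbitrary: e) auto

lemma sat_All1_pow: "(ALL E. (ALL i. E i \<in> ssets M) --> sat M e E p) ==> ALL i. E i \<in> ssets M ==>
  sat M e E ((All1 ^^ k) p)"
proof (induction k arbitrary: E)
  case (Suc k)
  have "ALL i. case_nat A E i \<in> ssets M" if "A \<in> ssets M" for A
    using that Suc.prems(2) by (auto split: nat.split)
  then show ?case using Suc by auto
qed auto

lemma standard_model: "is_model standard"
  unfolding is_model_def
proof (intro ballI allI impI)
  fix p and e :: "nat => nat" and E :: "nat => nat set"
  assume p: "p \<in> ACA0"
  have 1: "p \<in> basic_axioms ==> sat standard e E p"
    by (auto simp: basic_axioms_def sentence_def form_defs standard_def less_Suc_eq)
  have "A = UNIV" if "0 \<in> A" "ALL n. n \<in> A --> Suc n \<in> A" for A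
    using that nat_induct[of "%n. n \<in> A"] by auto
  then have 2: "sat standard e E induction_axiom"
    by (simp add: induction_axiom_def sentence_def form_defs standard_def) blast
  have "sat standard e E (comprehension q)" for q e E
    unfolding sat_comprehension by (rule bexI[of _ "{a. sat standard (case_nat a e) E q}"]) (auto simp: standard_def)
  then have 3: "sat standard e E ((All0 ^^ k) ((All1 ^^ l) (comprehension q)))" for q k l
    by (intro sat_All0_pow allI sat_All1_pow) (auto simp: standard_def)
  show "sat standard e E p" using p 1 2 3 unfolding ACA0_def by auto
qed

section \<open>The numbers of a countermodel as a type\<close>

definition bad_model :: "nat struct => bool" where
  "bad_model M <-> is_model M & (EX e E. (ALL i. E i \<in> ssets M) & ~ sat M e E statement)"

text \<open>A countermodel of the statement if there is any, so that the numbers of an arbitrary model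
  form a type, which can be made an instance of type classes.\<close>

definition chosen :: "nat struct" where
  "chosen = (if EX M. bad_model M then SOME M. bad_model M else standard)"

lemma chosen_model: "is_model chosen"
  using someI_ex[of bad_model] by (auto simp: chosen_def standard_model bad_model_def)

typedef N = "UNIV :: nat set" by simp

setup_lifting type_definition_N

instantiation N :: "{zero, one, plus, times, ord}"
begin
lift_definition zero_N :: N is "szero chosen" .
lift_definition one_N :: N is "sone chosen" .
lift_definition plus_N :: "N => N => N" is "sadd chosen" .
lift_definition times_N :: "N => N => N" is "smul chosen" .
lift_definition less_N :: "N => N => bool" is "sless chosen" .
definition less_eq_N :: "N => N => bool" where "less_eq_N x y <-> x < y | x = y"
instance ..
end

definition SS :: "N set set" where
  "SS = (%A. Rep_N -` A) ` ssets chosen"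

definition MN :: "N struct" where
  "MN = \<lparr>szero = 0, sone = 1, sadd = (+), smul = (*), sless = (<), ssets = SS\<rparr>"

lemma MN_simps [simp]:
  "szero MN = 0" "sone MN = 1" "sadd MN = (+)" "smul MN = (*)" "sless MN = (<)" "ssets MN = SS"
  by (auto simp: MN_def)

lemma sat_MN: "sat chosen (%i. Rep_N (e i)) E p <-> sat MN e (%i. Rep_N -` E i) p"
proof (induction p arbitrary: e E)
  case (Eq s t)
  have "tval chosen (%i. Rep_N (e i)) t = Rep_N (tval MN e t)" for t
    by (induction t) (auto simp: zero_N.rep_eq one_N.rep_eq plus_N.rep_eq times_N.rep_eq)
  then show ?case by (simp add: Rep_N_inject)
next
  case (Less s t)
  have "tval chosen (%i. Rep_N (e i)) t = Rep_N (tval MN e t)" for t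
    by (induction t) (auto simp: zero_N.rep_eq one_N.rep_eq plus_N.rep_eq times_N.rep_eq)
  then show ?case by (simp add: less_N.rep_eq)
next
  case (Mem t X)
  have "tval chosen (%i. Rep_N (e i)) t = Rep_N (tval MN e t)" for t
    by (induction t) (auto simp: zero_N.rep_eq one_N.rep_eq plus_N.rep_eq times_N.rep_eq)
  then show ?case by simp
next
  case (All0 p)
  have "(ALL a. sat chosen (case_nat a (%i. Rep_N (e i))) E p) <->
    (ALL a. sat chosen (case_nat (Rep_N a) (%i. Rep_N (e i))) E p)"
    by (metis Abs_N_inverse UNIV_I)
  moreover have "case_nat (Rep_N a) (%i. Rep_N (e i)) = (%i. Rep_N (case_nat a e i))" for a
    by (auto simp: fun_eq_iff split: nat.split)
  ultimately show ?case using All0 by simp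
next
  case (All1 p)
  have "case_nat (Rep_N -` A) (%i. Rep_N -` E i) = (%i. Rep_N -` (case_nat A E i))" for A
    by (auto simp: fun_eq_iff split: nat.split)
  then show ?case using All1 by (simp add: SS_def)
qed auto

lemma SS_choice:
  assumes "ALL i. E i \<in> SS"
  obtains F where "ALL i. F i \<in> ssets chosen" "E = (%i. Rep_N -` F i)"
proof -
  from assms have "ALL i. EX F. F \<in> ssets chosen & E i = Rep_N -` F"
    unfolding SS_def by (metis imageE)
  then show ?thesis using that by metis
qed

lemma MN_model: "is_model MN"
  unfolding is_model_def
proof (intro ballI allI impI)
  fix p and e :: "nat => N" and E :: "nat => N set" assume p: "p \<in> ACA0" and E: "ALL i. E i \<in> ssets MN"
  from E obtain F where "ALL i. F i \<in> ssets chosen" "E = (%i. Rep_N -` F i)" using SS_choice by auto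
  with p chosen_model show "sat MN e E p" unfolding is_model_def by (simp add: sat_MN[symmetric])
qed

text \<open>If there were a countermodel at all, then \<open>chosen\<close> would be one, and
  \<open>MN\<close> is a copy of \<open>chosen\<close>.\<close>

lemma derivable_if_true:
  assumes "!!e E. ALL i. E i \<in> SS ==> sat MN e E statement"
  shows "ACA0 \<turnstile> statement"
proof (rule completeness, rule ccontr)
  fix M :: "nat struct" and e :: "nat => nat" and E :: "nat => nat set"
  assume "is_model M" "ALL i. E i \<in> ssets M" "~ sat M e E statement"
  then have "bad_model M" unfolding bad_model_def by blast
  then have "EX M. bad_model M" by blast
  then have "bad_model chosen" unfolding chosen_def by (simp add: someI_ex)
  then obtain e E where *: "ALL i. E i \<in> ssets chosen" "~ sat chosen e E statement"
    unfolding bad_model_def by blast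
  have "e = (%i. Rep_N (Abs_N (e i)))" by (simp add: Abs_N_inverse)
  then have "~ sat MN (%i. Abs_N (e i)) (%i. Rep_N -` E i) statement" using *(2) sat_MN by metis
  moreover have "ALL i. Rep_N -` E i \<in> SS" using *(1) by (auto simp: SS_def)
  ultimately show False using assms[of "%i. Rep_N -` E i"] by simp
qed

text \<open>A structure without sets satisfies all axioms vacuously; but \<open>bad_model\<close>
  asks for an assignment of sets, and the standard model has sets anyway.\<close>

lemma SS_nonempty: "SS ~= {}"
proof
  assume e: "SS = {}"
  have "ssets chosen = {}" using e by (auto simp: SS_def)
  then have "EX M. bad_model M" unfolding chosen_def standard_def by (auto split: if_splits)
  then have "bad_model chosen" unfolding chosen_def by (simp add: someI_ex)
  with \<open>ssets chosen = {}\<close> show False unfolding bad_model_def by auto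
qed

lemma sat_All0_powD: "(ALL e. sat M e E ((All0 ^^ k) p)) ==> sat M e E p"
proof (induction k arbitrary: e)
  case (Suc k)
  have "sat M (case_nat (e 0) (%i. e (Suc i))) E ((All0 ^^ k) p)" for e using Suc.prems by simp
  moreover have "case_nat (e 0) (%i. e (Suc i)) = e" for e :: "nat => 'a"
    by (auto simp: fun_eq_iff split: nat.split)
  ultimately show ?case using Suc.IH by simp
qed auto

lemma sat_All1_powD:
  "(ALL E. (ALL i. E i \<in> ssets M) --> sat M e E ((All1 ^^ k) p)) ==> ALL i. E i \<in> ssets M ==> sat M e E p"
proof (induction k arbitrary: E)
  case (Suc k)
  have "sat M e E ((All1 ^^ k) p)" if E: "ALL i. E i \<in> ssets M" for E
  proof -
    have "sat M e (case_nat (E 0) (%i. E (Suc i))) ((All1 ^^ k) p)" using Suc.prems(1) E by simp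
    moreover have "case_nat (E 0) (%i. E (Suc i)) = E"
      by (auto simp: fun_eq_iff split: nat.split)
    ultimately show ?thesis by simp
  qed
  then show ?case using Suc by blast
qed auto

lemma comprehension_SS:
  assumes "arithmetical p" "ALL i. E i \<in> SS"
  shows "{a. sat MN (case_nat a e) E p} \<in> SS"
proof -
  obtain k where k: "fm_below k k (comprehension p)" using ex_fm_below by blast
  then have "(All0 ^^ k) ((All1 ^^ k) (comprehension p)) \<in> ACA0" using assms(1) unfolding ACA0_def by auto
  then have "ALL e E. (ALL i. E i \<in> SS) --> sat MN e E ((All0 ^^ k) ((All1 ^^ k) (comprehension p)))"
    using MN_model unfolding is_model_def by simp
  then have "sat MN e E (comprehension p)"
    using sat_All1_powD[of MN e k "comprehension p" E] assms(2) sat_All0_powD by (metis MN_simps(6))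
  then obtain A where "A \<in> SS" "ALL a. a \<in> A <-> sat MN (case_nat a e) E p"
    by (auto simp: sat_comprehension)
  moreover then have "{a. sat MN (case_nat a e) E p} = A" by auto
  ultimately show ?thesis by simp
qed

lemma sat_axiom: "p \<in> ACA0 ==> EX E. sat MN e E p"
proof -
  assume p: "p \<in> ACA0"
  obtain A where "A \<in> SS" using SS_nonempty by blast
  with p have "sat MN e (%i. A) p" using MN_model unfolding is_model_def by simp
  then show ?thesis by blast
qed

lemma N_axioms:
  fixes m n :: N
  shows "m + 1 ~= 0" "m + 1 = n + 1 ==> m = n" "m + 0 = m" "m + (n + 1) = (m + n) + 1"
    "m * 0 = 0" "m * (n + 1) = m * n + m" "~ m < 0" "m < n + 1 <-> m < n | m = n"
proof -
  have ax: "EX E. sat MN (%i. 0) E p" if "p \<in> basic_axioms" for p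
    using that by (intro sat_axiom) (simp add: ACA0_def)
  note ax' = ax[unfolded basic_axioms_def, OF imageI]
  note ev = sentence_def form_defs sat.simps tval.simps MN_simps diff_Suc_Suc minus_nat.diff_0 diff_self_eq_0
    nat.case insert_iff refl simp_thms
  show "m + 1 ~= 0" using ax'[of "\<forall>\<^sub>0 m. \<^bold>\<not> m \<^bold>+ \<^bold>1 \<^bold>= \<^bold>0"] by (simp only: ev)
  show "m + 1 = n + 1 ==> m = n" using ax'[of "\<forall>\<^sub>0 m n. m \<^bold>+ \<^bold>1 \<^bold>= n \<^bold>+ \<^bold>1 \<^bold>\<longrightarrow> m \<^bold>= n"] by (simp only: ev)
  show "m + 0 = m" using ax'[of "\<forall>\<^sub>0 m. m \<^bold>+ \<^bold>0 \<^bold>= m"] by (simp only: ev)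
  show "m + (n + 1) = (m + n) + 1" using ax'[of "\<forall>\<^sub>0 m n. m \<^bold>+ (n \<^bold>+ \<^bold>1) \<^bold>= (m \<^bold>+ n) \<^bold>+ \<^bold>1"] by (simp only: ev)
  show "m * 0 = 0" using ax'[of "\<forall>\<^sub>0 m. m \<^bold>* \<^bold>0 \<^bold>= \<^bold>0"] by (simp only: ev)
  show "m * (n + 1) = m * n + m" using ax'[of "\<forall>\<^sub>0 m n. m \<^bold>* (n \<^bold>+ \<^bold>1) \<^bold>= m \<^bold>* n \<^bold>+ m"] by (simp only: ev)
  show "~ m < 0" using ax'[of "\<forall>\<^sub>0 m. \<^bold>\<not> m \<^bold>< \<^bold>0"] by (simp only: ev)
  show "m < n + 1 <-> m < n | m = n" using ax'[of "\<forall>\<^sub>0 m n. m \<^bold>< n \<^bold>+ \<^bold>1 \<^bold>\<longleftrightarrow> (m \<^bold>< n \<^bold>\<or> m \<^bold>= n)"] by (simp only: ev) blast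
qed

lemma SS_induct:
  assumes "A \<in> SS" "0 \<in> A" "!!n. n \<in> A ==> n + 1 \<in> A"
  shows "n \<in> A"
proof -
  obtain E where "sat MN (%i. 0) E induction_axiom" using sat_axiom by (auto simp: ACA0_def)
  then have "ALL A:SS. 0 \<in> A & (ALL n. n \<in> A --> n + 1 \<in> A) --> (ALL n. n \<in> A)"
    by (simp only: induction_axiom_def sentence_def form_defs sat.simps tval.simps MN_simps nat.case
      diff_Suc_Suc minus_nat.diff_0 diff_self_eq_0) blast
  with assms show ?thesis by blast
qed

section \<open>Arithmetically definable predicates and functions\<close>

text \<open>Predicates and functions depend on a valuation of de Bruijn indices, so that the closure
  rules below apply to nested quantifiers. Set parameters from \<open>SS\<close> are allowed.\<close>

definition dfm :: "((nat => N) => bool) => bool" where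
  "dfm P <-> (EX p E. arithmetical p & (ALL i. E i \<in> SS) & (ALL e. P e <-> sat MN e E p))"

definition dtm :: "((nat => N) => N) => bool" where
  "dtm t <-> dfm (%e. t (%i. e (Suc i)) = e 0)"

named_theorems dfm_intros

lemma arithmetical_psub: "arithmetical (psub \<sigma> \<tau> p) <-> arithmetical p"
  by (induction p arbitrary: \<sigma> \<tau>) auto

lemma dfm_SS:
  assumes "dfm (%e. P (e 0))"
  shows "{x. P x} \<in> SS"
proof -
  obtain p E where p: "arithmetical p" "ALL i. E i \<in> SS" "!!e. P (e 0) <-> sat MN e E p"
    using assms unfolding dfm_def by blast
  have "P a <-> sat MN (case_nat a (%i. 0)) E p" for a using p(3)[of "case_nat a (%i. 0)"] by simp
  then show ?thesis using comprehension_SS[OF p(1,2)] by simp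
qed

lemma dfm_const [dfm_intros]: "dfm (%e. b)"
proof -
  obtain A where "A \<in> SS" using SS_nonempty by blast
  then have "dfm (%e. False)" "dfm (%e. True)" unfolding dfm_def
    by (intro exI[of _ Fls] exI[of _ "%i. A"], simp)
       (intro exI[of _ "Imp Fls Fls"] exI[of _ "%i. A"], use \<open>A \<in> SS\<close> in simp)
  then show ?thesis by (cases b) auto
qed

lemma dfm_imp [dfm_intros]:
  assumes "dfm P" "dfm Q"
  shows "dfm (%e. P e --> Q e)"
proof -
  obtain p E q F where p: "arithmetical p" "ALL i. E i \<in> SS" "!!e. P e <-> sat MN e E p"
    "arithmetical q" "ALL i. F i \<in> SS" "!!e. Q e <-> sat MN e F q"
    using assms unfolding dfm_def by blast
  \<comment> \<open>The set parameters of the two formulas are interleaved.\<close>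
  define G where "G i = (if even i then E (i div 2) else F (i div 2))" for i
  let ?r = "Imp (psub Var (%i. 2 * i) p) (psub Var (%i. 2 * i + 1) q)"
  have 1: "ALL e. (P e --> Q e) <-> sat MN e G ?r"
    by (simp add: sat_psub p G_def)
  have 2: "ALL i. G i \<in> SS" using p by (simp add: G_def)
  have 3: "arithmetical ?r" using p by (simp add: arithmetical_psub)
  show ?thesis unfolding dfm_def by (rule exI[of _ ?r], rule exI[of _ G]) (intro conjI 1 2 3)
qed

lemma dfm_not [dfm_intros]: "dfm P ==> dfm (%e. ~ P e)"
  using dfm_imp[of P "%e. False"] dfm_const by simp

lemma dfm_or [dfm_intros]: "dfm P ==> dfm Q ==> dfm (%e. P e | Q e)"
  using dfm_imp[of "%e. ~ P e" Q] dfm_not[of P] by (simp add: disj_imp)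

lemma dfm_and [dfm_intros]: "dfm P ==> dfm Q ==> dfm (%e. P e & Q e)"
  using dfm_not[of "%e. P e --> ~ Q e"] dfm_imp[of P "%e. ~ Q e"] dfm_not[of Q] by simp

lemma dfm_iff [dfm_intros]: "dfm P ==> dfm Q ==> dfm (%e. P e <-> Q e)"
  using dfm_and[of "%e. P e --> Q e" "%e. Q e --> P e"] dfm_imp[of P Q] dfm_imp[of Q P]
  by (simp add: iff_conv_conj_imp)

lemma dfm_all [dfm_intros]:
  assumes "dfm (%e. P (e 0) (%i. e (Suc i)))"
  shows "dfm (%e. ALL x. P x e)"
proof -
  obtain p E where p: "arithmetical p" "ALL i. E i \<in> SS" "!!e. P (e 0) (%i. e (Suc i)) <-> sat MN e E p"
    using assms unfolding dfm_def by blast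
  have "(ALL x. P x e) <-> sat MN e E (All0 p)" for e
    using p(3)[of "case_nat _ e"] by simp
  with p show ?thesis unfolding dfm_def by (intro exI[of _ "All0 p"] exI[of _ E]) simp
qed

lemma dfm_ex [dfm_intros]:
  assumes "dfm (%e. P (e 0) (%i. e (Suc i)))"
  shows "dfm (%e. EX x. P x e)"
  using dfm_not[OF dfm_all[of "%x e. ~ P x e"]] dfm_not[OF assms] by simp

lemma dfm_ball [dfm_intros]: "dfm (%e. ALL x. x \<in> S e --> P x e) ==> dfm (%e. ALL x:S e. P x e)"
  by (simp add: Ball_def)

lemma dfm_bex [dfm_intros]: "dfm (%e. EX x. x \<in> S e & P x e) ==> dfm (%e. EX x:S e. P x e)"
  by (simp add: Bex_def)

lemma dfm_ren:
  assumes "dfm P" shows "dfm (%e. P (%i. e (f i)))"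
proof -
  obtain p E where p: "arithmetical p" "ALL i. E i \<in> SS" "!!e. P e <-> sat MN e E p"
    using assms unfolding dfm_def by blast
  have "P (%i. e (f i)) <-> sat MN e E (psub (%i. Var (f i)) (%i. i) p)" for e
    by (simp add: sat_psub p(3))
  with p show ?thesis unfolding dfm_def
    by (intro exI[of _ "psub (%i. Var (f i)) (%i. i) p"] exI[of _ E]) (simp add: arithmetical_psub)
qed

lemma dtm_ren: "dtm t ==> dtm (%e. t (%i. e (f i)))"
  unfolding dtm_def
  using dfm_ren[of "%e. t (%i. e (Suc i)) = e 0" "case_nat 0 (%i. Suc (f i))"] by simp

lemma dfm_atomic: "arithmetical p ==> (!!e E. P e <-> sat MN e E p) ==> dfm P"
  using SS_nonempty unfolding dfm_def by fastforce

text \<open>The function \<open>t\<close> has a definable graph but need not be given by a term of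
  the language, so its value enters through a quantifier.\<close>

lemma dfm_sub:
  assumes "dfm (%e. R (e 0) (%i. e (Suc i)))" "dtm t"
  shows "dfm (%e. R (t e) e)"
proof -
  have "dfm (%e. EX y. t e = y & R y e)"
    using assms unfolding dtm_def by (intro dfm_intros)
  then show ?thesis by simp
qed

lemma dfm_sub1:
  assumes "dfm (%e. R (e 0))" "dtm t" shows "dfm (%e. R (t e))"
  using dfm_sub[of "%y e. R y" t] assms by simp

lemma dfm_sub2:
  assumes R: "dfm (%e. R (e 0) (e (Suc 0)))" and t: "dtm t" and u: "dtm u"
  shows "dfm (%e. R (t e) (u e))"
proof (rule dfm_sub[of "%y e. R y (u e)", OF _ t])
  have "dfm (%e. R (e (Suc 0)) (e 0))" using dfm_ren[OF R, of "%i. if i = 0 then Suc 0 else 0"] by simp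
  then show "dfm (%e. R (e 0) (u (%i. e (Suc i))))"
    using dfm_sub[of "%y e. R (e 0) y" "%e. u (%i. e (Suc i))"] dtm_ren[OF u] by simp
qed

lemma dfm_sub3:
  assumes R: "dfm (%e. R (e 0) (e (Suc 0)) (e (Suc (Suc 0))))" and t: "dtm t" and u: "dtm u" and v: "dtm v"
  shows "dfm (%e. R (t e) (u e) (v e))"
proof (rule dfm_sub[of "%y e. R y (u e) (v e)", OF _ t],
       rule dfm_sub[of "%y e. R (e 0) y (v (%i. e (Suc i)))", OF _ dtm_ren[OF u]])
  have "dfm (%e. R (e (Suc (Suc 0))) (e (Suc 0)) (e 0))"
    using dfm_ren[OF R, of "%i. if i = 0 then Suc (Suc 0) else if i = Suc 0 then Suc 0 else 0"] by simp
  then show "dfm (%e. R (e (Suc 0)) (e 0) (v (%i. e (Suc (Suc i)))))"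
    using dfm_sub[of "%y e. R (e (Suc 0)) (e 0) y" "%e. v (%i. e (Suc (Suc i)))"] dtm_ren[OF v] by simp
qed

lemma dtm_var [dfm_intros]: "dtm (%e. e k)"
  unfolding dtm_def by (rule dfm_atomic[of "Eq (Var (Suc k)) (Var 0)"]) auto

lemma dfm_eq [dfm_intros]: "dtm s ==> dtm t ==> dfm (%e. s e = t e)"
  by (rule dfm_sub2[of "(=)"]) (rule dfm_atomic[of "Eq (Var 0) (Var (Suc 0))"], auto)

lemma dfm_less [dfm_intros]: "dtm s ==> dtm t ==> dfm (%e. s e < t e)"
  by (rule dfm_sub2[of "(<)"]) (rule dfm_atomic[of "Less (Var 0) (Var (Suc 0))"], auto)

lemma dfm_le [dfm_intros]: "dtm s ==> dtm t ==> dfm (%e. s e <= t e)"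
  unfolding less_eq_N_def by (intro dfm_intros)

lemma dfm_mem: "A \<in> SS ==> dtm t ==> dfm (%e. t e \<in> A)"
  by (rule dfm_sub1[of "%x. x \<in> A"]) (auto simp: dfm_def intro!: exI[of _ "Mem (Var 0) 0"] exI[of _ "%i. A"])

lemma dtm_sub1:
  assumes f: "dtm (%e. f (e 0))" and t: "dtm t" shows "dtm (%e. f (t e))"
  using dfm_sub2[of "%x y. f x = y", OF _ dtm_ren[OF t, of Suc] dtm_var[of 0]] dfm_ren[OF f[unfolded dtm_def], of "%i. if i = 0 then Suc 0 else 0"]
  unfolding dtm_def by simp

lemma dtm_sub2:
  assumes f: "dtm (%e. f (e 0) (e (Suc 0)))" and t: "dtm t" and u: "dtm u" shows "dtm (%e. f (t e) (u e))"
  using dfm_sub3[of "%x z y. f x z = y", OF _ dtm_ren[OF t, of Suc] dtm_ren[OF u, of Suc] dtm_var[of 0]]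
    dfm_ren[OF f[unfolded dtm_def], of "%i. if i = 0 then Suc (Suc 0) else i - 1"]
  unfolding dtm_def by simp

lemma dtm_0 [dfm_intros]: "dtm (%e. 0)"
  unfolding dtm_def by (rule dfm_atomic[of "Eq Zero (Var 0)"]) auto

lemma dtm_1 [dfm_intros]: "dtm (%e. 1)"
  unfolding dtm_def by (rule dfm_atomic[of "Eq One (Var 0)"]) auto

lemma dtm_add [dfm_intros]: "dtm s ==> dtm t ==> dtm (%e. s e + t e)"
  by (rule dtm_sub2[of "(+)"]) (auto simp: dtm_def intro: dfm_atomic[of "Eq (Add (Var (Suc 0)) (Var (Suc (Suc 0)))) (Var 0)"])

lemma dtm_mul [dfm_intros]: "dtm s ==> dtm t ==> dtm (%e. s e * t e)"
  by (rule dtm_sub2[of "(*)"]) (auto simp: dtm_def intro: dfm_atomic[of "Eq (Mul (Var (Suc 0)) (Var (Suc (Suc 0)))) (Var 0)"])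

text \<open>\<open>dfm\<close> provides set parameters only; an element \<open>a\<close>, which may
  be non-standard, is supplied by the set parameter \<open>{a}\<close>.\<close>

lemma dtm_const [dfm_intros]: "dtm (%e. a)"
proof -
  obtain A where "A \<in> SS" using SS_nonempty by blast
  then have "{x. sat MN (case_nat x (%i. a)) (%i. A) (Eq (Var (Suc 0)) (Var 0))} \<in> SS"
    by (intro comprehension_SS) auto
  then have "{a} \<in> SS" by (simp add: eq_commute[of a])
  from dfm_mem[OF this dtm_var[of 0]] show ?thesis unfolding dtm_def by (simp add: eq_commute[of a])
qed

text \<open>The definite value 0 in the absence of a unique witness makes the graph arithmetical
  without side conditions (\<open>dtm_the0\<close>). Several later definitions rely on this
  default.\<close>

definition the0 :: "(N => bool) => N" where
  "the0 P = (if EX! x. P x then THE x. P x else 0)"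

lemma the0_eq: "the0 P = y <-> (P y & (ALL x. P x --> x = y)) | ((\<nexists>x. P x & (ALL z. P z --> z = x)) & y = 0)"
  unfolding the0_def Ex1_def by (auto intro: the_equality theI2)

lemma the0_equality: "P a ==> (!!x. P x ==> x = a) ==> the0 P = a"
  unfolding the0_eq by blast

lemma dtm_the0 [dfm_intros]:
  assumes "dfm (%e. P (e 0) (%i. e (Suc i)))"
  shows "dtm (%e. the0 (%x. P x e))"
  unfolding dtm_def the0_eq
  using dfm_ren[OF assms, of "%i. if i = 0 then 0 else Suc i"] dfm_ren[OF assms, of "%i. if i = 0 then 0 else Suc (Suc i)"]
    dfm_ren[OF assms, of "%i. if i = 0 then 0 else Suc (Suc (Suc i))"] assms
  by (intro dfm_intros) (simp_all add: dfm_ren)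

lemma dtm_if [dfm_intros]:
  assumes "dfm P" "dtm s" "dtm t"
  shows "dtm (%e. if P e then s e else t e)"
proof -
  have *: "(if b then x else y) = z <-> (b --> x = z) & (~ b --> y = z)" for b and x y z :: N by auto
  show ?thesis unfolding dtm_def *
    by (intro dfm_intros dfm_ren[OF assms(1)] dtm_ren[OF assms(2)] dtm_ren[OF assms(3)])
qed

lemma N_induct [case_names dfm 0 Suc]:
  assumes "dfm (%e. P (e 0))" "P 0" "!!n. P n ==> P (n + 1)"
  shows "P n"
  using SS_induct[OF dfm_SS[OF assms(1)], of n] assms(2,3) by simp

section \<open>Arithmetic in the model\<close>

lemma N_add_0: "0 + n = (n::N)"
  by (induction n rule: N_induct) (auto intro!: dfm_intros simp: N_axioms)

lemma N_add_Suc: "(m + 1) + n = (m + n) + (1::N)"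
  by (induction n rule: N_induct) (auto intro!: dfm_intros simp: N_axioms)

lemma N_add_comm: "m + n = n + (m::N)"
proof (induction n rule: N_induct)
  case (Suc n)
  then show ?case by (metis N_axioms(4) N_add_Suc)
qed (intro dfm_intros, simp only: N_axioms N_add_0)

lemma N_add_assoc: "(m + n) + k = m + (n + (k::N))"
  by (induction k rule: N_induct) (auto intro!: dfm_intros simp: N_axioms)

lemma N_mul_0: "0 * n = (0::N)"
  by (induction n rule: N_induct) (auto intro!: dfm_intros simp: N_axioms)

lemma N_mul_Suc: "(m + 1) * n = m * n + (n::N)"
proof (induction n rule: N_induct)
  case (Suc n)
  have "(m + 1) * (n + 1) = (m * n + n) + (m + 1)" by (simp add: N_axioms Suc)
  also have "\<dots> = (m * n + m) + (n + 1)" by (metis N_add_assoc N_add_comm)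
  finally show ?case by (simp add: N_axioms)
qed (auto intro!: dfm_intros simp: N_axioms)

lemma N_mul_comm: "m * n = n * (m::N)"
  by (induction n rule: N_induct) (auto intro!: dfm_intros simp: N_axioms N_mul_0 N_mul_Suc)

lemma N_distrib: "(m + n) * k = m * k + n * (k::N)"
proof (induction k rule: N_induct)
  case (Suc k)
  have "(m + n) * (k + 1) = (m * k + n * k) + (m + n)" by (simp add: N_axioms Suc)
  also have "\<dots> = (m * k + m) + (n * k + n)" by (metis N_add_assoc N_add_comm)
  finally show ?case by (simp add: N_axioms)
qed (auto intro!: dfm_intros simp: N_axioms)

lemma N_mul_assoc: "(m * n) * k = m * (n * (k::N))"
  by (induction k rule: N_induct) (auto intro!: dfm_intros simp: N_axioms, metis N_distrib N_mul_comm)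

lemma N_less_trans: "k < m ==> m < n ==> k < (n::N)"
  by (induction n rule: N_induct) (auto intro!: dfm_intros simp: N_axioms)

lemma N_zero_less_Suc: "0 < n + (1::N)"
  by (induction n rule: N_induct) (auto intro!: dfm_intros simp: N_axioms)

lemma N_Suc_less: "m < n ==> m + 1 < n + (1::N)"
  by (induction n rule: N_induct) (auto intro!: dfm_intros simp: N_axioms)

lemma N_less_irrefl: "~ n < (n::N)"
proof (induction n rule: N_induct)
  case (Suc n)
  have "n < n + 1" by (simp add: N_axioms)
  then show ?case using Suc N_less_trans N_axioms(8) by metis
qed (auto intro!: dfm_intros simp: N_axioms)

lemma N_zero_le: "0 = n | 0 < (n::N)"
  by (induction n rule: N_induct) (auto intro!: dfm_intros simp: N_axioms N_zero_less_Suc)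

lemma N_less_linear: "m < n | m = n | n < (m::N)"
proof (induction m rule: N_induct)
  case 0 then show ?case using N_zero_le by blast
next
  case (Suc m)
  have "m < n ==> m + 1 < n | m + 1 = n"
    using N_Suc_less[of m n] by (simp add: N_axioms)
  then show ?case using Suc by (auto simp: N_axioms)
qed (intro dfm_intros)

lemma N_add_less: "k < l ==> m + k < m + (l::N)"
  by (induction m rule: N_induct) (auto intro!: dfm_intros simp: N_add_0 N_add_Suc N_Suc_less)

lemma N_le_add: "n < m | n = m ==> EX d. m = n + (d::N)"
proof (induction m rule: N_induct)
  case 0 then show ?case by (auto simp: N_axioms intro: exI[of _ 0])
next
  case (Suc m)
  show ?case
  proof (cases "n = m + 1")
    case True then show ?thesis by (auto simp: N_axioms intro!: exI[of _ 0])
  next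
    case False
    then obtain d where "m = n + d" using Suc by (auto simp: N_axioms)
    then show ?thesis by (intro exI[of _ "d + 1"]) (simp add: N_axioms)
  qed
qed (intro dfm_intros)

lemma N_add_cancel: "m + k = m + l ==> k = (l::N)"
  using N_less_linear[of k l] N_add_less[of k l m] N_add_less[of l k m] N_less_irrefl by metis

lemma N_mul_less:
  assumes "k < l" shows "(m + 1) * k < (m + 1) * (l::N)"
proof (induction m rule: N_induct)
  case 0 then show ?case using assms by (metis N_mul_Suc N_mul_0 N_add_0)
next
  case (Suc m)
  have "(m + 1) * k + k < (m + 1) * k + l" using assms by (rule N_add_less)
  moreover have "l + (m + 1) * k < l + (m + 1) * l" using Suc by (rule N_add_less)
  ultimately show ?case unfolding N_mul_Suc[of "m + 1"] by (metis N_add_comm N_less_trans)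
qed (intro dfm_intros)

lemma N_gt_0: "n ~= 0 ==> EX m. n = m + (1::N)"
proof (induction n rule: N_induct)
  case dfm show ?case by (intro dfm_intros)
qed auto

instantiation N :: linordered_semidom
begin

text \<open>Truncated subtraction: the default value of \<open>the0\<close> covers the case
  \<open>m < n\<close>.\<close>

definition minus_N :: "N => N => N" where
  "m - n = the0 (%d. m = n + d)"

instance
proof
  fix a b c :: N
  show "a + b + c = a + (b + c)" by (rule N_add_assoc)
  show "a + b = b + a" by (rule N_add_comm)
  show "0 + a = a" by (rule N_add_0)
  show "a * b * c = a * (b * c)" by (rule N_mul_assoc)
  show "a * b = b * a" by (rule N_mul_comm)
  show "1 * a = a" using N_mul_Suc[of 0 a] by (simp only: N_mul_0 N_add_0)
  show "(a + b) * c = a * c + b * c" by (rule N_distrib)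
  show distr: "a * (b + c) = a * b + a * c" for a b c :: N using N_distrib N_mul_comm by metis
  show "0 * a = 0" by (rule N_mul_0)
  show "a * 0 = 0" by (rule N_axioms)
  show "(0::N) ~= 1" using N_axioms(1)[of 0] N_add_0[of 1] by metis
  show d: "a + b - a = b" for a b :: N
    unfolding minus_N_def by (rule the0_equality) (auto dest: N_add_cancel)
  have m: "a - b = 0" if "\<nexists>d. a = b + d" for a b :: N
    using that unfolding minus_N_def the0_eq by blast
  show "a - b - c = a - (b + c)"
  proof (cases "EX d. a = b + d")
    case True
    then obtain d where a: "a = b + d" by blast
    have eq: "(%x. d = c + x) = (%x. a = b + c + x)"
      by (rule ext) (metis a N_add_assoc N_add_cancel)
    have "a - b - c = d - c" unfolding a d ..
    also have "\<dots> = a - (b + c)" unfolding minus_N_def eq ..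
    finally show ?thesis .
  next
    case False
    then have "\<nexists>d. a = b + c + d" by (metis N_add_assoc)
    then have "a - (b + c) = 0" by (rule m)
    moreover have "0 - c = 0"
    proof (cases "c = 0")
      case True then show ?thesis using d[of 0 0] N_add_0[of 0] by (simp only:)
    next
      case False
      then have "0 ~= c + x" for x using N_gt_0[of c] N_axioms(1) N_add_Suc by metis
      then show ?thesis by (intro m) blast
    qed
    ultimately show ?thesis using m[OF False] by (simp only:)
  qed
  show lt: "(a < b) = (a <= b & ~ b <= a)" unfolding less_eq_N_def using N_less_trans[of a b a] N_less_irrefl[of a] by auto
  show "a <= a" unfolding less_eq_N_def by blast
  show "a <= b ==> b <= c ==> a <= c" unfolding less_eq_N_def using N_less_trans by blast
  show "a <= b ==> b <= a ==> a = b" unfolding less_eq_N_def using N_less_trans[of a b a] N_less_irrefl[of a] by auto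
  show "a <= b | b <= a" unfolding less_eq_N_def using N_less_linear by blast
  show "a <= b ==> c + a <= c + b" unfolding less_eq_N_def using N_add_less by blast
  show "a < b ==> 0 < c ==> c * a < c * b" using N_mul_less N_gt_0 N_less_irrefl by metis
  show "b <= a ==> a - b + b = a"
    unfolding less_eq_N_def using N_le_add[of b a] d N_add_comm by metis
  show "a * (b - c) = a * b - a * c"
  proof (cases "EX d. b = c + d")
    case True
    then show ?thesis using d distr by metis
  next
    case False
    show ?thesis
    proof (cases "a = 0")
      case True
      then show ?thesis using d[of 0 0] N_add_0[of 0] by (simp only: N_mul_0)
    next
      case a: False
      then obtain a' where a': "a = a' + 1" using N_gt_0 by blast
      have "b < c" using False N_le_add[of c b] N_less_linear by blast
      then have "a * b < a * c" using N_mul_less a' by metis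
      moreover have "x <= x + y" for x y :: N
        using N_zero_le[of y] N_add_less[of 0 y x] N_axioms(3) unfolding less_eq_N_def by metis
      ultimately have "\<nexists>d. a * b = a * c + d"
        unfolding less_eq_N_def using N_less_trans N_less_irrefl by metis
      then show ?thesis using m[OF False] m N_axioms(5) by metis
    qed
  qed
  show "a ~= 0 ==> b ~= 0 ==> a * b ~= 0"
    using N_gt_0[of a] N_gt_0[of b] N_axioms(1,4,6) by metis
  show "(0::N) < 1" using N_zero_less_Suc[of 0] by (simp only: N_add_0)
qed
end

instance N :: ordered_cancel_comm_monoid_diff
proof
  fix a b :: N
  show "a <= b <-> (EX c. b = a + c)"
  proof
    assume "a <= b" then show "EX c. b = a + c" unfolding less_eq_N_def by (rule N_le_add)
  next
    have "0 <= c" for c :: N unfolding less_eq_N_def using N_zero_le by blast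
    then show "EX c. b = a + c ==> a <= b" by auto
  qed
  have "0 ~= a + x" if "a ~= 0" for x
    using that N_zero_le[of a] N_zero_le[of x] by (metis add_pos_nonneg less_eq_N_def less_irrefl)
  then show "0 - a = 0" unfolding minus_N_def the0_eq by (cases "a = 0") auto
qed

lemma less_Suc [simp]: "(m::N) < n + 1 <-> m <= n"
  by (simp add: N_axioms less_eq_N_def)

lemma Suc_le [simp]: "(m::N) + 1 <= n <-> m < n"
  using less_Suc[of n m] by (simp add: not_less[symmetric] del: less_Suc)

lemma N_le_0 [simp]: "(0::N) <= n"
  unfolding less_eq_N_def using N_zero_le by blast

lemma N_not_less_0 [simp]: "~ (n::N) < 0"
  by (simp add: not_less)

lemma N_gt_0_iff: "0 < (n::N) <-> n ~= 0"
  using N_zero_le by auto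

lemma N_cases: obtains "(n::N) = 0" | m where "n = m + 1"
  using N_gt_0 by blast

lemma N_less_induct [case_names dfm less]:
  assumes P: "dfm (%e. P (e 0))" and step: "!!n. (!!m. m < n ==> P m) ==> P (n::N)"
  shows "P n"
proof -
  have "ALL m<k. P m" for k
  proof (induction k rule: N_induct)
    case dfm show ?case by (intro dfm_intros dfm_sub1[OF P])
  next
    case (Suc k) then show ?case using step[of k] by (metis N_axioms(8))
  qed auto
  then show ?thesis using step by blast
qed

lemma N_least:
  assumes P: "dfm (%e. P (e 0))" and "P n"
  obtains m :: N where "P m" "!!k. k < m ==> ~ P k"
  using N_less_induct[of "%n. ~ P n" n] dfm_not[OF P] assms(2) by blast

lemma dtm_minus [dfm_intros]: "dtm s ==> dtm t ==> dtm (%e. s e - t e)"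
  by (rule dtm_sub2[of "(-)"]) (unfold minus_N_def, intro dfm_intros)

section \<open>Pairs and finite sets\<close>

definition pr :: "N => N => N" where
  "pr s t = (s + t) * (s + t) + s"

lemma dtm_pr [dfm_intros]: "dtm s ==> dtm t ==> dtm (%e. pr (s e) (t e))"
  unfolding pr_def by (intro dfm_intros)

text \<open>A pair lies between the square of \<open>s + t\<close> and the next square.\<close>

lemma pr_aux: assumes "s + t < s' + (t'::N)" shows "pr s t < pr s' t'"
proof -
  let ?a = "s + t" and ?b = "s' + t'"
  have "?a + 1 <= ?b" using assms by simp
  then have "(?a + 1) * (?a + 1) <= ?b * ?b" by (intro mult_mono) auto
  moreover have "?a * ?a + s < (?a + 1) * (?a + 1)"
  proof -
    have "(?a + 1) * (?a + 1) = (?a * ?a + s) + (t + ?a + 1)" by (simp add: algebra_simps)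
    moreover have "0 < t + ?a + 1" by (simp add: add_nonneg_pos)
    ultimately show ?thesis by (metis add.right_neutral add_strict_left_mono)
  qed
  ultimately show ?thesis unfolding pr_def by (metis add_increasing2 N_le_0 less_le_trans)
qed

lemma pr_inject [simp]: "pr s t = pr s' t' <-> s = s' & t = t'"
proof
  assume eq: "pr s t = pr s' t'"
  then have "s + t = s' + t'" using pr_aux[of s t s' t'] pr_aux[of s' t' s t] by (metis less_irrefl linorder_neqE)
  with eq show "s = s' & t = t'" by (auto simp: pr_def)
qed auto

lemma mult_self_ge: "(a::N) <= a * a"
  by (metis N_cases N_le_0 N_mul_Suc add_increasing2 mult_zero_right mult.commute le_add_same_cancel2 order_refl)

lemma pr_ge1: "s <= pr s t" "t <= pr s t"
proof -
  show "s <= pr s t" by (simp add: pr_def)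
  have "t <= s + t" by simp
  also have "\<dots> <= (s + t) * (s + t)" by (rule mult_self_ge)
  also have "\<dots> <= pr s t" by (simp add: pr_def)
  finally show "t <= pr s t" .
qed

lemma pr_gt: assumes "0 < s" shows "t < pr s t"
proof -
  have "t < s + t" using assms by simp
  also have "\<dots> <= (s + t) * (s + t)" by (rule mult_self_ge)
  also have "\<dots> <= pr s t" by (simp add: pr_def)
  finally show "t < pr s t" .
qed

section \<open>Finite sets coded by divisibility\<close>

definition infin :: "N => N => bool" where
  "infin x a <-> (EX k m n. a = pr k (pr m n) & x < k & (EX q. n = q * (m * (x + 1) + 1)))"

lemma dfm_infin [dfm_intros]: "dtm s ==> dtm t ==> dfm (%e. infin (s e) (t e))"
  by (rule dfm_sub2[of infin]) (unfold infin_def, intro dfm_intros)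

definition FinSet :: "N => bool" where
  "FinSet a <-> (ALL b. b < a --> ~ (ALL x. infin x b <-> infin x a))"

lemma dfm_FinSet [dfm_intros]: "dtm t ==> dfm (%e. FinSet (t e))"
  by (rule dfm_sub1[of FinSet]) (unfold FinSet_def, intro dfm_intros)

lemma infin_less: "infin x a ==> x < a"
  unfolding infin_def using pr_ge1(1) by (metis less_le_trans)

text \<open>A substitute for the factorial of \<open>k\<close>: recursion becomes available only
  after the coding of finite sets, which depends on this lemma.\<close>

lemma ex_common_multiple: "EX m. 0 < m & (ALL i. 0 < i & i <= k --> (EX q. m = q * (i::N)))"
proof (induction k rule: N_induct)
  case 0 then show ?case by (auto intro!: exI[of _ 1])
next
  case (Suc k)
  then obtain m where m: "0 < m" "ALL i. 0 < i & i <= k --> (EX q. m = q * i)" by blast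
  have "EX q. m * (k + 1) = q * i" if i: "0 < i" "i <= k + 1" for i
  proof (cases "i = k + 1")
    case False
    then have "i <= k" using i by (metis less_Suc order_le_less)
    then obtain q where "m = q * i" using m(2) i(1) by blast
    then show ?thesis by (intro exI[of _ "q * (k + 1)"]) (simp add: algebra_simps)
  qed auto
  then show ?case using m(1) by (intro exI[of _ "m * (k + 1)"]) (auto simp: add_nonneg_pos)
qed (intro dfm_intros)

text \<open>Let \<open>u\<close> and \<open>v\<close> be the moduli of \<open>x\<close> and
  \<open>y\<close>. Since \<open>(x + 1) * v\<close> and \<open>(y + 1) * u\<close> differ by
  \<open>d\<close>, and \<open>u\<close> divides \<open>n * v\<close>, it also divides
  \<open>n * d\<close>, hence \<open>n * m * (x + 1)\<close>. This is \<open>n * u\<close> less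
  \<open>n\<close>, so \<open>u\<close> divides \<open>n\<close>.\<close>

lemma beta_coprime:
  fixes m n q x y d :: N
  assumes "m = p * d" "y = x + d | x = y + d" "n * (m * (y + 1) + 1) = q * (m * (x + 1) + 1)"
  shows "(m * (x + 1) + 1) dvd n"
proof -
  let ?u = "m * (x + 1) + 1" and ?v = "m * (y + 1) + 1"
  have "?u dvd n * d"
    using assms(2)
  proof
    assume y: "y = x + d"
    have "n * (y + 1) * ?u = n * ((x + 1) * ?v + d)" unfolding y by (simp add: algebra_simps)
    also have "\<dots> = (x + 1) * (n * ?v) + n * d" by (simp add: algebra_simps)
    also have "\<dots> = ((x + 1) * q) * ?u + n * d" unfolding assms(3) by (simp add: mult.assoc)
    finally show ?thesis by (metis dvd_add_times_triv_left_iff dvd_triv_right)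
  next
    assume x: "x = y + d"
    have "n * (y + 1) * ?u + n * d = (x + 1) * (n * ?v)" unfolding x by (simp add: algebra_simps)
    also have "\<dots> = ((x + 1) * q) * ?u" unfolding assms(3) by (simp add: mult.assoc)
    finally show ?thesis by (metis dvd_add_times_triv_left_iff dvd_triv_right)
  qed
  then have "?u dvd n * d * (p * (x + 1))" by (rule dvd_mult2)
  then obtain c where "n * d * (p * (x + 1)) = c * ?u" by (metis dvdE mult.commute)
  then have "n * ?u = c * ?u + n" using assms(1) by (simp add: algebra_simps)
  then show ?thesis by (metis dvd_add_times_triv_left_iff dvd_triv_right)
qed

text \<open>By induction on \<open>j\<close>, the number \<open>n\<close> is the product of the
  moduli \<open>m * (x + 1) + 1\<close> with \<open>P x\<close> and \<open>x < j\<close>. As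
  \<open>m\<close> is a multiple of all positive numbers up to \<open>k\<close>,
  \<open>beta_coprime\<close> shows that no other modulus divides it; \<open>0 < m\<close> makes all
  moduli larger than 1.\<close>

lemma beta_coding:
  assumes P: "dfm (%e. P (e 0))"
  shows "EX m n. ALL x<k. (EX q. n = q * (m * (x + 1) + 1)) <-> P x"
proof -
  obtain m where m: "0 < m" "ALL i. 0 < i & i <= k --> (EX q. m = q * i)" using ex_common_multiple by blast
  have "EX n. n ~= 0 & (ALL x<k. (EX q. n = q * (m * (x + 1) + 1)) <-> P x & x < j)" if "j <= k" for j
    using that
  proof (induction j rule: N_induct)
    case 0
    have "1 ~= q * (m * (x + 1) + 1)" for q x
    proof (cases q rule: N_cases)
      case (2 q')
      have "0 < m * (x + 1)" using m(1) by (simp add: add_nonneg_pos)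
      then have "1 < m * (x + 1) + 1" by simp
      also have "\<dots> <= q * (m * (x + 1) + 1)" unfolding 2 by (simp only: N_mul_Suc) simp
      finally show ?thesis by simp
    qed simp
    then show ?case by (intro exI[of _ 1]) auto
  next
    case (Suc j)
    then have j: "j < k" by simp
    with Suc obtain n where n: "n ~= 0" "!!x. x < k ==> (EX q. n = q * (m * (x + 1) + 1)) <-> P x & x < j" by (meson less_imp_le)
    show ?case
    proof (cases "P j")
      case False
      then have "P x & x < j + 1 <-> P x & x < j" for x by (metis less_Suc order_le_less)
      then show ?thesis using n by auto
    next
      case True
      let ?n = "n * (m * (j + 1) + 1)"
      have "(EX q. ?n = q * (m * (x + 1) + 1)) <-> P x & x < j + 1" if x: "x < k" for x
      proof (cases "x = j")
        case True with \<open>P j\<close> show ?thesis by auto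
      next
        case False
        have "(EX q. n = q * (m * (x + 1) + 1))" if "?n = q * (m * (x + 1) + 1)" for q
        proof -
          obtain d where d: "j = x + d | x = j + d" using le_iff_add linear by metis
          with False have "0 < d" by (auto simp: N_gt_0_iff)
          moreover have "d <= k" using d x j by (metis N_le_0 add_increasing le_add_same_cancel2 less_imp_le order_trans)
          ultimately obtain p where "m = p * d" using m(2) by blast
          from beta_coprime[OF this d that] show ?thesis by (metis dvdE mult.commute)
        qed
        moreover have "EX q. ?n = q * (m * (x + 1) + 1)" if "n = q * (m * (x + 1) + 1)" for q
          by (intro exI[of _ "q * (m * (j + 1) + 1)"]) (simp add: that algebra_simps)
        ultimately have "(EX q. ?n = q * (m * (x + 1) + 1)) <-> P x & x < j" using n(2)[OF x] by blast
        moreover have "x < j + 1 <-> x < j" using False by (metis less_Suc order_le_less)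
        ultimately show ?thesis by simp
      qed
      moreover have "?n ~= 0" using n(1) N_axioms(1) by (simp only: mult_eq_0_iff) simp
      ultimately show ?thesis by blast
    qed
  qed (intro dfm_intros dfm_sub1[OF P])
  from this[OF order_refl] show ?thesis by blast
qed

definition elts :: "N => N set" where
  "elts a = {x. infin x a}"

lemma dfm_elts [dfm_intros]: "dtm s ==> dtm t ==> dfm (%e. s e \<in> elts (t e))"
  unfolding elts_def by simp (intro dfm_intros)

lemma elts_less: "x \<in> elts a ==> x < a"
  by (simp add: elts_def infin_less)

lemma FinSet_eqI: "FinSet a ==> FinSet b ==> elts a = elts b ==> a = b"
  unfolding FinSet_def elts_def by (metis linorder_neqE mem_Collect_eq)

definition coded_set :: "N set => bool" where
  "coded_set A <-> (EX a. FinSet a & elts a = A)"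

text \<open>The code of a bounded set in \<open>SS\<close> (0 for other sets).\<close>

definition code :: "N set => N" where
  "code A = the0 (%a. FinSet a & elts a = A)"

lemma coded_setI:
  assumes A: "A \<in> SS" and b: "!!x. x \<in> A ==> x < k"
  shows "coded_set A"
proof -
  obtain m n where mn: "ALL x<k. (EX q. n = q * (m * (x + 1) + 1)) <-> x \<in> A"
    using beta_coding[OF dfm_mem[OF A dtm_var]] by blast
  let ?P = "%a. ALL x. infin x a <-> x \<in> A"
  have "infin x (pr k (pr m n)) <-> x < k & (EX q. n = q * (m * (x + 1) + 1))" for x
    unfolding infin_def by simp
  then have "?P (pr k (pr m n))" using mn b by blast
  moreover have "dfm (%e. ?P (e 0))" by (intro dfm_intros dfm_mem[OF A])
  ultimately obtain a where a: "?P a" "!!b. b < a ==> ~ ?P b" using N_least[of ?P] by blast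
  then have "FinSet a & elts a = A" unfolding FinSet_def elts_def by blast
  then show ?thesis unfolding coded_set_def by blast
qed

lemma code_eqI: "FinSet a ==> elts a = A ==> code A = a"
  unfolding code_def by (rule the0_equality) (auto intro: FinSet_eqI)

lemma coded_set_code: "coded_set A ==> FinSet (code A) & elts (code A) = A"
  unfolding coded_set_def by (metis code_eqI)

lemma code_elts [simp]: "FinSet a ==> code (elts a) = a"
  by (rule code_eqI) auto

lemma elts_SS [simp]: "elts a \<in> SS"
  using dfm_SS[of "%x. x \<in> elts a"] by (simp add: dfm_elts dtm_var dtm_const)

lemma coded_elts [simp]: "coded_set (elts a)"
  by (rule coded_setI[of _ a]) (auto simp: elts_less)

lemma coded_set_SS: "coded_set A ==> A \<in> SS"
  by (auto simp: coded_set_def)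

lemma coded_set_subset: "coded_set A ==> B \<in> SS ==> B \<subseteq> A ==> coded_set B"
  unfolding coded_set_def using coded_setI[of B] elts_less unfolding coded_set_def by blast

lemma code_inject: "coded_set A ==> coded_set B ==> code A = code B <-> A = B"
  by (metis coded_set_code)

lemma dtm_code [dfm_intros]:
  assumes "dfm (%e. P (e 0) (%i. e (Suc i)))"
  shows "dtm (%e. code {x. P x e})"
proof -
  have "dfm (%e. FinSet (e 0) & (ALL x. x \<in> elts (e 0) <-> P x (%i. e (Suc i))))"
    using dfm_ren[OF assms, of "%i. if i = 0 then 0 else Suc i"]
    by (intro dfm_intros) simp
  then show ?thesis unfolding code_def set_eq_iff by (intro dtm_the0) simp
qed

lemma coded_set_Collect:
  assumes "dfm (%e. P (e 0))" "!!x. P x ==> x < k"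
  shows "coded_set {x. P x}"
  using assms by (intro coded_setI[of _ k] dfm_SS) auto

lemma coded_set_sub: "coded_set A ==> dfm (%e. P (e 0)) ==> coded_set {x \<in> A. P x}"
  by (rule coded_set_subset[of A], assumption, rule dfm_SS, rule dfm_and, rule dfm_mem)
     (auto intro: dtm_var coded_set_SS)

lemma coded_set_bounded: "coded_set A ==> EX k. ALL x:A. x < k"
  by (auto simp: coded_set_def dest: elts_less)

lemma coded_set_empty [simp]: "coded_set {}"
  using coded_set_Collect[of "%x. False" 0] by (simp add: dfm_const)

lemma coded_set_Un:
  assumes "coded_set A" "coded_set B" shows "coded_set (A \<union> B)"
proof -
  obtain k l where "ALL x:A. x < k" "ALL x:B. x < l" using assms coded_set_bounded by blast
  moreover have "A \<union> B \<in> SS"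
    using dfm_SS[of "%x. x \<in> A | x \<in> B"] assms by (simp add: dfm_intros dfm_mem coded_set_SS Un_def)
  ultimately show ?thesis
    by (intro coded_setI[of _ "max k l"]) (auto simp: less_max_iff_disj)
qed

lemma coded_set_singleton [simp]: "coded_set {a}"
  using coded_set_Collect[of "%x. x = a" "a + 1"] by (simp add: dfm_intros)

lemma coded_set_insert [simp]: "coded_set A ==> coded_set (insert x A)"
  using coded_set_Un[of "{x}" A] by simp

lemma coded_set_below [simp]: "coded_set {x. x < k}"
  by (rule coded_set_Collect) (auto intro: dfm_intros)

lemma elts_code [simp]: "coded_set A ==> elts (code A) = A"
  using coded_set_code by blast

lemma FinSet_code [simp]: "coded_set A ==> FinSet (code A)"
  using coded_set_code by blast

lemma bounded_function:
  assumes "dtm (%e. f (e 0))" shows "EX b. ALL x<k. f x < b"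
proof (induction k rule: N_induct)
  case dfm show ?case by (intro dfm_intros dtm_sub1[OF assms])
next
  case (Suc k)
  then obtain b where "ALL x<k. f x < b" by blast
  then have "ALL x<k+1. f x < max b (f k + 1)" by (simp add: less_max_iff_disj le_less)
  then show ?case by blast
qed auto

lemma coded_set_image:
  assumes "coded_set A" "dtm (%e. f (e 0))" shows "coded_set (f ` A)"
proof -
  obtain k where "ALL x:A. x < k" using assms coded_set_bounded by blast
  moreover obtain b where "ALL x<k. f x < b" using bounded_function[OF assms(2)] by blast
  moreover have "f ` A = {y. EX x. x \<in> A & y = f x}" by auto
  moreover have "{y. EX x. x \<in> A & y = f x} \<in> SS"
    by (rule dfm_SS) (intro dfm_intros dfm_mem dtm_sub1[OF assms(2)] coded_set_SS[OF assms(1)])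
  ultimately show ?thesis by (intro coded_setI[of _ b]) auto
qed

text \<open>The induction in the model is over \<open>k\<close>, for the part of \<open>A\<close>
  below \<open>k\<close>; definability of \<open>P\<close> is expressed through codes for this
  purpose.\<close>

lemma coded_set_induct [consumes 1, case_names dfm empty insert]:
  assumes "coded_set A" "dfm (%e. P (elts (e 0)))" "P {}"
    "!!x A. coded_set A ==> x \<notin> A ==> P A ==> P (insert x A)"
  shows "P A"
proof -
  have *: "P {x \<in> A. x < k}" for k
  proof (induction k rule: N_induct)
    case dfm
    have "P {x \<in> A. x < k} <-> P (elts (code {x. x \<in> A & x < k}))" for k
      using coded_set_sub[OF assms(1), of "%x. x < k"] by (simp add: dfm_intros)
    then show ?case
      by simp (intro dfm_sub1[OF assms(2)] dfm_intros dfm_mem coded_set_SS[OF assms(1)])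
  next
    case 0 then show ?case using assms(3) by simp
  next
    case (Suc k)
    show ?case
    proof (cases "k \<in> A")
      case True
      then have "{x \<in> A. x < k + 1} = insert k {x \<in> A. x < k}" by auto
      then show ?thesis using assms(4)[OF coded_set_sub[OF assms(1), of "%x. x < k"] _ Suc] by (simp add: dfm_intros)
    next
      case False
      then have "{x \<in> A. x < k + 1} = {x \<in> A. x < k}" by (auto simp: le_less)
      then show ?thesis using Suc by simp
    qed
  qed
  obtain k where "ALL x:A. x < k" using assms coded_set_bounded by blast
  then have "{x \<in> A. x < k} = A" by auto
  then show ?thesis using *[of k] by simp
qed

section \<open>Coded functions and recursion\<close>

definition fapp :: "N => N => N" where
  "fapp f i = the0 (%y. pr i y \<in> elts f)"

definition gr :: "N => (N => N) => N" where
  "gr k f = code {p. EX i<k. p = pr i (f i)}"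

lemma dtm_fapp [dfm_intros]: "dtm s ==> dtm t ==> dtm (%e. fapp (s e) (t e))"
  by (rule dtm_sub2[of fapp]) (unfold fapp_def, intro dfm_intros)

lemma dtm_sub:
  assumes "dtm (%e. f (e 0) (%i. e (Suc i)))" "dtm t"
  shows "dtm (%e. f (t e) e)"
  unfolding dtm_def
proof (rule dfm_sub[of "%y e. f y (%i. e (Suc i)) = e 0" "%e. t (%i. e (Suc i))", OF _ dtm_ren[OF assms(2)]])
  show "dfm (%e. f (e 0) (%i. e (Suc (Suc i))) = e (Suc 0))"
    using dfm_ren[OF assms(1)[unfolded dtm_def], of "%i. if i = 0 then Suc 0 else if i = Suc 0 then 0 else i"]
    by simp
qed

lemma dtm_gr [dfm_intros]:
  assumes "dtm (%e. f (e 0) (%i. e (Suc i)))" "dtm t"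
  shows "dtm (%e. gr (t e) (%i. f i e))"
proof -
  have "dtm (%e. f (e 0) (%i. e (Suc (Suc i))))"
    using dtm_ren[OF assms(1), of "%i. if i = 0 then 0 else Suc i"] by simp
  then show ?thesis
    unfolding gr_def by (intro dfm_intros dtm_ren[OF assms(2)])
qed

lemma gr_cong: "(!!i. i < k ==> f i = g i) ==> gr k f = gr k g"
  unfolding gr_def by (rule arg_cong[of _ _ code]) auto

lemma coded_gr:
  assumes "dtm (%e. f (e 0))" shows "coded_set {p. EX i<k. p = pr i (f i)}"
proof -
  have "{p. EX i<k. p = pr i (f i)} = (%i. pr i (f i)) ` {i. i < k}" by auto
  then show ?thesis using coded_set_image[of "{i. i < k}" "%i. pr i (f i)"] assms by (simp add: dfm_intros)
qed

lemma elts_gr: "dtm (%e. f (e 0)) ==> elts (gr k f) = {p. EX i<k. p = pr i (f i)}"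
  unfolding gr_def by (simp add: coded_gr)

lemma FinSet_gr: "dtm (%e. f (e 0)) ==> FinSet (gr k f)"
  unfolding gr_def by (simp add: coded_gr)

lemma pr_in_gr: "dtm (%e. f (e 0)) ==> pr i y \<in> elts (gr k f) <-> i < k & y = f i"
  by (auto simp: elts_gr)

lemma fapp_gr [simp]: "dtm (%e. f (e 0)) ==> i < k ==> fapp (gr k f) i = f i"
  unfolding fapp_def by (rule the0_equality) (auto simp: pr_in_gr)

definition approx :: "(N => N => N) => N => N => bool" where
  "approx H c x <-> c = gr x (fapp c) & (ALL i<x. fapp c i = H i (gr i (fapp c)))"

text \<open>Course-of-values recursion: the second argument of \<open>H\<close> is the code of the graph of the
  function restricted to smaller arguments.\<close>

definition recur :: "(N => N => N) => N => N" where
  "recur H x = the0 (%y. EX c. approx H c x & y = H x c)"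

lemma dtm_recur [dfm_intros]:
  assumes H: "dtm (%e. H (e 0) (e (Suc 0)) (%i. e (Suc (Suc i))))" and t: "dtm t"
  shows "dtm (%e. recur (%x g. H x g e) (t e))"
proof -
  have H': "dtm (%e. H (u e) (v e) (%i. e (f i)))" if u: "dtm u" and v: "dtm v" for u v f
  proof -
    have "dtm (%e. H (e (Suc 0)) (e 0) (%i. e (Suc (Suc (f i)))))"
      using dtm_ren[OF H, of "%i. if i = 0 then Suc 0 else if i = Suc 0 then 0 else Suc (Suc (f (i - 2)))"]
      by (simp add: numeral_2_eq_2)
    from dtm_sub[of "%y e. H (e 0) y (%i. e (Suc (f i)))", OF this dtm_ren[OF v, of Suc]]
    have "dtm (%e. H (e 0) (v (%i. e (Suc i))) (%i. e (Suc (f i))))" by simp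
    from dtm_sub[of "%y e. H y (v e) (%i. e (f i))", OF this u]
    show ?thesis .
  qed
  show ?thesis
    unfolding recur_def approx_def
    by (intro dfm_intros H' dtm_ren[OF t])
qed

text \<open>Approximations are codes of initial segments of the function. Thus their existence and
  their agreement on common arguments are arithmetical statements, which can be proved by induction
  in the model.\<close>

lemma recur_eq:
  assumes H: "dtm (%e. H (e 0) (e (Suc 0)))"
  shows "recur H x = H x (gr x (recur H))"
proof -
  have uniq: "fapp c i = fapp d i" if "approx H c x" "approx H d y" "i < x" "i < y" for c d x y i
    using that(3,4)
  proof (induction i rule: N_less_induct)
    case dfm show ?case by (intro dfm_intros)
  next
    case (less i)
    then have "gr i (fapp c) = gr i (fapp d)" by (intro gr_cong) (auto dest: less_trans)
    then show ?case using that(1,2) less(2,3) unfolding approx_def by simp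
  qed
  then have uniq': "c = d" if "approx H c x" "approx H d x" for c d x
  proof -
    have "fapp c i = fapp d i" if "i < x" for i using uniq \<open>approx H c x\<close> \<open>approx H d x\<close> that by blast
    then have "gr x (fapp c) = gr x (fapp d)" by (rule gr_cong)
    then show ?thesis using that unfolding approx_def by simp
  qed
  have ex: "EX c. approx H c x" for x
  proof (induction x rule: N_induct)
    case dfm show ?case unfolding approx_def by (intro dfm_intros dtm_sub2[OF H])
  next
    case 0
    have "approx H (gr 0 fapp') 0" for fapp' unfolding approx_def by (auto intro: gr_cong)
    then show ?case by blast
  next
    case (Suc x)
    then obtain c where c: "approx H c x" by blast
    define f where "f = (%i. if i < x then fapp c i else H x c)"
    have f: "dtm (%e. f (e 0))" unfolding f_def by (intro dfm_intros dtm_sub2[OF H])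
    have g: "gr i (fapp (gr (x + 1) f)) = gr i f" if "i <= x + 1" for i
      by (intro gr_cong fapp_gr[OF f]) (rule less_le_trans[OF _ that])
    have "gr x f = c" using c gr_cong[of x f "fapp c"] by (simp add: f_def approx_def)
    moreover have "gr i f = gr i (fapp c)" if "i < x" for i
      using that by (intro gr_cong) (auto simp: f_def)
    ultimately have "f i = H i (gr i f)" if "i <= x" for i
      using that c by (cases "i = x") (auto simp: f_def approx_def)
    then have "approx H (gr (x + 1) f) (x + 1)"
      unfolding approx_def using g f by (simp del: less_Suc) (simp add: g)
    then show ?case by blast
  qed
  have val: "recur H x = H x c" if "approx H c x" for c x
    unfolding recur_def using that uniq' by (intro the0_equality) auto
  obtain c where c: "approx H c x" using ex by blast
  have "fapp c i = recur H i" if "i < x" for i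
  proof -
    have "fapp (gr i (fapp c)) j = fapp c j" if "j < i" for j
      using that by (intro fapp_gr) (auto intro: dfm_intros)
    then have "gr j (fapp (gr i (fapp c))) = gr j (fapp c)" if "j <= i" for j
      using that by (intro gr_cong) auto
    then have "approx H (gr i (fapp c)) i"
      using c that unfolding approx_def
      by (auto intro!: fapp_gr dfm_intros dest: less_trans) (simp add: dfm_intros)
    then show ?thesis using val c that unfolding approx_def by simp
  qed
  then have "gr x (recur H) = gr x (fapp c)" by (intro gr_cong) simp
  then show ?thesis using val[OF c] c unfolding approx_def by simp
qed

lemma dtm_recur1 [dfm_intros]: "dtm (%e. H (e 0) (e (Suc 0))) ==> dtm t ==> dtm (%e. recur H (t e))"
  using dtm_recur[of "%x g e. H x g" t] by simp

section \<open>Enumeration of finite sets\<close>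

definition linord :: "(N => bool) => (N => N => bool) => bool" where
  "linord A L <-> ((ALL x. A x --> ~ L x x)
     & (ALL x y z. A x & A y & A z & L x y & L y z --> L x z)
     & (ALL x y. A x & A y --> L x y | x = y | L y x))"

lemma linordD:
  assumes "linord A L"
  shows "A x ==> ~ L x x" "A x ==> A y ==> A z ==> L x y ==> L y z ==> L x z"
    "A x ==> A y ==> L x y | x = y | L y x"
  using assms unfolding linord_def by blast+

lemma linordI:
  assumes "!!x. A x ==> ~ L x x" "!!x y z. A x ==> A y ==> A z ==> L x y ==> L y z ==> L x z"
    "!!x y. A x ==> A y ==> L x y | x = y | L y x"
  shows "linord A L"
  using assms unfolding linord_def by blast

lemma linord_subset: "linord A L ==> (!!x. B x ==> A x) ==> linord B L"
  by (rule linordI) (simp_all add: linordD(1), blast dest: linordD(2), blast dest: linordD(3))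

lemma linord_less [simp]: "linord A (<)"
  unfolding linord_def by auto

definition finsub :: "N => (N => bool) => bool" where
  "finsub a P <-> FinSet a & (ALL x. x \<in> elts a --> P x)"

definition enum :: "(N => N => bool) => N => N => N => bool" where
  "enum L a n e <->
    (finsub e (%p. EX i x. p = pr i x & i < n & x \<in> elts a)
     & (ALL i. i < n --> (EX x. pr i x \<in> elts e))
     & (ALL x. x \<in> elts a --> (EX i. pr i x \<in> elts e))
     & (ALL i x j y. pr i x \<in> elts e & pr j y \<in> elts e -->
          (i = j --> x = y) & (i < j --> L x y)))"

lemma enum_alt:
  "enum L a n e <-> e = gr n (fapp e) & (ALL i<n. fapp e i \<in> elts a) & (ALL x:elts a. EX i<n. fapp e i = x)
     & (ALL j<n. ALL i<j. L (fapp e i) (fapp e j))"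
proof
  assume e: "enum L a n e"
  have 1: "fapp e i = x <-> pr i x \<in> elts e" if i: "i < n" for i x
  proof -
    obtain y where y: "pr i y \<in> elts e" using e i unfolding enum_def by blast
    have u: "z = y" if "pr i z \<in> elts e" for z
    proof -
      have "ALL i x j y. pr i x \<in> elts e & pr j y \<in> elts e --> (i = j --> x = y) & (i < j --> L x y)"
        using e unfolding enum_def by (elim conjE)
      from this[rule_format, OF conjI[OF that y]] show ?thesis by simp
    qed
    have y': "fapp e i = y" unfolding fapp_def by (rule the0_equality[of "%y. pr i y \<in> elts e", OF y u])
    show ?thesis unfolding y' using y u[of x] by blast
  qed
  have "elts e = {p. EX i<n. p = pr i (fapp e i)}"
  proof safe
    fix p assume p: "p \<in> elts e"
    with e obtain i x where ix: "p = pr i x" "i < n" unfolding enum_def finsub_def by blast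
    then show "EX i<n. p = pr i (fapp e i)" using 1[of i x] p by auto
  qed (use 1 in auto)
  moreover have "FinSet e" using e unfolding enum_def finsub_def by blast
  ultimately have "e = gr n (fapp e)" by (intro FinSet_eqI) (auto simp: FinSet_gr elts_gr dfm_intros)
  moreover have "ALL i<n. fapp e i \<in> elts a" using e 1 unfolding enum_def finsub_def by (metis pr_inject)
  moreover have "ALL x:elts a. EX i<n. fapp e i = x" using e 1 unfolding enum_def finsub_def by (metis pr_inject)
  moreover have "ALL j<n. ALL i<j. L (fapp e i) (fapp e j)"
  proof (intro allI impI)
    fix j i assume ij: "j < n" "i < j"
    from 1[OF less_trans[OF ij(2,1)]] 1[OF ij(1)] have "pr i (fapp e i) \<in> elts e" "pr j (fapp e j) \<in> elts e" by auto
    then show "L (fapp e i) (fapp e j)" using e ij(2) unfolding enum_def by blast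
  qed
  ultimately show "e = gr n (fapp e) & (ALL i<n. fapp e i \<in> elts a) & (ALL x:elts a. EX i<n. fapp e i = x)
     & (ALL j<n. ALL i<j. L (fapp e i) (fapp e j))" by blast
next
  assume *: "e = gr n (fapp e) & (ALL i<n. fapp e i \<in> elts a) & (ALL x:elts a. EX i<n. fapp e i = x)
     & (ALL j<n. ALL i<j. L (fapp e i) (fapp e j))"
  have d: "dtm (%x. fapp e (x 0))" by (intro dfm_intros)
  have "elts e = {p. EX i<n. p = pr i (fapp e i)}" "FinSet e" using * elts_gr[OF d] FinSet_gr[OF d] by metis+
  then show "enum L a n e" using * unfolding enum_def finsub_def by auto
qed

lemma dfm_enum:
  assumes "dfm (%e. L (e 0) (e (Suc 0)))" "dtm a" "dtm n" "dtm f"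
  shows "dfm (%e. enum L (a e) (n e) (f e))"
  by (rule dfm_sub3[of "enum L"]) (unfold enum_alt, intro dfm_intros dfm_sub2[OF assms(1)], fact+)

text \<open>At the first place where the enumerations differ, each of the two values would occur in
  the other enumeration at a later place only, so that each would precede the other in
  \<open>L\<close>.\<close>

lemma enum_unique:
  assumes L: "dfm (%e. L (e 0) (e (Suc 0)))" "linord (%x. x \<in> elts a) L"
    and e: "enum L a n e" "enum L a m f"
  shows "n = m & e = f"
proof -
  note e = e[unfolded enum_alt]
  note lin = linordD[OF L(2)]
  have eq: "fapp e i = fapp f i" if "i < n" "i < m" for i
    using that
  proof (induction i rule: N_less_induct)
    case dfm show ?case by (intro dfm_intros)
  next
    case (less i)
    then have eq: "fapp e j = fapp f j" if "j < i" for j using that by (metis less_trans)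
    have A: "fapp e i \<in> elts a" "fapp f i \<in> elts a" using e less by auto
    obtain k where k: "k < m" "fapp f k = fapp e i" using e A by metis
    obtain l where l: "l < n" "fapp e l = fapp f i" using e A by metis
    have irr: "~ L (fapp e i) (fapp e i)" "~ L (fapp f i) (fapp f i)"
      using lin(1) A by blast+
    have "~ k < i" using eq[of k] k e less(2) irr by metis
    moreover have "~ l < i" using eq[of l] l e less(3) irr by metis
    moreover have False if "i < k" "i < l"
    proof -
      have "L (fapp f i) (fapp e i)" "L (fapp e i) (fapp f i)" using that e k l by metis+
      then show False using lin(2) A irr by blast
    qed
    ultimately show ?case using k l by (metis linorder_neqE)
  qed
  have irr: "~ L (fapp e i) (fapp e i)" if "i < n" for i using that lin(1) e by blast
  have irr': "~ L (fapp f i) (fapp f i)" if "i < m" for i using that lin(1) e by blast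
  have "~ n < m"
  proof
    assume nm: "n < m"
    then obtain j where j: "j < n" "fapp e j = fapp f n" using e by metis
    then have "fapp f j = fapp f n" using eq[of j] nm by (metis less_trans)
    moreover have "L (fapp f j) (fapp f n)" using e j nm by blast
    ultimately show False using irr'[OF nm] by simp
  qed
  moreover have "~ m < n"
  proof
    assume nm: "m < n"
    then obtain j where j: "j < m" "fapp f j = fapp e m" using e by metis
    then have "fapp e j = fapp e m" using eq[of j] nm by (metis less_trans)
    moreover have "L (fapp e j) (fapp e m)" using e j nm by blast
    ultimately show False using irr[OF nm] by simp
  qed
  ultimately have nm: "n = m" by simp
  then have "gr n (fapp e) = gr m (fapp f)" using eq gr_cong[of n "fapp e" "fapp f"] by simp
  then show ?thesis using e nm by simp
qed

lemma less_cases: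
  fixes i r :: N
  obtains "i < r" | "i = r" | i' where "i = i' + 1" "r <= i'"
  by (metis N_cases N_not_less_0 less_Suc linorder_neqE)

lemma enum_insert:
  assumes L: "dfm (%e. L (e 0) (e (Suc 0)))" "linord (%y. y \<in> elts b) L"
    and e: "enum L a n e" and b: "elts b = insert x (elts a)" "x \<notin> elts a"
  shows "EX e. enum L b (n + 1) e"
proof -
  note e = e[unfolded enum_alt]
  note lin = linordD[OF L(2)]
  have eb: "fapp e i \<in> elts b" "fapp e i ~= x" if "i < n" for i using e b that by auto
  have xb: "x \<in> elts b" using b by simp
  have mono: "L (fapp e i) (fapp e j)" if "i < j" "j < n" for i j using e that by blast
  \<comment> \<open>\<open>r\<close> will be the place at which \<open>x\<close> is inserted: the
    first one with a larger value, or \<open>n\<close> if there is none.\<close>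
  have "dfm (%e'. e' 0 = n | L x (fapp e (e' 0)))" by (intro dfm_intros dfm_sub2[OF L(1)])
  then obtain r where r: "r = n | L x (fapp e r)" "!!i. i < r ==> ~ (i = n | L x (fapp e i))"
    using N_least[of "%i. i = n | L x (fapp e i)" n] by blast
  have rn: "r <= n" using r(2)[of n] by (meson not_le)
  define f where "f = (%i. if i < r then fapp e i else if i = r then x else fapp e (i - 1))"
  have f: "dtm (%e. f (e 0))" unfolding f_def by (intro dfm_intros)
  have f_simps: "i < r ==> f i = fapp e i" "f r = x" for i by (auto simp: f_def)
  have f_Suc: "f (i + 1) = fapp e i" if "r <= i" for i
  proof -
    have "r < i + 1" using that by simp
    then show ?thesis unfolding f_def by (metis add_diff_cancel_right' less_asym less_irrefl)
  qed
  have below: "L (fapp e i) x" if "i < r" for i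
    using r(2)[OF that] lin(3)[OF eb(1)[of i] xb] eb(2)[of i] order_less_le_trans[OF that rn] by blast
  have above: "L x (fapp e i)" if "r <= i" "i < n" for i
  proof (cases "i = r")
    case True then show ?thesis using r(1) that by auto
  next
    case False
    then have "r < i" using that by auto
    then show ?thesis using lin(2)[OF xb eb(1) eb(1), of r i] mono[of r i] r(1) that by auto
  qed
  have 1: "L (f i) (f j)" if ij: "i < j" "j < n + 1" for i j
  proof (cases j r rule: less_cases)
    case 1
    then have "i < r" "j < n" using ij rn by auto
    then show ?thesis using 1 ij mono by (simp add: f_simps)
  next
    case 2 then show ?thesis using ij below by (simp add: f_simps)
  next
    case (3 j')
    then have j': "j' < n" "f j = fapp e j'" "i <= j'" using ij by (auto simp: f_Suc)
    show ?thesis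
    proof (cases i r rule: less_cases)
      case 1
      then have "i < j'" using 3 by auto
      then show ?thesis using j' 1 mono by (simp add: f_simps)
    next
      case 2 then show ?thesis using j' above 3 by (simp add: f_simps)
    next
      case i: (3 i')
      then have "i' < j'" using j' by simp
      then show ?thesis using i j' mono by (simp add: f_Suc)
    qed
  qed
  have 2: "f i \<in> elts b" if "i < n + 1" for i
  proof (cases i r rule: less_cases)
    case 1 then show ?thesis using eb(1)[OF less_le_trans[OF 1 rn]] by (simp add: f_simps)
  next
    case (3 i') then show ?thesis using that eb by (simp add: f_Suc)
  qed (simp add: f_simps xb)
  have 3: "EX i<n + 1. f i = y" if "y \<in> elts b" for y
  proof (cases "y = x")
    case True then show ?thesis using rn f_simps(2) by (metis less_Suc)
  next
    case False
    then have "y \<in> elts a" using that b by blast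
    then obtain i where i: "i < n" "fapp e i = y" using e[THEN conjunct2] by blast
    show ?thesis
    proof (cases "i < r")
      case True then show ?thesis using i f_simps(1) by (metis less_Suc less_imp_le)
    next
      case False
      then have "f (i + 1) = y" using i f_Suc by simp
      moreover have "i + 1 < n + 1" using i by simp
      ultimately show ?thesis by blast
    qed
  qed
  have ff: "fapp (gr (n + 1) f) i = f i" if "i < n + 1" for i using that f by (rule fapp_gr[rotated])
  have "enum L b (n + 1) (gr (n + 1) f)"
    unfolding enum_alt
  proof (intro conjI allI impI ballI)
    show "gr (n + 1) f = gr (n + 1) (fapp (gr (n + 1) f))" by (intro gr_cong ff[symmetric])
    show "fapp (gr (n + 1) f) i \<in> elts b" if "i < n + 1" for i using ff[OF that] 2[OF that] by simp
    show "EX i<n + 1. fapp (gr (n + 1) f) i = y" if "y \<in> elts b" for y using 3[OF that] ff by auto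
    show "L (fapp (gr (n + 1) f) i) (fapp (gr (n + 1) f) j)" if "j < n + 1" "i < j" for i j
      using 1[OF that(2,1)] ff[OF that(1)] ff[OF less_trans[OF that(2,1)]] by simp
  qed
  then show ?thesis by blast
qed

definition crd :: "N => N" where
  "crd a = the0 (%n. EX e. enum (<) a n e)"

definition en :: "(N => N => bool) => N => N" where
  "en L a = the0 (%e. enum L a (crd a) e)"

text \<open>Enumerations with respect to \<open>L\<close> and to \<open><\<close> are built side by
  side, so that they have the same length. Hence \<open>crd\<close>, defined by means of
  \<open><\<close>, is the right length for any order.\<close>

lemma ex_enum:
  assumes L: "dfm (%e. L (e 0) (e (Suc 0)))" "linord (%y. y \<in> elts a) L"
  shows "EX n e e'. enum L a n e & enum (<) a n e'"
proof -
  have c: "coded_set (elts a)" by simp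
  have "EX n e e'. enum L (code A) n e & enum (<) (code A) n e'" if "coded_set A" "A \<subseteq> elts a" for A
    using that
  proof (induction A rule: coded_set_induct)
    case dfm
    show ?case unfolding subset_iff
      by (intro dfm_intros dfm_enum L dtm_code[of "%x e. x \<in> elts (e _)", unfolded Collect_mem_eq])
  next
    case empty
    have "enum R (code {}) 0 (gr 0 id)" for R
      unfolding enum_alt by (auto intro: gr_cong)
    then show ?case by blast
  next
    case (insert x A)
    then obtain n e e' where "enum L (code A) n e" "enum (<) (code A) n e'" by blast
    moreover have "linord (%y. y \<in> elts (code (insert x A))) L"
      using insert by (intro linord_subset[OF L(2)]) auto
    moreover have "dfm (%e. e 0 < e (Suc 0))" by (intro dfm_intros)
    ultimately show ?case
      using enum_insert[OF L(1), of "code (insert x A)" "code A" n e x]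
        enum_insert[of "(<)" "code (insert x A)" "code A" n e' x] insert by fastforce
  qed
  from this[OF c] obtain n e e' where "enum L (code (elts a)) n e" "enum (<) (code (elts a)) n e'" by blast
  then have "enum L a n e" "enum (<) a n e'" unfolding enum_alt by simp_all
  then show ?thesis by blast
qed

lemma dfm_less2: "dfm (%e. e 0 < e (Suc 0))"
  by (intro dfm_intros)

lemma enum_crd:
  assumes L: "dfm (%e. L (e 0) (e (Suc 0)))" "linord (%y. y \<in> elts a) L"
  shows "enum L a n e <-> n = crd a & e = en L a"
proof -
  obtain m f f' where m: "enum L a m f" "enum (<) a m f'" using ex_enum[OF L] by blast
  have "crd a = m" unfolding crd_def
    using m(2) enum_unique[OF dfm_less2 linord_less] by (intro the0_equality) blast+
  moreover then have "en L a = f" unfolding en_def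
    using m(1) enum_unique[OF L] by (intro the0_equality) blast+
  ultimately show ?thesis using m enum_unique[OF L] by blast
qed

lemma dtm_crd [dfm_intros]: "dtm t ==> dtm (%e. crd (t e))"
  by (rule dtm_sub1[of crd]) (unfold crd_def, intro dfm_intros dfm_enum)

lemma dtm_en: "dfm (%e. L (e 0) (e (Suc 0))) ==> dtm t ==> dtm (%e. en L (t e))"
  by (rule dtm_sub1[of "en L"]) (unfold en_def, intro dfm_intros dfm_enum)

section \<open>Semantics of the formalized notions\<close>

text \<open>The following definitions mirror the formulas of the same structure; \<open>pr\<close>, \<open>elts\<close>, \<open>FinSet\<close>,
  \<open>finsub\<close>, \<open>enum\<close> and \<open>linord\<close> correspond to pairing, \<open>in_fin\<close>, \<open>finset\<close>, \<open>fin_subset\<close>,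
  \<open>enumerates\<close> and \<open>linear_order\<close>.\<close>

definition isc :: "N => (N => bool) => bool" where
  "isc a F <-> FinSet a & (ALL x. x \<in> elts a <-> F x)"

definition imf :: "(N => N => bool) => N => N => bool" where
  "imf F a b <-> isc b (%y. EX x. x \<in> elts a & F x y)"

definition smor :: "N => N => N => bool" where
  "smor f n l <-> finsub f (%p. EX i j. p = pr i j & i < n & j < l)
     & (ALL i. i < n --> (EX j. pr i j \<in> elts f))
     & (ALL i j i' j'. pr i j \<in> elts f & pr i' j' \<in> elts f --> (i = i' --> j = j') & (i < i' --> j < j'))"

definition incl :: "(N => N => bool) => N => N => N => N => N => bool" where
  "incl L a c k l f <-> (EX u v. enum L a k u & enum L c l v & smor f k l
      & (ALL i j x. pr i j \<in> elts f & pr i x \<in> elts u --> pr j x \<in> elts v))"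

definition wellf :: "(N => bool) => (N => N => bool) => bool" where
  "wellf A L <-> ~ (EX G:SS. (ALL n. EX x. pr n x \<in> G) & (ALL n x. pr n x \<in> G --> A x)
     & (ALL n x y. pr n x \<in> G & pr n y \<in> G --> x = y) & (ALL n x y. pr n x \<in> G & pr (n + 1) y \<in> G --> L y x))"

definition wellord :: "N set => N set => bool" where
  "wellord X R <-> linord (%x. x \<in> X) (%x y. pr x y \<in> R) & wellf (%x. x \<in> X) (%x y. pr x y \<in> R)"

record sdil =
  Fld :: "N => N => bool"
  Lss :: "N => N => N => bool"
  Act :: "N => N => N => N => N => bool"
  Spp :: "N => N => N => bool"
  Mu :: "N => N => N => bool"

abbreviation N2 :: N where "N2 \<equiv> 0 + 1 + 1"
abbreviation N3 :: N where "N3 \<equiv> N2 + 1"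
abbreviation N4 :: N where "N4 \<equiv> N3 + 1"

definition scoded :: "N set => sdil" where
  "scoded T = \<lparr>Fld = (%n s. pr 0 (pr n s) \<in> T), Lss = (%n s t. pr (0 + 1) (pr n (pr s t)) \<in> T),
     Act = (%n l f s t. pr N2 (pr n (pr l (pr f (pr s t)))) \<in> T),
     Spp = (%n s a. pr N3 (pr n (pr s a)) \<in> T), Mu = (%n m s. pr N4 (pr n (pr m s)) \<in> T)\<rparr>"

definition sfunctor :: "sdil => bool" where
  "sfunctor T <->
    ((ALL n. linord (Fld T n) (Lss T n))
     & (ALL n l f s. smor f n l & Fld T n s -->
          (EX t. Act T n l f s t & Fld T l t)
          & (ALL t t'. Act T n l f s t & Act T n l f s t' --> t = t'))
     & (ALL n l f s s' t t'. smor f n l & Fld T n s & Fld T n s'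
          & Act T n l f s t & Act T n l f s' t' & Lss T n s s' --> Lss T l t t')
     & (ALL n f s. smor f n n & (ALL i. i < n --> pr i i \<in> elts f) & Fld T n s --> Act T n n f s s)
     & (ALL n l k f g h s t r. smor f n l & smor g l k & smor h n k
          & (ALL i j j'. pr i j \<in> elts f & pr j j' \<in> elts g --> pr i j' \<in> elts h)
          & Fld T n s & Act T n l f s t & Act T l k g t r --> Act T n k h s r))"

definition sprae :: "sdil => bool" where
  "sprae T <->
    (sfunctor T
     & (ALL n s. Fld T n s -->
          (EX a. Spp T n s a & finsub a (%i. i < n))
          & (ALL a a'. Spp T n s a & Spp T n s a' --> a = a'))
     & (ALL n l f s t a b. smor f n l & Fld T n s & Act T n l f s t & Spp T n s a & Spp T l t b -->
          imf (%i j. pr i j \<in> elts f) a b)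
     & (ALL n s a k e. Fld T n s & Spp T n s a & enum (<) a k e -->
          (EX t. Fld T k t & Act T k n e t s)))"

definition snpd :: "sdil => bool" where
  "snpd T <->
    (sprae T
     & (ALL n m. m < n -->
          (EX s. Mu T n m s & Fld T n s)
          & (ALL s s'. Mu T n m s & Mu T n m s' --> s = s'))
     & (ALL n m m' s s'. m < m' & m' < n & Mu T n m s & Mu T n m' s' --> Lss T n s s')
     & (ALL n l f m m' s t. smor f n l & pr m m' \<in> elts f & Mu T n m s & Mu T l m' t -->
          Act T n l f s t)
     & (ALL n m t s a. m < n & Mu T n m t & Fld T n s & Spp T n s a -->
          (Lss T n s t <-> (ALL i. i \<in> elts a --> i < m))))"

definition scard :: "N => N => bool" where
  "scard a n <-> (EX e. enum (<) a n e)"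

definition sfull :: "sdil => N => N => bool" where
  "sfull T a s <-> (EX k b. scard a k & Fld T k s & Spp T k s b & isc b (%i. i < k))"

definition Dfield :: "sdil => (N => bool) => N => bool" where
  "Dfield T A p <-> (EX a s. p = pr a s & finsub a A & sfull T a s)"

definition Dless :: "sdil => (N => N => bool) => N => N => bool" where
  "Dless T L p q <->
    (EX a s b t c. p = pr a s & q = pr b t & isc c (%x. x \<in> elts a | x \<in> elts b)
      & (EX k l m f g s' t'. incl L a c k m f & incl L b c l m g
           & Act T k m f s s' & Act T l m g t t' & Lss T m s' t'))"

definition Dwf :: "sdil => N set => N set => bool" where
  "Dwf T X R <-> wellf (Dfield T (%x. x \<in> X)) (Dless T (%x y. pr x y \<in> R))"

definition spwf :: "sdil => bool" where
  "spwf T <-> (ALL X:SS. ALL R:SS. wellord X R --> Dwf T X R)"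

definition sndil :: "sdil => bool" where
  "sndil T <-> snpd T & spwf T"

definition scomp :: "sdil => sdil => sdil" where
  "scomp T S = \<lparr>
     Fld = (%n. Dfield T (Fld S n)),
     Lss = (%n. Dless T (Lss S n)),
     Act = (%n l f p q. EX a b t. p = pr a t & q = pr b t & imf (Act S n l f) a b),
     Spp = (%n p c. EX a t. p = pr a t & isc c (%i. EX s b. s \<in> elts a & Spp S n s b & i \<in> elts b)),
     Mu = (%n m p. EX s a t. Mu S n m s & isc a (%x. x = s) & Mu T 1 0 t & p = pr a t)\<rparr>"

definition smorph :: "sdil => sdil => N set => bool" where
  "smorph T S Z <->
    ((ALL n x. Fld T n x -->
        (EX y. pr n (pr x y) \<in> Z & Fld S n y)
        & (ALL y y'. pr n (pr x y) \<in> Z & pr n (pr x y') \<in> Z --> y = y'))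
     & (ALL n x x' y y'. Fld T n x & Fld T n x' & pr n (pr x y) \<in> Z & pr n (pr x' y') \<in> Z
          & Lss T n x x' --> Lss S n y y')
     & (ALL n l f x x' y y'. smor f n l & Fld T n x & Act T n l f x x'
          & pr n (pr x y) \<in> Z & pr l (pr x' y') \<in> Z --> Act S n l f y y')
     & (ALL n m x y. m < n & Mu T n m x & pr n (pr x y) \<in> Z --> Mu S n m y))"

definition sup_der :: "sdil => sdil => N set => bool" where
  "sup_der T S Z <-> snpd S & smorph (scomp T S) S Z"

definition mut :: "N => N" where
  "mut m = pr 0 m"

definition xit :: "N => N => N" where
  "xit a s = pr (0 + 1) (pr a s)"

definition sp_field :: "sdil => sdil => bool" where
  "sp_field T P <->
    (ALL n t. Fld P n t <->
      (EX m. m < n & t = mut m)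
      | (EX a s. t = xit a s & finsub a (Fld P n) & sfull T a s
           & ~ (EX m. m < n & isc a (%r. r = mut m) & Mu T 1 0 s)))"

definition sp_less :: "sdil => sdil => bool" where
  "sp_less T P <->
    (ALL n s t. Fld P n s & Fld P n t --> (Lss P n s t <->
      (EX m k. s = mut m & t = mut k & m < k)
      | (EX m b v. s = mut m & t = xit b v
           & (EX r. r \<in> elts b & (Lss P n s r | s = r)))
      | (EX a u k. s = xit a u & t = mut k & (ALL r. r \<in> elts a --> Lss P n r t))
      | (EX a u b v. s = xit a u & t = xit b v
           & linord (%r. r \<in> elts a | r \<in> elts b) (Lss P n)
           & Dless T (Lss P n) (pr a u) (pr b v))))"

definition sp_act :: "sdil => bool" where
  "sp_act P <->
    (ALL n l f s t. smor f n l & Fld P n s --> (Act P n l f s t <->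
      (EX m m'. s = mut m & pr m m' \<in> elts f & t = mut m')
      | (EX a b u. s = xit a u & t = xit b u & imf (Act P n l f) a b)))"

definition sp_supp :: "sdil => bool" where
  "sp_supp P <->
    (ALL n s c. Fld P n s --> (Spp P n s c <->
      (EX m. s = mut m & isc c (%i. i = m))
      | (EX a u. s = xit a u & isc c (%i. EX t b. t \<in> elts a & Spp P n t b & i \<in> elts b))))"

definition sp_mu :: "sdil => bool" where
  "sp_mu P <-> (ALL n m s. m < n --> (Mu P n m s <-> s = mut m))"

definition sp_all :: "sdil => sdil => bool" where
  "sp_all T P <-> (sp_field T P & sp_less T P & sp_act P & sp_supp P & sp_mu P)"

definition stm :: "N => bool" where
  "stm t <-> (EX E:SS. t \<in> E & (ALL u. u \<in> E -->
     (EX i. u = pr 0 i) | u = pr (0 + 1) 0 | u = pr N2 0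
     | (EX v w. (u = pr N3 (pr v w) | u = pr N4 (pr v w)) & v \<in> E & w \<in> E)))"

definition sarith :: "N => bool" where
  "sarith p <-> (EX C:SS. p \<in> C & (ALL q. q \<in> C -->
     q = pr 0 0
     | (EX t u. (q = pr (0 + 1) (pr t u) | q = pr N2 (pr t u)) & stm t & stm u)
     | (EX t j. q = pr N3 (pr t j) & stm t)
     | (EX r r'. q = pr N4 (pr r r') & r \<in> C & r' \<in> C)
     | (EX r. q = pr (N4 + 1) r & r \<in> C)))"

definition sPi11 :: "N => bool" where
  "sPi11 p <-> (EX q. p = pr (N4 + 1 + 1) q & sarith q)"

definition sassign :: "N => bool" where
  "sassign s <-> (FinSet s & (ALL i x y. pr i x \<in> elts s & pr i y \<in> elts s --> x = y))"

definition slookup :: "N => N => N => bool" where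
  "slookup s i x <-> (pr i x \<in> elts s | (~ (EX y. pr i y \<in> elts s) & x = 0))"

definition spush :: "N => N => N => bool" where
  "spush x s s' <-> isc s' (%p. p = pr 0 x | (EX i y. p = pr (i + 1) y & pr i y \<in> elts s))"

definition seval :: "N set => bool" where
  "seval V <-> (ALL t s x. sassign s --> (pr t (pr s x) \<in> V <->
     (EX i. t = pr 0 i & slookup s i x)
     | (t = pr (0 + 1) 0 & x = 0)
     | (t = pr N2 0 & x = 1)
     | (EX u v y z. pr u (pr s y) \<in> V & pr v (pr s z) \<in> V
          & ((t = pr N3 (pr u v) & x = y + z) | (t = pr N4 (pr u v) & x = y * z)))))"

definition ssat :: "N => N set => N set => N set => N set => bool" where
  "ssat p Y A V S <-> (ALL q s. (q < p | q = p) & sassign s --> (pr q s \<in> S <->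
     (EX t u x y. pr t (pr s x) \<in> V & pr u (pr s y) \<in> V
        & ((q = pr (0 + 1) (pr t u) & x = y) | (q = pr N2 (pr t u) & x < y)))
     | (EX t j x. q = pr N3 (pr t j) & pr t (pr s x) \<in> V
        & ((j = 0 & x \<in> Y) | (EX i. j = i + 1 & pr i x \<in> A)))
     | (EX r r'. q = pr N4 (pr r r') & (pr r s \<in> S --> pr r' s \<in> S))
     | (EX r. q = pr (N4 + 1) r & (ALL x s'. spush x s s' --> pr r s' \<in> S))))"

definition strue :: "N => N => N set => bool" where
  "strue p s A <-> (EX q. p = pr (N4 + 1 + 1) q
     & (ALL Y:SS. ALL V:SS. ALL S:SS. seval V & ssat q Y A V S --> pr q s \<in> S))"

definition sder_statement :: bool where
  "sder_statement <-> (ALL T:SS. sndil (scoded T) --> (EX P:SS. sp_all (scoded T) (scoded P) & spwf (scoded P)))"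

definition supper_statement :: bool where
  "supper_statement <-> (ALL T:SS. sndil (scoded T) -->
     (EX S:SS. EX Z:SS. sup_der (scoded T) (scoded S) Z & spwf (scoded S)))"

definition sbar :: bool where
  "sbar <-> (ALL X:SS. ALL R:SS. wellord X R -->
      (ALL p s. ALL A:SS. sPi11 p & sassign s -->
        ((ALL x. x \<in> X --> (ALL y. y \<in> X & pr y x \<in> R --> (ALL s'. spush y s s' --> strue p s' A)) -->
            (ALL s'. spush x s s' --> strue p s' A))
         --> (ALL x. x \<in> X --> (ALL s'. spush x s s' --> strue p s' A)))))"

section \<open>Evaluation of formulas in the model\<close>

text \<open>Contexts \<open>vs\<close> and \<open>Vs\<close> list the values of the bound variables, innermost first.\<close>

definition env :: "(nat => 'a) => 'a list => nat => 'a" where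
  "env d l i = (if i < length l then l ! i else d (i - length l))"

lemma env_Cons: "case_nat a (env d l) = env d (a # l)"
  by (auto simp: env_def fun_eq_iff split: nat.split)

definition suf :: "'a list => 'a list => bool" where
  "suf l m <-> (EX k. m = k @ l)"

lemma suf_refl: "suf l l" by (auto simp: suf_def)
lemma suf_Cons: "suf l m ==> suf l (a # m)" by (auto simp: suf_def intro: exI[of _ "a # _"])
lemma suf_trans: "suf l m ==> suf m n ==> suf l n" by (auto simp: suf_def)

text \<open>A term in higher order abstract syntax may be used below further quantifiers, which is
  why all longer contexts \<open>us\<close> are considered.\<close>

definition Nden :: "N list => nterm => N => bool" where
  "Nden vs t a <-> (ALL us d. suf vs us --> tval MN (env d us) (t (length us)) = a)"

definition Sden :: "N set list => sterm => N set => bool" where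
  "Sden Vs X A <-> (ALL Us D. suf Vs Us --> env D Us (X (length Us)) = A)"

definition Fden :: "N list => N set list => form => bool => bool" where
  "Fden vs Vs F P <-> (ALL d D. sat MN (env d vs) (env D Vs) (F (length vs) (length Vs)) <-> P)"

text \<open>The numeral is the number of arguments. Classes and relations are applied below
  quantifiers that come after their parameters, so they have to be interpreted uniformly in longer
  contexts.\<close>

definition C1 :: "N list => N set list => (nterm => form) => (N => bool) => bool" where
  "C1 vs Vs A P <-> (ALL us Us x a. suf vs us --> suf Vs Us --> Nden us x a --> Fden us Us (A x) (P a))"

definition C2 :: "N list => N set list => (nterm => nterm => form) => (N => N => bool) => bool" where
  "C2 vs Vs A P <-> (ALL us Us x a. suf vs us --> suf Vs Us --> Nden us x a --> C1 us Us (A x) (P a))"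

definition C3 :: "N list => N set list => (nterm => nterm => nterm => form) => (N => N => N => bool) => bool" where
  "C3 vs Vs A P <-> (ALL us Us x a. suf vs us --> suf Vs Us --> Nden us x a --> C2 us Us (A x) (P a))"

definition C5 where
  "C5 vs Vs A P <-> (ALL us Us x a y b. suf vs us --> suf Vs Us --> Nden us x a --> Nden us y b --> C3 us Us (A x y) (P a b))"

definition Pden :: "N list => N set list => praedil => sdil => bool" where
  "Pden vs Vs T S <-> C2 vs Vs (fld T) (Fld S) & C3 vs Vs (lss T) (Lss S) & C5 vs Vs (act T) (Act S)
     & C3 vs Vs (spp T) (Spp S) & C3 vs Vs (mu T) (Mu S)"

lemma NdenD: "Nden vs t a ==> tval MN (env d vs) (t (length vs)) = a"
  unfolding Nden_def by (simp add: suf_refl)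

lemma Nden_suf: "Nden vs t a ==> suf vs us ==> Nden us t a"
  unfolding Nden_def using suf_trans by blast

lemma Sden_suf: "Sden vs t a ==> suf vs us ==> Sden us t a"
  unfolding Sden_def using suf_trans by blast

lemma C1D: "C1 vs Vs A P ==> suf vs us ==> suf Vs Us ==> Nden us x a ==> Fden us Us (A x) (P a)"
  unfolding C1_def by blast

lemma C2D: "C2 vs Vs A P ==> suf vs us ==> suf Vs Us ==> Nden us x a ==> C1 us Us (A x) (P a)"
  unfolding C2_def by blast

lemma C3D: "C3 vs Vs A P ==> suf vs us ==> suf Vs Us ==> Nden us x a ==> C2 us Us (A x) (P a)"
  unfolding C3_def by blast

lemma C5D: "C5 vs Vs A P ==> suf vs us ==> suf Vs Us ==> Nden us x a ==> Nden us y b ==> C3 us Us (A x y) (P a b)"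
  unfolding C5_def by blast

lemma C2DD: "C2 vs Vs A P ==> suf vs us ==> suf Vs Us ==> Nden us x a ==> Nden us y b ==> Fden us Us (A x y) (P a b)"
  by (rule C1D[OF C2D suf_refl suf_refl])

lemma C3DD: "C3 vs Vs A P ==> suf vs us ==> suf Vs Us ==> Nden us x a ==> Nden us y b ==> Nden us z c ==>
    Fden us Us (A x y z) (P a b c)"
  by (rule C2DD[OF C3D suf_refl suf_refl])

lemma C5DD: "C5 vs Vs A P ==> suf vs us ==> suf Vs Us ==> Nden us x a ==> Nden us y b ==> Nden us z c ==>
    Nden us w d ==> Nden us v e ==> Fden us Us (A x y z w v) (P a b c d e)"
  by (rule C3DD[OF C5D suf_refl suf_refl])

lemma C5DC: "C5 vs Vs A P ==> suf vs us ==> suf Vs Us ==> Nden us x a ==> Nden us y b ==> Nden us z c ==>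
    C2 us Us (A x y z) (P a b c)"
  by (rule C3D[OF C5D suf_refl suf_refl])

lemma C1I: "(!!us Us x a. suf vs us ==> suf Vs Us ==> Nden us x a ==> Fden us Us (A x) (P a)) ==> C1 vs Vs A P"
  unfolding C1_def by blast

lemma C2I: "(!!us Us x a y b. suf vs us ==> suf Vs Us ==> Nden us x a ==> Nden us y b ==> Fden us Us (A x y) (P a b)) ==>
   C2 vs Vs A P"
  unfolding C2_def C1_def by (meson Nden_suf suf_trans)

lemma C3I: "(!!us Us x a y b z c. suf vs us ==> suf Vs Us ==> Nden us x a ==> Nden us y b ==> Nden us z c ==>
     Fden us Us (A x y z) (P a b c)) ==> C3 vs Vs A P"
  unfolding C3_def C2_def C1_def by (meson Nden_suf suf_trans)

lemma C5I: "(!!us Us x a y b z c w d v e. suf vs us ==> suf Vs Us ==> Nden us x a ==> Nden us y b ==> Nden us z c ==>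
     Nden us w d ==> Nden us v e ==> Fden us Us (A x y z w v) (P a b c d e)) ==> C5 vs Vs A P"
  unfolding C5_def by (rule allI)+ (intro impI, rule C3I, meson Nden_suf suf_trans)

named_theorems den

lemma Nden_zero [den]: "Nden vs (%d. Zero) 0" by (simp add: Nden_def)
lemma Nden_one [den]: "Nden vs (%d. One) 1" by (simp add: Nden_def)
lemma Nden_add [den]: "Nden vs s a ==> Nden vs t b ==> Nden vs (s \<^bold>+ t) (a + b)" by (simp add: Nden_def n_add_def)
lemma Nden_mul [den]: "Nden vs s a ==> Nden vs t b ==> Nden vs (s \<^bold>* t) (a * b)" by (simp add: Nden_def n_mul_def)
lemma Nden_pair [den]: "Nden vs s a ==> Nden vs t b ==> Nden vs \<langle>s, t\<rangle> (pr a b)"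
  unfolding n_pair_def pr_def by (intro Nden_add Nden_mul)
lemma Nden_num0 [den]: "Nden vs (num 0) 0" by (simp add: Nden_def)
lemma Nden_num1 [den]: "Nden vs (num 1) (0 + 1)" by (simp add: Nden_def n_add_def)
lemma Nden_num2 [den]: "Nden vs (num 2) N2" by (simp add: Nden_def n_add_def numeral_eq_Suc)
lemma Nden_num3 [den]: "Nden vs (num 3) N3" by (simp add: Nden_def n_add_def numeral_eq_Suc)
lemma Nden_num4 [den]: "Nden vs (num 4) N4" by (simp add: Nden_def n_add_def numeral_eq_Suc)
lemma Nden_num5 [den]: "Nden vs (num 5) (N4 + 1)" by (simp add: Nden_def n_add_def numeral_eq_Suc)
lemma Nden_num6 [den]: "Nden vs (num 6) (N4 + 1 + 1)" by (simp add: Nden_def n_add_def numeral_eq_Suc)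
lemma Nden_mu [den]: "Nden vs s a ==> Nden vs (mu_term s) (mut a)"
  unfolding mu_term_def mut_def by (intro den)
lemma Nden_xi [den]: "Nden vs s a ==> Nden vs t b ==> Nden vs (xi_term s t) (xit a b)"
  unfolding xi_term_def xit_def by (intro den)

lemma Fden_eq [den]: "Nden vs s a ==> Nden vs t b ==> Fden vs Vs (s \<^bold>= t) (a = b)"
  by (simp add: Fden_def f_eq_def NdenD)
lemma Fden_less [den]: "Nden vs s a ==> Nden vs t b ==> Fden vs Vs (s \<^bold>< t) (a < b)"
  by (simp add: Fden_def f_less_def NdenD)
lemma Fden_mem [den]: "Nden vs s a ==> Sden Vs X A ==> Fden vs Vs (s \<^bold>\<in> X) (a \<in> A)"
  by (simp add: Fden_def f_mem_def NdenD Sden_def suf_refl)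
lemma Fden_imp [den]: "Fden vs Vs F P ==> Fden vs Vs G Q ==> Fden vs Vs (F \<^bold>\<longrightarrow> G) (P --> Q)"
  by (simp add: Fden_def f_imp_def)
lemma Fden_not [den]: "Fden vs Vs F P ==> Fden vs Vs (\<^bold>\<not> F) (~ P)"
  by (simp add: Fden_def f_not_def)
lemma Fden_or [den]: "Fden vs Vs F P ==> Fden vs Vs G Q ==> Fden vs Vs (F \<^bold>\<or> G) (P | Q)"
  by (simp add: Fden_def form_defs disj_imp)
lemma Fden_and [den]: "Fden vs Vs F P ==> Fden vs Vs G Q ==> Fden vs Vs (F \<^bold>\<and> G) (P & Q)"
  by (simp add: Fden_def form_defs)
lemma Fden_iff [den]: "Fden vs Vs F P ==> Fden vs Vs G Q ==> Fden vs Vs (F \<^bold>\<longleftrightarrow> G) (P <-> Q)"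
  by (simp add: Fden_def form_defs) blast

lemma Nden_bound: "Nden (a # vs) (%d'. Var (d' - Suc (length vs))) a"
  by (auto simp: Nden_def suf_def env_def)

lemma Sden_bound: "Sden (A # Vs) (%d'. d' - Suc (length Vs)) A"
  by (auto simp: Sden_def suf_def env_def)

lemma Fden_all0 [den]:
  "(!!x a. Nden (a # vs) x a ==> Fden (a # vs) Vs (F x) (P a)) ==> Fden vs Vs (\<forall>\<^sub>0 x. F x) (ALL a. P a)"
  using Nden_bound[of _ vs] unfolding Fden_def num_all_def by (simp add: env_Cons)

lemma Fden_all1 [den]:
  "(!!X A. A \<in> SS ==> Sden (A # Vs) X A ==> Fden vs (A # Vs) (F X) (P A)) ==> Fden vs Vs (\<forall>\<^sub>1 X. F X) (ALL A:SS. P A)"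
  using Sden_bound[of _ Vs] unfolding Fden_def set_all_def by (simp add: env_Cons)

lemma Fden_ex0 [den]:
  "(!!x a. Nden (a # vs) x a ==> Fden (a # vs) Vs (F x) (P a)) ==> Fden vs Vs (\<exists>\<^sub>0 x. F x) (EX a. P a)"
  using Fden_not[OF Fden_all0[of vs Vs "%x. \<^bold>\<not> F x" "%x. ~ P x"]] Fden_not unfolding num_ex_def by fastforce

lemma Fden_ex1 [den]:
  "(!!X A. A \<in> SS ==> Sden (A # Vs) X A ==> Fden vs (A # Vs) (F X) (P A)) ==> Fden vs Vs (\<exists>\<^sub>1 X. F X) (EX A:SS. P A)"
  using Fden_not[OF Fden_all1[of Vs vs "%x. \<^bold>\<not> F x" "%x. ~ P x"]] Fden_not unfolding set_ex_def by fastforce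

lemma Nden_Cons: "Nden vs t a ==> Nden (b # vs) t a"
  by (rule Nden_suf) (auto intro: suf_Cons suf_refl)
lemma Sden_Cons: "Sden vs t a ==> Sden (b # vs) t a"
  by (rule Sden_suf) (auto intro: suf_Cons suf_refl)

lemma Fden_infin [den]: "Nden vs s a ==> Nden vs t b ==> Fden vs Vs (s \<^bold>\<in>\<^sub>f t) (a \<in> elts b)"
  unfolding in_fin_def elts_def mem_Collect_eq infin_def
  by (assumption | rule den Nden_mul | rule Nden_Cons)+

lemma C1_suf: "suf vs us ==> suf Vs Us ==> C1 vs Vs A P ==> C1 us Us A P"
  unfolding C1_def by (meson suf_trans)
lemma C2_suf: "suf vs us ==> suf Vs Us ==> C2 vs Vs A P ==> C2 us Us A P"
  unfolding C2_def by (meson suf_trans)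
lemma C3_suf: "suf vs us ==> suf Vs Us ==> C3 vs Vs A P ==> C3 us Us A P"
  unfolding C3_def by (meson suf_trans)
lemma C5_suf: "suf vs us ==> suf Vs Us ==> C5 vs Vs A P ==> C5 us Us A P"
  unfolding C5_def by (meson suf_trans)
lemma Pden_suf: "suf vs us ==> suf Vs Us ==> Pden vs Vs T S ==> Pden us Us T S"
  unfolding Pden_def using C2_suf C3_suf C5_suf by blast

lemma PdenI: "C2 vs Vs (fld T) (Fld S) ==> C3 vs Vs (lss T) (Lss S) ==> C5 vs Vs (act T) (Act S)
    ==> C3 vs Vs (spp T) (Spp S) ==> C3 vs Vs (mu T) (Mu S) ==> Pden vs Vs T S"
  unfolding Pden_def by blast

lemmas sufs = suf_trans[rotated] Nden_suf[rotated] Sden_suf[rotated]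
lemmas dens = C1I C2I Nden_Cons Sden_Cons suf_refl suf_Cons
  Pden_suf[OF suf_Cons[OF suf_refl] suf_refl] Pden_suf[OF suf_refl suf_Cons[OF suf_refl]]

lemma Pden_fld [den]: "Pden vs Vs T S ==> Nden vs x a ==> Nden vs y b ==> Fden vs Vs (fld T x y) (Fld S a b)"
  unfolding Pden_def by (elim conjE, rule C2DD, assumption, rule suf_refl, rule suf_refl)
lemma Pden_fld1 [den]: "Pden vs Vs T S ==> Nden vs x a ==> C1 vs Vs (fld T x) (Fld S a)"
  unfolding Pden_def by (elim conjE, rule C2D, assumption, rule suf_refl, rule suf_refl)
lemma Pden_lss [den]: "Pden vs Vs T S ==> Nden vs x a ==> Nden vs y b ==> Nden vs z c ==> Fden vs Vs (lss T x y z) (Lss S a b c)"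
  unfolding Pden_def by (elim conjE, rule C3DD, assumption, rule suf_refl, rule suf_refl)
lemma Pden_lss1 [den]: "Pden vs Vs T S ==> Nden vs x a ==> C2 vs Vs (lss T x) (Lss S a)"
  unfolding Pden_def by (elim conjE, rule C3D, assumption, rule suf_refl, rule suf_refl)
lemma Pden_spp [den]: "Pden vs Vs T S ==> Nden vs x a ==> Nden vs y b ==> Nden vs z c ==> Fden vs Vs (spp T x y z) (Spp S a b c)"
  unfolding Pden_def by (elim conjE, rule C3DD, assumption, rule suf_refl, rule suf_refl)
lemma Pden_mu [den]: "Pden vs Vs T S ==> Nden vs x a ==> Nden vs y b ==> Nden vs z c ==> Fden vs Vs (mu T x y z) (Mu S a b c)"
  unfolding Pden_def by (elim conjE, rule C3DD, assumption, rule suf_refl, rule suf_refl)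
lemma Pden_act [den]: "Pden vs Vs T S ==> Nden vs x a ==> Nden vs y b ==> Nden vs z c ==> Nden vs v d ==> Nden vs w e ==>
    Fden vs Vs (act T x y z v w) (Act S a b c d e)"
  unfolding Pden_def by (elim conjE, rule C5DD, assumption, rule suf_refl, rule suf_refl)
lemma Pden_act2 [den]: "Pden vs Vs T S ==> Nden vs x a ==> Nden vs y b ==> Nden vs z c ==> C2 vs Vs (act T x y z) (Act S a b c)"
  unfolding Pden_def by (elim conjE, rule C5DC, assumption, rule suf_refl, rule suf_refl)

lemma Fden_finset [den]: "Nden vs t a ==> Fden vs Vs (finset t) (FinSet a)"
proof -
  have eq: "FinSet a <-> (ALL b. b < a --> ~ (ALL x. x \<in> elts b <-> x \<in> elts a))" for a
    by (simp add: FinSet_def elts_def)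
  show "Nden vs t a ==> Fden vs Vs (finset t) (FinSet a)"
    unfolding eq finset_def by (assumption | rule den dens | erule sufs | erule (1) Pden_suf)+
qed

lemma Fden_codes [den]:
  assumes "Nden vs t a" and A: "C1 vs Vs A P" shows "Fden vs Vs (codes t A) (isc a P)"
proof -
  note [den] = C1D[OF A] C1_suf[OF _ _ A]
  show ?thesis using assms unfolding codes_def isc_def by - (assumption | rule den dens | erule sufs | erule (1) Pden_suf)+
qed

lemma Fden_finsub [den]:
  assumes "Nden vs t a" and A: "C1 vs Vs A P" shows "Fden vs Vs (fin_subset t A) (finsub a P)"
proof -
  note [den] = C1D[OF A] C1_suf[OF _ _ A]
  show ?thesis using assms unfolding fin_subset_def finsub_def by - (assumption | rule den dens | erule sufs | erule (1) Pden_suf)+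
qed

lemma Fden_image_fin [den]:
  assumes A: "C2 vs Vs F P" and "Nden vs s a" "Nden vs t b" shows "Fden vs Vs (image_fin F s t) (imf P a b)"
proof -
  note [den] = C2DD[OF A] C2_suf[OF _ _ A]
  show ?thesis using assms unfolding image_fin_def imf_def
    by - (assumption | rule den dens | erule sufs | erule (1) Pden_suf)+
qed

lemma Fden_mor [den]: "Nden vs s a ==> Nden vs t b ==> Nden vs u c ==> Fden vs Vs (mor s t u) (smor a b c)"
  unfolding mor_def smor_def by (assumption | rule den dens | erule sufs | erule (1) Pden_suf)+

lemma Fden_enumerates [den]:
  assumes A: "C2 vs Vs L P" and "Nden vs s a" "Nden vs t b" "Nden vs u c"
  shows "Fden vs Vs (enumerates L s t u) (enum P a b c)"
proof -
  note [den] = C2DD[OF A] C2_suf[OF _ _ A]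
  show ?thesis using assms unfolding enumerates_def enum_def
    by - (assumption | rule den dens | erule sufs | erule (1) Pden_suf)+
qed

lemma C2_less [den]: "C2 vs Vs (\<^bold><) (<)"
  by (rule C2I) (assumption | rule den dens | erule sufs | erule (1) Pden_suf)+

lemma Fden_card_fin [den]: "Nden vs s a ==> Nden vs t b ==> Fden vs Vs (card_fin s t) (scard a b)"
  unfolding card_fin_def scard_def by (assumption | rule den dens | erule sufs | erule (1) Pden_suf)+

lemma Fden_inclusion_mor [den]:
  assumes A: "C2 vs Vs L P" and "Nden vs s a" "Nden vs t b" "Nden vs u c" "Nden vs v d" "Nden vs w e"
  shows "Fden vs Vs (inclusion_mor L s t u v w) (incl P a b c d e)"
proof -
  note [den] = C2_suf[OF _ _ A]
  show ?thesis using assms unfolding inclusion_mor_def incl_def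
    by - (assumption | rule den dens | erule sufs | erule (1) Pden_suf)+
qed

lemma Fden_linear_order [den]:
  assumes A: "C1 vs Vs A P" and L: "C2 vs Vs L Q"
  shows "Fden vs Vs (linear_order A L) (linord P Q)"
proof -
  note [den] = C1D[OF A] C2DD[OF L] C1_suf[OF _ _ A] C2_suf[OF _ _ L]
  show ?thesis using assms unfolding linear_order_def linord_def
    by - (assumption | rule den dens | erule sufs | erule (1) Pden_suf)+
qed

lemma Fden_well_founded [den]:
  assumes A: "C1 vs Vs A P" and L: "C2 vs Vs L Q"
  shows "Fden vs Vs (well_founded A L) (wellf P Q)"
proof -
  note [den] = C1D[OF A] C2DD[OF L] C1_suf[OF _ _ A] C2_suf[OF _ _ L]
  show ?thesis using assms unfolding well_founded_def wellf_def
    by - (assumption | rule den dens | erule sufs | erule (1) Pden_suf)+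
qed

lemma C1_set [den]: "Sden Vs X A ==> C1 vs Vs (set_field X) (%x. x \<in> A)"
  by (rule C1I) (assumption | rule den dens | erule sufs | erule (1) Pden_suf)+

lemma C2_set [den]: "Sden Vs X A ==> C2 vs Vs (set_rel X) (%x y. pr x y \<in> A)"
  by (rule C2I) (assumption | rule den dens | erule sufs | erule (1) Pden_suf)+

lemma Fden_well_order [den]: "Sden Vs X A ==> Sden Vs R B ==> Fden vs Vs (well_order X R) (wellord A B)"
  unfolding well_order_def wellord_def by (assumption | rule den dens | erule sufs | erule (1) Pden_suf)+

lemma Pden_coded [den]: "Sden Vs X A ==> Pden vs Vs (coded X) (scoded A)"
  by (rule PdenI; unfold coded_def scoded_def praedil.simps sdil.simps; rule C2I C3I C5I;
      (assumption | rule den dens | erule sufs | erule (1) Pden_suf)+)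

lemma Fden_functor_LO [den]: "Pden vs Vs T S ==> Fden vs Vs (functor_LO T) (sfunctor S)"
  unfolding functor_LO_def sfunctor_def by (assumption | rule den dens | erule sufs | erule (1) Pden_suf)+

lemma Fden_prae_dilator [den]: "Pden vs Vs T S ==> Fden vs Vs (prae_dilator T) (sprae S)"
  unfolding prae_dilator_def sprae_def
  by (assumption | rule den dens | erule sufs | erule (1) Pden_suf)+

lemma Fden_npd [den]: "Pden vs Vs T S ==> Fden vs Vs (normal_prae_dilator T) (snpd S)"
  unfolding normal_prae_dilator_def snpd_def by (assumption | rule den dens | erule sufs | erule (1) Pden_suf)+

lemma Fden_full_supp [den]: "Pden vs Vs T S ==> Nden vs s a ==> Nden vs t b ==> Fden vs Vs (full_supp T s t) (sfull S a b)"
  unfolding full_supp_def sfull_def by (assumption | rule den dens | erule sufs | erule (1) Pden_suf)+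

lemma Fden_D_field [den]:
  assumes A: "C1 vs Vs A P" and "Pden vs Vs T S" "Nden vs s a"
  shows "Fden vs Vs (D_field T A s) (Dfield S P a)"
proof -
  note [den] = C1_suf[OF _ _ A]
  show ?thesis using assms unfolding D_field_def Dfield_def
    by - (assumption | rule den dens | erule sufs | erule (1) Pden_suf)+
qed

lemma Fden_D_less [den]:
  assumes A: "C2 vs Vs A P" and "Pden vs Vs T S" "Nden vs s a" "Nden vs t b"
  shows "Fden vs Vs (D_less T A s t) (Dless S P a b)"
proof -
  note [den] = C2_suf[OF _ _ A]
  show ?thesis using assms unfolding D_less_def Dless_def
    by - (assumption | rule den dens | erule sufs | erule (1) Pden_suf)+
qed

lemma C1_D_field [den]: "Pden vs Vs T S ==> C1 vs Vs A P ==> C1 vs Vs (D_field T A) (Dfield S P)"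
  by (rule C1I) (intro Fden_D_field; blast intro: C1_suf Pden_suf)

lemma C2_D_less [den]: "Pden vs Vs T S ==> C2 vs Vs A P ==> C2 vs Vs (D_less T A) (Dless S P)"
  by (rule C2I) (intro Fden_D_less; blast intro: C2_suf Pden_suf Nden_suf)

lemma Fden_Dwf [den]: "Pden vs Vs T S ==> Sden Vs X A ==> Sden Vs R B ==> Fden vs Vs (D_well_founded T X R) (Dwf S A B)"
  unfolding D_well_founded_def Dwf_def by (assumption | rule den dens | erule sufs | erule (1) Pden_suf)+

lemma Fden_pwf [den]: "Pden vs Vs T S ==> Fden vs Vs (preserves_well_foundedness T) (spwf S)"
  unfolding preserves_well_foundedness_def spwf_def by (assumption | rule den dens | erule sufs | erule (1) Pden_suf)+

lemma Fden_normal_dilator [den]: "Pden vs Vs T S ==> Fden vs Vs (normal_dilator T) (sndil S)"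
  unfolding normal_dilator_def sndil_def by (assumption | rule den dens | erule sufs | erule (1) Pden_suf)+

lemma Pden_compose [den]:
  assumes "Pden vs Vs T T'" "Pden vs Vs S S'" shows "Pden vs Vs (compose T S) (scomp T' S')"
  using assms
  by - (rule PdenI; unfold compose_def scomp_def praedil.simps sdil.simps; rule C2I C3I C5I;
      (assumption | rule den dens | erule sufs | erule (1) Pden_suf)+)

lemma Fden_normal_morphism [den]:
  "Pden vs Vs T T' ==> Pden vs Vs S S' ==> Sden Vs Z A ==> Fden vs Vs (normal_morphism T S Z) (smorph T' S' A)"
  unfolding normal_morphism_def smorph_def by (assumption | rule den dens | erule sufs | erule (1) Pden_suf)+

lemma Fden_upper_derivative [den]:
  "Pden vs Vs T T' ==> Pden vs Vs S S' ==> Sden Vs Z A ==> Fden vs Vs (upper_derivative T S Z) (sup_der T' S' A)"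
  unfolding upper_derivative_def sup_der_def by (assumption | rule den dens | erule sufs | erule (1) Pden_suf)+

lemma Fden_is_partial [den]:
  "Pden vs Vs T T' ==> Pden vs Vs P P' ==> Fden vs Vs (is_partial T P) (sp_all T' P')"
  unfolding is_partial_def sp_all_def partial_field_def sp_field_def partial_less_def sp_less_def
    partial_act_def sp_act_def partial_supp_def sp_supp_def partial_mu_def sp_mu_def
  by (assumption | rule den dens | erule sufs | erule (1) Pden_suf)+

lemma Fden_tm_code [den]: "Nden vs s a ==> Fden vs Vs (tm_code s) (stm a)"
  unfolding tm_code_def stm_def by (assumption | rule den dens | erule sufs | erule (1) Pden_suf)+

lemma Fden_Pi11_code [den]: "Nden vs s a ==> Fden vs Vs (Pi11_code s) (sPi11 a)"
  unfolding Pi11_code_def sPi11_def arithmetical_code_def sarith_def by (assumption | rule den dens | erule sufs | erule (1) Pden_suf)+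

lemma Fden_assignment [den]: "Nden vs s a ==> Fden vs Vs (assignment s) (sassign a)"
  unfolding assignment_def sassign_def by (assumption | rule den dens | erule sufs | erule (1) Pden_suf)+

lemma Fden_push [den]: "Nden vs s a ==> Nden vs t b ==> Nden vs u c ==> Fden vs Vs (push_assignment s t u) (spush a b c)"
  unfolding push_assignment_def spush_def by (assumption | rule den dens | erule sufs | erule (1) Pden_suf)+

lemma Fden_evaluation [den]: "Sden Vs X A ==> Fden vs Vs (evaluation X) (seval A)"
  unfolding evaluation_def seval_def lookup_def slookup_def by (assumption | rule den dens | erule sufs | erule (1) Pden_suf)+

lemma Fden_satisfaction [den]:
  "Nden vs s a ==> Sden Vs X1 A1 ==> Sden Vs X2 A2 ==> Sden Vs X3 A3 ==> Sden Vs X4 A4 ==>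
    Fden vs Vs (satisfaction s X1 X2 X3 X4) (ssat a A1 A2 A3 A4)"
  unfolding satisfaction_def ssat_def by (assumption | rule den dens | erule sufs | erule (1) Pden_suf)+

lemma Fden_Pi11_true [den]:
  "Nden vs s a ==> Nden vs t b ==> Sden Vs X A ==> Fden vs Vs (Pi11_true s t X) (strue a b A)"
  unfolding Pi11_true_def strue_def by (assumption | rule den dens | erule sufs | erule (1) Pden_suf)+

theorem derivable_if_equivalent:
  assumes "sder_statement <-> supper_statement" "supper_statement <-> sbar"
  shows "ACA0 \<turnstile> statement"
proof (rule derivable_if_true)
  fix e :: "nat => N" and E :: "nat => N set"
  let ?F = "(derivative_statement \<^bold>\<longleftrightarrow> upper_derivative_statement)
     \<^bold>\<and> (upper_derivative_statement \<^bold>\<longleftrightarrow> Pi11_bar_induction)"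
  have 1: "Fden [] [] derivative_statement sder_statement"
    unfolding derivative_statement_def sder_statement_def by (assumption | rule den dens | erule sufs | erule (1) Pden_suf)+
  have 2: "Fden [] [] upper_derivative_statement supper_statement"
    unfolding upper_derivative_statement_def supper_statement_def by (assumption | rule den dens | erule sufs | erule (1) Pden_suf)+
  have 3: "Fden [] [] Pi11_bar_induction sbar"
    unfolding Pi11_bar_induction_def sbar_def Let_def by (assumption | rule den dens | erule sufs | erule (1) Pden_suf)+
  have "Fden [] [] ?F ((sder_statement <-> supper_statement) & (supper_statement <-> sbar))"
    by (intro Fden_and Fden_iff 1 2 3)
  then have "sat MN (env e []) (env E []) statement"
    using assms unfolding Fden_def statement_def sentence_def by simp
  moreover have "env e [] = e" "env E [] = E" by (simp_all add: env_def fun_eq_iff)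
  ultimately show "sat MN e E statement" by simp
qed

section \<open>Well-foundedness\<close>

definition mwf :: "(N => bool) => (N => N => bool) => bool" where
  "mwf A L <-> (ALL Q:SS. (ALL x:Q. A x) --> Q ~= {} --> (EX m:Q. ALL y:Q. ~ L y m))"

lemma mwfD:
  assumes "mwf A L" "dfm (%e. Q (e 0))" "!!x. Q x ==> A x" "Q x"
  obtains m where "Q m" "!!y. Q y ==> ~ L y m"
proof -
  have "EX m:{x. Q x}. ALL y:{x. Q x}. ~ L y m"
    using assms(1)[unfolded mwf_def, rule_format, of "{x. Q x}"] dfm_SS[OF assms(2)] assms(3,4) by blast
  then show ?thesis using that by blast
qed

text \<open>The range of a descending sequence has no minimal element. Conversely, from a set
  without minimal element a descending sequence is defined by recursion; taking the numerically
  least among the smaller elements makes the step definable.\<close>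

lemma wellf_iff_mwf:
  assumes L: "dfm (%e. L (e 0) (e (Suc 0)))"
  shows "wellf A L <-> mwf A L"
proof
  assume w: "mwf A L"
  show "wellf A L" unfolding wellf_def
  proof
    assume "EX G:SS. (ALL n. EX x. pr n x \<in> G) & (ALL n x. pr n x \<in> G --> A x)
      & (ALL n x y. pr n x \<in> G & pr n y \<in> G --> x = y) & (ALL n x y. pr n x \<in> G & pr (n + 1) y \<in> G --> L y x)"
    then obtain G where G: "G \<in> SS" "ALL n. EX x. pr n x \<in> G" "ALL n x. pr n x \<in> G --> A x"
      "ALL n x y. pr n x \<in> G & pr (n + 1) y \<in> G --> L y x" by blast
    have d: "dfm (%e. EX n. pr n (e 0) \<in> G)" by (intro dfm_intros dfm_mem[OF G(1)])
    obtain x where "pr 0 x \<in> G" using G(2) by blast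
    then obtain m where m: "EX n. pr n m \<in> G" "!!y. EX n. pr n y \<in> G ==> ~ L y m"
      using mwfD[OF w d] G(3) by blast
    then show False using G(2,4) by blast
  qed
next
  assume w: "wellf A L"
  show "mwf A L" unfolding mwf_def
  proof (intro ballI impI, rule ccontr)
    fix Q assume Q: "Q \<in> SS" "ALL x:Q. A x" "Q ~= {}" "~ (EX m:Q. ALL y:Q. ~ L y m)"
    then obtain q where q: "q \<in> Q" by blast
    note dQ = dfm_mem[OF Q(1)] dfm_sub2[OF L]
    define nx where "nx x = the0 (%y. y \<in> Q & L y x & (ALL z<y. ~ (z \<in> Q & L z x)))" for x
    have dnx: "dtm t ==> dtm (%e. nx (t e))" for t
      by (rule dtm_sub1[of nx]) (unfold nx_def, intro dfm_intros dQ)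
    have nx: "nx x \<in> Q & L (nx x) x" if xQ: "x \<in> Q" for x
    proof -
      obtain y where "y \<in> Q & L y x" using Q(4) xQ by blast
      moreover have "dfm (%e. e 0 \<in> Q & L (e 0) x)" by (intro dfm_intros dQ)
      ultimately obtain m where "m \<in> Q & L m x" "!!k. k < m ==> ~ (k \<in> Q & L k x)"
        using N_least[of "%y. y \<in> Q & L y x"] by blast
      moreover have "y = m" if "y \<in> Q & L y x & (ALL z<y. ~ (z \<in> Q & L z x))" for y
        using calculation that by (metis linorder_neqE)
      ultimately have "nx x = m"
        unfolding nx_def by (intro the0_equality[of "%y. y \<in> Q & L y x & (ALL z<y. ~ (z \<in> Q & L z x))"]) blast+
      then show ?thesis using \<open>m \<in> Q & L m x\<close> by simp
    qed
    define H where "H = (%i g. if i = 0 then q else nx (fapp g (i - 1)))"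
    have H: "dtm (%e. H (e 0) (e (Suc 0)))" unfolding H_def by (intro dfm_intros dnx)
    define g where "g = recur H"
    have dg: "dtm (%e. g (e 0))" unfolding g_def by (intro dfm_intros H)
    have g0: "g 0 = q" using recur_eq[OF H, of 0] by (simp add: g_def H_def)
    have gS: "g (n + 1) = nx (g n)" for n
    proof -
      have "g (n + 1) = H (n + 1) (gr (n + 1) g)" unfolding g_def by (rule recur_eq[OF H])
      also have "\<dots> = nx (fapp (gr (n + 1) g) n)" by (simp add: H_def)
      also have "fapp (gr (n + 1) g) n = g n" using dg by (rule fapp_gr) simp
      finally show ?thesis .
    qed
    have gQ: "g n \<in> Q" for n
      by (induction n rule: N_induct) (use g0 gS nx q in \<open>auto intro!: dQ dg\<close>)
    define G where "G = {p. EX n. p = pr n (g n)}"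
    have "G \<in> SS" unfolding G_def by (rule dfm_SS) (intro dfm_intros dtm_sub1[OF dg])
    moreover have "pr n x \<in> G <-> x = g n" for n x unfolding G_def by auto
    ultimately show False using w gQ Q(2) gS nx unfolding wellf_def by auto
  qed
qed

lemma mwf_embed:
  assumes w: "mwf B K" and h: "dtm (%e. h (e 0))" and "!!x. A x ==> B (h x)"
    "!!x y. A x ==> A y ==> L x y ==> K (h x) (h y)"
  shows "mwf A L"
  unfolding mwf_def
proof (intro ballI impI)
  fix Q assume Q: "Q \<in> SS" "ALL x:Q. A x" "Q ~= {}"
  have "dfm (%e. EX x. x \<in> Q & e 0 = h x)"
    by (intro dfm_intros dfm_mem[OF Q(1)] dtm_sub1[OF h])
  moreover obtain q where "q \<in> Q" using Q by blast
  ultimately obtain m where m: "EX x. x \<in> Q & m = h x" "!!y. EX x. x \<in> Q & y = h x ==> ~ K y m"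
    using mwfD[OF w, of "%y. EX x. x \<in> Q & y = h x"] Q(2) assms(3) by metis
  then show "EX m:Q. ALL y:Q. ~ L y m" using assms(4) Q(2) by blast
qed

lemma mwf_subset: "mwf B L ==> (!!x. A x ==> B x) ==> mwf A L"
  unfolding mwf_def by blast

section \<open>Morphisms between finite orders\<close>

text \<open>Morphisms as definable functions; \<open>gr k f\<close> is the code to which
  \<open>smor\<close> refers.\<close>

definition mmap :: "(N => N) => N => N => bool" where
  "mmap f k l <-> dtm (%e. f (e 0)) & (ALL i<k. f i < l) & (ALL j<k. ALL i<j. f i < f j)"

lemma smor_gr: assumes "mmap f k l" shows "smor (gr k f) k l"
proof -
  have d: "dtm (%e. f (e 0))" using assms by (simp add: mmap_def)
  show ?thesis unfolding smor_def finsub_def using assms unfolding mmap_def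
    by (auto simp: pr_in_gr[OF d] elts_gr[OF d] FinSet_gr[OF d])
qed

lemma mmap_fapp:
  assumes "smor f k l" shows "mmap (fapp f) k l" "f = gr k (fapp f)"
proof -
  have u: "ALL i j i' j'. pr i j \<in> elts f & pr i' j' \<in> elts f --> (i = i' --> j = j') & (i < i' --> j < j')"
    and ex: "ALL i. i < k --> (EX j. pr i j \<in> elts f)" and FS: "FinSet f"
    and el: "ALL p. p \<in> elts f --> (EX i j. p = pr i j & i < k & j < l)"
    using assms unfolding smor_def finsub_def by simp_all
  have 1: "fapp f i = x <-> pr i x \<in> elts f" if i: "i < k" for i x
  proof -
    obtain y where y: "pr i y \<in> elts f" using ex i by blast
    have u': "z = y" if "pr i z \<in> elts f" for z using u[rule_format, OF conjI[OF that y]] by simp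
    have "fapp f i = y" unfolding fapp_def by (rule the0_equality[of "%y. pr i y \<in> elts f", OF y u'])
    then show ?thesis using y u'[of x] by blast
  qed
  have d: "dtm (%e. fapp f (e 0))" by (intro dfm_intros)
  have "fapp f i < l" if "i < k" for i
    using 1[OF that, of "fapp f i"] el by (metis pr_inject)
  moreover have "fapp f i < fapp f j" if "j < k" "i < j" for i j
    using 1[OF that(1), of "fapp f j"] 1[OF less_trans[OF that(2,1)], of "fapp f i"] u that(2) by metis
  ultimately show "mmap (fapp f) k l" unfolding mmap_def using d by blast
  have "elts f = {p. EX i<k. p = pr i (fapp f i)}" using 1 el by (auto, metis)
  then show "f = gr k (fapp f)" by (intro FinSet_eqI FS) (auto simp: FinSet_gr elts_gr d)
qed

lemma mmapD: "mmap f k l ==> i < k ==> f i < l" "mmap f k l ==> i < j ==> j < k ==> f i < f j"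
  "mmap f k l ==> dtm (%e. f (e 0))"
  unfolding mmap_def by blast+

section \<open>Enumerations and inclusions\<close>

abbreviation dp1 :: "(N => bool) => bool" where "dp1 P \<equiv> dfm (%e. P (e 0))"
abbreviation dp2 :: "(N => N => bool) => bool" where "dp2 P \<equiv> dfm (%e. P (e 0) (e (Suc 0)))"
abbreviation df1 :: "(N => N) => bool" where "df1 P \<equiv> dtm (%e. P (e 0))"

definition flin :: "(N => N => bool) => N => bool" where
  "flin L a <-> dp2 L & linord (%x. x \<in> elts a) L"

lemma flin_less [simp]: "flin (<) a"
  by (simp add: flin_def dfm_less2)

lemma flin_subset: "flin L c ==> elts a \<subseteq> elts c ==> flin L a"
  unfolding flin_def using linord_subset[of "%x. x \<in> elts c" L "%x. x \<in> elts a"] by auto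

definition enf :: "(N => N => bool) => N => N => N" where
  "enf L a i = fapp (en L a) i"

definition idx :: "(N => N => bool) => N => N => N" where
  "idx L a x = the0 (%i. i < crd a & enf L a i = x)"

lemma dtm_enf: "dp2 L ==> dtm s ==> dtm t ==> dtm (%e. enf L (s e) (t e))"
  unfolding enf_def by (intro dfm_intros dtm_en)

lemma dtm_idx: "dp2 L ==> dtm s ==> dtm t ==> dtm (%e. idx L (s e) (t e))"
  by (rule dtm_sub2[of "idx L"]) (unfold idx_def, intro dfm_intros dtm_enf)

lemma enum_en: "flin L a ==> enum L a (crd a) (en L a)"
  unfolding flin_def using enum_crd by blast

lemma enum_iff: "flin L a ==> enum L a n e <-> n = crd a & e = en L a"
  unfolding flin_def using enum_crd by blast

lemma en_gr: "flin L a ==> en L a = gr (crd a) (enf L a)"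
  using enum_en[unfolded enum_alt] unfolding enf_def by blast

lemma enf:
  assumes "flin L a"
  shows "i < crd a ==> enf L a i \<in> elts a" "x \<in> elts a ==> EX i<crd a. enf L a i = x"
    "i < j ==> j < crd a ==> L (enf L a i) (enf L a j)"
  using enum_en[OF assms, unfolded enum_alt] unfolding enf_def by blast+

lemma enf_inj: assumes "flin L a" "i < crd a" "j < crd a" shows "enf L a i = enf L a j <-> i = j"
proof -
  have "~ L (enf L a i) (enf L a i)" "~ L (enf L a j) (enf L a j)"
    using assms enf(1) unfolding flin_def by (blast dest: linordD(1))+
  then show ?thesis using enf(3)[OF assms(1)] assms(2,3) by (metis linorder_neqE)
qed

lemma idx:
  assumes "flin L a" "x \<in> elts a" shows "idx L a x < crd a" "enf L a (idx L a x) = x"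
proof -
  obtain i where "i < crd a" "enf L a i = x" using enf(2)[OF assms] by blast
  then have "idx L a x = i" unfolding idx_def using enf_inj[OF assms(1)] by (intro the0_equality) auto
  then show "idx L a x < crd a" "enf L a (idx L a x) = x" using \<open>i < crd a\<close> \<open>enf L a i = x\<close> by auto
qed

lemma idx_enf: "flin L a ==> i < crd a ==> idx L a (enf L a i) = i"
  using idx enf(1) enf_inj by metis

lemma enf_less_iff:
  assumes "flin L a" "i < crd a" "j < crd a" shows "L (enf L a i) (enf L a j) <-> i < j"
proof
  assume l: "L (enf L a i) (enf L a j)"
  note lin = assms(1)[unfolded flin_def, THEN conjunct2]
  have A: "enf L a i \<in> elts a" "enf L a j \<in> elts a" using assms enf(1) by auto
  show "i < j"
  proof (rule ccontr)
    assume "~ i < j"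
    then have "i = j | L (enf L a j) (enf L a i)" using enf(3)[OF assms(1)] assms(2) by (metis linorder_neqE)
    then show False using l A linordD(1,2)[OF lin] by metis
  qed
qed (use enf(3)[OF assms(1)] assms in auto)

lemma idx_less_iff: "flin L a ==> x \<in> elts a ==> y \<in> elts a ==> idx L a x < idx L a y <-> L x y"
  using enf_less_iff[of L a "idx L a x" "idx L a y"] idx by simp

lemma enf_eqI:
  assumes "flin L a" and f: "df1 f" "!!i. i < n ==> f i \<in> elts a" "!!x. x \<in> elts a ==> EX i<n. f i = x"
    "!!i j. i < j ==> j < n ==> L (f i) (f j)"
  shows "crd a = n" "i < n ==> enf L a i = f i"
proof -
  have "gr n f = gr n (fapp (gr n f))" by (intro gr_cong fapp_gr[symmetric] f)
  then have "enum L a n (gr n f)"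
    unfolding enum_alt
  proof (intro conjI allI impI ballI)
    fix i assume i: "i < n"
    then show "fapp (gr n f) i \<in> elts a" using f(1,2) by simp
    fix j assume j: "j < i"
    then show "L (fapp (gr n f) j) (fapp (gr n f) i)" using f(1,4) less_trans[OF j i] i by simp
  next
    fix x assume "x \<in> elts a"
    then obtain i where "i < n" "f i = x" using f(3) by blast
    then show "EX i<n. fapp (gr n f) i = x" using f(1) by auto
  qed
  then have "n = crd a" "gr n f = en L a" using enum_iff[OF assms(1)] by blast+
  then show "crd a = n" "i < n ==> enf L a i = f i" unfolding enf_def using fapp_gr[OF f(1), of i n] by simp_all
qed

text \<open>The function coded by the morphism from \<open>|a|\<close> to \<open>|c|\<close> induced by the inclusion.\<close>

definition inc :: "(N => N => bool) => N => N => N => N" where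
  "inc L a c i = idx L c (enf L a i)"

lemma mmap_inc:
  assumes "flin L c" "elts a \<subseteq> elts c" shows "mmap (inc L a c) (crd a) (crd c)"
proof -
  have a: "flin L a" using assms flin_subset by blast
  have "df1 (inc L a c)" unfolding inc_def using assms(1) unfolding flin_def
    by (intro dtm_idx dtm_enf dfm_intros) auto
  moreover have "inc L a c i < crd c" if "i < crd a" for i
    unfolding inc_def using idx(1)[OF assms(1)] enf(1)[OF a that] assms(2) by blast
  moreover have "inc L a c i < inc L a c j" if "i < j" "j < crd a" for i j
  proof -
    have "enf L a i \<in> elts c" "enf L a j \<in> elts c" using enf(1)[OF a] assms(2) that by (metis less_trans subsetD)+
    then show ?thesis unfolding inc_def using idx_less_iff[OF assms(1)] enf(3)[OF a that] by simp
  qed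
  ultimately show ?thesis unfolding mmap_def by blast
qed

lemma enf_inc:
  assumes "flin L c" "elts a \<subseteq> elts c" "i < crd a" shows "enf L c (inc L a c i) = enf L a i"
  unfolding inc_def using idx(2)[OF assms(1)] enf(1)[OF flin_subset[OF assms(1,2)] assms(3)] assms(2) by blast

lemma incl_iff:
  assumes c: "flin L c" "elts a \<subseteq> elts c"
  shows "incl L a c k l f <-> k = crd a & l = crd c & f = gr (crd a) (inc L a c)"
proof -
  have a: "flin L a" using assms flin_subset by blast
  have de: "df1 (enf L a)" "df1 (enf L c)" using a c unfolding flin_def by (auto intro!: dtm_enf dfm_intros)
  have m: "mmap (inc L a c) (crd a) (crd c)" using mmap_inc[OF c] .
  note di = mmapD(3)[OF m]
  have 1: "pr i x \<in> elts (en L a) <-> i < crd a & x = enf L a i" for i x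
    unfolding en_gr[OF a] by (rule pr_in_gr[OF de(1)])
  have 2: "pr i x \<in> elts (en L c) <-> i < crd c & x = enf L c i" for i x
    unfolding en_gr[OF c(1)] by (rule pr_in_gr[OF de(2)])
  have "incl L a c k l f <-> k = crd a & l = crd c & smor f (crd a) (crd c) &
      (ALL i j x. pr i j \<in> elts f & i < crd a & x = enf L a i --> j < crd c & x = enf L c j)"
    unfolding incl_def enum_iff[OF a] enum_iff[OF c(1)] 1[symmetric] 2[symmetric] by blast
  also have "\<dots> <-> k = crd a & l = crd c & f = gr (crd a) (inc L a c)"
  proof safe
    assume s: "smor f (crd a) (crd c)"
      and *: "ALL i j x. pr i j \<in> elts f & i < crd a & x = enf L a i --> j < crd c & x = enf L c j"
    note f = mmap_fapp[OF s]
    have "fapp f i = inc L a c i" if "i < crd a" for i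
    proof -
      have "pr i (fapp f i) \<in> elts (gr (crd a) (fapp f))" using pr_in_gr[OF mmapD(3)[OF f(1)]] that by simp
      then have "pr i (fapp f i) \<in> elts f" using f(2) by simp
      then have "enf L a i = enf L c (fapp f i)" "fapp f i < crd c" using * that by auto
      then show ?thesis using idx_enf[OF c(1)] unfolding inc_def by simp
    qed
    then show "f = gr (crd a) (inc L a c)" using f(2) gr_cong by metis
  next
    show "smor (gr (crd a) (inc L a c)) (crd a) (crd c)" by (rule smor_gr[OF m])
  next
    fix i j assume "pr i j \<in> elts (gr (crd a) (inc L a c))" "i < crd a"
    then have j: "j = inc L a c i" "i < crd a" using pr_in_gr[OF di] by auto
    show "j < crd c" using mmapD(1)[OF m] j by simp
    show "enf L a i = enf L c j" using enf_inc[OF c] j by simp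
  qed
  finally show ?thesis .
qed

lemma inc_image:
  assumes c: "flin L c" "elts a \<subseteq> elts c"
  shows "inc L a c ` {i. i < crd a} = {i. i < crd c & enf L c i \<in> elts a}"
proof safe
  have a: "flin L a" using assms flin_subset by blast
  fix i assume i: "i < crd a"
  then show "inc L a c i < crd c" using mmapD(1)[OF mmap_inc[OF c]] by simp
  show "enf L c (inc L a c i) \<in> elts a" using enf_inc[OF c i] enf(1)[OF a i] by simp
next
  have a: "flin L a" using assms flin_subset by blast
  fix i assume i: "i < crd c" "enf L c i \<in> elts a"
  then have "inc L a c (idx L a (enf L c i)) = i" unfolding inc_def using idx(2)[OF a] idx_enf[OF c(1)] by simp
  then show "i \<in> inc L a c ` {i. i < crd a}" using idx(1)[OF a i(2)] by (intro image_eqI[of _ _ "idx L a (enf L c i)"]) simp_all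
qed

lemma enf_image:
  assumes L: "flin L a" and K: "flin K b" and h: "df1 h" and b: "elts b = h ` elts a"
    and mono: "!!x y. x \<in> elts a ==> y \<in> elts a ==> L x y ==> K (h x) (h y)"
  shows "crd b = crd a" "i < crd a ==> enf K b i = h (enf L a i)"
proof -
  have d: "df1 (%i. h (enf L a i))" using L unfolding flin_def by (intro dtm_sub1[OF h] dtm_enf dfm_intros) auto
  have "h (enf L a i) \<in> elts b" if "i < crd a" for i using enf(1)[OF L that] b by blast
  moreover have "EX i<crd a. h (enf L a i) = x" if x: "x \<in> elts b" for x
  proof -
    obtain y where "y \<in> elts a" "x = h y" using x b by blast
    then show ?thesis using enf(2)[OF L] by blast
  qed
  moreover have "K (h (enf L a i)) (h (enf L a j))" if "i < j" "j < crd a" for i j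
    using mono enf(1)[OF L] enf(3)[OF L that] that by (metis less_trans)
  ultimately show "crd b = crd a" "i < crd a ==> enf K b i = h (enf L a i)"
    using enf_eqI[OF K d, of "crd a"] by blast+
qed

lemma inc_transport:
  assumes L: "flin L c" and K: "flin K d" and h: "df1 h" and d: "elts d = h ` elts c"
    and mono: "!!x y. x \<in> elts c ==> y \<in> elts c ==> L x y ==> K (h x) (h y)"
    and a: "elts a \<subseteq> elts c" "elts b = h ` elts a" and i: "i < crd a"
  shows "inc K b d i = inc L a c i"
proof -
  have La: "flin L a" using flin_subset L a by blast
  have Kb: "flin K b" using flin_subset K a d by blast
  have "enf K b i = h (enf L a i)" using enf_image(2)[OF La Kb h a(2)] mono a(1) i by blast
  moreover have e: "enf L a i \<in> elts c" using enf(1)[OF La i] a(1) by blast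
  moreover have "enf K d (inc L a c i) = h (enf L a i)"
    using enf_image(2)[OF L K h d mono, of "inc L a c i"] mmapD(1)[OF mmap_inc[OF L a(1)] i] enf_inc[OF L a(1) i] by simp
  ultimately show ?thesis
    using idx_enf[OF K, of "inc L a c i"] mmapD(1)[OF mmap_inc[OF L a(1)] i] enf_image(1)[OF L K h d mono]
    unfolding inc_def[of K] by simp
qed

section \<open>Normal prae-dilators in the model\<close>

definition defdil :: "sdil => bool" where
  "defdil S <-> (ALL n s. dtm n --> dtm s --> dfm (%e. Fld S (n e) (s e)))
    & (ALL n s t. dtm n --> dtm s --> dtm t --> dfm (%e. Lss S (n e) (s e) (t e)))
    & (ALL n l f s t. dtm n --> dtm l --> dtm f --> dtm s --> dtm t --> dfm (%e. Act S (n e) (l e) (f e) (s e) (t e)))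
    & (ALL n s t. dtm n --> dtm s --> dtm t --> dfm (%e. Spp S (n e) (s e) (t e)))
    & (ALL n s t. dtm n --> dtm s --> dtm t --> dfm (%e. Mu S (n e) (s e) (t e)))"

lemma defdilD:
  assumes "defdil S"
  shows "dtm n ==> dtm s ==> dfm (%e. Fld S (n e) (s e))"
    "dtm n ==> dtm s ==> dtm t ==> dfm (%e. Lss S (n e) (s e) (t e))"
    "dtm n ==> dtm l ==> dtm f ==> dtm s ==> dtm t ==> dfm (%e. Act S (n e) (l e) (f e) (s e) (t e))"
    "dtm n ==> dtm s ==> dtm t ==> dfm (%e. Spp S (n e) (s e) (t e))"
    "dtm n ==> dtm s ==> dtm t ==> dfm (%e. Mu S (n e) (s e) (t e))"
  using assms unfolding defdil_def by simp_all

lemma defdil_scoded: "T \<in> SS ==> defdil (scoded T)"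
  unfolding defdil_def scoded_def sdil.simps
  by (intro conjI allI impI; intro dfm_mem dfm_intros; assumption)

text \<open>Relations with further parameters occur below quantifiers, where their arguments are
  substituted and the indices of their parameters shifted by some \<open>f\<close>.\<close>

lemma dfm_ctx2:
  assumes L: "dfm (%e. L (e 0) (e (Suc 0)) (%i. e (Suc (Suc i))))" and u: "dtm u" and v: "dtm v"
  shows "dfm (%e. L (u e) (v e) (%i. e (f i)))"
proof -
  have "dfm (%e. L (e (Suc 0)) (e 0) (%i. e (Suc (Suc (f i)))))"
    using dfm_ren[OF L, of "%i. if i = 0 then Suc 0 else if i = Suc 0 then 0 else Suc (Suc (f (i - 2)))"]
    by (simp add: numeral_2_eq_2)
  from dfm_sub[of "%y e. L (e 0) y (%i. e (Suc (f i)))", OF this dtm_ren[OF v, of Suc]]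
  have "dfm (%e. L (e 0) (v (%i. e (Suc i))) (%i. e (Suc (f i))))" by simp
  from dfm_sub[of "%y e. L y (v e) (%i. e (f i))", OF this u]
  show ?thesis .
qed

lemma dfm_enum_ctx:
  assumes L: "dfm (%e. L (e 0) (e (Suc 0)) (%i. e (Suc (Suc i))))" and a: "dtm a" and n: "dtm n" and f: "dtm f"
  shows "dfm (%e. enum (%x y. L x y e) (a e) (n e) (f e))"
  unfolding enum_alt
  by (intro dfm_intros dfm_ctx2[OF L] dtm_ren[OF a] dtm_ren[OF n] dtm_ren[OF f] a n f)

lemma dfm_smor [dfm_intros]: "dtm f ==> dtm n ==> dtm l ==> dfm (%e. smor (f e) (n e) (l e))"
  by (rule dfm_sub3[of smor]) (unfold smor_def finsub_def, intro dfm_intros)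

lemma dfm_incl_ctx:
  assumes L: "dfm (%e. L (e 0) (e (Suc 0)) (%i. e (Suc (Suc i))))"
    and a: "dtm a" and c: "dtm c" and k: "dtm k" and l: "dtm l" and f: "dtm f"
  shows "dfm (%e. incl (%x y. L x y e) (a e) (c e) (k e) (l e) (f e))"
proof -
  have L': "dfm (%e. L (e 0) (e (Suc 0)) (%i. e (Suc (Suc (f i)))))" for f
    using dfm_ctx2[OF L dtm_var dtm_var] .
  show ?thesis
    unfolding incl_def
    by (intro dfm_intros dfm_enum_ctx L' dtm_ren[OF a] dtm_ren[OF c] dtm_ren[OF k] dtm_ren[OF l] dtm_ren[OF f])
qed

lemma dfm_isc [dfm_intros]:
  assumes P: "dfm (%e. P (e 0) (%i. e (Suc i)))" and a: "dtm a"
  shows "dfm (%e. isc (a e) (%x. P x e))"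
  unfolding isc_def by (intro dfm_intros dtm_ren[OF a] a P)

lemma dfm_Dless_ctx:
  assumes L: "dfm (%e. L (e 0) (e (Suc 0)) (%i. e (Suc (Suc i))))" and T: "defdil T" and p: "dtm p" and q: "dtm q"
  shows "dfm (%e. Dless T (%x y. L x y e) (p e) (q e))"
proof -
  have L': "dfm (%e. L (e 0) (e (Suc 0)) (%i. e (Suc (Suc (f i)))))" for f
    using dfm_ctx2[OF L dtm_var dtm_var] .
  show ?thesis
    unfolding Dless_def
    by (intro dfm_intros dfm_incl_ctx L' defdilD[OF T] dtm_ren[OF p] dtm_ren[OF q])
qed

lemma isc_iff: "isc a P <-> FinSet a & elts a = {x. P x}"
  unfolding isc_def by auto

locale npdil =
  fixes T :: sdil
  assumes npd: "snpd T" and def: "defdil T"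
begin

lemmas dfm_sdil = defdilD[OF def]

definition act :: "N => N => (N => N) => N => N" where
  "act k l f s = the0 (%t. Act T k l (gr k f) s t)"

definition supp :: "N => N => N set" where
  "supp n s = elts (the0 (%a. Spp T n s a))"

definition mu :: "N => N => N" where
  "mu n m = the0 (%s. Mu T n m s)"

lemma lin: "linord (Fld T n) (Lss T n)"
  using npd[unfolded snpd_def sprae_def sfunctor_def, THEN conjunct1, THEN conjunct1, THEN conjunct1] by (rule spec)

lemma functorD:
  "smor f n l ==> Fld T n s ==> EX t. Act T n l f s t & Fld T l t"
  "smor f n l ==> Fld T n s ==> Act T n l f s t ==> Act T n l f s t' ==> t = t'"
  "smor f n l ==> Fld T n s ==> Fld T n s' ==> Act T n l f s t ==> Act T n l f s' t' ==> Lss T n s s' ==> Lss T l t t'"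
  "smor f n n ==> (!!i. i < n ==> pr i i \<in> elts f) ==> Fld T n s ==> Act T n n f s s"
  "smor f n l ==> smor g l k ==> smor h n k ==> (!!i j j'. pr i j \<in> elts f ==> pr j j' \<in> elts g ==> pr i j' \<in> elts h)
    ==> Fld T n s ==> Act T n l f s t ==> Act T l k g t r ==> Act T n k h s r"
proof goal_cases
  note F = npd[unfolded snpd_def sprae_def sfunctor_def, THEN conjunct1, THEN conjunct1, THEN conjunct2]
  {
    case 1 then show ?case using F[THEN conjunct1] by blast
  next
    case 2 then show ?case using F[THEN conjunct1] by blast
  next
    case 3 then show ?case using F[THEN conjunct2, THEN conjunct1] by blast
  next
    case 4 then show ?case using F[THEN conjunct2, THEN conjunct2, THEN conjunct1] by blast
  next
    case 5 then show ?case
      using F[THEN conjunct2, THEN conjunct2, THEN conjunct2, rule_format, of f n l g k h s t r] by blast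
  }
qed

lemma act_fld: "mmap f k l ==> Fld T k s ==> Fld T l (act k l f s)"
  and Act_iff: "mmap f k l ==> Fld T k s ==> Act T k l (gr k f) s t <-> t = act k l f s"
proof -
  assume *: "mmap f k l" "Fld T k s"
  note sm = smor_gr[OF *(1)]
  obtain t' where t': "Act T k l (gr k f) s t'" "Fld T l t'" using functorD(1)[OF sm *(2)] by blast
  have "act k l f s = t'" unfolding act_def
    using t' functorD(2)[OF sm *(2)] by (intro the0_equality) blast+
  then show "Fld T l (act k l f s)" "Act T k l (gr k f) s t <-> t = act k l f s"
    using t' functorD(2)[OF sm *(2)] by blast+
qed

lemma act_cong: "(!!i. i < k ==> f i = g i) ==> act k l f s = act k l g s"
  unfolding act_def using gr_cong[of k f g] by simp

lemma act_mono: "mmap f k l ==> Fld T k s ==> Fld T k t ==> Lss T k s t ==> Lss T l (act k l f s) (act k l f t)"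
  using functorD(3)[OF smor_gr] Act_iff by blast

lemma act_less_iff:
  assumes "mmap f k l" "Fld T k s" "Fld T k t"
  shows "Lss T l (act k l f s) (act k l f t) <-> Lss T k s t"
  using act_mono[OF assms] act_mono[OF assms(1,3,2)] act_fld[OF assms(1)] assms(2,3)
    linordD[OF lin[of k]] linordD[OF lin[of l]] by metis

lemma act_inj:
  assumes "mmap f k l" "Fld T k s" "Fld T k t"
  shows "act k l f s = act k l f t <-> s = t"
  using act_less_iff[OF assms] act_less_iff[OF assms(1,3,2)] act_fld[OF assms(1)] assms(2,3)
    linordD[OF lin[of k]] linordD[OF lin[of l]] by metis

lemma act_id:
  assumes f: "mmap f n n" "!!i. i < n ==> f i = i" and s: "Fld T n s"
  shows "act n n f s = s"
proof -
  have "pr i i \<in> elts (gr n f)" if "i < n" for i using pr_in_gr[OF mmapD(3)[OF f(1)]] f(2) that by simp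
  then have "Act T n n (gr n f) s s" using functorD(4)[OF smor_gr[OF f(1)]] s by blast
  then show ?thesis using Act_iff[OF f(1) s] by simp
qed

lemma act_comp:
  assumes f: "mmap f k l" and g: "mmap g l m" and h: "mmap h k m" "!!i. i < k ==> h i = g (f i)" and s: "Fld T k s"
  shows "act l m g (act k l f s) = act k m h s"
proof -
  have "pr i j' \<in> elts (gr k h)" if "pr i j \<in> elts (gr k f)" "pr j j' \<in> elts (gr l g)" for i j j'
    using that pr_in_gr[OF mmapD(3)[OF f]] pr_in_gr[OF mmapD(3)[OF g]] pr_in_gr[OF mmapD(3)[OF h(1)]] h(2) by simp
  then have "Act T k m (gr k h) s (act l m g (act k l f s))"
    using functorD(5)[OF smor_gr[OF f] smor_gr[OF g] smor_gr[OF h(1)]] s Act_iff[OF f s] Act_iff[OF g act_fld[OF f s]] by blast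
  then show ?thesis using Act_iff[OF h(1) s] by simp
qed

lemma praeD:
  "Fld T n s ==> EX a. Spp T n s a & finsub a (%i. i < n)"
  "Fld T n s ==> Spp T n s a ==> Spp T n s a' ==> a = a'"
  "smor f n l ==> Fld T n s ==> Act T n l f s t ==> Spp T n s a ==> Spp T l t b ==> imf (%i j. pr i j \<in> elts f) a b"
  "Fld T n s ==> Spp T n s a ==> enum (<) a k e ==> EX t. Fld T k t & Act T k n e t s"
proof goal_cases
  note F = npd[unfolded snpd_def sprae_def, THEN conjunct1, THEN conjunct2]
  {
    case 1 then show ?case using F[THEN conjunct1] by blast
  next
    case 2 then show ?case using F[THEN conjunct1] by blast
  next
    case 3 then show ?case using F[THEN conjunct2, THEN conjunct1, rule_format, of f n l s t a b] by blast
  next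
    case 4 then show ?case using F[THEN conjunct2, THEN conjunct2, rule_format, of n s a k e] by blast
  }
qed

lemma Spp_iff: "Fld T n s ==> Spp T n s a <-> FinSet a & elts a = supp n s"
  and supp_less: "Fld T n s ==> i \<in> supp n s ==> i < n"
proof -
  assume s: "Fld T n s"
  obtain b where b: "Spp T n s b" "finsub b (%i. i < n)" using praeD(1)[OF s] by blast
  have "the0 (%a. Spp T n s a) = b" using b praeD(2)[OF s] by (intro the0_equality) blast+
  then have *: "supp n s = elts b" by (simp add: supp_def)
  show "Spp T n s a <-> FinSet a & elts a = supp n s"
    using * b praeD(2)[OF s] FinSet_eqI[of a b] unfolding finsub_def by auto
  show "i \<in> supp n s ==> i < n" using * b(2) unfolding finsub_def by auto
qed

lemma coded_supp [simp]: "coded_set (supp n s)"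
  by (simp add: supp_def)

lemma Spp_code: "Fld T n s ==> Spp T n s (code (supp n s))"
  using Spp_iff by simp

lemma supp_act:
  assumes f: "mmap f k l" and s: "Fld T k s"
  shows "supp l (act k l f s) = f ` supp k s"
proof -
  have "imf (%i j. pr i j \<in> elts (gr k f)) (code (supp k s)) (code (supp l (act k l f s)))"
    using praeD(3)[OF smor_gr[OF f] s _ Spp_code[OF s] Spp_code[OF act_fld[OF f s]]] Act_iff[OF f s] by blast
  then have "supp l (act k l f s) = {y. EX x. x \<in> supp k s & x < k & y = f x}"
    unfolding imf_def isc_iff using pr_in_gr[OF mmapD(3)[OF f]] by simp
  then show ?thesis using supp_less[OF s] by auto
qed

text \<open>The support condition in sharper form: the preimage has full support, because the
  enumeration maps its support onto \<open>supp n s\<close>. So every element of \<open>T\<close> at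
  \<open>n\<close> comes from an element of \<open>D\<close> over its support.\<close>

lemma supp_range:
  assumes s: "Fld T n s"
  obtains t where "Fld T (crd (code (supp n s))) t" "act (crd (code (supp n s))) n (enf (<) (code (supp n s))) t = s"
    "supp (crd (code (supp n s))) t = {i. i < crd (code (supp n s))}"
proof -
  let ?a = "code (supp n s)"
  have m: "mmap (enf (<) ?a) (crd ?a) n"
    unfolding mmap_def using enf[OF flin_less[of ?a]] supp_less[OF s] by (auto intro!: dtm_enf dfm_less2 dfm_intros)
  obtain t where t: "Fld T (crd ?a) t" "Act T (crd ?a) n (en (<) ?a) t s"
    using praeD(4)[OF s Spp_code[OF s] enum_en[OF flin_less]] by blast
  then have a: "act (crd ?a) n (enf (<) ?a) t = s" using Act_iff[OF m t(1)] en_gr[OF flin_less] by metis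
  have "enf (<) ?a ` supp (crd ?a) t = elts ?a" using supp_act[OF m t(1)] a by simp
  then have "i \<in> supp (crd ?a) t" if i: "i < crd ?a" for i
  proof -
    have "enf (<) ?a i \<in> enf (<) ?a ` supp (crd ?a) t" using enf(1)[OF flin_less i] \<open>enf (<) ?a ` supp (crd ?a) t = elts ?a\<close> by simp
    then obtain j where "j \<in> supp (crd ?a) t" "enf (<) ?a i = enf (<) ?a j" by blast
    then show ?thesis using enf_inj[OF flin_less i, of j] supp_less[OF t(1)] by simp
  qed
  then have "supp (crd ?a) t = {i. i < crd ?a}" using supp_less[OF t(1)] by blast
  then show ?thesis using that t(1) a by blast
qed

lemma normalD:
  "m < n ==> EX s. Mu T n m s & Fld T n s"
  "m < n ==> Mu T n m s ==> Mu T n m s' ==> s = s'"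
  "m < m' ==> m' < n ==> Mu T n m s ==> Mu T n m' s' ==> Lss T n s s'"
  "smor f n l ==> pr m m' \<in> elts f ==> Mu T n m s ==> Mu T l m' t ==> Act T n l f s t"
  "m < n ==> Mu T n m t ==> Fld T n s ==> Spp T n s a ==> Lss T n s t <-> (ALL i. i \<in> elts a --> i < m)"
proof goal_cases
  note F = npd[unfolded snpd_def, THEN conjunct2]
  {
    case 1 then show ?case using F[THEN conjunct1] by blast
  next
    case 2 then show ?case using F[THEN conjunct1] by blast
  next
    case 3 then show ?case using F[THEN conjunct2, THEN conjunct1] by blast
  next
    case 4 then show ?case using F[THEN conjunct2, THEN conjunct2, THEN conjunct1] by blast
  next
    case 5 then show ?case
      using F[THEN conjunct2, THEN conjunct2, THEN conjunct2, rule_format, of m n t s a] by blast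
  }
qed

lemma mu_fld: "m < n ==> Fld T n (mu n m)" and Mu_iff: "m < n ==> Mu T n m s <-> s = mu n m"
proof -
  assume m: "m < n"
  obtain t where t: "Mu T n m t" "Fld T n t" using normalD(1)[OF m] by blast
  have "mu n m = t" unfolding mu_def using t normalD(2)[OF m] by (intro the0_equality) blast+
  then show "Fld T n (mu n m)" "Mu T n m s <-> s = mu n m" using t normalD(2)[OF m] by blast+
qed

lemma act_mu: assumes f: "mmap f k l" and m: "m < k" shows "act k l f (mu k m) = mu l (f m)"
proof -
  have "f m < l" using mmapD(1)[OF f m] .
  moreover have "pr m (f m) \<in> elts (gr k f)" using pr_in_gr[OF mmapD(3)[OF f]] m by simp
  ultimately have "Act T k l (gr k f) (mu k m) (mu l (f m))"
    using normalD(4)[OF smor_gr[OF f]] Mu_iff m by blast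
  then show ?thesis using Act_iff[OF f mu_fld[OF m]] by simp
qed

lemma less_mu_iff: "m < n ==> Fld T n s ==> Lss T n s (mu n m) <-> (ALL i:supp n s. i < m)"
  using normalD(5)[of m n "mu n m" s "code (supp n s)"] Mu_iff Spp_code by auto

text \<open>By normality, an empty support would put \<open>mu 1 0\<close> below itself.\<close>

lemma supp_mu1: "supp 1 (mu 1 0) = {0}"
proof -
  have f: "Fld T 1 (mu 1 0)" by (rule mu_fld) simp
  have "~ Lss T 1 (mu 1 0) (mu 1 0)" using linordD(1)[OF lin f] .
  then have "supp 1 (mu 1 0) ~= {}" using less_mu_iff[OF _ f, of 0] by auto
  moreover have "i = 0" if "i \<in> supp 1 (mu 1 0)" for i
    using supp_less[OF f that] less_Suc[of i 0] by (auto simp: le_less)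
  ultimately show ?thesis by auto
qed

section \<open>The linear order \<open>D(X)\<close>\<close>

definition full :: "N => N => bool" where
  "full a s <-> Fld T (crd a) s & supp (crd a) s = {i. i < crd a}"

lemma scard_iff: "scard a k <-> k = crd a"
  unfolding scard_def using enum_iff[OF flin_less] by blast

lemma sfull_iff: "sfull T a s <-> full a s"
  unfolding sfull_def full_def scard_iff isc_iff using Spp_iff
  by (auto intro!: exI[of _ "code {i. i < crd a}"])

lemma dfm_full: "dtm s ==> dtm t ==> dfm (%e. full (s e) (t e))"
  unfolding sfull_iff[symmetric]
  by (rule dfm_sub2[of "sfull T"])
     (unfold sfull_def scard_iff, intro dfm_intros dfm_sdil)

lemma Dfield_iff: "Dfield T A p <-> (EX a s. p = pr a s & FinSet a & (ALL x:elts a. A x) & full a s)"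
  unfolding Dfield_def sfull_iff finsub_def by auto

text \<open>Transport along the inclusion of \<open>a\<close> into \<open>c\<close>, by which
  elements of \<open>D(X)\<close> with different supports are brought into one order, that of
  \<open>T\<close> at \<open>|c|\<close>.\<close>

definition J :: "(N => N => bool) => N => N => N => N" where
  "J L a c s = act (crd a) (crd c) (inc L a c) s"

lemma J_fld: "flin L c ==> elts a \<subseteq> elts c ==> Fld T (crd a) s ==> Fld T (crd c) (J L a c s)"
  unfolding J_def by (intro act_fld mmap_inc)

lemma J_comp:
  assumes "flin L d" "elts a \<subseteq> elts c" "elts c \<subseteq> elts d" "Fld T (crd a) s"
  shows "J L c d (J L a c s) = J L a d s"
  unfolding J_def
proof (rule act_comp)
  have c: "flin L c" using flin_subset assms by blast
  show "mmap (inc L a c) (crd a) (crd c)" "mmap (inc L c d) (crd c) (crd d)" "mmap (inc L a d) (crd a) (crd d)"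
    using assms c by (auto intro!: mmap_inc)
  fix i assume i: "i < crd a"
  show "inc L a d i = inc L c d (inc L a c i)"
    unfolding inc_def[of L c d] enf_inc[OF c assms(2) i] by (simp add: inc_def)
qed (use assms in auto)

lemma J_id: assumes "flin L a" "Fld T (crd a) s" shows "J L a a s = s"
  unfolding J_def by (rule act_id) (use assms mmap_inc in \<open>auto simp: inc_def idx_enf\<close>)

lemma J_less_iff:
  "flin L c ==> elts a \<subseteq> elts c ==> Fld T (crd a) s ==> Fld T (crd a) t ==>
    Lss T (crd c) (J L a c s) (J L a c t) <-> Lss T (crd a) s t"
  unfolding J_def by (intro act_less_iff mmap_inc)

lemma supp_J:
  assumes "flin L c" "elts a \<subseteq> elts c" "full a s"
  shows "supp (crd c) (J L a c s) = {i. i < crd c & enf L c i \<in> elts a}"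
  unfolding J_def using supp_act[OF mmap_inc[OF assms(1,2)], of s] inc_image[OF assms(1,2)] assms(3) by (simp add: full_def)

text \<open>By definition, elements are compared over the union of their supports. Since
  \<open>J\<close> composes and reflects the order, any larger finite set \<open>c\<close> gives the
  same result, so several elements can be compared over a common \<open>c\<close>.\<close>

lemma Dless_iff:
  assumes c: "flin L c" "elts a \<subseteq> elts c" "elts b \<subseteq> elts c" and s: "Fld T (crd a) s" and t: "Fld T (crd b) t"
  shows "Dless T L (pr a s) (pr b t) <-> Lss T (crd c) (J L a c s) (J L b c t)"
proof -
  define d where "d = code (elts a \<union> elts b)"
  have d: "FinSet d" "elts d = elts a \<union> elts b" unfolding d_def by (simp_all add: coded_set_Un)
  have Ld: "flin L d" and dc: "elts d \<subseteq> elts c" using flin_subset[OF c(1)] d(2) c by auto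
  have isc: "isc x (%x. x \<in> elts a | x \<in> elts b) <-> x = d" for x
    unfolding isc_iff using d FinSet_eqI[of x d] by auto
  have ab: "elts a \<subseteq> elts d" "elts b \<subseteq> elts d" using d by auto
  have "Dless T L (pr a s) (pr b t) <-> (EX k l m f g s' t'. incl L a d k m f & incl L b d l m g
           & Act T k m f s s' & Act T l m g t t' & Lss T m s' t')"
    by (simp add: Dless_def isc)
  also have "\<dots> <-> (EX s' t'. Act T (crd a) (crd d) (gr (crd a) (inc L a d)) s s' & Act T (crd b) (crd d) (gr (crd b) (inc L b d)) t t'
      & Lss T (crd d) s' t')"
    unfolding incl_iff[OF Ld ab(1)] incl_iff[OF Ld ab(2)] by blast
  also have "\<dots> <-> Lss T (crd d) (J L a d s) (J L b d t)"
    unfolding J_def by (simp add: Act_iff[OF mmap_inc[OF Ld ab(1)] s] Act_iff[OF mmap_inc[OF Ld ab(2)] t])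
  also have "\<dots> <-> Lss T (crd c) (J L d c (J L a d s)) (J L d c (J L b d t))"
    using J_less_iff[OF c(1) dc J_fld[OF Ld ab(1) s] J_fld[OF Ld ab(2) t]] by simp
  also have "\<dots> <-> Lss T (crd c) (J L a c s) (J L b c t)"
    using J_comp[OF c(1) ab(1) dc s] J_comp[OF c(1) ab(2) dc t] by simp
  finally show ?thesis .
qed

lemma flinI: "dp2 L ==> linord A L ==> (!!x. x \<in> elts c ==> A x) ==> flin L c"
  unfolding flin_def using linord_subset[of A L "%x. x \<in> elts c"] by auto

lemma D_linord:
  assumes L: "dp2 L" "linord A L"
  shows "linord (Dfield T A) (Dless T L)"
proof (rule linordI)
  fix p assume "Dfield T A p"
  then obtain a s where p: "p = pr a s" "ALL x:elts a. A x" "full a s" unfolding Dfield_iff by blast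
  then have "flin L a" using flinI L by blast
  then show "~ Dless T L p p"
    using p Dless_iff[of L a a a s s] linordD(1)[OF lin J_fld] by (auto simp: full_def)
next
  fix p q r assume pqr: "Dfield T A p" "Dfield T A q" "Dfield T A r" and less: "Dless T L p q" "Dless T L q r"
  obtain a s where p: "p = pr a s" "ALL x:elts a. A x" "full a s" using pqr unfolding Dfield_iff by blast
  obtain b t where q: "q = pr b t" "ALL x:elts b. A x" "full b t" using pqr unfolding Dfield_iff by blast
  obtain c u where r: "r = pr c u" "ALL x:elts c. A x" "full c u" using pqr unfolding Dfield_iff by blast
  define d where "d = code (elts a \<union> elts b \<union> elts c)"
  have d: "elts d = elts a \<union> elts b \<union> elts c" unfolding d_def by (simp add: coded_set_Un)
  have Ld: "flin L d" by (rule flinI[OF L]) (use p q r d in auto)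
  have sub: "elts a \<subseteq> elts d" "elts b \<subseteq> elts d" "elts c \<subseteq> elts d" using d by auto
  have F: "Fld T (crd a) s" "Fld T (crd b) t" "Fld T (crd c) u" using p q r by (auto simp: full_def)
  have "Lss T (crd d) (J L a d s) (J L c d u)"
    using less Dless_iff[OF Ld sub(1,2) F(1,2)] Dless_iff[OF Ld sub(2,3) F(2,3)]
      linordD(2)[OF lin J_fld[OF Ld sub(1) F(1)] J_fld[OF Ld sub(2) F(2)] J_fld[OF Ld sub(3) F(3)]]
    unfolding p(1) q(1) r(1) by blast
  then show "Dless T L p r" unfolding p(1) r(1) using Dless_iff[OF Ld sub(1,3) F(1,3)] by blast
next
  fix p q assume pq: "Dfield T A p" "Dfield T A q"
  obtain a s where p: "p = pr a s" "FinSet a" "ALL x:elts a. A x" "full a s" using pq unfolding Dfield_iff by blast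
  obtain b t where q: "q = pr b t" "FinSet b" "ALL x:elts b. A x" "full b t" using pq unfolding Dfield_iff by blast
  define d where "d = code (elts a \<union> elts b)"
  have d: "elts d = elts a \<union> elts b" unfolding d_def by (simp add: coded_set_Un)
  have Ld: "flin L d" by (rule flinI[OF L]) (use p q d in auto)
  have sub: "elts a \<subseteq> elts d" "elts b \<subseteq> elts d" using d by auto
  have F: "Fld T (crd a) s" "Fld T (crd b) t" using p q by (auto simp: full_def)
  consider "Lss T (crd d) (J L a d s) (J L b d t)" | "Lss T (crd d) (J L b d t) (J L a d s)" | "J L a d s = J L b d t"
    using linordD(3)[OF lin] J_fld[OF Ld] sub F by metis
  then show "Dless T L p q | p = q | Dless T L q p"
  proof cases
    case 3
    \<comment> \<open>As both elements have full support, the sets \<open>a\<close> and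
      \<open>b\<close> can be recovered from the supports of the images over
      \<open>d\<close>.\<close>
    have "x \<in> elts a <-> x \<in> elts b" if "x \<in> elts d" for x
    proof -
      have "idx L d x \<in> supp (crd d) (J L a d s) <-> x \<in> elts a" "idx L d x \<in> supp (crd d) (J L b d t) <-> x \<in> elts b"
        using supp_J[OF Ld sub(1)] supp_J[OF Ld sub(2)] p q idx[OF Ld that] by auto
      then show ?thesis using 3 by simp
    qed
    then have "elts a = elts b" using d by blast
    then have "a = b" using p q FinSet_eqI by blast
    moreover have "s = t" using 3 \<open>a = b\<close> F act_inj[OF mmap_inc[OF Ld sub(1)], of s t] by (simp add: J_def)
    ultimately show ?thesis using p q by simp
  qed (use Dless_iff[OF Ld] sub F p q in auto)
qed

lemma crd_singleton: "crd (code {z}) = 1" and enf_singleton: "flin L (code {z}) ==> enf L (code {z}) 0 = z"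
proof -
  have *: "crd (code {z}) = 1 & enf L (code {z}) 0 = z" if "flin L (code {z})" for L
  proof -
    have lt1: "i < 1 <-> i = 0" for i :: N using less_Suc[of i 0] by (auto simp: le_less)
    show ?thesis using enf_eqI[OF that, of "%i. z" 1] by (auto simp: dfm_intros lt1)
  qed
  show "crd (code {z}) = 1" using *[OF flin_less] by blast
  show "flin L (code {z}) ==> enf L (code {z}) 0 = z" using * by blast
qed

lemma full_singleton: "full (code {z}) (mu 1 0)"
  unfolding full_def crd_singleton using mu_fld[of 0 1] supp_mu1 less_Suc[of _ 0] by (auto simp: le_less)

text \<open>The value at \<open>z\<close> of the function \<open>\<mu>\<close> on \<open>D\<^sup>T\<close>.\<close>

definition Dmu :: "N => N" where
  "Dmu z = pr (code {z}) (mu 1 0)"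

lemma Dfield_Dmu: "A z ==> Dfield T A (Dmu z)"
  unfolding Dfield_iff Dmu_def using full_singleton by auto

text \<open>Normality carried over to \<open>D(X)\<close>: over \<open>c\<close>, the element
  \<open>Dmu z\<close> becomes the value of \<open>mu\<close> at the position of
  \<open>z\<close>.\<close>

lemma Dless_Dmu_iff:
  assumes c: "flin L c" "elts a \<subseteq> elts c" "z \<in> elts c" and s: "full a s"
  shows "Dless T L (pr a s) (Dmu z) <-> (ALL r:elts a. L r z)"
proof -
  have sub: "elts (code {z}) \<subseteq> elts c" using c by simp
  have Lz: "flin L (code {z})" using flin_subset[OF c(1) sub] .
  have m: "mmap (inc L (code {z}) c) 1 (crd c)" using mmap_inc[OF c(1) sub] crd_singleton by simp
  have 0: "(0::N) < 1" by simp
  have "inc L (code {z}) c 0 = idx L c z" unfolding inc_def enf_singleton[OF Lz] ..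
  then have Jm: "J L (code {z}) c (mu 1 0) = mu (crd c) (idx L c z)"
    unfolding J_def crd_singleton using act_mu[OF m 0] by simp
  have Fs: "Fld T (crd a) s" using s by (simp add: full_def)
  have "Dless T L (pr a s) (Dmu z) <-> Lss T (crd c) (J L a c s) (mu (crd c) (idx L c z))"
    unfolding Dmu_def using Dless_iff[OF c(1,2) sub Fs, of "mu 1 0"] Jm crd_singleton mu_fld[OF 0] by simp
  also have "\<dots> <-> (ALL i:supp (crd c) (J L a c s). i < idx L c z)"
    using less_mu_iff idx(1)[OF c(1,3)] J_fld[OF c(1,2) Fs] by blast
  also have "\<dots> <-> (ALL i<crd c. enf L c i \<in> elts a --> i < idx L c z)"
    unfolding supp_J[OF c(1,2) s] by blast
  also have "\<dots> <-> (ALL r:elts a. L r z)"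
  proof
    assume *: "ALL i<crd c. enf L c i \<in> elts a --> i < idx L c z"
    show "ALL r:elts a. L r z"
    proof
      fix r assume r: "r \<in> elts a"
      then have rc: "r \<in> elts c" using c(2) by blast
      have "idx L c r < idx L c z" using * idx[OF c(1) rc] r by simp
      then show "L r z" using idx_less_iff[OF c(1) rc c(3)] by simp
    qed
  next
    assume *: "ALL r:elts a. L r z"
    show "ALL i<crd c. enf L c i \<in> elts a --> i < idx L c z"
    proof (intro allI impI)
      fix i assume i: "i < crd c" "enf L c i \<in> elts a"
      then show "i < idx L c z" using * idx_less_iff[OF c(1) _ c(3), of "enf L c i"] idx_enf[OF c(1) i(1)] c(2) by auto
    qed
  qed
  finally show ?thesis .
qed

lemma full_image:
  assumes L: "flin L a" and K: "flin K b" and h: "df1 h" and b: "elts b = h ` elts a"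
    and mono: "!!x y. x \<in> elts a ==> y \<in> elts a ==> L x y ==> K (h x) (h y)"
  shows "full b s <-> full a s"
  unfolding full_def using enf_image(1)[OF L K h b mono] by simp

text \<open>Functoriality of \<open>D\<close>. The map \<open>h\<close> is assumed to be increasing
  on \<open>c\<close> only, so that the lemma applies within inductions where nothing is known about
  other elements yet.\<close>

lemma Dless_image:
  assumes L: "flin L c" and K: "flin K d" and h: "df1 h" and d: "elts d = h ` elts c"
    and mono: "!!x y. x \<in> elts c ==> y \<in> elts c ==> L x y ==> K (h x) (h y)"
    and a: "elts a \<subseteq> elts c" "elts a' = h ` elts a" and b: "elts b \<subseteq> elts c" "elts b' = h ` elts b"
    and s: "Fld T (crd a) s" and t: "Fld T (crd b) t"
  shows "Dless T K (pr a' s) (pr b' t) <-> Dless T L (pr a s) (pr b t)"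
proof -
  have La: "flin L a" "flin L b" using flin_subset L a b by blast+
  have sub: "elts a' \<subseteq> elts d" "elts b' \<subseteq> elts d" using a b d by auto
  have Ka: "flin K a'" "flin K b'" using flin_subset[OF K] sub by auto
  have ca: "crd a' = crd a" using enf_image(1)[OF La(1) Ka(1) h a(2)] mono a by blast
  have cb: "crd b' = crd b" using enf_image(1)[OF La(2) Ka(2) h b(2)] mono b by blast
  have cd: "crd d = crd c" using enf_image(1)[OF L K h d] mono by blast
  have "J K a' d s = J L a c s"
    unfolding J_def ca cd by (rule act_cong) (rule inc_transport[OF L K h d mono a])
  moreover have "J K b' d t = J L b c t"
    unfolding J_def cb cd by (rule act_cong) (rule inc_transport[OF L K h d mono b])
  moreover have "elts a' \<subseteq> elts d" "elts b' \<subseteq> elts d" using a b d by auto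
  ultimately show ?thesis
    using Dless_iff[OF L a(1) b(1) s t] Dless_iff[OF K, of a' b' s t] s t ca cb cd by simp
qed

lemma dfm_Dless: "dp2 L ==> dtm p ==> dtm q ==> dfm (%e. Dless T L (p e) (q e))"
  using dfm_Dless_ctx[OF _ def, of "%x y e. L x y"] by simp

lemma dfm_Dfield: "dp1 A ==> dtm p ==> dfm (%e. Dfield T A (p e))"
proof -
  assume A: "dp1 A" and p: "dtm p"
  have "dfm (%e. Dfield T A (e 0))"
    unfolding Dfield_iff by (intro dfm_intros dfm_full dfm_sub1[OF A])
  then show ?thesis using p by (rule dfm_sub1)
qed

text \<open>\<open>spwf\<close> speaks about orders that are sets of the model; comprehension makes
  it applicable to definable ones.\<close>

lemma spwf_mwf:
  assumes wf: "spwf T" and A: "dp1 A" and L: "dp2 L" "linord A L" "mwf A L"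
  shows "mwf (Dfield T A) (Dless T L)"
proof -
  define X where "X = {x. A x}"
  define R where "R = {p. EX x y. p = pr x y & L x y}"
  have X: "X \<in> SS" unfolding X_def by (rule dfm_SS[OF A])
  have R: "R \<in> SS" unfolding R_def by (rule dfm_SS) (intro dfm_intros dfm_sub2[OF L(1)])
  have eq: "(%x. x \<in> X) = A" "(%x y. pr x y \<in> R) = L" by (auto simp: X_def R_def fun_eq_iff)
  have "wellord X R" unfolding wellord_def eq using L wellf_iff_mwf by blast
  then have "Dwf T X R" using wf X R unfolding spwf_def by blast
  then have "wellf (Dfield T A) (Dless T L)" unfolding Dwf_def eq .
  then show ?thesis using wellf_iff_mwf[of "Dless T L"] dfm_Dless[OF L(1)] by (simp add: dfm_intros)
qed

end

section \<open>Recursive definitions of predicates\<close>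

definition precur :: "((N => bool) => N => bool) => N => bool" where
  "precur F x <-> recur (%x g. if F (%y. fapp g y = 1) x then 1 else 0) x = 1"

lemma precur_eq:
  assumes F: "dfm (%e. F (%y. fapp (e (Suc 0)) y = 1) (e 0))"
    and local: "!!P Q. (!!y. y < x ==> P y <-> Q y) ==> F P x <-> F Q x"
  shows "precur F x <-> F (precur F) x"
proof -
  let ?H = "%x g. if F (%y. fapp g y = 1) x then 1 else 0 :: N"
  have H: "dtm (%e. ?H (e 0) (e (Suc 0)))" by (intro dfm_intros F)
  have "precur F x <-> F (%y. fapp (gr x (recur ?H)) y = 1) x"
    unfolding precur_def recur_eq[OF H, of x] by simp
  also have "\<dots> <-> F (precur F) x"
    by (rule local) (simp add: precur_def fapp_gr[OF dtm_recur1[OF H dtm_var]])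
  finally show ?thesis .
qed

lemma dfm_precur:
  assumes F: "dfm (%e. F (%y. fapp (e (Suc 0)) y = 1) (e 0) (%i. e (Suc (Suc i))))" and t: "dtm t"
  shows "dfm (%e. precur (%P x. F P x e) (t e))"
  unfolding precur_def by (intro dfm_intros F t)

text \<open>Szudzik's pairing, which takes the place of the measure by \<open>L\<close>. In the
  clause for two \<open>xi\<close>-terms, every pair of elements of \<open>a \<union> b\<close> must
  precede the pair of terms, even if both elements come from the larger term. So pairs have to be
  ordered by their maximum; \<open>pr\<close> orders them by their sum.\<close>

definition spair :: "N => N => N" where
  "spair s t = (if s < t then t * t + s else s * s + s + t)"

lemma dtm_spair [dfm_intros]: "dtm s ==> dtm t ==> dtm (%e. spair (s e) (t e))"
  unfolding spair_def by (intro dfm_intros)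

lemma spair_bounds: "max s t * max s t <= spair s t" "spair s t < (max s t + 1) * (max s t + 1)"
proof -
  have sq: "(m + 1) * (m + 1) = (m * m + m + m) + (1::N)" for m by (simp add: algebra_simps)
  show "max s t * max s t <= spair s t" by (auto simp: spair_def max_def add.assoc)
  have "spair s t <= max s t * max s t + max s t + max s t"
    by (auto simp: spair_def max_def add.assoc intro!: add_left_mono)
       (meson add_increasing2 N_le_0 less_imp_le order_trans)
  then show "spair s t < (max s t + 1) * (max s t + 1)" unfolding sq by (simp only: less_Suc)
qed

lemma spair_less_max: assumes "max s t < max s' t'" shows "spair s t < spair s' t'"
proof -
  have "max s t + 1 <= max s' t'" using assms by (simp only: Suc_le)
  then have "(max s t + 1) * (max s t + 1) <= max s' t' * max s' t'" by (intro mult_mono) auto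
  then show ?thesis using spair_bounds(2)[of s t] spair_bounds(1)[of s' t'] by (meson less_le_trans)
qed

lemma spair_inject [simp]: "spair s t = spair s' t' <-> s = s' & t = t'"
proof
  assume eq: "spair s t = spair s' t'"
  then have m: "max s t = max s' t'" using spair_less_max[of s t s' t'] spair_less_max[of s' t' s t]
    by (metis less_irrefl linorder_neqE)
  have A: False if "a < b" "b * b + a = b * b + b + (c::N)" for a b c
  proof -
    have "a = b + c" using that by (simp only: add.assoc add_left_cancel)
    then show False using that(1) by simp
  qed
  consider "s < t" "s' < t'" | "s < t" "t' <= s'" | "t <= s" "s' < t'" | "t <= s" "t' <= s'" by force
  then show "s = s' & t = t'"
  proof cases
    case 1 then show ?thesis using eq m by (simp add: spair_def max_def split: if_splits)
  next
    case 2
    then have "t = s'" using m by (simp add: max_def split: if_splits)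
    then show ?thesis using 2 eq A[of s t t'] leD[of t' s'] by (simp add: spair_def)
  next
    case 3
    then have "s = t'" using m by (simp add: max_def split: if_splits)
    then show ?thesis using 3 eq A[of s' t' t] leD[of t s] by (simp add: spair_def)
  next
    case 4
    then have "s = s'" using m by (auto simp: max_def split: if_splits)
    then show ?thesis using 4 eq leD[of t s] leD[of t' s'] by (simp add: spair_def)
  qed
qed auto

lemma spair_less1: assumes "r < t" shows "spair s r < spair s t"
proof (cases "max s r < max s t")
  case False
  then have "t <= s" using assms by (auto simp: max_def split: if_splits)
  then show ?thesis using assms leD[of t s] leD[of r s] by (simp add: spair_def)
qed (rule spair_less_max)

lemma spair_less2: assumes "r < s" shows "spair r t < spair s t"
proof (cases "max r t < max s t")
  case False
  then have st: "s <= t" using assms by (auto simp: max_def split: if_splits)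
  then have rt: "r < t" using assms by simp
  show ?thesis
  proof (cases "s = t")
    case True
    have "t * t + r < t * t + (t + t)" using rt by (intro add_strict_left_mono) (meson add_strict_increasing2 N_le_0 less_le_trans order_refl)
    then show ?thesis using True rt by (simp add: spair_def add.assoc)
  next
    case False
    then show ?thesis using st rt assms by (simp add: spair_def)
  qed
qed (rule spair_less_max)

definition precur2 :: "((N => N => bool) => N => N => bool) => N => N => bool" where
  "precur2 F s t <-> precur (%P x. EX s t. x = spair s t & F (%r q. P (spair r q)) s t) (spair s t)"

lemma precur2_eq:
  assumes F: "dfm (%e. F (%r q. fapp (e (Suc (Suc 0))) (spair r q) = 1) (e 0) (e (Suc 0)))"
    and local: "!!P Q. (!!r q. spair r q < spair s t ==> P r q <-> Q r q) ==> F P s t <-> F Q s t"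
  shows "precur2 F s t <-> F (precur2 F) s t"
proof -
  let ?G = "%P x. EX s t. x = spair s t & F (%r q. P (spair r q)) s t"
  have "dfm (%e. ?G (%y. fapp (e (Suc 0)) y = 1) (e 0))"
    by (intro dfm_intros dfm_sub3[OF F])
  then have "precur2 F s t <-> ?G (precur ?G) (spair s t)"
    unfolding precur2_def
  proof (rule precur_eq)
    fix P Q :: "N => bool" assume "!!y. y < spair s t ==> P y = Q y"
    then have "F (%r q. P (spair r q)) s t <-> F (%r q. Q (spair r q)) s t" by (intro local)
    then show "?G P (spair s t) <-> ?G Q (spair s t)" by simp
  qed
  then show ?thesis unfolding precur2_def by simp
qed

lemma dfm_precur2:
  assumes F: "dfm (%e. F (%r q. fapp (e (Suc (Suc 0))) (spair r q) = 1) (e 0) (e (Suc 0)))" and t: "dtm t" and u: "dtm u"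
  shows "dfm (%e. precur2 F (t e) (u e))"
  unfolding precur2_def
  by (rule dfm_precur) (intro dfm_intros dfm_sub3[OF F] t u)+

section \<open>Finite unions and coded structures\<close>

lemma coded_set_UN:
  assumes a: "coded_set A" and f: "df1 f" shows "coded_set (\<Union>x\<in>A. elts (f x))"
proof -
  obtain k where "ALL x:A. x < k" using coded_set_bounded[OF a] by blast
  moreover obtain b where "ALL x<k. f x < b" using bounded_function[OF f] by blast
  moreover have "(\<Union>x\<in>A. elts (f x)) = {y. EX x. x \<in> A & y \<in> elts (f x)}" by auto
  moreover have "{y. EX x. x \<in> A & y \<in> elts (f x)} \<in> SS"
    by (rule dfm_SS) (intro dfm_intros dfm_mem dtm_sub1[OF f] coded_set_SS[OF a])
  moreover have "y < b" if "x \<in> A" "y \<in> elts (f x)" "f x < b" for x y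
    using elts_less[OF that(2)] that(3) by (rule less_trans)
  ultimately show ?thesis
    using coded_setI[of "\<Union>x\<in>A. elts (f x)" b] by (metis (no_types, lifting) UN_E)
qed

lemma numerals_distinct [simp]: "(0::N) ~= x + 1" "x + 1 ~= (0::N)" "x + 1 = (1::N) <-> x = 0" "1 = x + (1::N) <-> x = 0"
proof -
  show "x + 1 ~= 0" "0 ~= x + 1" using N_axioms(1)[of x] by (simp, metis)
  show "x + 1 = 1 <-> x = 0" "1 = x + 1 <-> x = 0" using add_right_cancel[of x 1 0] by (simp, metis add_0)
qed

lemma scoded_surj:
  assumes "defdil S" shows "EX P:SS. scoded P = S"
proof -
  define P where "P = {x. (EX n s. x = pr 0 (pr n s) & Fld S n s) | (EX n s t. x = pr 1 (pr n (pr s t)) & Lss S n s t)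
    | (EX n l f s t. x = pr N2 (pr n (pr l (pr f (pr s t)))) & Act S n l f s t)
    | (EX n s a. x = pr N3 (pr n (pr s a)) & Spp S n s a) | (EX n m s. x = pr N4 (pr n (pr m s)) & Mu S n m s)}"
  have "P \<in> SS" unfolding P_def by (rule dfm_SS) (intro dfm_intros defdilD[OF assms])
  moreover have "scoded P = S"
    unfolding scoded_def P_def by (cases S) simp
  ultimately show ?thesis by blast
qed

context npdil
begin

section \<open>The terms of \<open>\<partial>T\<close>\<close>

definition tmF :: "(N => bool) => (N => bool) => N => bool" where
  "tmF A P t <-> (EX m. A m & t = mut m) |
    (EX a s. t = xit a s & FinSet a & (ALL r:elts a. P r) & full a s & ~ (EX m. A m & elts a = {mut m} & s = mu 1 0))"

text \<open>Admitting any class \<open>A\<close> in place of \<open>n\<close> allows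
  \<open>D(A)\<close> for \<open>\<partial>T\<close> to be studied as an order of terms over
  \<open>A\<close>.\<close>

definition trm :: "(N => bool) => N => bool" where
  "trm A = precur (tmF A)"

lemma dtm_mut [dfm_intros]: "dtm t ==> dtm (%e. mut (t e))"
  unfolding mut_def by (intro dfm_intros)

lemma dtm_xit [dfm_intros]: "dtm s ==> dtm t ==> dtm (%e. xit (s e) (t e))"
  unfolding xit_def by (intro dfm_intros)

lemma mut_xit_simps [simp]: "mut m = mut k <-> m = k" "mut m ~= xit a s" "xit a s ~= mut m"
  "xit a s = xit b t <-> a = b & s = t"
  by (auto simp: mut_def xit_def)

lemma less_xit: "r \<in> elts a ==> r < xit a s"
  using elts_less[of r a] pr_ge1(1)[of a s] pr_ge1(2)[of "pr a s" "0 + 1"] unfolding xit_def by (meson less_le_trans)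

lemma dfm_tmF:
  assumes A: "dfm (%e. A (e 0) (%i. e (Suc i)))" and P: "dfm (%e. P (e 0) (%i. e (Suc i)))" and t: "dtm t"
  shows "dfm (%e. tmF (%m. A m e) (%r. P r e) (t e))"
proof -
  have eq: "elts a = {mut m} <-> (ALL x. x \<in> elts a <-> x = mut m)" for a m by auto
  have A': "dfm (%e. A (e 0) (%i. e (Suc (f i))))" for f
    using dfm_ren[OF A, of "%i. if i = 0 then 0 else Suc (f (i - 1))"] by simp
  have P': "dfm (%e. P (e 0) (%i. e (Suc (f i))))" for f
    using dfm_ren[OF P, of "%i. if i = 0 then 0 else Suc (f (i - 1))"] by simp
  show ?thesis
    unfolding tmF_def eq by (intro dfm_intros dtm_ren[OF t] dfm_full A' P')
qed

lemma tmF_local: "(!!r. r < t ==> P r <-> Q r) ==> tmF A P t <-> tmF A Q t"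
  unfolding tmF_def using less_xit by blast

lemma trm_eq: assumes "dp1 A" shows "trm A t <-> tmF A (trm A) t"
  unfolding trm_def
proof (rule precur_eq)
  show "dfm (%e. tmF A (%y. fapp (e (Suc 0)) y = 1) (e 0))"
    by (rule dfm_tmF[of "%m e. A m"]) (intro dfm_intros assms)+
qed (rule tmF_local)

lemma dfm_trm_ctx:
  assumes A: "dfm (%e. A (e 0) (%i. e (Suc i)))" and t: "dtm t"
  shows "dfm (%e. trm (%m. A m e) (t e))"
proof -
  have A': "dfm (%e. A (e 0) (%i. e (Suc (Suc (Suc i)))))"
    using dfm_ren[OF A, of "%i. if i = 0 then 0 else Suc (Suc i)"] by simp
  show ?thesis unfolding trm_def
    by (rule dfm_precur[of "%P x e. tmF (%m. A m e) P x", OF _ t])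
       (rule dfm_tmF[of "%m e. A m (%i. e (Suc (Suc i)))"]; intro dfm_intros A')
qed

lemma dfm_trm: "dp1 A ==> dtm t ==> dfm (%e. trm A (t e))"
  using dfm_trm_ctx[of "%m e. A m"] by simp

lemma trm_mut [simp]: "dp1 A ==> trm A (mut m) <-> A m"
  by (subst trm_eq) (auto simp: tmF_def)

lemma trm_xit: "dp1 A ==> trm A (xit a s) <-> FinSet a & (ALL r:elts a. trm A r) & full a s
    & ~ (EX m. A m & elts a = {mut m} & s = mu 1 0)"
  by (subst trm_eq) (auto simp: tmF_def)

lemma trm_cases:
  assumes "dp1 A" "trm A t"
  obtains m where "A m" "t = mut m"
  | a s where "t = xit a s" "FinSet a" "!!r. r \<in> elts a ==> trm A r" "full a s" "!!m. ~ (A m & elts a = {mut m} & s = mu 1 0)"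
  using assms(2) unfolding trm_eq[OF assms(1), of t] tmF_def by blast

lemma trm_induct [consumes 2, case_names dfm mut xit]:
  assumes A: "dp1 A" and t: "trm A t" and P: "dp1 P"
    and mut: "!!m. A m ==> P (mut m)"
    and xit: "!!a s. FinSet a ==> (!!r. r \<in> elts a ==> trm A r & P r) ==> full a s ==>
      (!!m. ~ (A m & elts a = {mut m} & s = mu 1 0)) ==> P (xit a s)"
  shows "P t"
  using t
proof (induction t rule: N_less_induct)
  case dfm show ?case by (intro dfm_intros dfm_trm A P)
next
  case (less t)
  show ?case
    using A less(2)
  proof (cases rule: trm_cases)
    case (2 a s)
    then show ?thesis using xit[of a s] less(1) less_xit by blast
  qed (simp add: mut)
qed

section \<open>The order of \<open>\<partial>T\<close>\<close>

definition ltF :: "(N => N => bool) => (N => N => bool) => N => N => bool" where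
  "ltF K P s t <-> (EX m k. s = mut m & t = mut k & K m k)
      | (EX m b v. s = mut m & t = xit b v & (EX r. r \<in> elts b & (P s r | s = r)))
      | (EX a u k. s = xit a u & t = mut k & (ALL r. r \<in> elts a --> P r t))
      | (EX a u b v. s = xit a u & t = xit b v
           & linord (%r. r \<in> elts a | r \<in> elts b) P & Dless T P (pr a u) (pr b v))"

definition lt :: "(N => N => bool) => N => N => bool" where
  "lt K = precur2 (ltF K)"

lemma dfm_ltF:
  assumes K: "dp2 K"
  shows "dfm (%e. ltF K (%r q. fapp (e (Suc (Suc 0))) (spair r q) = 1) (e 0) (e (Suc 0)))"
  unfolding ltF_def linord_def
  by (intro dfm_intros dfm_sub2[OF K] dfm_Dless_ctx[OF _ def])

lemma linord_cong:
  assumes "!!x y. A x ==> A y ==> L x y <-> K x y" shows "linord A L <-> linord A K"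
proof -
  have "linord A K" if "linord A L" "!!x y. A x ==> A y ==> L x y <-> K x y" for L K
    using linordD[OF that(1)] that(2) by (intro linordI) metis+
  then show ?thesis using assms by blast
qed

lemma enum_cong:
  assumes "!!x y. x \<in> elts a ==> y \<in> elts a ==> L x y <-> K x y" shows "enum L a n e <-> enum K a n e"
proof -
  have "enum L a n e ==> enum K a n e" if LK: "!!x y. x \<in> elts a ==> y \<in> elts a ==> L x y <-> K x y" for L K
  proof -
    assume h: "enum L a n e"
    note h = h[unfolded enum_alt]
    have "K (fapp e i) (fapp e j)" if "j < n" "i < j" for i j
    proof -
      have "i < n" using that by (meson less_trans)
      then have "L (fapp e i) (fapp e j)" "fapp e i \<in> elts a" "fapp e j \<in> elts a" using h[THEN conjunct2] that by blast+
      then show ?thesis using LK by simp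
    qed
    then show "enum K a n e" unfolding enum_alt by (intro conjI h[THEN conjunct1] h[THEN conjunct2, THEN conjunct1] h[THEN conjunct2, THEN conjunct2, THEN conjunct1]) blast
  qed
  then show ?thesis using assms by blast
qed

lemma Dless_cong:
  assumes "!!x y. x \<in> elts a \<union> elts b ==> y \<in> elts a \<union> elts b ==> L x y <-> K x y"
  shows "Dless S L (pr a u) (pr b v) <-> Dless S K (pr a u) (pr b v)"
proof -
  have e: "enum L c n e <-> enum K c n e" if "elts c \<subseteq> elts a \<union> elts b" for c n e
    using enum_cong[of c L K] assms that by blast
  have "isc c (%x. x \<in> elts a | x \<in> elts b) ==> elts c \<subseteq> elts a \<union> elts b" for c by (auto simp: isc_def)
  then have "isc c (%x. x \<in> elts a | x \<in> elts b) ==> (incl L a c k m f <-> incl K a c k m f) & (incl L b c k m f <-> incl K b c k m f)" for c k m f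
    unfolding incl_def using e by simp
  then show ?thesis unfolding Dless_def by (simp cong: conj_cong)
qed

lemma ltF_cong:
  assumes 1: "!!b v r. t = xit b v ==> r \<in> elts b ==> P s r <-> Q s r"
    and 2: "!!b v r. s = xit b v ==> r \<in> elts b ==> P r t <-> Q r t"
    and 3: "!!a u b v r q. s = xit a u ==> t = xit b v ==> r \<in> elts a \<union> elts b ==> q \<in> elts a \<union> elts b ==> P r q <-> Q r q"
  shows "ltF K P s t <-> ltF K Q s t"
proof -
  have "linord (%r. r \<in> elts a | r \<in> elts b) P & Dless T P (pr a u) (pr b v) <->
    linord (%r. r \<in> elts a | r \<in> elts b) Q & Dless T Q (pr a u) (pr b v)" if "s = xit a u" "t = xit b v" for a u b v
    using Dless_cong[of a b P Q T u v] linord_cong[of "%r. r \<in> elts a | r \<in> elts b" P Q] 3[OF that] by auto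
  then have "(EX a u b v. s = xit a u & t = xit b v
           & linord (%r. r \<in> elts a | r \<in> elts b) P & Dless T P (pr a u) (pr b v)) <->
    (EX a u b v. s = xit a u & t = xit b v
           & linord (%r. r \<in> elts a | r \<in> elts b) Q & Dless T Q (pr a u) (pr b v))" by blast
  moreover have "(EX m b v. s = mut m & t = xit b v & (EX r. r \<in> elts b & (P s r | s = r))) <->
    (EX m b v. s = mut m & t = xit b v & (EX r. r \<in> elts b & (Q s r | s = r)))" using 1 by blast
  moreover have "(EX a u k. s = xit a u & t = mut k & (ALL r. r \<in> elts a --> P r t)) <->
    (EX a u k. s = xit a u & t = mut k & (ALL r. r \<in> elts a --> Q r t))" using 2 by blast
  ultimately show ?thesis unfolding ltF_def by argo
qed

lemma ltF_local:
  assumes "!!r q. spair r q < spair s t ==> P r q <-> Q r q" shows "ltF K P s t <-> ltF K Q s t"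
proof (rule ltF_cong)
  show "P s r <-> Q s r" if "t = xit b v" "r \<in> elts b" for b v r
    using assms spair_less1 less_xit that by blast
  show "P r t <-> Q r t" if "s = xit b v" "r \<in> elts b" for b v r
    using assms spair_less2 less_xit that by blast
  show "P r q <-> Q r q" if "s = xit a u" "t = xit b v" "r \<in> elts a \<union> elts b" "q \<in> elts a \<union> elts b" for a u b v r q
  proof (rule assms, rule spair_less_max)
    have "x < max s t" if "x \<in> elts a \<union> elts b" for x
      using that \<open>s = xit a u\<close> \<open>t = xit b v\<close> less_xit[of x a u] less_xit[of x b v] by (auto simp: less_max_iff_disj)
    then show "max r q < max s t" using that by simp
  qed
qed

lemma lt_eq: "dp2 K ==> lt K s t <-> ltF K (lt K) s t"
  unfolding lt_def by (rule precur2_eq[OF dfm_ltF ltF_local])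

lemma dfm_lt: "dp2 K ==> dtm s ==> dtm t ==> dfm (%e. lt K (s e) (t e))"
  unfolding lt_def by (rule dfm_precur2[OF dfm_ltF])

lemma dp2_lt: "dp2 K ==> dp2 (lt K)"
  by (intro dfm_lt dfm_intros)

lemma lt_simps:
  assumes "dp2 K"
  shows "lt K (mut m) (mut k) <-> K m k"
    "lt K (mut m) (xit b v) <-> (EX r:elts b. lt K (mut m) r | mut m = r)"
    "lt K (xit a u) (mut k) <-> (ALL r:elts a. lt K r (mut k))"
    "lt K (xit a u) (xit b v) <-> linord (%r. r \<in> elts a | r \<in> elts b) (lt K) & Dless T (lt K) (pr a u) (pr b v)"
proof -
  note eq = lt_eq[OF assms, unfolded ltF_def]
  show "lt K (mut m) (mut k) <-> K m k" using eq[of "mut m" "mut k"] by simp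
  show "lt K (mut m) (xit b v) <-> (EX r:elts b. lt K (mut m) r | mut m = r)" using eq[of "mut m" "xit b v"] by auto
  show "lt K (xit a u) (mut k) <-> (ALL r:elts a. lt K r (mut k))" using eq[of "xit a u" "mut k"] by auto
  show "lt K (xit a u) (xit b v) <-> linord (%r. r \<in> elts a | r \<in> elts b) (lt K) & Dless T (lt K) (pr a u) (pr b v)"
    using eq[of "xit a u" "xit b v"] by simp
qed

text \<open>The inverse of \<open>\<xi>\<close>, which is a bijection because \<open>\<mu>\<^sub>m\<close> is the value of \<open>\<xi>\<close> at
  \<open>\<langle>{\<mu>\<^sub>m}, \<mu>\<^sub>1(0)\<rangle>\<close>.\<close>

definition dec :: "N => N" where
  "dec t = (if EX m. t = mut m then Dmu t else the0 (%p. t = pr 1 p))"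

definition xi :: "N => N" where
  "xi p = (if EX m. p = Dmu (mut m) then the0 (%t. p = Dmu t) else pr 1 p)"

lemma dec_simps [simp]: "dec (mut m) = Dmu (mut m)" "dec (xit a s) = pr a s"
  unfolding dec_def by (auto simp: xit_def mut_def intro: the0_equality)

lemma Dmu_inject [simp]: "Dmu x = Dmu y <-> x = y"
  unfolding Dmu_def by (auto simp: code_inject)

lemma xi_Dmu [simp]: "xi (Dmu (mut m)) = mut m"
  unfolding xi_def by (auto intro: the0_equality)

lemma xi_pr: "~ (EX m. pr a s = Dmu (mut m)) ==> xi (pr a s) = xit a s"
  unfolding xi_def xit_def by auto

lemma pr_eq_Dmu: "FinSet a ==> pr a s = Dmu z <-> elts a = {z} & s = mu 1 0"
  unfolding Dmu_def by (metis FinSet_code FinSet_eqI coded_set_singleton elts_code pr_inject)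

lemma Dfield_dec:
  assumes A: "dp1 A" "trm A t" and Z: "!!a s r. t = xit a s ==> r \<in> elts a ==> Z r" "!!m. t = mut m ==> Z t"
  shows "Dfield T Z (dec t)"
  using A
proof (cases rule: trm_cases)
  case (1 m) then show ?thesis using Dfield_Dmu[of Z] Z by simp
next
  case (2 a s) then show ?thesis unfolding Dfield_iff using Z by auto
qed

lemma dec_inj:
  assumes A: "dp1 A" "trm A s" "trm A t" and eq: "dec s = dec t" shows "s = t"
  using A(1,2)
proof (cases rule: trm_cases)
  case s: (1 m)
  show ?thesis using A(1,3)
  proof (cases rule: trm_cases)
    case (2 b v) then show ?thesis using eq s pr_eq_Dmu[of b v "mut m"] by auto
  qed (use s eq in simp)
next
  case s: (2 a u)
  show ?thesis using A(1,3)
  proof (cases rule: trm_cases)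
    case (1 m) then show ?thesis using eq s pr_eq_Dmu[of a u "mut m"] by auto
  qed (use s eq in simp)
qed

text \<open>The clauses for \<open>mut\<close> agree with comparisons in \<open>D\<close> by
  \<open>Dless_Dmu_iff\<close>. If \<open>mut m\<close> is on the left, this needs linearity of
  \<open>D\<close> and the fact that terms of the excluded form do not occur. Linearity of
  \<open>lt\<close> is assumed on a class \<open>Z\<close> only, because it is proved by induction
  with the help of this lemma.\<close>

lemma lt_dec:
  assumes A: "dp1 A" "trm A s" "trm A t" and K: "dp2 K" and Z: "linord Z (lt K)"
    and s: "Dfield T Z (dec s)" and t: "Dfield T Z (dec t)"
  shows "lt K s t <-> Dless T (lt K) (dec s) (dec t)"
proof -
  note L = dp2_lt[OF K]
  have el: "Dfield T Z (Dmu z) ==> Z z" for z unfolding Dfield_iff Dmu_def by auto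
  have DD: "Dless T (lt K) (pr a u) (Dmu z) <-> (ALL r:elts a. lt K r z)" if "Dfield T Z (pr a u)" "Dfield T Z (Dmu z)" for a u z
  proof -
    define c where "c = code (insert z (elts a))"
    have c: "elts c = insert z (elts a)" unfolding c_def by simp
    have "flin (lt K) c" by (rule flinI[OF L Z]) (use that el c in \<open>auto simp: Dfield_iff\<close>)
    then show ?thesis by (rule Dless_Dmu_iff) (use that c in \<open>auto simp: Dfield_iff\<close>)
  qed
  show ?thesis using A(1,2)
  proof (cases rule: trm_cases)
    case s': (1 m)
    show ?thesis using A(1,3)
    proof (cases rule: trm_cases)
      case (1 k)
      then show ?thesis using DD[of "code {mut m}" "mu 1 0" "mut k"] s t s' by (simp add: Dmu_def[symmetric])
    next
      case (2 b v)
      have bv: "Dfield T Z (pr b v)" "Dfield T Z (Dmu (mut m))" using s t s' 2 by simp_all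
      have Zb: "Z r" if "r \<in> elts b" for r using bv(1) that unfolding Dfield_iff by auto
      have ne: "pr b v ~= Dmu (mut m)" using pr_eq_Dmu[OF 2(2)] 2(5) s'(1) by blast
      note D = linordD[OF D_linord[OF L Z]]
      have "Dless T (lt K) (Dmu (mut m)) (pr b v) <-> ~ Dless T (lt K) (pr b v) (Dmu (mut m))"
        using D(1)[OF bv(1)] D(2)[OF bv bv(1)] D(3)[OF bv] ne by blast
      also have "\<dots> <-> (EX r:elts b. ~ lt K r (mut m))" using DD[OF bv] by blast
      also have "\<dots> <-> (EX r:elts b. lt K (mut m) r | mut m = r)"
        using linordD[OF Z] Zb el[OF bv(2)] by metis
      finally show ?thesis using s' 2 lt_simps(2)[OF K] by simp
    qed
  next
    case s': (2 a u)
    show ?thesis using A(1,3)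
    proof (cases rule: trm_cases)
      case (1 k)
      then show ?thesis using DD[of a u "mut k"] s t s' lt_simps(3)[OF K] by simp
    next
      case (2 b v)
      have "linord (%r. r \<in> elts a | r \<in> elts b) (lt K)"
        by (rule linord_subset[OF Z]) (use s t s' 2 in \<open>auto simp: Dfield_iff\<close>)
      then show ?thesis using s' 2 lt_simps(4)[OF K] by simp
    qed
  qed
qed

text \<open>The terms \<open>mut m\<close> belong to every stage because \<open>dec (mut m)\<close>
  has \<open>mut m\<close> itself as an element, so that codes do not decrease there.\<close>

definition tmk :: "(N => bool) => N => N => bool" where
  "tmk A k t <-> trm A t & (t < k | (EX m. t = mut m))"

lemma dfm_tmk: "dp1 A ==> dtm k ==> dtm t ==> dfm (%e. tmk A (k e) (t e))"
  by (rule dfm_sub2[of "tmk A"]) (unfold tmk_def, intro dfm_intros dfm_trm)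

lemma Dfield_dec_tmk: "dp1 A ==> tmk A (k + 1) t ==> Dfield T (tmk A k) (dec t)"
  by (rule Dfield_dec[of A])
     (auto simp: tmk_def trm_xit dest: less_xit intro: less_le_trans)

text \<open>By \<open>dec\<close>, stage \<open>k + 1\<close> is embedded into \<open>D\<close> of
  stage \<open>k\<close>, which is linear by \<open>D_linord\<close>. Stage 0 is a copy of
  \<open>A\<close>.\<close>

lemma lt_linord:
  assumes A: "dp1 A" and K: "dp2 K" "linord A K"
  shows "linord (trm A) (lt K)"
proof -
  note L = dp2_lt[OF K(1)]
  have *: "linord (tmk A k) (lt K)" for k
  proof (induction k rule: N_induct)
    case dfm show ?case unfolding linord_def by (intro dfm_intros dfm_tmk A dfm_lt K)
  next
    case 0
    have 0: "EX m. t = mut m & A m" if "tmk A 0 t" for t using that A by (auto simp: tmk_def)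
    note lts = lt_simps(1)[OF K(1)]
    show ?case
    proof (rule linordI)
      fix x y assume "tmk A 0 x" "tmk A 0 y"
      then obtain m k where "x = mut m" "A m" "y = mut k" "A k" using 0 by blast
      then show "lt K x y | x = y | lt K y x" using lts linordD(3)[OF K(2), of m k] by blast
    next
      fix x assume "tmk A 0 x"
      then obtain m where "x = mut m" "A m" using 0 by blast
      then show "~ lt K x x" using lts linordD(1)[OF K(2)] by blast
    next
      fix x y z assume xyz: "tmk A 0 x" "tmk A 0 y" "tmk A 0 z" and l: "lt K x y" "lt K y z"
      obtain m k n where "x = mut m" "A m" "y = mut k" "A k" "z = mut n" "A n" using 0 xyz by metis
      then show "lt K x z" using l lts linordD(2)[OF K(2), of m k n] by simp
    qed
  next
    case (Suc k)
    have eq: "lt K s t <-> Dless T (lt K) (dec s) (dec t)" if "tmk A (k + 1) s" "tmk A (k + 1) t" for s t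
      using lt_dec[OF A _ _ K(1) Suc Dfield_dec_tmk[OF A that(1)] Dfield_dec_tmk[OF A that(2)]] that
      unfolding tmk_def by blast
    note D = linordD[OF D_linord[OF L Suc]]
    show ?case
    proof (rule linordI)
      fix s t assume st: "tmk A (k + 1) s" "tmk A (k + 1) t"
      show "lt K s t | s = t | lt K t s"
        using D(3)[OF Dfield_dec_tmk[OF A st(1)] Dfield_dec_tmk[OF A st(2)]] eq st dec_inj[OF A, of s t]
        unfolding tmk_def by blast
    next
      fix s assume "tmk A (k + 1) s"
      then show "~ lt K s s" using D(1) Dfield_dec_tmk[OF A] eq by blast
    next
      fix s t r assume "tmk A (k + 1) s" "tmk A (k + 1) t" "tmk A (k + 1) r" "lt K s t" "lt K t r"
      then show "lt K s r" using D(2) Dfield_dec_tmk[OF A] eq by meson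
    qed
  qed
  have k: "EX k. tmk A k s & tmk A k t & tmk A k r" if "trm A s" "trm A t" "trm A r" for s t r
    using that by (intro exI[of _ "max s (max t r) + 1"]) (auto simp: tmk_def le_max_iff_disj)
  show ?thesis
  proof (rule linordI)
    fix x y assume "trm A x" "trm A y"
    then show "lt K x y | x = y | lt K y x" using k[of x y y] linordD(3)[OF *] by blast
  next
    fix x assume "trm A x" then show "~ lt K x x" using k[of x x x] linordD(1)[OF *] by blast
  next
    fix x y z assume "trm A x" "trm A y" "trm A z" "lt K x y" "lt K y z"
    then show "lt K x z" using k[of x y z] linordD(2)[OF *] by blast
  qed
qed

lemma lt_iff_dec:
  assumes A: "dp1 A" and K: "dp2 K" "linord A K" and st: "trm A s" "trm A t"
  shows "lt K s t <-> Dless T (lt K) (dec s) (dec t)"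
  using st A
  by (intro lt_dec[OF A st K(1) lt_linord[OF A K]] Dfield_dec) (auto simp: trm_xit)

lemma xi_dec: assumes A: "dp1 A" and t: "trm A t" shows "xi (dec t) = t"
  using A t
proof (cases rule: trm_cases)
  case (2 a s)
  have "pr a s ~= Dmu (mut m)" for m
    using 2 pr_eq_Dmu[of a s "mut m"] trm_mut[OF A, of m] by (metis insertI1)
  then show ?thesis using 2 xi_pr[of a s] by auto
qed simp

lemma dec_xi:
  assumes A: "dp1 A" and p: "Dfield T (trm A) p" shows "dec (xi p) = p" "trm A (xi p)"
proof -
  obtain a s where as: "p = pr a s" "FinSet a" "ALL r:elts a. trm A r" "full a s" using p unfolding Dfield_iff by blast
  show "dec (xi p) = p"
    by (cases "EX m. p = Dmu (mut m)") (auto simp: as(1) xi_pr)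
  show "trm A (xi p)"
  proof (cases "EX m. p = Dmu (mut m)")
    case True
    then obtain m where m: "p = Dmu (mut m)" by blast
    then have "mut m \<in> elts a" using as pr_eq_Dmu[OF as(2)] by auto
    then show ?thesis using m as(3) by simp
  next
    case False
    then show ?thesis using as A by (auto simp: xi_pr trm_xit pr_eq_Dmu)
  qed
qed

end

lemma dp1_below [simp]: "dp1 (%m. m < n)"
  by (intro dfm_intros)

lemma df1_fapp [simp]: "df1 (fapp f)"
  by (intro dfm_intros)

lemma smor_app: "smor f k l ==> i < k ==> pr i j \<in> elts f <-> fapp f i = j"
  using mmap_fapp(2)[of f k l] pr_in_gr[OF df1_fapp, of i j k f] by auto

definition mono_on_ord :: "(N => bool) => (N => N => bool) => (N => bool) => (N => N => bool) => (N => N) => bool" where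
  "mono_on_ord A K B L f <-> dp1 A & dp2 K & linord A K & dp1 B & dp2 L & linord B L & df1 f
    & (ALL x. A x --> B (f x)) & (ALL x y. A x --> A y --> K x y --> L (f x) (f y))"

lemma mono_on_ord_inj: "mono_on_ord A K B L f ==> A x ==> A y ==> f x = f y ==> x = y"
proof -
  assume m: "mono_on_ord A K B L f" and xy: "A x" "A y" "f x = f y"
  have K: "linord A K" and L: "linord B L" and B: "B (f x)"
    and fm: "!!x y. A x ==> A y ==> K x y ==> L (f x) (f y)"
    using m xy(1) unfolding mono_on_ord_def by blast+
  show "x = y" using linordD(3)[OF K xy(1,2)] fm xy linordD(1)[OF L B] by metis
qed

lemma mono_on_ord_mmap: "mmap f k l ==> mono_on_ord (%m. m < k) (<) (%m. m < l) (<) f"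
  unfolding mono_on_ord_def using mmapD by (simp add: dfm_less2)

lemma mono_on_ord_smor: "smor f k l ==> mono_on_ord (%m. m < k) (<) (%m. m < l) (<) (fapp f)"
  by (rule mono_on_ord_mmap) (rule mmap_fapp)

lemma isc_singleton: "isc a (%r. r = x) <-> FinSet a & elts a = {x}"
  unfolding isc_iff by auto

lemma isc_code: "coded_set A ==> isc c (%x. x \<in> A) <-> c = code A"
  unfolding isc_iff using FinSet_eqI[of c "code A"] by auto

section \<open>Normal prae-dilators given by functors on all linear orders\<close>

text \<open>\<open>E A L\<close> and \<open>lc L\<close> are the field and the order over
  \<open>(A, L)\<close>, \<open>rn f\<close> is the action of \<open>f\<close>, \<open>sp\<close>
  the code of the support, and \<open>mc\<close> the family of values of \<mu>; the last three do
  not depend on the order. Both \<open>\<partial>T\<close> and the dilator of approximations are of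
  this kind.\<close>

locale concrete =
  fixes E :: "(N => bool) => (N => N => bool) => N => bool" and lc :: "(N => N => bool) => N => N => bool"
    and rn :: "(N => N) => N => N" and sp :: "N => N" and mc :: "N => N"
  assumes dfm_E: "!!n t. dtm n ==> dtm t ==> dfm (%e. E (%i. i < n e) (<) (t e))"
    and dfm_lc: "!!s t. dp2 L ==> dtm s ==> dtm t ==> dfm (%e. lc L (s e) (t e))"
    and dtm_rnc: "!!f t. dtm (%e. f (e 0) (%i. e (Suc i))) ==> dtm t ==> dtm (%e. rn (%m. f m e) (t e))"
    and df1_sp: "df1 sp" and df1_mc: "df1 mc"
    and lin_E: "dp1 A ==> dp2 L ==> linord A L ==> linord (E A L) (lc L)"
    and rn_E: "mono_on_ord A K B L f ==> E A K t ==> E B L (rn f t)"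
    and rn_less: "mono_on_ord A K B L f ==> E A K s ==> E A K t ==> lc K s t ==> lc L (rn f s) (rn f t)"
    and rn_cong: "dp1 A ==> E A L t ==> df1 f ==> df1 g ==> (!!i. i \<in> elts (sp t) ==> f i = g i) ==> rn f t = rn g t"
    and rn_id: "dp1 A ==> E A L t ==> df1 f ==> (!!i. A i ==> f i = i) ==> rn f t = t"
    and rn_comp: "dp1 A ==> E A L t ==> df1 f ==> df1 g ==> rn g (rn f t) = rn (%i. g (f i)) t"
    and sp_rn: "dp1 A ==> E A L t ==> df1 f ==> elts (sp (rn f t)) = f ` elts (sp t)"
    and sp_E: "dp1 A ==> E A L t ==> FinSet (sp t)" "dp1 A ==> E A L t ==> i \<in> elts (sp t) ==> A i"
      "dp1 A ==> E A L t ==> E (%i. i \<in> elts (sp t)) L t"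
    and mc: "dp1 A ==> A m ==> E A L (mc m)" "df1 f ==> rn f (mc m) = mc (f m)" "elts (sp (mc m)) = {m}"
    and less_mc: "dp1 A ==> dp2 L ==> linord A L ==> E A L t ==> A m ==> lc L t (mc m) <-> (ALL i:elts (sp t). L i m)"
begin

definition FD :: sdil where
  "FD = \<lparr>Fld = %n. E (%m. m < n) (<), Lss = %n. lc (<), Act = %n l f s t. t = rn (fapp f) s,
     Spp = %n s a. a = sp s, Mu = %n m s. s = mc m\<rparr>"

lemma FD_simps [simp]: "Act FD n l f = (%s t. t = rn (fapp f) s)" "Fld FD n = E (%m. m < n) (<)" "Lss FD n = lc (<)"
  "Spp FD n s a <-> a = sp s" "Mu FD n m s <-> s = mc m"
  by (simp_all add: FD_def)

lemma defdil_FD: "defdil FD"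
  unfolding defdil_def FD_simps
  by (intro conjI allI impI)
     (intro dfm_E dfm_lc dfm_less2 dfm_intros dtm_rnc dtm_sub1[OF df1_sp] dtm_sub1[OF df1_mc]; (rule dtm_ren)?; assumption)+

lemma snpd_FD: "snpd FD"
  unfolding snpd_def sprae_def sfunctor_def FD_simps
proof (intro conjI allI impI)
  show "linord (E (%m. m < n) (<)) (lc (<))" for n by (rule lin_E[OF dp1_below dfm_less2 linord_less])
next
  fix n l f s assume *: "smor f n l & E (%m. m < n) (<) s"
  then show "EX t. t = rn (fapp f) s & E (%m. m < l) (<) t" using rn_E[OF mono_on_ord_smor] by blast
next
  fix n l f s s' t t'
  assume "smor f n l & E (%m. m < n) (<) s & E (%m. m < n) (<) s' & t = rn (fapp f) s & t' = rn (fapp f) s' & lc (<) s s'"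
  then show "lc (<) t t'" using rn_less[OF mono_on_ord_smor] by blast
next
  fix n f s assume *: "smor f n n & (ALL i<n. pr i i \<in> elts f) & E (%m. m < n) (<) s"
  then have "fapp f i = i" if "i < n" for i using that smor_app by blast
  then show "s = rn (fapp f) s" using rn_id[OF dp1_below, of n "(<)" s "fapp f"] * by simp
next
  fix n l k f g h s t r
  assume *: "smor f n l & smor g l k & smor h n k & (ALL i j j'. pr i j \<in> elts f & pr j j' \<in> elts g --> pr i j' \<in> elts h)
    & E (%m. m < n) (<) s & t = rn (fapp f) s & r = rn (fapp g) t"
  have eq: "fapp h i = fapp g (fapp f i)" if "i < n" for i
  proof -
    have "pr i (fapp f i) \<in> elts f" using * that smor_app[of f n l i] by blast
    moreover have "fapp f i < l" using * that mmapD(1)[OF mmap_fapp(1)] by blast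
    then have "pr (fapp f i) (fapp g (fapp f i)) \<in> elts g" using * smor_app[of g l k] by blast
    ultimately have "pr i (fapp g (fapp f i)) \<in> elts h" using * by blast
    then show ?thesis using * that smor_app[of h n k i] by blast
  qed
  have s: "E (%m. m < n) (<) s" using * by blast
  have "r = rn (%i. fapp g (fapp f i)) s" using * rn_comp[OF dp1_below s df1_fapp df1_fapp] by simp
  also have "\<dots> = rn (fapp h) s"
    by (rule rn_cong[OF dp1_below s]) (use sp_E(2)[OF dp1_below s] eq in \<open>auto simp: dfm_intros\<close>)
  finally show "r = rn (fapp h) s" .
next
  fix n s assume *: "E (%m. m < n) (<) s"
  show "EX a. a = sp s & finsub a (%i. i < n)"
    unfolding finsub_def using sp_E(1,2)[OF dp1_below *] by auto
next
  fix n l f s t a b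
  assume *: "smor f n l & E (%m. m < n) (<) s & t = rn (fapp f) s & a = sp s & b = sp t"
  have t: "E (%m. m < l) (<) t" using * rn_E[OF mono_on_ord_smor] by blast
  have "elts b = fapp f ` elts a" using * sp_rn[OF dp1_below] df1_fapp by blast
  moreover have "ALL i:elts a. i < n" using * sp_E(2)[OF dp1_below] by blast
  ultimately show "imf (%i j. pr i j \<in> elts f) a b"
    unfolding imf_def isc_iff using sp_E(1)[OF dp1_below t] * smor_app[of f n l] by auto
next
  \<comment> \<open>The required preimage of \<open>s\<close> is its renaming by the index function
    of its support.\<close>
  fix n s a k e assume *: "E (%m. m < n) (<) s & a = sp s & enum (<) a k e"
  then have k: "k = crd a" "e = en (<) a" using enum_iff[OF flin_less] by blast+
  have s: "E (%i. i \<in> elts a) (<) s" using sp_E(3)[OF dp1_below] * by blast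
  have dA: "dp1 (%i. i \<in> elts a)" by (intro dfm_intros)
  have di: "df1 (idx (<) a)" by (intro dtm_idx dfm_less2 dfm_intros)
  have "mono_on_ord (%i. i \<in> elts a) (<) (%i. i < k) (<) (idx (<) a)"
    unfolding mono_on_ord_def using idx(1)[OF flin_less] idx_less_iff[OF flin_less] k dA di by (simp add: dfm_less2)
  then have "E (%i. i < k) (<) (rn (idx (<) a) s)" using rn_E s by blast
  moreover have "rn (fapp e) (rn (idx (<) a) s) = s"
    unfolding rn_comp[OF dA s di df1_fapp]
  proof (rule rn_id[OF dA s])
    show "df1 (%i. fapp e (idx (<) a i))" by (intro dfm_intros di)
    show "fapp e (idx (<) a i) = i" if "i \<in> elts a" for i using idx(2)[OF flin_less that] k by (simp add: enf_def)
  qed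
  ultimately show "EX t. E (%m. m < k) (<) t & s = rn (fapp e) t" by metis
next
  fix n m :: N assume "m < n"
  then show "EX s. s = mc m & E (%m. m < n) (<) s" using mc(1)[OF dp1_below] by blast
next
  fix n m m' s s' assume *: "m < m' & m' < n & s = mc m & s' = mc m'"
  then have "E (%m. m < n) (<) (mc m)" using mc(1)[OF dp1_below, of m n] less_trans by blast
  then show "lc (<) s s'" using less_mc[OF dp1_below dfm_less2 linord_less, of n "mc m" m'] * mc(3) by simp
next
  fix n l f m m' s t assume *: "smor f n l & pr m m' \<in> elts f & s = mc m & t = mc m'"
  then have "m < n" unfolding smor_def finsub_def by auto
  then show "t = rn (fapp f) s" using * smor_app[of f n l m m'] mc(2)[OF df1_fapp] by auto
next
  fix n m t s a assume "m < n & t = mc m & E (%m. m < n) (<) s & a = sp s"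
  then show "lc (<) s t <-> (ALL i. i \<in> elts a --> i < m)" using less_mc[OF dp1_below dfm_less2 linord_less, of n s m] by auto
qed auto

lemma npdil_FD: "npdil FD"
  using snpd_FD defdil_FD by unfold_locales

end

text \<open>For a functor defined on all linear orders \<open>E\<close>, the linear order \<open>D(A)\<close> is isomorphic to \<open>E(A)\<close>.\<close>

context concrete
begin

interpretation F: npdil FD by (rule npdil_FD)

definition toE :: "(N => N => bool) => N => N" where
  "toE L p = the0 (%t. EX a s. p = pr a s & t = rn (enf L a) s)"

definition toD :: "(N => N => bool) => N => N" where
  "toD L t = pr (sp t) (rn (idx L (sp t)) t)"

context
  fixes A L assumes A: "dp1 A" and L: "dp2 L" and lin: "linord A L"
begin

lemma toE_pr: "toE L (pr a s) = rn (enf L a) s"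
  unfolding toE_def by (intro the0_equality) auto

lemma df1_toE: "df1 (toE L)"
proof -
  have "dtm a ==> dtm s ==> dtm (%e. rn (enf L (a e)) (s e))" for a s
    using dtm_rnc[of "%m e. enf L (a e) m" s] by (simp add: dtm_enf[OF L] dtm_ren dfm_intros)
  from this[OF dtm_var dtm_var] show ?thesis unfolding toE_def by (intro dfm_intros)
qed

lemma dtm_toD: "dtm t ==> dtm (%e. toD L (t e))"
proof (rule dtm_sub1[of "toD L"])
  have "dtm a ==> dtm s ==> dtm (%e. rn (idx L (a e)) (s e))" for a s
    using dtm_rnc[of "%m e. idx L (a e) m" s] by (simp add: dtm_idx[OF L] dtm_ren dfm_intros)
  from this[OF df1_sp dtm_var] show "df1 (toD L)" unfolding toD_def by (intro dfm_intros df1_sp)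
qed

lemma fl: "(!!x. x \<in> elts a ==> A x) ==> flin L a" by (rule F.flinI[OF L lin])

lemma df1_enf: "df1 (enf L a)" and df1_idx: "df1 (idx L a)"
  by (intro dtm_enf[OF L] dtm_idx[OF L] dfm_intros)+

lemma mono_enf: "(!!x. x \<in> elts a ==> A x) ==> mono_on_ord (%i. i < crd a) (<) A L (enf L a)"
  unfolding mono_on_ord_def using A L lin df1_enf enf(1)[OF fl] enf_less_iff[OF fl] by (simp add: dfm_less2)

text \<open>\<open>F.J\<close> is renaming by \<open>inc\<close>, and composing \<open>inc\<close>
  with the enumeration of \<open>c\<close> gives that of \<open>d\<close>.\<close>

lemma J_eq:
  assumes c: "!!x. x \<in> elts c ==> A x" and d: "elts d \<subseteq> elts c" and r: "E (%i. i < crd d) (<) r"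
  shows "E (%i. i < crd c) (<) (F.J L d c r)" "rn (enf L c) (F.J L d c r) = rn (enf L d) r"
proof -
  have flc: "flin L c" by (rule fl) (rule c)
  note m = mmap_inc[OF flc d]
  note di = mmapD(3)[OF m]
  have "F.J L d c r = rn (fapp (gr (crd d) (inc L d c))) r"
    unfolding F.J_def F.act_def FD_simps by (rule the0_equality) auto
  also have "\<dots> = rn (inc L d c) r"
    by (rule rn_cong[OF dp1_below r df1_fapp di]) (use sp_E(2)[OF dp1_below[of "crd d"] r] fapp_gr[OF di] in blast)
  finally have J: "F.J L d c r = rn (inc L d c) r" .
  show "E (%i. i < crd c) (<) (F.J L d c r)" unfolding J by (rule rn_E[OF mono_on_ord_mmap[OF m] r])
  show "rn (enf L c) (F.J L d c r) = rn (enf L d) r"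
    unfolding J rn_comp[OF dp1_below[of "crd d"] r di df1_enf]
    by (rule rn_cong[OF dp1_below r dtm_sub1[OF df1_enf di] df1_enf])
       (use sp_E(2)[OF dp1_below[of "crd d"] r] enf_inc[OF flc d] in blast)
qed

lemma toE:
  assumes "Dfield FD A p" shows "E A L (toE L p)"
proof -
  obtain a s where p: "p = pr a s" "ALL x:elts a. A x" "F.full a s" using assms unfolding F.Dfield_iff by blast
  then show ?thesis using rn_E[OF mono_enf[of a]] toE_pr by (auto simp: F.full_def)
qed

lemma toE_less:
  assumes pq: "Dfield FD A p" "Dfield FD A q" and l: "Dless FD L p q" shows "lc L (toE L p) (toE L q)"
proof -
  obtain a s where p: "p = pr a s" "ALL x:elts a. A x" "F.full a s" using pq(1) unfolding F.Dfield_iff by blast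
  obtain b t where q: "q = pr b t" "ALL x:elts b. A x" "F.full b t" using pq(2) unfolding F.Dfield_iff by blast
  define c where "c = code (elts a \<union> elts b)"
  have c: "elts c = elts a \<union> elts b" unfolding c_def by (simp add: coded_set_Un)
  have cA: "!!x. x \<in> elts c ==> A x" using p q c by auto
  have st: "E (%i. i < crd a) (<) s" "E (%i. i < crd b) (<) t" using p(3) q(3) by (simp_all add: F.full_def)
  have ab: "elts a \<subseteq> elts c" "elts b \<subseteq> elts c" using c by auto
  note Ja = J_eq[OF cA ab(1) st(1)] and Jb = J_eq[OF cA ab(2) st(2)]
  have "lc (<) (F.J L a c s) (F.J L b c t)"
    using F.Dless_iff[OF fl[OF cA] ab, of s t] l st p(1) q(1) by simp
  then show ?thesis
    using rn_less[OF mono_enf[of c, OF cA] Ja(1) Jb(1)] Ja(2) Jb(2) p(1) q(1) toE_pr by metis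
qed

lemma toD:
  assumes t: "E A L t" shows "Dfield FD A (toD L t)" "toE L (toD L t) = t"
proof -
  note a = sp_E(1,2)[OF A t] and flt = fl[OF sp_E(2)[OF A t]]
  have dA: "dp1 (%i. i \<in> elts (sp t))" by (intro dfm_intros)
  have t': "E (%i. i \<in> elts (sp t)) L t" by (rule sp_E(3)[OF A t])
  have "mono_on_ord (%i. i \<in> elts (sp t)) L (%i. i < crd (sp t)) (<) (idx L (sp t))"
    unfolding mono_on_ord_def using idx(1)[OF flt] idx_less_iff[OF flt] dA L df1_idx flt by (simp add: dfm_less2 flin_def)
  then have f: "E (%i. i < crd (sp t)) (<) (rn (idx L (sp t)) t)" using rn_E t' by blast
  have "F.supp (crd (sp t)) (rn (idx L (sp t)) t) = elts (sp (rn (idx L (sp t)) t))"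
    unfolding F.supp_def FD_simps by (rule arg_cong[of _ _ elts], rule the0_equality) auto
  also have "\<dots> = idx L (sp t) ` elts (sp t)" by (rule sp_rn[OF A t df1_idx])
  also have "\<dots> = {i. i < crd (sp t)}" using idx(1)[OF flt] enf(1)[OF flt] idx_enf[OF flt] by (auto simp: image_iff) metis
  finally have "F.full (sp t) (rn (idx L (sp t)) t)" using f unfolding F.full_def by simp
  then show "Dfield FD A (toD L t)" unfolding toD_def F.Dfield_iff using a by auto
  have "toE L (toD L t) = rn (%i. enf L (sp t) (idx L (sp t) i)) t"
    unfolding toD_def toE_pr by (rule rn_comp[OF A t df1_idx df1_enf])
  also have "\<dots> = rn (%i. i) t"
    by (rule rn_cong[OF A t dtm_sub1[OF df1_enf df1_idx]]) (use idx(2)[OF flt] in \<open>auto simp: dfm_intros\<close>)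
  also have "\<dots> = t" by (rule rn_id[OF A t]) (auto simp: dfm_intros)
  finally show "toE L (toD L t) = t" .
qed

text \<open>By linearity, since \<open>toE\<close> is increasing and undoes
  \<open>toD\<close>.\<close>

lemma toD_less: assumes st: "E A L s" "E A L t" and l: "lc L s t" shows "Dless FD L (toD L s) (toD L t)"
proof -
  have D: "Dless FD L (toD L s) (toD L t) | toD L s = toD L t | Dless FD L (toD L t) (toD L s)"
    by (rule linordD(3)[OF F.D_linord[OF L lin]]) (rule toD(1)[OF st(1)] toD(1)[OF st(2)])+
  have "~ lc L s s" "~ lc L t s" using linordD(1,2)[OF lin_E[OF A L lin]] st l by blast+
  then show ?thesis
    using D l toE_less[OF toD(1)[OF st(2)] toD(1)[OF st(1)]] toD(2)[OF st(1)] toD(2)[OF st(2)] by metis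
qed

lemma toD_mc: assumes m: "A m" shows "toD L (mc m) = F.Dmu m"
proof -
  have mA: "E A L (mc m)" by (rule mc(1)[OF A m])
  have c: "sp (mc m) = code {m}" by (rule FinSet_eqI) (use sp_E(1)[OF A mA] mc(3) in auto)
  have flm: "flin L (code {m})" by (rule fl) (use m in simp)
  have "idx L (code {m}) m = 0" using idx(1)[OF flm, of m] F.crd_singleton less_Suc[of _ 0] by simp
  moreover have "F.mu 1 0 = mc 0" unfolding F.mu_def FD_simps by (rule the0_equality) auto
  ultimately show ?thesis unfolding toD_def F.Dmu_def c mc(2)[OF df1_idx] by simp
qed

end

lemma spwf_FD:
  assumes w: "!!A L. dp1 A ==> dp2 L ==> linord A L ==> mwf A L ==> mwf (E A L) (lc L)" shows "spwf FD"
  unfolding spwf_def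
proof (intro ballI impI)
  fix X R assume XR: "X \<in> SS" "R \<in> SS" "wellord X R"
  let ?A = "%x. x \<in> X" and ?L = "%x y. pr x y \<in> R"
  have A: "dp1 ?A" by (intro dfm_mem[OF XR(1)] dfm_intros)
  have L: "dp2 ?L" by (intro dfm_mem[OF XR(2)] dfm_intros)
  have lin: "linord ?A ?L" and wf: "mwf ?A ?L" using XR(3) wellf_iff_mwf[OF L] unfolding wellord_def by blast+
  have "mwf (Dfield FD ?A) (Dless FD ?L)"
    by (rule mwf_embed[OF w[OF A L lin wf] df1_toE[OF A L lin]]) (rule toE[OF A L lin] toE_less[OF A L lin]; assumption)+
  then show "Dwf FD X R" unfolding Dwf_def using wellf_iff_mwf[of "Dless FD ?L"] F.dfm_Dless[OF L] by (simp add: dfm_intros)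
qed

end

context npdil
begin

section \<open>Renaming and support of terms\<close>

definition renH :: "(N => N) => N => N => N" where
  "renH f t g = the0 (%y. (EX m. t = mut m & y = mut (f m)) |
    (EX a u. t = xit a u & y = xit (code {z. EX r. r \<in> elts a & z = fapp g r}) u))"

definition ren :: "(N => N) => N => N" where
  "ren f = recur (renH f)"

definition tspH :: "N => N => N" where
  "tspH t g = the0 (%y. (EX m. t = mut m & y = code {i. i = m}) |
    (EX a u. t = xit a u & y = code {i. EX r. r \<in> elts a & i \<in> elts (fapp g r)}))"

definition tsp :: "N => N" where
  "tsp = recur tspH"

lemma renH_simps: "renH f (mut m) g = mut (f m)" "renH f (xit a u) g = xit (code {z. EX r. r \<in> elts a & z = fapp g r}) u"
  unfolding renH_def by (rule the0_equality; auto)+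

lemma tspH_simps: "tspH (mut m) g = code {m}" "tspH (xit a u) g = code {i. EX r. r \<in> elts a & i \<in> elts (fapp g r)}"
  unfolding tspH_def by (rule the0_equality; auto)+

lemma dtm_renH:
  assumes f: "dtm (%e. f (e 0) (%i. e (Suc i)))" and t: "dtm t" and g: "dtm g"
  shows "dtm (%e. renH (%m. f m e) (t e) (g e))"
proof -
  have f': "dtm (%e. f (e 0) (%i. e (Suc (h i))))" for h
    using dtm_ren[OF f, of "%i. if i = 0 then 0 else Suc (h (i - 1))"] by simp
  show ?thesis unfolding renH_def by (intro dfm_intros f' dtm_ren[OF t] dtm_ren[OF g])
qed

lemma dtm_ren_ctx:
  assumes f: "dtm (%e. f (e 0) (%i. e (Suc i)))" and t: "dtm t"
  shows "dtm (%e. ren (%m. f m e) (t e))"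
proof -
  have f': "dtm (%e. f (e 0) (%i. e (Suc (Suc (Suc i)))))"
    using dtm_ren[OF f, of "%i. if i = 0 then 0 else Suc (Suc i)"] by simp
  show ?thesis
    unfolding ren_def
    by (rule dtm_recur[of "%t g e. renH (%m. f m e) t g", OF _ t])
       (rule dtm_renH[of "%m e. f m (%i. e (Suc (Suc i)))", OF f']; intro dfm_intros)
qed

lemma dtm_rn: "df1 f ==> dtm t ==> dtm (%e. ren f (t e))"
  using dtm_ren_ctx[of "%m e. f m"] by simp

lemma df2_tspH: "dtm (%e. tspH (e 0) (e (Suc 0)))"
  unfolding tspH_def by (intro dfm_intros)

lemma dtm_tsp [dfm_intros]: "dtm t ==> dtm (%e. tsp (t e))"
  unfolding tsp_def by (intro dfm_intros df2_tspH)

lemma ren_simps: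
  assumes f: "df1 f"
  shows "ren f (mut m) = mut (f m)" "ren f (xit a u) = xit (code (ren f ` elts a)) u"
proof -
  have H: "dtm (%e. renH f (e 0) (e (Suc 0)))"
    using dtm_renH[of "%m e. f m"] f by (simp add: dfm_intros)
  note eq = recur_eq[OF H, folded ren_def]
  show "ren f (mut m) = mut (f m)" using eq[of "mut m"] by (simp add: renH_simps)
  have "fapp (gr (xit a u) (ren f)) r = ren f r" if "r \<in> elts a" for r
    by (rule fapp_gr[OF dtm_rn[OF f dtm_var] less_xit[OF that]])
  then have "{z. EX r. r \<in> elts a & z = fapp (gr (xit a u) (ren f)) r} = ren f ` elts a" by auto
  then show "ren f (xit a u) = xit (code (ren f ` elts a)) u" using eq[of "xit a u"] by (simp add: renH_simps)
qed

lemma coded_ren [simp]: "df1 f ==> coded_set (ren f ` elts a)"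
  by (rule coded_set_image) (auto intro: dtm_rn dfm_intros)

lemma tsp_simps: "tsp (mut m) = code {m}" "tsp (xit a u) = code (\<Union>r\<in>elts a. elts (tsp r))"
proof -
  note eq = recur_eq[OF df2_tspH, folded tsp_def]
  show "tsp (mut m) = code {m}" using eq[of "mut m"] by (simp add: tspH_simps)
  have "fapp (gr (xit a u) tsp) r = tsp r" if "r \<in> elts a" for r
    by (rule fapp_gr[OF dtm_tsp[OF dtm_var] less_xit[OF that]])
  then have "{i. EX r. r \<in> elts a & i \<in> elts (fapp (gr (xit a u) tsp) r)} = (\<Union>r\<in>elts a. elts (tsp r))" by auto
  then show "tsp (xit a u) = code (\<Union>r\<in>elts a. elts (tsp r))" using eq[of "xit a u"] by (simp add: tspH_simps)
qed

lemma coded_tsp_UN: "coded_set (\<Union>r\<in>elts a. elts (tsp r))"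
  by (rule coded_set_UN) (auto intro: dfm_intros)

lemma elts_tsp [simp]: "elts (tsp (mut m)) = {m}" "elts (tsp (xit a u)) = (\<Union>r\<in>elts a. elts (tsp r))"
  unfolding tsp_simps using coded_tsp_UN by simp_all

lemma FinSet_tsp: "dp1 A ==> trm A t ==> FinSet (tsp t)"
  by (erule (1) trm_cases) (auto simp: tsp_simps coded_tsp_UN)

lemma trm_tsp: assumes A: "dp1 A" and t: "trm A t" shows "ALL i:elts (tsp t). A i"
  using A t
proof (induction t rule: trm_induct)
  case dfm
  show ?case by (intro dfm_intros dfm_sub1[OF A])
qed auto

lemma trm_transfer:
  assumes A: "dp1 A" and B: "dp1 B" and t: "trm A t"
  shows "(ALL i:elts (tsp t). B i) --> trm B t"
  using A t
proof (induction t rule: trm_induct)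
  case dfm show ?case by (intro dfm_intros dfm_sub1[OF B] dfm_trm B)
next
  case (mut m) then show ?case using B by simp
next
  case (xit a s)
  \<comment> \<open>Hence a term of the excluded form over \<open>B\<close> would be of the excluded
    form over \<open>A\<close> as well.\<close>
  have "A m" if "elts a = {mut m}" for m
  proof -
    have "trm A (mut m)" using xit that by blast
    then show ?thesis using A by simp
  qed
  then show ?case using xit B by (auto simp: trm_xit)
qed

lemma ren_cong:
  assumes A: "dp1 A" and f: "df1 f" "df1 g" and t: "trm A t"
  shows "(ALL i:elts (tsp t). f i = g i) --> ren f t = ren g t"
  using A t
proof (induction t rule: trm_induct)
  case dfm show ?case by (intro dfm_intros dtm_rn f dtm_sub1[OF f(1)] dtm_sub1[OF f(2)])
next
  case (mut m) then show ?case using f by (simp add: ren_simps)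
next
  case (xit a s)
  show ?case
  proof
    assume "ALL i:elts (tsp (xit a s)). f i = g i"
    then have e: "ALL i:elts (tsp r). f i = g i" if "r \<in> elts a" for r using that by auto
    have "ren f r = ren g r" if "r \<in> elts a" for r using xit e[OF that] that by blast
    then have "ren f ` elts a = ren g ` elts a" by (intro image_cong) auto
    then show "ren f (xit a s) = ren g (xit a s)" using f by (simp add: ren_simps)
  qed
qed

lemma ren_id:
  assumes A: "dp1 A" and f: "df1 f" "!!i. A i ==> f i = i" and t: "trm A t"
  shows "ren f t = t"
  using A t
proof (induction t rule: trm_induct)
  case dfm show ?case by (intro dfm_intros dtm_rn f)
next
  case (mut m) then show ?case using f by (simp add: ren_simps)
next
  case (xit a s)
  then have "ren f ` elts a = elts a" by force
  moreover have "FinSet a" using xit by blast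
  ultimately show ?case using f by (simp add: ren_simps)
qed

lemma ren_comp:
  assumes A: "dp1 A" and f: "df1 f" and g: "df1 g" and t: "trm A t"
  shows "ren g (ren f t) = ren (%i. g (f i)) t"
proof -
  have gf: "df1 (%i. g (f i))" by (rule dtm_sub1[OF g f])
  show ?thesis
    using A t
  proof (induction t rule: trm_induct)
    case dfm show ?case by (intro dfm_intros dtm_rn f g gf)
  next
    case (mut m) then show ?case using f g gf by (simp add: ren_simps)
  next
    case (xit a s)
    then have "ren g ` ren f ` elts a = ren (%i. g (f i)) ` elts a" by (force simp: image_image)
    then show ?case using f g gf by (simp add: ren_simps)
  qed
qed

lemma tsp_ren:
  assumes A: "dp1 A" and f: "df1 f" and t: "trm A t"
  shows "elts (tsp (ren f t)) = f ` elts (tsp t)"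
  using A t
proof (induction t rule: trm_induct)
  case dfm
  have eq: "X = f ` Y <-> (ALL x. x \<in> X <-> (EX y. y \<in> Y & x = f y))" for X Y by auto
  show ?case unfolding eq by (intro dfm_intros dtm_rn f dtm_sub1[OF f])
next
  case (mut m) then show ?case using f by (simp add: ren_simps)
next
  case (xit a s)
  then show ?case using f by (auto simp: ren_simps)
qed

lemma dec_ren:
  assumes "dp1 A" "df1 f" "trm A t" "dec t = pr a u"
  shows "dec (ren f t) = pr (code (ren f ` elts a)) u"
  using assms(1,3)
  by (cases rule: trm_cases) (use assms(2,4) in \<open>auto simp: ren_simps Dmu_def\<close>)

text \<open>Both claims depend on each other: renaming preserves full support only if it is
  injective on the elements of the term, and injectivity follows from the preservation of the order
  at the previous stage.\<close>

lemma ren_order: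
  assumes m: "mono_on_ord A K B L f"
  shows "trm A t ==> trm B (ren f t)" "trm A s ==> trm A t ==> lt K s t ==> lt L (ren f s) (ren f t)"
proof -
  have A: "dp1 A" "dp2 K" "linord A K" and B: "dp1 B" "dp2 L" "linord B L" and f: "df1 f"
    and fAB: "!!x. A x ==> B (f x)" and fm: "!!x y. A x ==> A y ==> K x y ==> L (f x) (f y)"
    using m unfolding mono_on_ord_def by blast+
  note lA = lt_linord[OF A] and lB = lt_linord[OF B] and dA = dp2_lt[OF A(2)] and dB = dp2_lt[OF B(2)]
  have *: "(ALL t. tmk A k t --> trm B (ren f t)) &
    (ALL s t. tmk A k s --> tmk A k t --> lt K s t --> lt L (ren f s) (ren f t))" for k
  proof (induction k rule: N_induct)
    case dfm show ?case by (intro dfm_intros dfm_tmk A dfm_trm B dtm_rn f dfm_lt)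
  next
    case 0
    have 0: "EX m. t = mut m & A m" if "tmk A 0 t" for t using that A by (auto simp: tmk_def)
    show ?case
    proof (intro conjI allI impI)
      fix s t assume "tmk A 0 s" "tmk A 0 t" and l: "lt K s t"
      then obtain m k where "s = mut m" "A m" "t = mut k" "A k" using 0 by metis
      then show "lt L (ren f s) (ren f t)" using l fm lt_simps(1)[OF A(2)] lt_simps(1)[OF B(2)] f by (simp add: ren_simps)
    next
      fix t assume "tmk A 0 t"
      then obtain m where "t = mut m" "A m" using 0 by metis
      then show "trm B (ren f t)" using fAB B f by (simp add: ren_simps)
    qed
  next
    case (Suc k)
    then have IH: "!!t. tmk A k t ==> trm B (ren f t)"
      "!!s t. tmk A k s ==> tmk A k t ==> lt K s t ==> lt L (ren f s) (ren f t)" by blast+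
    have tmkA: "tmk A k t ==> trm A t" for t by (simp add: tmk_def)
    have flA: "flin (lt K) a" if "!!r. r \<in> elts a ==> tmk A k r" for a
      by (rule flinI[OF dA lA]) (use that tmkA in blast)
    have flB: "flin (lt L) b" if "elts b = ren f ` elts a" "!!r. r \<in> elts a ==> tmk A k r" for a b
      by (rule flinI[OF dB lB]) (use that IH in auto)
    have t1: "trm B (ren f t)" if t: "tmk A (k + 1) t" for t
      using A(1) t[unfolded tmk_def, THEN conjunct1]
    proof (cases rule: trm_cases)
      case (1 m) then show ?thesis using f fAB B by (simp add: ren_simps)
    next
      case (2 a s)
      have a: "tmk A k r" if "r \<in> elts a" for r
        using t 2 that less_xit[OF that, of s] unfolding tmk_def by (auto intro: less_le_trans)
      let ?b = "code (ren f ` elts a)"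
      have b: "elts ?b = ren f ` elts a" using f by simp
      have "full ?b s"
        using full_image[OF flA[OF a] flB[OF b a] dtm_rn[OF f dtm_var] b IH(2)[OF a a]] 2(4) by blast
      \<comment> \<open>Only terms \<open>mut n\<close> are renamed to \<open>mut m\<close>, and
        since \<open>f\<close> is injective on \<open>A\<close>, there is at most one of them; so
        the excluded form could arise only from itself.\<close>
      moreover have "~ (B m & elts ?b = {mut m} & s = mu 1 0)" for m
      proof
        assume *: "B m & elts ?b = {mut m} & s = mu 1 0"
        have r: "EX n. r = mut n & A n & f n = m" if "r \<in> elts a" for r
        proof -
          have "ren f r = mut m" using * b that by auto
          then show ?thesis using A(1) 2(3)[OF that] f by (elim trm_cases) (auto simp: ren_simps)
        qed
        obtain r where "r \<in> elts a" using * b by auto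
        then obtain n where n: "mut n \<in> elts a" "A n" "f n = m" using r by blast
        have "elts a = {mut n}" using r n mono_on_ord_inj[OF m] by blast
        then show False using 2(5) n * by blast
      qed
      ultimately show ?thesis using f B(1) 2 IH(1)[OF a] b by (simp add: ren_simps trm_xit)
    qed
    have "lt L (ren f s) (ren f t)" if st: "tmk A (k + 1) s" "tmk A (k + 1) t" "lt K s t" for s t
    proof -
      have tr: "trm A s" "trm A t" using st unfolding tmk_def by blast+
      obtain a u where a: "dec s = pr a u" "ALL r:elts a. tmk A k r" "full a u"
        using Dfield_dec_tmk[OF A(1) st(1)] unfolding Dfield_iff by blast
      obtain b v where b: "dec t = pr b v" "ALL r:elts b. tmk A k r" "full b v"
        using Dfield_dec_tmk[OF A(1) st(2)] unfolding Dfield_iff by blast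
      define c where "c = code (elts a \<union> elts b)"
      have c: "elts c = elts a \<union> elts b" unfolding c_def by (simp add: coded_set_Un)
      have ck: "tmk A k r" if "r \<in> elts c" for r using that c a b by blast
      define d where "d = code (ren f ` elts c)"
      have d: "elts d = ren f ` elts c" unfolding d_def using f by simp
      have "Dless T (lt K) (pr a u) (pr b v)" using lt_iff_dec[OF A tr] st a b by simp
      then have "Dless T (lt L) (pr (code (ren f ` elts a)) u) (pr (code (ren f ` elts b)) v)"
        using Dless_image[OF flA[OF ck] flB[OF d ck] dtm_rn[OF f dtm_var] d IH(2)[OF ck ck], of a _ b _ u v] c f a b
        by (simp add: full_def)
      then show ?thesis
        using lt_iff_dec[OF B t1[OF st(1)] t1[OF st(2)]] dec_ren[OF A(1) f tr(1) a(1)] dec_ren[OF A(1) f tr(2) b(1)] by simp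
    qed
    then show ?case using t1 by blast
  qed
  show "trm A t ==> trm B (ren f t)" for t
    using *[of "t + 1"] by (auto simp: tmk_def)
  show "trm A s ==> trm A t ==> lt K s t ==> lt L (ren f s) (ren f t)"
    using *[of "max s t + 1"] by (auto simp: tmk_def le_max_iff_disj)
qed

lemma lt_mut_iff:
  assumes A: "dp1 A" and K: "dp2 K" and t: "trm A t"
  shows "lt K t (mut m) <-> (ALL i:elts (tsp t). K i m)"
  using A t
proof (induction t rule: trm_induct)
  case dfm show ?case by (intro dfm_intros dfm_lt K dfm_sub2[OF K])
next
  case (mut m) then show ?case using K by (simp add: lt_simps)
next
  case (xit a s) then show ?case using K by (simp add: lt_simps)
qed

section \<open>The normal prae-dilator \<open>\<partial>T\<close>\<close>

lemma concrete_PT: "concrete (%A L. trm A) lt ren tsp mut"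
proof
  show "dfm (%e. trm (%i. i < n e) (t e))" if "dtm n" "dtm t" for n t
    by (intro dfm_trm_ctx dfm_intros dtm_ren[OF that(1)] that)
  show "df1 tsp" "df1 mut" by (intro dfm_intros)+
next
  fix A t assume A: "dp1 A" "trm A t"
  show "trm (%i. i \<in> elts (tsp t)) t"
    using trm_transfer[OF A(1) _ A(2), of "%i. i \<in> elts (tsp t)"] by (simp add: dfm_intros)
  show "FinSet (tsp t)" "i \<in> elts (tsp t) ==> A i" for i
    using FinSet_tsp[OF A] trm_tsp[OF A] by blast+
  show "elts (tsp (ren f t)) = f ` elts (tsp t)" if "df1 f" for f using tsp_ren A that by blast
  show "ren g (ren f t) = ren (%i. g (f i)) t" if "df1 f" "df1 g" for f g using ren_comp A that by blast
  show "ren f t = t" if "df1 f" "!!i. A i ==> f i = i" for f using ren_id[OF A(1) that A(2)] .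
  show "ren f t = ren g t" if "df1 f" "df1 g" "!!i. i \<in> elts (tsp t) ==> f i = g i" for f g
    using ren_cong[OF A(1) that(1,2) A(2)] that(3) by blast
  show "lt L t (mut m) <-> (ALL i:elts (tsp t). L i m)" if "dp2 L" for L m
    by (rule lt_mut_iff[OF A(1) that A(2)])
qed (auto simp: ren_simps intro: ren_order lt_linord dfm_lt dtm_ren_ctx)

definition PT :: sdil where
  "PT = concrete.FD (%A L. trm A) lt ren tsp mut"

lemmas PT_simps [simp] = concrete.FD_simps[OF concrete_PT, folded PT_def]
lemmas defdil_PT = concrete.defdil_FD[OF concrete_PT, folded PT_def]
lemmas snpd_PT = concrete.snpd_FD[OF concrete_PT, folded PT_def]

lemma Mu1_iff: "Mu T 1 0 s <-> s = mu 1 0"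
  by (rule Mu_iff) simp

lemma sp_all_PT: "sp_all T PT"
  unfolding sp_all_def
proof (intro conjI)
  show "sp_field T PT"
    unfolding sp_field_def sfull_iff Mu1_iff isc_singleton finsub_def PT_simps
  proof (intro allI)
    fix n t
    show "trm (%m. m < n) t <-> (EX m<n. t = mut m) | (EX a s. t = xit a s & (FinSet a & (ALL x. x \<in> elts a --> trm (%m. m < n) x))
       & full a s & ~ (EX m<n. (FinSet a & elts a = {mut m}) & s = mu 1 0))"
      using trm_eq[OF dp1_below, of n t] unfolding tmF_def by blast
  qed
  show "sp_less T PT"
    unfolding sp_less_def PT_simps using lt_eq[OF dfm_less2] unfolding ltF_def by blast
  have "t = ren (fapp f) s <-> (EX m m'. s = mut m & pr m m' \<in> elts f & t = mut m') |
      (EX a b u. s = xit a u & t = xit b u & imf (%s t. t = ren (fapp f) s) a b)"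
    if f: "smor f n l" and s: "trm (%m. m < n) s" for n l f s t
  proof -
    have im: "imf (%s t. t = ren (fapp f) s) a b <-> b = code (ren (fapp f) ` elts a)" for a b
      unfolding imf_def using isc_code[OF coded_ren[OF df1_fapp], of b f a] by (simp add: image_def Bex_def)
    show ?thesis
      using dp1_below[of n] s
    proof (cases rule: trm_cases)
      case (1 m)
      then show ?thesis using smor_app[OF f, of m] ren_simps[OF df1_fapp] by auto
    next
      case (2 a u)
      then show ?thesis unfolding im using ren_simps[OF df1_fapp] by auto
    qed
  qed
  then show "sp_act PT" unfolding sp_act_def PT_simps by blast
  show "sp_supp PT"
    unfolding sp_supp_def PT_simps
  proof (intro allI impI)
    fix n s c assume s: "trm (%m. m < n) s"
    have eq: "(EX t b. t \<in> elts a & b = tsp t & i \<in> elts b) <-> i \<in> (\<Union>r\<in>elts a. elts (tsp r))" for a i by blast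
    show "c = tsp s <-> (EX m. s = mut m & isc c (%i. i = m)) |
      (EX a u. s = xit a u & isc c (%i. EX t b. t \<in> elts a & b = tsp t & i \<in> elts b))"
      using dp1_below[of n] s
    proof (cases rule: trm_cases)
      case (1 m)
      then show ?thesis using isc_code[of "{m}" c] by (simp add: tsp_simps)
    next
      case (2 a u)
      then show ?thesis unfolding eq isc_code[OF coded_tsp_UN] by (simp add: tsp_simps)
    qed
  qed
  show "sp_mu PT" unfolding sp_mu_def by simp
qed

end

section \<open>\<open>\<partial>T\<close> as an upper derivative\<close>

context npdil
begin

lemma dtm_Dmu [dfm_intros]: "dtm t ==> dtm (%e. Dmu (t e))"
proof -
  have eq: "Dmu = (%x. pr (code {y. y = x}) (mu 1 0))" by (simp add: Dmu_def fun_eq_iff)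
  show "dtm t ==> dtm (%e. Dmu (t e))" unfolding eq by (rule dtm_sub1[of "%x. pr (code {y. y = x}) (mu 1 0)"]) (intro dfm_intros)
qed

lemma dtm_xi [dfm_intros]: "dtm t ==> dtm (%e. xi (t e))"
  by (rule dtm_sub1[of xi]) (unfold xi_def, intro dfm_intros)

lemma dtm_dec [dfm_intros]: "dtm t ==> dtm (%e. dec (t e))"
  by (rule dtm_sub1[of dec]) (unfold dec_def, intro dfm_intros)

lemma scomp_simps [simp]: "Fld (scomp T S) n = Dfield T (Fld S n)" "Lss (scomp T S) n = Dless T (Lss S n)"
  "Act (scomp T S) n l f p q <-> (EX a b t. p = pr a t & q = pr b t & imf (Act S n l f) a b)"
  "Mu (scomp T S) n m p <-> (EX s a t. Mu S n m s & isc a (%x. x = s) & Mu T 1 0 t & p = pr a t)"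
  by (simp_all add: scomp_def)

text \<open>All conditions are read off from the inverse \<open>dec\<close>, which respects the
  order (\<open>lt_iff_dec\<close>) and renaming (\<open>dec_ren\<close>).\<close>

lemma smorph_xi: "smorph (scomp T PT) PT {p. EX n x. p = pr n (pr x (xi x))}"
  unfolding smorph_def scomp_simps PT_simps mem_Collect_eq
proof (intro conjI allI impI)
  fix n x assume "Dfield T (trm (%m. m < n)) x"
  then show "EX y. (EX na xa. pr n (pr x y) = pr na (pr xa (xi xa))) & trm (%m. m < n) y"
    using dec_xi[OF dp1_below] by (intro exI[of _ "xi x"]) simp
next
  fix n x x' y y'
  assume *: "Dfield T (trm (%m. m < n)) x & Dfield T (trm (%m. m < n)) x' & (EX na xa. pr n (pr x y) = pr na (pr xa (xi xa)))
    & (EX na x. pr n (pr x' y') = pr na (pr x (xi x))) & Dless T (lt (<)) x x'"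
  then show "lt (<) y y'"
    using lt_iff_dec[OF dp1_below dfm_less2 linord_less, of n "xi x" "xi x'"] dec_xi[OF dp1_below, of n] by simp
next
  fix n l f x x' y y'
  assume *: "smor f n l & Dfield T (trm (%m. m < n)) x & (EX a b t. x = pr a t & x' = pr b t & imf (%s t. t = ren (fapp f) s) a b)
    & (EX na xa. pr n (pr x y) = pr na (pr xa (xi xa))) & (EX n x. pr l (pr x' y') = pr n (pr x (xi x)))"
  then obtain a b t where x: "x = pr a t" "x' = pr b t" "imf (%s t. t = ren (fapp f) s) a b" by blast
  have b: "b = code (ren (fapp f) ` elts a)"
    using x(3) isc_code[OF coded_ren[OF df1_fapp], of b f a] unfolding imf_def by (simp add: image_def Bex_def)
  have d: "trm (%m. m < n) (xi x)" "dec (xi x) = pr a t" using * dec_xi[OF dp1_below, of n x] x by simp_all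
  have "dec (ren (fapp f) (xi x)) = x'" using dec_ren[OF dp1_below df1_fapp d] x b by simp
  moreover have "trm (%m. m < l) (ren (fapp f) (xi x))" using ren_order(1)[OF mono_on_ord_smor] * d by blast
  ultimately have "xi x' = ren (fapp f) (xi x)" using xi_dec[OF dp1_below] by metis
  then show "y' = ren (fapp f) y" using * by simp
next
  fix n m x y
  assume *: "m < n & (EX s a t. s = mut m & isc a (%x. x = s) & Mu T 1 0 t & x = pr a t) & (EX na xa. pr n (pr x y) = pr na (pr xa (xi xa)))"
  then have "x = Dmu (mut m)" unfolding Mu1_iff isc_singleton using pr_eq_Dmu by auto
  then show "y = mut m" using * by simp
qed auto

lemma dfm_SS_xi: "{p. EX n x. p = pr n (pr x (xi x))} \<in> SS"
  by (rule dfm_SS) (intro dfm_intros)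

section \<open>Uniqueness of \<open>\<partial>T\<close>\<close>

text \<open>Statement (1) yields some \<open>P\<close> that satisfies the recursive clauses. By
  induction on codes, these determine the data of \<open>P\<close> on the relevant arguments, and so
  \<open>P\<close> can be replaced by \<open>PT\<close>.\<close>

lemma sp_all_unique:
  assumes P: "defdil P" "sp_all T P"
  shows "Fld P n s <-> trm (%m. m < n) s"
    "trm (%m. m < n) s ==> trm (%m. m < n) t ==> Lss P n s t <-> lt (<) s t"
    "smor f n l ==> trm (%m. m < n) s ==> Act P n l f s t <-> t = ren (fapp f) s"
    "trm (%m. m < n) s ==> Spp P n s t <-> t = tsp s"
proof -
  note d = defdilD[OF P(1)]
  have sp: "sp_field T P" "sp_less T P" "sp_act P" "sp_supp P" using P(2) unfolding sp_all_def by blast+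
  have sp': "sp_field T PT" "sp_less T PT" "sp_act PT" "sp_supp PT" using sp_all_PT unfolding sp_all_def by blast+
  show F: "Fld P n s <-> trm (%m. m < n) s" for n s
  proof (induction s rule: N_less_induct)
    case dfm show ?case by (intro dfm_intros d dfm_trm)
  next
    case (less s)
    have "(EX a u. s = xit a u & finsub a (Fld P n) & sfull T a u & ~ (EX m. m < n & isc a (%r. r = mut m) & Mu T 1 0 u)) <->
      (EX a u. s = xit a u & finsub a (Fld PT n) & sfull T a u & ~ (EX m. m < n & isc a (%r. r = mut m) & Mu T 1 0 u))"
      unfolding finsub_def using less less_xit by auto
    then show ?case
      using sp(1)[unfolded sp_field_def, rule_format, of n s] sp'(1)[unfolded sp_field_def, rule_format, of n s] by simp
  qed
  show L: "Lss P n s t <-> lt (<) s t" if "trm (%m. m < n) s" "trm (%m. m < n) t" for n s t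
  proof -
    have "ALL s t. k = spair s t --> trm (%m. m < n) s --> trm (%m. m < n) t --> (Lss P n s t <-> lt (<) s t)" for k
    proof (induction k rule: N_less_induct)
      case dfm show ?case by (intro dfm_intros d dfm_trm dfm_lt dfm_less2)
    next
      case (less k)
      show ?case
      proof (intro allI impI)
        fix s t assume k: "k = spair s t" and st: "trm (%m. m < n) s" "trm (%m. m < n) t"
        have IH: "Lss P n r q <-> lt (<) r q" if "spair r q < spair s t" "trm (%m. m < n) r" "trm (%m. m < n) q" for r q
          using less k that by blast
        have "Lss P n s t <-> ltF (<) (Lss P n) s t"
          using sp(2)[unfolded sp_less_def, rule_format, of n s t] st F by (simp add: ltF_def)
        also have "\<dots> <-> ltF (<) (lt (<)) s t"
        proof (rule ltF_cong)
          show "Lss P n s r <-> lt (<) s r" if "t = xit b v" "r \<in> elts b" for b v r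
            using IH[of s r] spair_less1[of r t s] less_xit[of r b v] that st by (simp add: trm_xit)
          show "Lss P n r t <-> lt (<) r t" if "s = xit b v" "r \<in> elts b" for b v r
            using IH[of r t] spair_less2[of r s t] less_xit[of r b v] that st by (simp add: trm_xit)
          show "Lss P n r q <-> lt (<) r q" if "s = xit a u" "t = xit b v" "r \<in> elts a \<union> elts b" "q \<in> elts a \<union> elts b" for a u b v r q
          proof (rule IH)
            have "x < max s t" if "x \<in> elts a \<union> elts b" for x
              using that \<open>s = xit a u\<close> \<open>t = xit b v\<close> less_xit[of x a u] less_xit[of x b v] by (auto simp: less_max_iff_disj)
            then show "spair r q < spair s t" using that by (intro spair_less_max) simp
          qed (use that st in \<open>auto simp: trm_xit\<close>)
        qed
        also have "\<dots> <-> lt (<) s t" using lt_eq[OF dfm_less2] by blast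
        finally show "Lss P n s t <-> lt (<) s t" .
      qed
    qed
    then show ?thesis using that by blast
  qed
  have A: "ALL t. Act P n l f s t <-> t = ren (fapp f) s" if f: "smor f n l" and s: "trm (%m. m < n) s" for f n l s
    using dp1_below s
  proof (induction s rule: trm_induct)
    case dfm show ?case by (intro dfm_intros d dtm_rn)
  next
    case (mut m)
    then show ?case
      using sp(3)[unfolded sp_act_def, rule_format, of f n l "mut m"] sp'(3)[unfolded sp_act_def, rule_format, of f n l "mut m"] f F by simp
  next
    case (xit a u)
    have im: "imf (Act P n l f) a b <-> imf (Act PT n l f) a b" for b
      unfolding imf_def isc_def PT_simps using xit by (metis (no_types, lifting))
    have tr: "trm (%m. m < n) (xit a u)" using xit by (auto simp: trm_xit)
    show ?case
      using sp(3)[unfolded sp_act_def, rule_format, of f n l "xit a u"] sp'(3)[unfolded sp_act_def, rule_format, of f n l "xit a u"] f F tr im by simp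
  qed
  then show "smor f n l ==> trm (%m. m < n) s ==> Act P n l f s t <-> t = ren (fapp f) s" by blast
  have S: "ALL t. Spp P n s t <-> t = tsp s" if s: "trm (%m. m < n) s" for n s
    using dp1_below s
  proof (induction s rule: trm_induct)
    case dfm show ?case by (intro dfm_intros d)
  next
    case (mut m)
    then show ?case
      using sp(4)[unfolded sp_supp_def, rule_format, of n "mut m"] sp'(4)[unfolded sp_supp_def, rule_format, of n "mut m"] F by simp
  next
    case (xit a u)
    have im: "(EX t b. t \<in> elts a & Spp P n t b & i \<in> elts b) <-> (EX t b. t \<in> elts a & b = tsp t & i \<in> elts b)" for i using xit by auto
    have tr: "trm (%m. m < n) (xit a u)" using xit by (auto simp: trm_xit)
    show ?case
      using sp(4)[unfolded sp_supp_def, rule_format, of n "xit a u"] sp'(4)[unfolded sp_supp_def, rule_format, of n "xit a u"] F tr im by simp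
  qed
  then show "trm (%m. m < n) s ==> Spp P n s t <-> t = tsp s" by blast
qed

end

lemma (in npdil) npdil_PT: "npdil PT"
  using snpd_PT defdil_PT by unfold_locales

text \<open>\<open>P\<close> and \<open>PT\<close> are known to agree on terms only; so their orders
  are compared within the field of \<open>D\<close>, where descending sequences live.\<close>

lemma (in npdil) spwf_PT:
  assumes P: "defdil P" "sp_all T P" "spwf P" shows "spwf PT"
  unfolding spwf_def
proof (intro ballI impI)
  fix X R assume XR: "X \<in> SS" "R \<in> SS" "wellord X R"
  interpret PT: npdil PT by (rule npdil_PT)
  note u = sp_all_unique[OF P(1,2)]
  let ?A = "%x. x \<in> X" and ?L = "%x y. pr x y \<in> R"
  have L: "dp2 ?L" by (intro dfm_mem[OF XR(2)] dfm_intros)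
  have lin: "linord ?A ?L" using XR(3) unfolding wellord_def by blast
  have F: "Dfield P ?A p <-> Dfield PT ?A p" for p
    unfolding Dfield_def sfull_def using u(1,4) by (metis PT_simps(2,4))
  have D: "Dless P ?L p q" if pq: "Dfield PT ?A p" "Dfield PT ?A q" "Dless PT ?L p q" for p q
  proof -
    obtain a s where p: "p = pr a s" "ALL x:elts a. x \<in> X" "PT.full a s" using pq(1) unfolding PT.Dfield_iff by blast
    obtain b t where q: "q = pr b t" "ALL x:elts b. x \<in> X" "PT.full b t" using pq(2) unfolding PT.Dfield_iff by blast
    obtain c k l m f g s' t' where c: "isc c (%x. x \<in> elts a | x \<in> elts b)" "incl ?L a c k m f" "incl ?L b c l m g"
      "Act PT k m f s s'" "Act PT l m g t t'" "Lss PT m s' t'" using pq(3) unfolding Dless_def p q by auto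
    have ec: "elts c = elts a \<union> elts b" using c(1) unfolding isc_iff by auto
    have fl: "flin ?L c" by (rule PT.flinI[OF L lin]) (use ec p q in auto)
    have k: "k = crd a" "l = crd b" using incl_iff[OF fl, of a] incl_iff[OF fl, of b] c(2,3) ec by auto
    have sm: "smor f k m" "smor g l m" using c(2,3) unfolding incl_def by blast+
    have st: "trm (%m. m < k) s" "trm (%m. m < l) t" using p(3) q(3) k unfolding PT.full_def by simp_all
    have s': "trm (%i. i < m) s'" "trm (%i. i < m) t'"
      using c(4,5) st ren_order(1)[OF mono_on_ord_smor[OF sm(1)]] ren_order(1)[OF mono_on_ord_smor[OF sm(2)]] by auto
    have "Act P k m f s s'" "Act P l m g t t'" "Lss P m s' t'" using u(2,3) c(4-6) sm st s' by simp_all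
    then show ?thesis unfolding Dless_def p q using c(1-3) by blast
  qed
  have "wellf (Dfield P ?A) (Dless P ?L)" using P(3) XR unfolding spwf_def Dwf_def by blast
  then have nG: "~ ((ALL n. EX x. pr n x \<in> G) & (ALL n x. pr n x \<in> G --> Dfield PT ?A x)
      & (ALL n x y. pr n x \<in> G & pr n y \<in> G --> x = y) & (ALL n x y. pr n x \<in> G & pr (n + 1) y \<in> G --> Dless P ?L y x))"
    if "G \<in> SS" for G unfolding wellf_def F using that by blast
  show "Dwf PT X R"
    unfolding Dwf_def wellf_def
  proof (rule notI, elim bexE)
    fix G assume G: "G \<in> SS" and *: "(ALL n. EX x. pr n x \<in> G) & (ALL n x. pr n x \<in> G --> Dfield PT ?A x)
      & (ALL n x y. pr n x \<in> G & pr n y \<in> G --> x = y) & (ALL n x y. pr n x \<in> G & pr (n + 1) y \<in> G --> Dless PT ?L y x)"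
    then have "Dless P ?L y x" if "pr n x \<in> G" "pr (n + 1) y \<in> G" for n x y
      using D[of y x] that by meson
    then show False using nG[OF G] * by meson
  qed
qed

lemma npdil_scoded: "T \<in> SS ==> sndil (scoded T) ==> npdil (scoded T)"
  unfolding sndil_def by unfold_locales (auto intro: defdil_scoded)

theorem derivative_imp_upper:
  assumes sder_statement shows supper_statement
  unfolding supper_statement_def
proof (intro ballI impI)
  fix T assume T: "T \<in> SS" "sndil (scoded T)"
  interpret npdil "scoded T" by (rule npdil_scoded[OF T])
  obtain P where P: "P \<in> SS" "sp_all (scoded T) (scoded P)" "spwf (scoded P)"
    using assms T unfolding sder_statement_def by blast
  obtain S where S: "S \<in> SS" "scoded S = PT" using scoded_surj[OF defdil_PT] by blast
  have "spwf (scoded S)" using spwf_PT[OF defdil_scoded[OF P(1)] P(2,3)] S by simp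
  moreover have "sup_der (scoded T) (scoded S) {p. EX n x. p = pr n (pr x (xi x))}"
    unfolding sup_der_def S(2) using snpd_PT smorph_xi by blast
  ultimately show "EX S:SS. EX Z:SS. sup_der (scoded T) (scoded S) Z & spwf (scoded S)"
    using S(1) dfm_SS_xi by blast
qed

section \<open>Bar induction for well-foundedness\<close>

definition wfs :: "N set => N => bool" where
  "wfs Q x <-> mwf (%_. True) (%p q. pr x (pr p q) \<in> Q)"

definition wfbar :: bool where
  "wfbar <-> (ALL X:SS. ALL R:SS. ALL Q:SS. wellord X R -->
     (ALL x:X. (ALL y:X. pr y x \<in> R --> wfs Q y) --> wfs Q x) --> (ALL x:X. wfs Q x))"

text \<open>Numbers outside of \<open>B\<close> are isolated and hence minimal.\<close>

lemma mwf_UNIV: assumes B: "dp1 B" shows "mwf (%_. True) (%p q. B p & B q & L p q) <-> mwf B L"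
proof
  assume w: "mwf (%_. True) (%p q. B p & B q & L p q)"
  show "mwf B L" unfolding mwf_def
  proof (intro ballI impI)
    fix Q assume Q: "Q \<in> SS" "ALL x:Q. B x" "Q ~= {}"
    then obtain m where "m \<in> Q" "!!y. y \<in> Q ==> ~ (B y & B m & L y m)"
      using w[unfolded mwf_def, rule_format, of Q] by blast
    then have "~ L y m" if "y \<in> Q" for y using Q(2) that by blast
    then show "EX m:Q. ALL y:Q. ~ L y m" using \<open>m \<in> Q\<close> by blast
  qed
next
  assume w: "mwf B L"
  show "mwf (%_. True) (%p q. B p & B q & L p q)" unfolding mwf_def
  proof (intro ballI impI)
    fix Q :: "N set" assume Q: "Q \<in> SS" "Q ~= {}"
    show "EX m:Q. ALL y:Q. ~ (B y & B m & L y m)"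
    proof (cases "EX x. x \<in> Q & B x")
      case True
      then obtain x where x: "x \<in> Q & B x" by blast
      have "dfm (%e. e 0 \<in> Q & B (e 0))" by (intro dfm_intros dfm_mem[OF Q(1)] B)
      then obtain m where "m \<in> Q & B m" "!!y. y \<in> Q & B y ==> ~ L y m" using mwfD[OF w, of "%x. x \<in> Q & B x" x] x by blast
      then show ?thesis by blast
    qed (use Q in blast)
  qed
qed

lemma mwf_less: "mwf A (<)"
  unfolding mwf_def
proof (intro ballI impI)
  fix Q assume Q: "Q \<in> SS" "Q ~= {}"
  have "dfm (%e. e 0 \<in> Q)" by (intro dfm_mem[OF Q(1)] dfm_intros)
  moreover obtain x where "x \<in> Q" using Q by blast
  ultimately show "EX m:Q. ALL y:Q. ~ y < m" using N_least[of "%x. x \<in> Q"] by metis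
qed

lemma mwf_local:
  assumes L: "linord A L" "dp2 L" and w: "!!x. A x ==> mwf (%y. A y & L y x) L" shows "mwf A L"
  unfolding mwf_def
proof (intro ballI impI)
  fix Q assume Q: "Q \<in> SS" "ALL x:Q. A x" "Q ~= {}"
  then obtain x where x: "x \<in> Q" by blast
  show "EX m:Q. ALL y:Q. ~ L y m"
  proof (cases "EX y. y \<in> Q & L y x")
    case True
    then obtain y where y: "y \<in> Q & L y x" by blast
    have "dfm (%e. e 0 \<in> Q & L (e 0) x)" by (intro dfm_intros dfm_mem[OF Q(1)] dfm_sub2[OF L(2)])
    then obtain m where m: "m \<in> Q & L m x" "!!y. y \<in> Q & L y x ==> ~ L y m"
      using mwfD[OF w[of x], of "%y. y \<in> Q & L y x" y] x y Q(2) by blast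
    then show ?thesis using linordD(2)[OF L(1)] Q(2) x by blast
  qed (use x in blast)
qed

lemma wfbar_induct:
  assumes bar: wfbar and A: "dp1 A" and L: "dp2 L" "linord A L" "mwf A L"
    and B: "dp2 B" and K: "dfm (%e. K (e 0) (e (Suc 0)) (e (Suc (Suc 0))))"
    and prog: "!!x. A x ==> (!!y. A y ==> L y x ==> mwf (B y) (K y)) ==> mwf (B x) (K x)"
    and x: "A x"
  shows "mwf (B x) (K x)"
proof -
  define X where "X = {x. A x}"
  define R where "R = {p. EX x y. p = pr x y & L x y}"
  define Q where "Q = {p. EX x y z. p = pr x (pr y z) & B x y & B x z & K x y z}"
  have X: "X \<in> SS" unfolding X_def by (rule dfm_SS[OF A])
  have R: "R \<in> SS" unfolding R_def by (rule dfm_SS) (intro dfm_intros dfm_sub2[OF L(1)])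
  have Q: "Q \<in> SS" unfolding Q_def by (rule dfm_SS) (intro dfm_intros dfm_sub2[OF B] dfm_sub3[OF K])
  have eq: "(%x. x \<in> X) = A" "(%x y. pr x y \<in> R) = L" by (auto simp: X_def R_def fun_eq_iff)
  have w: "wfs Q x <-> mwf (B x) (K x)" for x
    using mwf_UNIV[of "B x" "K x"] dfm_sub2[OF B, of "%e. x" "%e. e 0"] unfolding wfs_def Q_def by (simp add: dfm_intros)
  have "wellord X R" unfolding wellord_def eq using L wellf_iff_mwf by blast
  moreover have "wfs Q x" if "x \<in> X" "ALL y:X. pr y x \<in> R --> wfs Q y" for x
    using that prog[of x] unfolding w X_def R_def by simp
  ultimately have "ALL x:X. wfs Q x" using bar X R Q unfolding wfbar_def by blast
  then show ?thesis using x w unfolding X_def by blast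
qed

section \<open>Well-foundedness of the terms\<close>

context npdil
begin

text \<open>Otherwise all of \<open>a\<close> would lie below \<open>r\<close>, and normality would
  put \<open>pr a u\<close> below \<open>Dmu r\<close>. But \<open>pr b v\<close> is not below
  \<open>Dmu r\<close>, because \<open>r\<close> is one of its own elements.\<close>

lemma Dmu_gr:
  assumes A: "dp1 A" and L: "dp2 L" "linord A L"
    and p: "Dfield T A (pr a u)" "Dfield T A (pr b v)" and less: "Dless T L (pr b v) (pr a u)" and r: "r \<in> elts b"
  shows "EX q:elts a. L r q | r = q"
proof (rule ccontr)
  assume n: "~ (EX q:elts a. L r q | r = q)"
  have ar: "A r" using p(2) r unfolding Dfield_iff by auto
  define c where "c = code (elts a \<union> elts b)"
  have c: "elts c = elts a \<union> elts b" unfolding c_def by (simp add: coded_set_Un)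
  have fl: "flin L c" by (rule flinI[OF L]) (use p c in \<open>auto simp: Dfield_iff\<close>)
  have f: "full a u" "full b v" using p unfolding Dfield_iff by auto
  have "ALL q:elts a. L q r"
    using n linordD(3)[OF L(2)] p(1) ar unfolding Dfield_iff by auto
  then have 1: "Dless T L (pr a u) (Dmu r)" using Dless_Dmu_iff[OF fl, of a r u] f c r by auto
  have "~ Dless T L (pr b v) (Dmu r)"
    using Dless_Dmu_iff[OF fl, of b r v] f c r linordD(1)[OF L(2) ar] by auto
  then show False
    using linordD(2)[OF D_linord[OF L] p(2,1) Dfield_Dmu[of A, OF ar]] 1 less by blast
qed

text \<open>\<open>B\<close> collects the indices whose segments are known to be well-founded: those
  below \<open>x\<close> during the induction along \<open>A\<close>, and all of \<open>A\<close>
  afterwards. Even the induction along the usual order of codes is an instance of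
  \<open>wfbar\<close>, since its claim is not arithmetical.\<close>

lemma trm_segment_wf:
  assumes bar: wfbar and wf: "spwf T" and A: "dp1 A" and K: "dp2 K" "linord A K"
    and B: "dp1 B" and w: "!!x. A x ==> B x ==> mwf (%s. trm A s & lt K s (mut x)) (lt K)"
    and t: "trm A t" "ALL i:elts (tsp t). B i"
  shows "mwf (%s. trm A s & lt K s t) (lt K)"
proof -
  let ?B = "%t s. (trm A t & (ALL i:elts (tsp t). B i)) & trm A s & lt K s t"
  note lin = lt_linord[OF A K] and dlt = dp2_lt[OF K(1)]
  have "mwf (?B t) (lt K)"
  proof (rule wfbar_induct[OF bar, of "%_. True" "(<)" ?B "%_. lt K"])
    show "dp2 ?B" by (intro dfm_intros dfm_trm A dfm_lt K dfm_sub1[OF B])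
    show "dfm (%e. lt K (e (Suc 0)) (e (Suc (Suc 0))))" by (intro dfm_lt K dfm_intros)
    fix t assume IH: "!!y. True ==> y < t ==> mwf (?B y) (lt K)"
    show "mwf (?B t) (lt K)"
    proof (cases "trm A t & (ALL i:elts (tsp t). B i)")
      case False then show ?thesis unfolding mwf_def by blast
    next
      case True
      then have t: "trm A t" "ALL i:elts (tsp t). B i" by blast+
      have "mwf (%s. trm A s & lt K s t) (lt K)"
        using A t(1)
      proof (cases rule: trm_cases)
        case (1 m) then show ?thesis using w[of m] t by auto
      next
        case (2 a u)
        \<comment> \<open>Each segment of \<open>?C\<close> is contained in the segment below some
          element of \<open>a\<close>, whose code is smaller than \<open>t\<close>; so
          \<open>mwf_local\<close> reduces the well-foundedness of \<open>?C\<close> to the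
          induction hypothesis.\<close>
        let ?C = "%r. trm A r & (EX q. q \<in> elts a & (lt K r q | r = q))"
        have dC: "dp1 ?C" by (intro dfm_intros dfm_trm A dfm_lt K)
        have CA: "linord ?C (lt K)" by (rule linord_subset[OF lin]) blast
        have W: "mwf (%s. trm A s & lt K s q) (lt K)" if q: "q \<in> elts a" for q
        proof -
          have "trm A q & (ALL i:elts (tsp q). B i)" using 2 q t by auto
          moreover have "q < t" using less_xit[OF q] 2 by simp
          ultimately show ?thesis using IH[of q] by simp
        qed
        have C: "mwf ?C (lt K)"
        proof (rule mwf_local[OF CA dlt])
          fix x assume x: "?C x"
          then obtain q where q: "q \<in> elts a" "lt K x q | x = q" by blast
          show "mwf (%y. ?C y & lt K y x) (lt K)"
          proof (rule mwf_subset[OF W[OF q(1)]])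
            fix y assume "?C y & lt K y x"
            then show "trm A y & lt K y q" using q x linordD(2)[OF lin, of y x q] 2(3)[OF q(1)] by blast
          qed
        qed
        have D: "mwf (Dfield T ?C) (Dless T (lt K))" by (rule spwf_mwf[OF wf dC dlt CA C])
        show ?thesis
        proof (rule mwf_embed[OF D, of dec])
          show "df1 dec" by (intro dfm_intros)
          have Fld: "Dfield T (trm A) (dec s)" if "trm A s" for s
            by (rule Dfield_dec[OF A that]) (use A that in \<open>auto simp: trm_xit\<close>)
          fix s assume s: "trm A s & lt K s t"
          obtain b v where b: "dec s = pr b v" using Fld s unfolding Dfield_iff by blast
          have ts: "Dfield T (trm A) (pr b v)" "Dfield T (trm A) (pr a u)" using Fld[of s] Fld[of t] s t b 2 by auto
          have "Dless T (lt K) (pr b v) (pr a u)" using lt_iff_dec[OF A K, of s t] s t b 2 by simp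
          then have "?C r" if "r \<in> elts b" for r
            using Dmu_gr[OF _ dlt lin ts(2,1)] that ts(1) by (auto simp: Dfield_iff dfm_intros dfm_trm[OF A])
          then show "Dfield T ?C (dec s)" using ts(1) unfolding b Dfield_iff by auto
        next
          fix s s' assume "trm A s & lt K s t" "trm A s' & lt K s' t" "lt K s s'"
          then show "Dless T (lt K) (dec s) (dec s')" using lt_iff_dec[OF A K] by blast
        qed
      qed
      then show ?thesis using t by simp
    qed
  qed (auto simp: dfm_intros dfm_less2 mwf_less)
  then show ?thesis using t by simp
qed

lemma trm_wf:
  assumes bar: wfbar and wf: "spwf T" and A: "dp1 A" and K: "dp2 K" "linord A K" "mwf A K"
  shows "mwf (trm A) (lt K)"
proof (rule mwf_local[OF lt_linord[OF A K(1,2)] dp2_lt[OF K(1)]])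
  have W: "mwf (%s. trm A s & lt K s (mut x)) (lt K)" if "A x" for x
  proof (rule wfbar_induct[OF bar A K, of "%x s. trm A s & lt K s (mut x)" "%_. lt K"])
    show "dp2 (%x s. trm A s & lt K s (mut x))" by (intro dfm_intros dfm_trm A dfm_lt K)
    show "dfm (%e. lt K (e (Suc 0)) (e (Suc (Suc 0))))" by (intro dfm_lt K dfm_intros)
    fix x assume x: "A x" and IH: "!!y. A y ==> K y x ==> mwf (%s. trm A s & lt K s (mut y)) (lt K)"
    note lin = lt_linord[OF A K(1,2)] and dlt = dp2_lt[OF K(1)]
    show "mwf (%s. trm A s & lt K s (mut x)) (lt K)"
    proof (rule mwf_local[OF linord_subset[OF lin] dlt])
      fix t assume t: "trm A t & lt K t (mut x)"
      then have "mwf (%s. trm A s & lt K s t) (lt K)"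
        using trm_segment_wf[OF bar wf A K(1,2), of "%y. K y x" t] IH lt_mut_iff[OF A K(1), of t x]
          dfm_sub2[OF K(1), of "%e. e 0" "%e. x"] by (auto simp: dfm_intros)
      then show "mwf (%y. (trm A y & lt K y (mut x)) & lt K y t) (lt K)" by (rule mwf_subset) blast
    qed blast
  qed (rule that)
  fix t assume "trm A t"
  then show "mwf (%s. trm A s & lt K s t) (lt K)"
    using trm_segment_wf[OF bar wf A K(1,2) A] W trm_tsp[OF A] by blast
qed

lemma spwf_PT_bar: "wfbar ==> spwf T ==> spwf PT"
  unfolding PT_def by (rule concrete.spwf_FD[OF concrete_PT]) (rule trm_wf)

end

theorem wfbar_imp_derivative: assumes wfbar shows sder_statement
  unfolding sder_statement_def
proof (intro ballI impI)
  fix T assume T: "T \<in> SS" "sndil (scoded T)"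
  interpret npdil "scoded T" by (rule npdil_scoded[OF T])
  obtain P where "P \<in> SS" "scoded P = PT" using scoded_surj[OF defdil_PT] by blast
  then show "EX P:SS. sp_all (scoded T) (scoded P) & spwf (scoded P)"
    using sp_all_PT spwf_PT_bar[OF assms] T(2) unfolding sndil_def by metis
qed

section \<open>The Kleene normal form\<close>

definition cut :: "N set => N => N" where
  "cut G w = code {i. i \<in> G & i < w}"

lemma coded_cut: "G \<in> SS ==> coded_set {i. i \<in> G & i < w}"
  by (rule coded_setI[of _ w]) (auto intro!: dfm_SS dfm_intros dfm_mem)

lemma elts_cut [simp]: "G \<in> SS ==> elts (cut G w) = {i. i \<in> G & i < w}"
  and FinSet_cut [simp]: "G \<in> SS ==> FinSet (cut G w)"
  unfolding cut_def using coded_cut by auto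

lemma dtm_cut: "G \<in> SS ==> dtm t ==> dtm (%e. cut G (t e))"
  by (rule dtm_sub1[of "cut G"]) (unfold cut_def, intro dfm_intros dfm_mem)

lemma dtm_cut_elts [dfm_intros]: "dtm c ==> dtm t ==> dtm (%e. cut (elts (c e)) (t e))"
  by (rule dtm_sub2[of "%c. cut (elts c)"]) (unfold cut_def, intro dfm_intros)

lemma cut_cut: "G \<in> SS ==> u <= w ==> cut (elts (cut G w)) u = cut G u"
  unfolding cut_def[of "elts (cut G w)"] cut_def[of G u] by (rule arg_cong[of _ _ code]) auto

lemma N_bounding:
  assumes P: "dp2 P" and ex: "!!z. EX w. P z w"
  shows "EX v. k <= v & (ALL z<k. EX w<=v. P z w)"
proof -
  define f where "f z = the0 (%w. P z w & (ALL u<w. ~ P z u))" for z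
  have f: "P z (f z)" for z
  proof -
    obtain w where w: "P z w" "!!u. u < w ==> ~ P z u" using N_least[of "P z"] dfm_sub2[OF P, of "%e. z" "%e. e 0"] ex[of z] by (auto simp: dfm_intros)
    have "f z = w" unfolding f_def using w by (intro the0_equality) (auto, metis linorder_neqE)
    then show ?thesis using w by simp
  qed
  have "df1 f" unfolding f_def by (intro dfm_intros dfm_sub2[OF P])
  then obtain b where "ALL z<k. f z < b" using bounded_function[of f k] by blast
  then have "ALL z<k. EX w<=max k b. P z w" using f by (metis le_max_iff_disj less_imp_le)
  then show ?thesis by (intro exI[of _ "max k b"]) simp
qed

text \<open>Approximations \<open>\<langle>k, v, c\<rangle>\<close> of sets \<open>G\<close> satisfying a formula \<open>\<forall>z \<exists>w. B(z, w, G \<inter> w)\<close>.\<close>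

definition kn :: "(N => N => N => bool) => N => bool" where
  "kn B p <-> (EX k v c. p = pr k (pr v c) & FinSet c & (ALL i:elts c. i < v) & k <= v
     & (ALL z<k. EX w<=v. B z w (cut (elts c) w)))"

definition kl :: "N => N => bool" where
  "kl p' p <-> (EX k v c v' c'. p = pr k (pr v c) & p' = pr (k + 1) (pr v' c') & v <= v' & cut (elts c') v = c)"

lemma dfm_kl [dfm_intros]: "dtm s ==> dtm t ==> dfm (%e. kl (s e) (t e))"
  by (rule dfm_sub2[of kl]) (unfold kl_def, intro dfm_intros)

text \<open>A solution \<open>G\<close> yields the branch of its segments
  \<open>cut G (V k)\<close>, where \<open>V k\<close> is the least suitable bound for witnesses of
  all \<open>z < k\<close>; being least, it is monotone in \<open>k\<close>. Conversely, the finite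
  sets along a branch are segments of a single set \<open>G\<close>.\<close>

lemma kleene_normal_form:
  assumes B: "dfm (%e. B (e 0) (e (Suc 0)) (e (Suc (Suc 0))))"
  shows "mwf (kn B) kl <-> ~ (EX G:SS. ALL z. EX w. B z w (cut G w))"
proof
  assume w: "mwf (kn B) kl"
  show "~ (EX G:SS. ALL z. EX w. B z w (cut G w))"
  proof
    assume "EX G:SS. ALL z. EX w. B z w (cut G w)"
    then obtain G where G: "G \<in> SS" "!!z. EX w. B z w (cut G w)" by blast
    define P where "P k v <-> k <= v & (ALL z<k. EX w<=v. B z w (cut G w))" for k v
    have dP: "dtm s ==> dtm t ==> dfm (%e. P (s e) (t e))" for s t
      by (rule dfm_sub2[of P]) (unfold P_def, intro dfm_intros dfm_sub3[OF B] dtm_cut G)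
    have "dp2 (%z w. B z w (cut G w))" by (intro dfm_sub3[OF B] dtm_cut G dfm_intros)
    then have exP: "EX v. P k v" for k unfolding P_def using N_bounding[of "%z w. B z w (cut G w)"] G(2) by blast
    define V where "V k = the0 (%v. P k v & (ALL u<v. ~ P k u))" for k
    have V: "P k (V k) & (ALL u<V k. ~ P k u)" for k
    proof -
      obtain v where v: "P k v" "!!u. u < v ==> ~ P k u" using N_least[of "P k"] dP[of "%e. k" "%e. e 0"] exP[of k] by (auto simp: dfm_intros)
      have "V k = v" unfolding V_def using v by (intro the0_equality) (auto, metis linorder_neqE)
      then show ?thesis using v by simp
    qed
    have dV: "dtm t ==> dtm (%e. V (t e))" for t
      by (rule dtm_sub1[of V]) (unfold V_def, intro dfm_intros dP)
    define f where "f k = pr k (pr (V k) (cut G (V k)))" for k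
    define Q where "Q p <-> (EX k. p = f k)" for p
    have dQ: "dp1 Q" unfolding Q_def f_def by (intro dfm_intros dV dtm_cut G)
    have "Q p ==> kn B p" for p
    proof -
      assume "Q p"
      then obtain k where k: "p = f k" unfolding Q_def by blast
      have "EX w<=V k. B z w (cut (elts (cut G (V k))) w)" if z: "z < k" for z
      proof -
        have "ALL z<k. EX w<=V k. B z w (cut G w)" using V[of k] unfolding P_def by blast
        then obtain w where "w <= V k" "B z w (cut G w)" using z by blast
        then show ?thesis using cut_cut[OF G(1), of w "V k"] by auto
      qed
      moreover have "k <= V k" using V[of k] unfolding P_def by blast
      ultimately show "kn B p" unfolding kn_def k f_def using G(1)
        by (intro exI[of _ k] exI[of _ "V k"] exI[of _ "cut G (V k)"]) simp
    qed
    then obtain m where m: "Q m" "!!y. Q y ==> ~ kl y m" using mwfD[OF w dQ, of "f 0"] unfolding Q_def by blast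
    obtain k where k: "m = f k" using m unfolding Q_def by blast
    have "k <= k + 1" "!!z. z < k ==> z < k + 1" by (auto intro: less_le_trans simp: less_Suc)
    then have "P k (V (k + 1))" using V[of "k + 1"] unfolding P_def by (meson order_trans)
    then have le: "V k <= V (k + 1)" using V[of k] by (meson not_less)
    note c = cut_cut[OF G(1) le]
    have "f k = pr k (pr (V k) (cut G (V k))) & f (k + 1) = pr (k + 1) (pr (V (k + 1)) (cut G (V (k + 1))))
        & V k <= V (k + 1) & cut (elts (cut G (V (k + 1)))) (V k) = cut G (V k)"
      using f_def[of k] f_def[of "k + 1"] le c by (intro conjI)
    then have "kl (f (k + 1)) (f k)" unfolding kl_def by (intro exI)
    moreover have "Q (f (k + 1))" unfolding Q_def by (rule exI) (rule refl)
    ultimately show False using m(2) k by simp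
  qed
next
  assume nG: "~ (EX G:SS. ALL z. EX w. B z w (cut G w))"
  have "wellf (kn B) kl" unfolding wellf_def
  proof
    assume "EX G:SS. (ALL n. EX x. pr n x \<in> G) & (ALL n x. pr n x \<in> G --> kn B x)
      & (ALL n x y. pr n x \<in> G & pr n y \<in> G --> x = y) & (ALL n x y. pr n x \<in> G & pr (n + 1) y \<in> G --> kl y x)"
    then obtain P where P: "P \<in> SS" "!!n. EX x. pr n x \<in> P" "!!n x. pr n x \<in> P ==> kn B x"
      "!!n x y. pr n x \<in> P ==> pr n y \<in> P ==> x = y" "!!n x y. pr n x \<in> P ==> pr (n + 1) y \<in> P ==> kl y x" by blast
    note dP = dfm_mem[OF P(1)]
    have node: "EX k v c. pr n (pr k (pr v c)) \<in> P & FinSet c & (ALL i:elts c. i < v) & k <= v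
     & (ALL z<k. EX w<=v. B z w (cut (elts c) w))" for n
      using P(2)[of n] P(3) unfolding kn_def by metis
    have *: "ALL k v c k' v' c'. pr n (pr k (pr v c)) \<in> P --> pr (n + d) (pr k' (pr v' c')) \<in> P --> k' = k + d & v <= v' & cut (elts c') v = c" for n d
    proof (induction d rule: N_induct)
      case dfm show ?case by (intro dfm_intros dP)
    next
      case 0
      have "cut (elts c) v = c" if "pr n (pr k (pr v c)) \<in> P" for k v c
      proof -
        have c: "FinSet c" "ALL i:elts c. i < v" using P(3)[OF that] unfolding kn_def by auto
        show ?thesis by (rule FinSet_eqI) (use c elts_SS in auto)
      qed
      then show ?case using P(4) by fastforce
    next
      case (Suc d)
      show ?case
      proof (intro allI impI)
        fix k v c k' v' c' assume 1: "pr n (pr k (pr v c)) \<in> P" "pr (n + (d + 1)) (pr k' (pr v' c')) \<in> P"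
        obtain k1 v1 c1 where 2: "pr (n + d) (pr k1 (pr v1 c1)) \<in> P" using node[of "n + d"] by blast
        have 3: "k1 = k + d" "v <= v1" "cut (elts c1) v = c" using Suc 1 2 by blast+
        have "kl (pr k' (pr v' c')) (pr k1 (pr v1 c1))" using P(5)[OF 2] 1(2) by (simp only: add.assoc)
        then have 4: "k' = k1 + 1" "v1 <= v'" "cut (elts c') v1 = c1" unfolding kl_def by auto
        have "cut (elts c') v = c" using cut_cut[OF elts_SS 3(2), of c'] 3(3) 4(3) by simp
        then show "k' = k + (d + 1) & v <= v' & cut (elts c') v = c" using 3 4 by (simp add: add.assoc)
      qed
    qed
    define G where "G = {i. EX n k v c. pr n (pr k (pr v c)) \<in> P & i \<in> elts c}"
    have G: "G \<in> SS" unfolding G_def by (rule dfm_SS) (intro dfm_intros dP)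
    have cutG: "cut G v = c" if p: "pr n (pr k (pr v c)) \<in> P" for n k v c
    proof (rule FinSet_eqI)
      have c: "FinSet c" "ALL i:elts c. i < v" using P(3)[OF p] unfolding kn_def by auto
      show "FinSet (cut G v)" "FinSet c" using G c by auto
      have "i \<in> elts c" if i: "i \<in> G" "i < v" for i
      proof -
        obtain n' k' v' c' where p': "pr n' (pr k' (pr v' c')) \<in> P" "i \<in> elts c'" using i(1) unfolding G_def by blast
        show ?thesis
        proof (cases "n <= n'")
          case True
          then obtain d where "n' = n + d" using le_iff_add by blast
          then have "cut (elts c') v = c" using * p p' by blast
          then show ?thesis using elts_cut[OF elts_SS, of c' v] p'(2) i by auto
        next
          case False
          then obtain d where "n = n' + d" using le_iff_add[of n' n] by auto
          then have "cut (elts c) v' = c'" using * p p' by blast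
          then show ?thesis using elts_cut[OF elts_SS, of c v'] p'(2) i by auto
        qed
      qed
      moreover have "i \<in> G" if "i \<in> elts c" for i using p that unfolding G_def by blast
      ultimately show "elts (cut G v) = elts c" using c unfolding elts_cut[OF G] by blast
    qed
    have "EX w. B z w (cut G w)" for z
    proof -
      \<comment> \<open>The branch may start at any level \<open>k0\<close>; in any case, the level
        of its entry with number \<open>z + 1\<close> exceeds \<open>z\<close>.\<close>
      obtain k0 v0 c0 where p0: "pr 0 (pr k0 (pr v0 c0)) \<in> P" using node by blast
      obtain k v c where p: "pr (0 + (z + 1)) (pr k (pr v c)) \<in> P" "ALL z<k. EX w<=v. B z w (cut (elts c) w)" using node by blast
      have "k = k0 + (z + 1)" using * p p0 by blast
      then have "z + 1 <= k" by simp
      then have "z < k" using Suc_le by simp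
      then obtain w where "w <= v" "B z w (cut (elts c) w)" using p by blast
      moreover have "cut (elts c) w = cut G w" using cut_cut[OF G \<open>w <= v\<close>] cutG[OF p(1)] by simp
      ultimately show ?thesis by auto
    qed
    then show False using nG G by blast
  qed
  then show "mwf (kn B) kl" using wellf_iff_mwf[of kl] by (simp add: dfm_intros)
qed

text \<open>\<open>K1\<close> and \<open>K2\<close> are the formulas of the shapes \<open>\<exists>w. B(w, G \<inter> w)\<close> and \<open>\<forall>z \<exists>w. B(z, w, G \<inter> w)\<close>,
  where \<open>B\<close> is arithmetical in parameters other than \<open>G\<close>.\<close>

definition K1w :: "(N => N => (nat => N) => bool) => ((nat => N) => N set => bool) => bool" where
  "K1w B P <-> dfm (%e. B (e 0) (e (Suc 0)) (%i. e (Suc (Suc i))))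
     & (ALL e. ALL G:SS. P e G <-> (EX w. B w (cut G w) e))"

definition K1 :: "((nat => N) => N set => bool) => bool" where
  "K1 P <-> (EX B. K1w B P)"

definition K2w :: "(N => (nat => N) => N set => bool) => ((nat => N) => N set => bool) => bool" where
  "K2w Q P <-> K1 (%e G. Q (e 0) (%i. e (Suc i)) G) & (ALL e. ALL G:SS. P e G <-> (ALL z. Q z e G))"

definition K2 :: "((nat => N) => N set => bool) => bool" where
  "K2 P <-> (EX Q. K2w Q P)"

named_theorems K_intros

lemma K1I: "dfm (%e. B (e 0) (e (Suc 0)) (%i. e (Suc (Suc i)))) ==> (!!e G. G \<in> SS ==> P e G <-> (EX w. B w (cut G w) e)) ==> K1 P"
  unfolding K1_def K1w_def by blast

lemma K1wD: "K1w B P ==> dfm (%e. B (e 0) (e (Suc 0)) (%i. e (Suc (Suc i))))"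
  "K1w B P ==> G \<in> SS ==> P e G <-> (EX w. B w (cut G w) e)"
  unfolding K1w_def by blast+

lemma K1_ren: assumes "K1 P" shows "K1 (%e G. P (%i. e (f i)) G)"
proof -
  obtain B where "K1w B P" using assms unfolding K1_def by blast
  note B = K1wD[OF this]
  show ?thesis
    by (rule K1I[of "%w c e. B w c (%i. e (f i))"]) (use B(2) dfm_ctx2[OF B(1), of "%e. e 0" "%e. e (Suc 0)" "%i. Suc (Suc (f i))"] in \<open>auto simp: dfm_intros\<close>)
qed

lemma K1_dfm: assumes "dfm D" shows "K1 (%e G. D e)"
  by (rule K1I[of "%w c. D"]) (use dfm_ren[OF assms, of "%i. Suc (Suc i)"] in auto)

lemma K1_mem [K_intros]: assumes t: "dtm t" shows "K1 (%e G. t e \<in> G)"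
proof (rule K1I[of "%w c e. t e \<in> elts c"])
  show "dfm (%e. t (%i. e (Suc (Suc i))) \<in> elts (e (Suc 0)))" by (intro dfm_intros dtm_ren[OF t])
  show "t e \<in> G <-> (EX w. t e \<in> elts (cut G w))" if "G \<in> SS" for e G
    using that by (auto intro: exI[of _ "t e + 1"] simp: less_Suc)
qed

text \<open>The bound \<open>t e < w\<close> matters, because the segment below \<open>w\<close>
  carries no information about numbers from \<open>w\<close> on.\<close>

lemma K1_notmem [K_intros]: assumes t: "dtm t" shows "K1 (%e G. t e \<notin> G)"
proof (rule K1I[of "%w c e. t e < w & t e \<notin> elts c"])
  show "dfm (%e. t (%i. e (Suc (Suc i))) < e 0 & t (%i. e (Suc (Suc i))) \<notin> elts (e (Suc 0)))" by (intro dfm_intros dtm_ren[OF t])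
  show "t e \<notin> G <-> (EX w. t e < w & t e \<notin> elts (cut G w))" if "G \<in> SS" for e G
    using that by (auto intro: exI[of _ "t e + 1"] simp: less_Suc)
qed

lemma K1_or [K_intros]: assumes "K1 P" "K1 Q" shows "K1 (%e G. P e G | Q e G)"
proof -
  obtain B where "K1w B P" using assms(1) unfolding K1_def by blast
  note B = K1wD[OF this]
  obtain C where "K1w C Q" using assms(2) unfolding K1_def by blast
  note C = K1wD[OF this]
  show ?thesis
    by (rule K1I[of "%w c e. B w c e | C w c e"]) (use B(2) C(2) in \<open>auto intro: dfm_or[OF B(1) C(1)]\<close>)
qed

text \<open>One number \<open>w\<close> has to bound both the witness \<open>y\<close> and the
  length \<open>u\<close> of the segment that is inspected for it; \<open>cut_cut\<close> recovers
  the shorter segment from the longer one.\<close>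

lemma K1_ex [K_intros]: assumes "K1 (%e G. P (e 0) (%i. e (Suc i)) G)" shows "K1 (%e G. EX y. P y e G)"
proof -
  obtain B where "K1w B (%e. P (e 0) (%i. e (Suc i)))" using assms unfolding K1_def by blast
  note B = K1wD[OF this]
  define C where "C = (%w c e. EX y u. y <= w & u <= w & B u (cut (elts c) u) (case_nat y e))"
  show ?thesis
  proof (rule K1I[of C])
    have eq: "(%i. (case i of 0 => e (Suc 0) | Suc j => e (Suc (Suc (Suc (Suc j)))))) = (%i. e (if i = 0 then Suc 0 else Suc (Suc (Suc i))))" for e :: "nat => N"
      by (auto split: nat.split)
    show "dfm (%e. C (e 0) (e (Suc 0)) (%i. e (Suc (Suc i))))"
      unfolding C_def by (intro dfm_intros, unfold eq) (intro dfm_ctx2[OF B(1)] dfm_intros)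
    fix e G assume G: "G \<in> SS"
    show "(EX y. P y e G) <-> (EX w. C w (cut G w) e)"
    proof
      assume "EX y. P y e G"
      then obtain y where "P y e G" by blast
      then obtain u where u: "B u (cut G u) (case_nat y e)" using B(2)[OF G, of "case_nat y e"] by auto
      have "u <= max y u" by simp
      from cut_cut[OF G this] have "B u (cut (elts (cut G (max y u))) u) (case_nat y e)" using u by simp
      then show "EX w. C w (cut G w) e" unfolding C_def by (intro exI[of _ "max y u"] exI[of _ y] exI[of _ u]) auto
    next
      assume "EX w. C w (cut G w) e"
      then obtain w y u where "u <= w" "B u (cut (elts (cut G w)) u) (case_nat y e)" unfolding C_def by blast
      then have "B u (cut G u) (case_nat y e)" using cut_cut[OF G] by simp
      then show "EX y. P y e G" using B(2)[OF G, of "case_nat y e"] by auto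
    qed
  qed
qed

lemma K1_and [K_intros]: assumes "K1 P" "K1 Q" shows "K1 (%e G. P e G & Q e G)"
proof -
  obtain B where "K1w B P" using assms(1) unfolding K1_def by blast
  note B = K1wD[OF this]
  obtain C where "K1w C Q" using assms(2) unfolding K1_def by blast
  note C = K1wD[OF this]
  define D where "D = (%w c e. (EX u. u <= w & B u (cut (elts c) u) e) & (EX u. u <= w & C u (cut (elts c) u) e))"
  show ?thesis
  proof (rule K1I[of D])
    show "dfm (%e. D (e 0) (e (Suc 0)) (%i. e (Suc (Suc i))))"
      unfolding D_def by (intro dfm_intros dfm_ctx2[OF B(1)] dfm_ctx2[OF C(1)])
    fix e G assume G: "G \<in> SS"
    show "P e G & Q e G <-> (EX w. D w (cut G w) e)"
    proof
      assume "P e G & Q e G"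
      then obtain u v where uv: "B u (cut G u) e" "C v (cut G v) e" using B(2) C(2) G by blast
      have "u <= max u v" "v <= max u v" by auto
      then have "D (max u v) (cut G (max u v)) e" unfolding D_def using uv cut_cut[OF G] by metis
      then show "EX w. D w (cut G w) e" by blast
    next
      assume "EX w. D w (cut G w) e"
      then obtain w u v where "u <= w" "v <= w" "B u (cut (elts (cut G w)) u) e" "C v (cut (elts (cut G w)) v) e" unfolding D_def by blast
      then have "B u (cut G u) e" "C v (cut G v) e" using cut_cut[OF G] by simp_all
      then show "P e G & Q e G" using B(2) C(2) G by blast
    qed
  qed
qed

lemma K2I: "K1 (%e G. Q (e 0) (%i. e (Suc i)) G) ==> (!!e G. G \<in> SS ==> P e G <-> (ALL z. Q z e G)) ==> K2 P"
  unfolding K2_def K2w_def by blast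

lemma K2wD: "K2w Q P ==> K1 (%e G. Q (e 0) (%i. e (Suc i)) G)"
  "K2w Q P ==> G \<in> SS ==> P e G <-> (ALL z. Q z e G)"
  unfolding K2w_def by blast+

lemma K2_K1: assumes "K1 P" shows "K2 P"
  by (rule K2I[of "%z. P"]) (use K1_ren[OF assms, of Suc] in auto)

lemma K2_and: assumes "K2 P" "K2 Q" shows "K2 (%e G. P e G & Q e G)"
proof -
  obtain B where "K2w B P" using assms(1) unfolding K2_def by blast
  note B = K2wD[OF this]
  obtain C where "K2w C Q" using assms(2) unfolding K2_def by blast
  note C = K2wD[OF this]
  show ?thesis
    by (rule K2I[of "%z e G. B z e G & C z e G"]) (use B(2) C(2) in \<open>auto intro: K1_and[OF B(1) C(1)]\<close>)
qed

text \<open>Two universal quantifiers are merged by pairing; a number that is not a pair imposes no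
  condition.\<close>

lemma K2_all: assumes "K2 (%e G. P (e 0) (%i. e (Suc i)) G)" shows "K2 (%e G. ALL y. P y e G)"
proof -
  obtain B where "K2w B (%e. P (e 0) (%i. e (Suc i)))" using assms unfolding K2_def by blast
  note B = K2wD[OF this]
  define C where "C x e G <-> (ALL y z. x ~= pr y z) | (EX y z. x = pr y z & B z (case_nat y e) G)" for x e G
  show ?thesis
  proof (rule K2I[of C])
    have "dfm (%e. ALL y z. e 0 ~= pr y z)" by (intro dfm_intros)
    moreover have "K1 (%e G. B (e 0) (case_nat (e (Suc 0)) (%i. e (Suc (Suc (Suc i))))) G)"
    proof -
      have eq: "(%i. e (Suc (Suc (case i of 0 => n | Suc j => f j)))) = case_nat (e (Suc (Suc n))) (%i. e (Suc (Suc (f i))))" for e :: "nat => N" and f n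
        by (auto split: nat.split)
      have "K1 (%e G. B (e 0) (%i. e (case i of 0 => Suc 0 | Suc j => Suc (Suc (Suc j)))) G)"
        using K1_ren[OF B(1), of "%i. case i of 0 => 0 | Suc j => (case j of 0 => Suc 0 | Suc j => Suc (Suc (Suc j)))"] by simp
      moreover have "(%i. e (case i of 0 => Suc 0 | Suc j => Suc (Suc (Suc j)))) = case_nat (e (Suc 0)) (%i. e (Suc (Suc (Suc i))))" for e :: "nat => N"
        by (auto split: nat.split)
      ultimately show ?thesis by simp
    qed
    moreover have "dfm (%e. e (Suc (Suc 0)) = pr (e (Suc 0)) (e 0))" by (intro dfm_intros)
    ultimately show "K1 (%e G. C (e 0) (%i. e (Suc i)) G)"
      unfolding C_def by (intro K_intros K1_dfm)
    fix e G assume G: "G \<in> SS"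
    show "(ALL y. P y e G) <-> (ALL z. C z e G)"
    proof
      assume "ALL y. P y e G"
      then have "B z (case_nat y e) G" for y z using B(2)[OF G, of "case_nat y e"] by auto
      then show "ALL z. C z e G" unfolding C_def by blast
    next
      assume *: "ALL z. C z e G"
      have "B z (case_nat y e) G" for y z using *[rule_format, of "pr y z"] unfolding C_def by auto
      then show "ALL y. P y e G" using B(2)[OF G, of "case_nat y e" for y] by auto
    qed
  qed
qed

section \<open>Bar induction for \<open>\<Pi>\<^sup>1\<^sub>1\<close>-formulas\<close>

lemma dfm_sub4:
  assumes C: "dfm (%e. C (e 0) (e (Suc 0)) (e (Suc (Suc 0))) (e (Suc (Suc (Suc 0)))))"
    and t: "dtm x" "dtm z" "dtm w" "dtm c"
  shows "dfm (%e. C (x e) (z e) (w e) (c e))"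
proof -
  have "dfm (%e. EX y4 y3 y2 y1. x e = y1 & z e = y2 & w e = y3 & c e = y4 & C y1 y2 y3 y4)"
    by (intro dfm_intros dtm_ren[OF t(1)] dtm_ren[OF t(2)] dtm_ren[OF t(3)] dtm_ren[OF t(4)] C)
  then show ?thesis by simp
qed

lemma wfbar_K2:
  assumes bar: wfbar and K: "K2 (%e. P (e 0))" and XR: "X \<in> SS" "R \<in> SS" "wellord X R"
    and prog: "!!x. x \<in> X ==> (!!y. y \<in> X ==> pr y x \<in> R ==> ~ (EX G:SS. P y G)) ==> ~ (EX G:SS. P x G)"
    and x: "x \<in> X"
  shows "~ (EX G:SS. P x G)"
proof -
  obtain Q where "K2w Q (%e. P (e 0))" using K unfolding K2_def by blast
  note Q = K2wD[OF this]
  obtain B where "K1w B (%e. Q (e 0) (%i. e (Suc i)))" using Q(1) unfolding K1_def by blast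
  note B = K1wD[OF this]
  define C where "C x z w c = B w c (case_nat z (%i. x))" for x z w c
  have PC: "P x G <-> (ALL z. EX w. C x z w (cut G w))" if G: "G \<in> SS" for x G
  proof -
    have "P x G <-> (ALL z. Q z (%i. x) G)" using Q(2)[OF G, of "%i. x"] by simp
    also have "\<dots> <-> (ALL z. EX w. C x z w (cut G w))" unfolding C_def using B(2)[OF G, of "case_nat z (%i. x)" for z] by simp
    finally show ?thesis .
  qed
  have "(%i. e (if i = 0 then Suc 0 else 0)) = case_nat (e (Suc 0)) (%i. e 0)" for e :: "nat => N"
    by (auto split: nat.split)
  then have C: "dfm (%e. C (e 0) (e (Suc 0)) (e (Suc (Suc 0))) (e (Suc (Suc (Suc 0)))))"
    using dfm_ctx2[OF B(1), of "%e. e (Suc (Suc 0))" "%e. e (Suc (Suc (Suc 0)))" "%i. if i = 0 then Suc 0 else 0"]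
    by (simp add: C_def dfm_intros)
  note dC = dfm_sub4[OF C]
  have w: "mwf (kn (C x)) kl <-> ~ (EX G:SS. P x G)" for x
    using kleene_normal_form[of "C x"] dC[of "%e. x" "%e. e 0" "%e. e (Suc 0)" "%e. e (Suc (Suc 0))"] PC
    by (simp add: dfm_intros)
  have X: "dp1 (%x. x \<in> X)" "dp2 (%x y. pr x y \<in> R)" by (intro dfm_mem dfm_intros XR)+
  have L: "linord (%x. x \<in> X) (%x y. pr x y \<in> R)" "mwf (%x. x \<in> X) (%x y. pr x y \<in> R)"
    using XR(3) wellf_iff_mwf[OF X(2)] unfolding wellord_def by blast+
  have "mwf (kn (C x)) kl"
  proof (rule wfbar_induct[OF bar X L, of "%x. kn (C x)" "%x. kl"])
    show "dp2 (%x. kn (C x))" unfolding kn_def by (intro dfm_intros dC)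
    show "dfm (%e. kl (e (Suc 0)) (e (Suc (Suc 0))))" by (intro dfm_intros)
    fix y assume y: "y \<in> X" and IH: "!!z. z \<in> X ==> pr z y \<in> R ==> mwf (kn (C z)) kl"
    have "~ (EX G:SS. P z G)" if "z \<in> X" "pr z y \<in> R" for z using IH[OF that] w by simp
    from prog[OF y this] show "mwf (kn (C y)) kl" unfolding w .
  qed (rule x)
  then show ?thesis using w by blast
qed

lemma dfm_sassign [dfm_intros]: "dtm s ==> dfm (%e. sassign (s e))"
  by (rule dfm_sub1[of sassign]) (unfold sassign_def, intro dfm_intros)

lemma dfm_slookup [dfm_intros]: "dtm s ==> dtm i ==> dtm x ==> dfm (%e. slookup (s e) (i e) (x e))"
  by (rule dfm_sub3[of slookup]) (unfold slookup_def, intro dfm_intros)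

lemma dfm_spush [dfm_intros]: "dtm s ==> dtm i ==> dtm x ==> dfm (%e. spush (s e) (i e) (x e))"
  by (rule dfm_sub3[of spush]) (unfold spush_def, intro dfm_intros)

definition vbase :: "N => N => N => bool" where
  "vbase t s x <-> (EX i. t = pr 0 i & slookup s i x) | (t = pr (0 + 1) 0 & x = 0) | (t = pr N2 0 & x = 1)"

definition vstep :: "N => N => N => N => N => N => bool" where
  "vstep t x u v y z <-> (t = pr N3 (pr u v) & x = y + z) | (t = pr N4 (pr u v) & x = y * z)"

text \<open>A normal form from which \<open>K2\<close> can be read off: apart from parts that do not
  mention \<open>V\<close>, no universal quantifier is in the scope of an existential one.\<close>

lemma seval_nnf: "seval V <->
    (ALL t s x. ~ sassign s | pr t (pr s x) \<notin> V | vbase t s x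
      | (EX u v y z. pr u (pr s y) \<in> V & pr v (pr s z) \<in> V & vstep t x u v y z))
  & (ALL t s x. ~ sassign s | pr t (pr s x) \<in> V | ~ vbase t s x)
  & (ALL t s x u v y z. ~ sassign s | pr t (pr s x) \<in> V | pr u (pr s y) \<notin> V | pr v (pr s z) \<notin> V | ~ vstep t x u v y z)"
proof -
  have "seval V <-> (ALL t s x. sassign s --> (pr t (pr s x) \<in> V <-> vbase t s x
      | (EX u v y z. pr u (pr s y) \<in> V & pr v (pr s z) \<in> V & vstep t x u v y z)))"
    unfolding seval_def vbase_def vstep_def disj_assoc ..
  then show ?thesis by blast
qed

text \<open>The sets \<open>Y\<close>, \<open>V\<close> and \<open>S\<close> of the truth definition
  are bundled as the sections 0, 1 and 2 of a single set \<open>G\<close>.\<close>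

lemma K2_seval: "K2 (%e G. seval {p. pr 1 p \<in> G})"
proof -
  have 1: "dfm (%e. vbase (t e) (s e) (x e))" if "dtm t" "dtm s" "dtm x" for t s x
    by (rule dfm_sub3[OF _ that]) (unfold vbase_def, intro dfm_intros)
  have 2: "dfm (%e. vstep (t e) (x e) (u e) (v e) (y e) (z e))"
    if "dtm t" "dtm x" "dtm u" "dtm v" "dtm y" "dtm z" for t x u v y z
    unfolding vstep_def by (intro dfm_intros that)
  show ?thesis
    unfolding seval_nnf mem_Collect_eq
    by (intro K2_and K2_all K2_K1) (intro K_intros dfm_intros | rule K1_dfm, intro dfm_intros 1 2)+
qed

definition sat1 :: "N => N => N => N => N => bool" where
  "sat1 q t u x y <-> (q = pr (0 + 1) (pr t u) & x = y) | (q = pr N2 (pr t u) & x < y)"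

definition satR :: "N => N => N set => N set => N set => N set => bool" where
  "satR q s Y A V S <-> (EX t u x y. pr t (pr s x) \<in> V & pr u (pr s y) \<in> V & sat1 q t u x y)
     | (EX t j x. q = pr N3 (pr t j) & pr t (pr s x) \<in> V
        & ((j = 0 & x \<in> Y) | (EX i. j = i + 1 & pr i x \<in> A)))
     | (EX r r'. q = pr N4 (pr r r') & (pr r s \<in> S --> pr r' s \<in> S))
     | (EX r. q = pr (N4 + 1) r & (ALL x s'. spush x s s' --> pr r s' \<in> S))"

lemma ssat_iff: "ssat p Y A V S <-> (ALL q s. (q < p | q = p) & sassign s --> (pr q s \<in> S <-> satR q s Y A V S))"
  unfolding ssat_def satR_def sat1_def ..

lemma ssat_nnf: "ssat p Y A V S <->
    (ALL q s x s'. ~ ((q < p | q = p) & sassign s) | pr q s \<notin> S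
     | (EX t u x y. pr t (pr s x) \<in> V & pr u (pr s y) \<in> V & sat1 q t u x y)
     | (EX t j x. q = pr N3 (pr t j) & pr t (pr s x) \<in> V
        & ((j = 0 & x \<in> Y) | (EX i. j = i + 1 & pr i x \<in> A)))
     | (EX r r'. q = pr N4 (pr r r') & (pr r s \<notin> S | pr r' s \<in> S))
     | (EX r. q = pr (N4 + 1) r & (~ spush x s s' | pr r s' \<in> S)))
  & (ALL q s t u x y. ~ ((q < p | q = p) & sassign s) | pr q s \<in> S
     | pr t (pr s x) \<notin> V | pr u (pr s y) \<notin> V | ~ sat1 q t u x y)
  & (ALL q s t j x. ~ ((q < p | q = p) & sassign s) | pr q s \<in> S
     | q ~= pr N3 (pr t j) | pr t (pr s x) \<notin> V | ((~ j = 0 | x \<notin> Y) & ~ (EX i. j = i + 1 & pr i x \<in> A)))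
  & (ALL q s r r'. ~ ((q < p | q = p) & sassign s) | pr q s \<in> S
     | q ~= pr N4 (pr r r') | (pr r s \<in> S & pr r' s \<notin> S))
  & (ALL q s r. ~ ((q < p | q = p) & sassign s) | pr q s \<in> S
     | q ~= pr (N4 + 1) r | (EX x s'. spush x s s' & pr r s' \<notin> S))" (is "_ <-> ?a & ?b & ?c & ?d & ?e")
proof -
  \<comment> \<open>Since \<open>q\<close> determines \<open>r\<close>, the universal quantifiers
    can be moved in front of the existential one.\<close>
  have u: "(EX r. q = pr (N4 + 1) r & (ALL x s'. ~ spush x s s' | pr r s' \<in> S)) <->
    (ALL x s'. EX r. q = pr (N4 + 1) r & (~ spush x s s' | pr r s' \<in> S))" for q s
    by (cases "EX r. q = pr (N4 + 1) r") auto
  have g1: "(ALL q s. a q s | b q s | r1 q s | r2 q s | r3 q s | (ALL x s'. z q s x s')) <->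
    (ALL q s x s'. a q s | b q s | r1 q s | r2 q s | r3 q s | z q s x s')" for a b r1 r2 r3 :: "N => N => bool" and z by blast
  have g2: "(ALL q s. a q s | b q s | ~ ((EX t u x y. r1 q s t u x y) | (EX t j x. r2 q s t j x) | (EX r r'. r3 q s r r') | (EX r. r4 q s r))) <->
    (ALL q s t u x y. a q s | b q s | ~ r1 q s t u x y) & (ALL q s t j x. a q s | b q s | ~ r2 q s t j x)
    & (ALL q s r r'. a q s | b q s | ~ r3 q s r r') & (ALL q s r. a q s | b q s | ~ r4 q s r)"
    for a b :: "N => N => bool" and r1 :: "N => N => N => N => N => N => bool" and r2 :: "N => N => N => N => N => bool"
      and r3 :: "N => N => N => N => bool" and r4 :: "N => N => N => bool" by blast
  have "ssat p Y A V S <->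
      (ALL q s. ~ ((q < p | q = p) & sassign s) | pr q s \<notin> S | satR q s Y A V S)
    & (ALL q s. ~ ((q < p | q = p) & sassign s) | pr q s \<in> S | ~ satR q s Y A V S)"
    unfolding ssat_iff by blast
  also have "(ALL q s. ~ ((q < p | q = p) & sassign s) | pr q s \<notin> S | satR q s Y A V S) <-> ?a"
    unfolding satR_def imp_conv_disj u g1 ..
  also have "(ALL q s. ~ ((q < p | q = p) & sassign s) | pr q s \<in> S | ~ satR q s Y A V S) <-> ?b & ?c & ?d & ?e"
    unfolding satR_def g2 by (intro arg_cong2[where f = "(&)"] all_cong1) blast+
  finally show ?thesis .
qed

lemma K2_ssat: assumes A: "A \<in> SS" shows "K2 (%e G. ssat p {p. pr 0 p \<in> G} A {p. pr 1 p \<in> G} {p. pr N2 p \<in> G})"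
proof -
  have 1: "dfm (%e. sat1 (t e) (x e) (u e) (v e) (y e))"
    if "dtm t" "dtm x" "dtm u" "dtm v" "dtm y" for t x u v y
    unfolding sat1_def by (intro dfm_intros that)
  show ?thesis
    unfolding ssat_nnf mem_Collect_eq
    by (intro K2_and K2_all K2_K1) (intro K_intros dfm_intros | rule K1_dfm, intro dfm_intros 1 dfm_mem A)+
qed

definition push :: "N => N => N" where
  "push x s = code {p. p = pr 0 x | (EX i y. p = pr (i + 1) y & pr i y \<in> elts s)}"

lemma coded_push: "coded_set {p. p = pr 0 x | (EX i y. p = pr (i + 1) y & pr i y \<in> elts s)}"
proof -
  define f where "f q = the0 (%p. EX i y. q = pr i y & p = pr (i + 1) y)" for q
  have d: "df1 f" unfolding f_def by (intro dfm_intros)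
  have f: "f (pr j z) = pr (j + 1) z" for j z unfolding f_def by (rule the0_equality) auto
  have "{p. p = pr 0 x | (EX i y. p = pr (i + 1) y & pr i y \<in> elts s)} = insert (pr 0 x) (f ` {q \<in> elts s. EX i y. q = pr i y})"
    using f by (force simp: image_iff)
  moreover have "coded_set {q \<in> elts s. EX i y. q = pr i y}" by (intro coded_set_sub dfm_intros) simp
  ultimately show ?thesis using coded_set_image[OF _ d] by simp
qed

lemma elts_push [simp]: "elts (push x s) = {p. p = pr 0 x | (EX i y. p = pr (i + 1) y & pr i y \<in> elts s)}"
  unfolding push_def using coded_push by simp

lemma spush_iff: "spush x s s' <-> s' = push x s"
  unfolding spush_def isc_iff using coded_push FinSet_eqI[of s' "push x s"] by (auto simp: push_def)

lemma dtm_push [dfm_intros]: "dtm x ==> dtm s ==> dtm (%e. push (x e) (s e))"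
  by (rule dtm_sub2[of push]) (unfold push_def, intro dfm_intros)

lemma sassign_push: "sassign s ==> sassign (push x s)"
  unfolding sassign_def using coded_push by (auto simp: push_def)

lemma slookup_push: "slookup (push x s) 0 y <-> y = x" "slookup (push x s) (i + 1) y <-> slookup s i y"
  unfolding slookup_def by auto

text \<open>Falsity at \<open>x\<close> takes the form \<open>EX G:SS. P x G\<close> with
  \<open>P\<close> in \<open>K2\<close>. This only depends on the shape of the truth definition and
  is uniform in the code \<open>p\<close>; it thus covers non-standard codes, for which satisfaction
  sets need not exist.\<close>

theorem wfbar_imp_bar: assumes bar: wfbar shows sbar
  unfolding sbar_def spush_iff
proof (intro ballI allI impI)
  fix X R p s A x s'
  assume XR: "X \<in> SS" "R \<in> SS" "wellord X R" and A: "A \<in> SS" and ps: "sPi11 p & sassign s" and x: "x \<in> X"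
    and s': "s' = push x s"
    and prog: "ALL x. x \<in> X --> (ALL y. y \<in> X & pr y x \<in> R --> (ALL s'. s' = push y s --> strue p s' A)) -->
            (ALL s'. s' = push x s --> strue p s' A)"
  obtain q where q: "p = pr (N4 + 1 + 1) q" using ps unfolding sPi11_def by blast
  define P where "P x G <-> seval {p. pr 1 p \<in> G} & ssat q {p. pr 0 p \<in> G} A {p. pr 1 p \<in> G} {p. pr N2 p \<in> G}
      & pr N2 (pr q (push x s)) \<notin> G" for x G
  have st: "strue p (push x s) A <-> ~ (EX G:SS. P x G)" for x
  proof
    assume *: "strue p (push x s) A"
    show "~ (EX G:SS. P x G)"
    proof
      assume "EX G:SS. P x G"
      then obtain G where G: "G \<in> SS" "P x G" by blast
      have "{p. pr i p \<in> G} \<in> SS" for i by (rule dfm_SS) (intro dfm_mem G dfm_intros)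
      then show False using * G(2) unfolding P_def strue_def q by auto
    qed
  next
    assume *: "~ (EX G:SS. P x G)"
    have "pr q (push x s) \<in> S" if Y: "Y \<in> SS" "V \<in> SS" "S \<in> SS" "seval V" "ssat q Y A V S" for Y V S
    proof (rule ccontr)
      assume n: "pr q (push x s) \<notin> S"
      define G where "G = {u. (EX p. u = pr 0 p & p \<in> Y) | (EX p. u = pr 1 p & p \<in> V) | (EX p. u = pr N2 p & p \<in> S)}"
      have "G \<in> SS" unfolding G_def by (rule dfm_SS) (intro dfm_intros dfm_mem Y)
      moreover have "{p. pr 0 p \<in> G} = Y" "{p. pr 1 p \<in> G} = V" "{p. pr N2 p \<in> G} = S" unfolding G_def by auto
      ultimately have "P x G" unfolding P_def using Y n by auto
      then show False using * \<open>G \<in> SS\<close> by blast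
    qed
    then show "strue p (push x s) A" unfolding strue_def q by auto
  qed
  have "K2 (%e. P (e 0))" unfolding P_def by (intro K2_and K2_seval K2_ssat A K2_K1 K_intros dfm_intros)
  then have "~ (EX G:SS. P x G)"
    by (rule wfbar_K2[OF bar _ XR _ x]) (use prog st in blast)
  then show "strue p s' A" using st s' by simp
qed

section \<open>The property of well-foundedness as a \<open>\<Pi>\<^sup>1\<^sub>1\<close>-formula\<close>

abbreviation cimp :: "N => N => N" where "cimp r q \<equiv> pr N4 (pr r q)"
abbreviation call :: "N => N" where "call r \<equiv> pr (N4 + 1) r"
abbreviation cmem :: "N => N => N" where "cmem t j \<equiv> pr N3 (pr t j)"
abbreviation cadd :: "N => N => N" where "cadd t u \<equiv> pr N3 (pr t u)"
abbreviation cmul :: "N => N => N" where "cmul t u \<equiv> pr N4 (pr t u)"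
abbreviation cfalse :: N where "cfalse \<equiv> pr 0 0"
abbreviation cvar :: "N => N" where "cvar i \<equiv> pr 0 i"
abbreviation cpair :: "N => N => N" where "cpair t u \<equiv> cadd (cmul (cadd t u) (cadd t u)) t"

text \<open>The common shape of \<open>stm\<close> and \<open>sarith\<close>.\<close>

definition wfcode :: "(N => (N => bool) => bool) => N => bool" where
  "wfcode F p <-> (EX C:SS. p \<in> C & (ALL q. q \<in> C --> F q (%r. r \<in> C)))"

lemma wfcodeI: "C \<in> SS ==> p \<in> C ==> (!!q. q \<in> C ==> F q (%r. r \<in> C)) ==> wfcode F p"
  unfolding wfcode_def by blast

lemma wfcode_step:
  assumes mono: "!!q C D. F q C ==> (!!r. C r ==> D r) ==> F q D"
    and r: "wfcode F r" "wfcode F r'" and c: "F c (%q. q = r | q = r')" shows "wfcode F c"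
proof -
  obtain C where C: "C \<in> SS" "r \<in> C" "!!q. q \<in> C ==> F q (%r. r \<in> C)" using r(1) unfolding wfcode_def by blast
  obtain D where D: "D \<in> SS" "r' \<in> D" "!!q. q \<in> D ==> F q (%r. r \<in> D)" using r(2) unfolding wfcode_def by blast
  show ?thesis
  proof (rule wfcodeI[of "{x. x = c | x \<in> C | x \<in> D}"])
    show "{x. x = c | x \<in> C | x \<in> D} \<in> SS" by (rule dfm_SS) (intro dfm_intros dfm_mem C D)
    fix q assume q: "q \<in> {x. x = c | x \<in> C | x \<in> D}"
    consider "q = c" | "q \<in> C" | "q \<in> D" using q by blast
    then show "F q (%r. r \<in> {x. x = c | x \<in> C | x \<in> D})"
    proof cases
      case 1 show ?thesis unfolding 1 by (rule mono[OF c]) (use C(2) D(2) in blast)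
    next
      case 2 show ?thesis by (rule mono[OF C(3)[OF 2]]) blast
    next
      case 3 show ?thesis by (rule mono[OF D(3)[OF 3]]) blast
    qed
  qed simp
qed

lemma wfcode_atom:
  assumes mono: "!!q C D. F q C ==> (!!r. C r ==> D r) ==> F q D" and c: "F c (%q. False)" shows "wfcode F c"
proof (rule wfcodeI[of "{x. x = c}"])
  show "{x. x = c} \<in> SS" by (rule dfm_SS) (intro dfm_intros)
  show "F q (%r. r \<in> {x. x = c})" if "q \<in> {x. x = c}" for q using mono[OF c] that by simp
qed simp

definition ctm :: "N => (N => bool) => bool" where
  "ctm u E <-> (EX i. u = pr 0 i) | u = pr (0 + 1) 0 | u = pr N2 0
     | (EX v w. (u = pr N3 (pr v w) | u = pr N4 (pr v w)) & E v & E w)"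

definition cform :: "N => (N => bool) => bool" where
  "cform q C <-> q = pr 0 0
     | (EX t u. (q = pr (0 + 1) (pr t u) | q = pr N2 (pr t u)) & stm t & stm u)
     | (EX t j. q = pr N3 (pr t j) & stm t)
     | (EX r r'. q = pr N4 (pr r r') & C r & C r')
     | (EX r. q = pr (N4 + 1) r & C r)"

lemma stm_iff: "stm = wfcode ctm"
  unfolding fun_eq_iff stm_def wfcode_def ctm_def by (intro allI) (rule refl)

lemma sarith_iff: "sarith = wfcode cform"
  unfolding fun_eq_iff sarith_def wfcode_def cform_def by (intro allI) (rule refl)

lemma ctm_mono: "ctm q C ==> (!!r. C r ==> D r) ==> ctm q D"
  unfolding ctm_def by (elim disj_forward ex_forward conj_forward)

lemma cform_mono: "cform q C ==> (!!r. C r ==> D r) ==> cform q D"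
  unfolding cform_def by (elim disj_forward ex_forward conj_forward)

lemma stm_intros: "stm (cvar i)" "stm t ==> stm u ==> stm (cadd t u)" "stm t ==> stm u ==> stm (cmul t u)"
  unfolding stm_iff
  using wfcode_atom[where F = ctm and c = "cvar i", OF ctm_mono] wfcode_step[where F = ctm and r = t and r' = u, OF ctm_mono]
  by (simp_all add: ctm_def)

lemma sarith_intros: "sarith cfalse" "stm t ==> sarith (cmem t j)" "sarith r ==> sarith r' ==> sarith (cimp r r')"
  "sarith r ==> sarith (call r)"
proof -
  show "sarith cfalse"
    unfolding sarith_iff by (rule wfcode_atom[where F = cform, OF cform_mono]) (auto simp: cform_def)
  show "stm t ==> sarith (cmem t j)"
    unfolding sarith_iff by (rule wfcode_atom[where F = cform, OF cform_mono]) (auto simp: cform_def)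
  show "sarith r ==> sarith r' ==> sarith (cimp r r')"
    unfolding sarith_iff by (rule wfcode_step[where F = cform and r = r and r' = r', OF cform_mono]) (auto simp: cform_def)
  show "sarith r ==> sarith (call r)"
    unfolding sarith_iff by (rule wfcode_step[where F = cform and r = r and r' = r, OF cform_mono]) (auto simp: cform_def)
qed

lemma dfm_vbase [dfm_intros]: "dtm t ==> dtm s ==> dtm x ==> dfm (%e. vbase (t e) (s e) (x e))"
  by (rule dfm_sub3[of vbase]) (unfold vbase_def, intro dfm_intros)

section \<open>Evaluation of terms and satisfaction of formulas\<close>

text \<open>Values are shifted by one, so that the default 0 of \<open>the0\<close> stands for the
  absence of a value.\<close>

definition tvP :: "N => N => N => N => bool" where
  "tvP s t g y <-> (EX x. y = x + 1 & (vbase t s x | (EX u v a b. vstep t x u v a b & fapp g u = a + 1 & fapp g v = b + 1)))"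

definition tvH :: "N => N => N => N" where
  "tvH s t g = the0 (tvP s t g)"

definition tv :: "N => N => N" where
  "tv s = recur (tvH s)"

lemma dtm_tv [dfm_intros]: "dtm s ==> dtm t ==> dtm (%e. tv (s e) (t e))"
proof (rule dtm_sub2[of tv])
  show "dtm (%e. tv (e 0) (e (Suc 0)))"
    unfolding tv_def tvH_def tvP_def vstep_def
    by (rule dtm_recur[of "%t g e. the0 (%y. EX x. y = x + 1 & (vbase t (e 0) x | (EX u v a b. (t = pr N3 (pr u v) & x = a + b | t = pr N4 (pr u v) & x = a * b)
      & fapp g u = a + 1 & fapp g v = b + 1)))" "%e. e (Suc 0)"]) (intro dfm_intros)+
qed

lemma vstep_less: "vstep t x u v a b ==> u < t & v < t"
proof -
  have "u < pr (i + 1) (pr u v)" "v < pr (i + 1) (pr u v)" for i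
    using pr_gt[of "i + 1" "pr u v"] pr_ge1(1)[of u v] pr_ge1(2)[of v u] by (auto simp: less_Suc intro: le_less_trans)
  then show "vstep t x u v a b ==> u < t & v < t" unfolding vstep_def by blast
qed

lemma vbase_unique: "sassign s ==> vbase t s x ==> vbase t s y ==> x = y"
  unfolding vbase_def slookup_def sassign_def by auto

lemma vbase_vstep: "vbase t s x ==> ~ vstep t y u v a b"
  unfolding vbase_def vstep_def by auto

lemma tv_iff:
  assumes s: "sassign s"
  shows "tv s t = x + 1 <-> vbase t s x | (EX u v a b. vstep t x u v a b & tv s u = a + 1 & tv s v = b + 1)" (is "_ <-> ?R x")
proof -
  have H: "dtm (%e. tvH s (e 0) (e (Suc 0)))"
    unfolding tvH_def tvP_def vstep_def by (intro dfm_intros)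
  have fg: "fapp (gr t (tv s)) u = tv s u" if "u < t" for u
    using that by (intro fapp_gr dtm_tv dfm_intros)
  have P: "tvP s t (gr t (tv s)) y <-> (EX x. y = x + 1 & ?R x)" for y
  proof -
    have "vstep t x u v a b & fapp (gr t (tv s)) u = a + 1 & fapp (gr t (tv s)) v = b + 1 <->
       vstep t x u v a b & tv s u = a + 1 & tv s v = b + 1" for x u v a b
      using vstep_less[of t x u v a b] fg by auto
    then show ?thesis unfolding tvP_def by simp
  qed
  have uniq: "x = z" if "?R x" "?R z" for x z
  proof -
    have "~ vbase t s z" if "vstep t x u v a b" for x u v a b z using that vbase_vstep by blast
    moreover have "x = z" if "vstep t x u v a b" "tv s u = a + 1" "tv s v = b + 1" "vstep t z u' v' a' b'" "tv s u' = a' + 1" "tv s v' = b' + 1"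
      for x z u v a b u' v' a' b' using that unfolding vstep_def by auto
    ultimately show ?thesis using that vbase_unique[OF s] by metis
  qed
  have "tv s t = the0 (%y. EX x. y = x + 1 & ?R x)"
  proof -
    have "tv s t = tvH s t (gr t (tv s))" using recur_eq[OF H, of t] unfolding tv_def .
    then show ?thesis unfolding tvH_def ext[OF P] .
  qed
  moreover have "the0 (%y. EX x. y = x + 1 & ?R x) = x + 1 <-> ?R x"
  proof
    assume "?R x"
    then show "the0 (%y. EX x. y = x + 1 & ?R x) = x + 1" using uniq by (intro the0_equality) blast+
  next
    assume "the0 (%y. EX x. y = x + 1 & ?R x) = x + 1"
    then have "(EX z. x + 1 = z + 1 & ?R z) | x + 1 = 0" unfolding the0_eq by meson
    then show "?R x" by auto
  qed
  ultimately show ?thesis by simp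
qed

text \<open>In contrast to satisfaction, the evaluation of terms is given by one recursion in the
  model, for standard and non-standard codes alike.\<close>

definition VV :: "N set" where
  "VV = {p. EX t s x. p = pr t (pr s x) & tv s t = x + 1}"

lemma VV_SS: "VV \<in> SS"
  unfolding VV_def by (rule dfm_SS) (intro dfm_intros)

lemma seval_VV: "seval VV"
proof -
  have V: "pr t (pr s x) \<in> VV <-> tv s t = x + 1" for t s x unfolding VV_def by auto
  have "pr t (pr s x) \<in> VV <-> vbase t s x | (EX u v y z. pr u (pr s y) \<in> VV & pr v (pr s z) \<in> VV & vstep t x u v y z)"
    if "sassign s" for t s x
    unfolding V tv_iff[OF that, of t x] by blast
  then show ?thesis unfolding seval_nnf by blast
qed

lemma satR_cong: "(!!r s. r < q ==> pr r s \<in> S <-> pr r s \<in> S') ==> satR q s Y A V S <-> satR q s Y A V S'"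
proof -
  assume *: "!!r s. r < q ==> pr r s \<in> S <-> pr r s \<in> S'"
  have 1: "r < pr (i + 1) (pr r r') & r' < pr (i + 1) (pr r r')" for r r' i
    using pr_gt[of "i + 1" "pr r r'"] pr_ge1(1)[of r r'] pr_ge1(2)[of r' r] by (auto simp: less_Suc intro: le_less_trans)
  have 2: "r < pr (i + 1) r" for r i using pr_gt[of "i + 1" r] by (auto simp: less_Suc)
  have 3: "q = pr N4 (pr r r') & (pr r s \<in> S --> pr r' s \<in> S) <-> q = pr N4 (pr r r') & (pr r s \<in> S' --> pr r' s \<in> S')" for r r'
    using *[of r s] *[of r' s] 1[of r N3 r'] by metis
  have 4: "q = pr (N4 + 1) r & (ALL x s'. spush x s s' --> pr r s' \<in> S) <-> q = pr (N4 + 1) r & (ALL x s'. spush x s s' --> pr r s' \<in> S')" for r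
    using *[of r] 2[of r N4] by metis
  show ?thesis unfolding satR_def 3 4 ..
qed

lemma dfm_satR:
  assumes "Y \<in> SS" "A \<in> SS" "V \<in> SS" "S \<in> SS" and t: "dtm q" "dtm s" shows "dfm (%e. satR (q e) (s e) Y A V S)"
  by (rule dfm_sub2[OF _ t]) (unfold satR_def sat1_def, intro dfm_intros dfm_mem assms)

text \<open>Satisfaction sets exist for formulas with standard codes only.\<close>

lemma ex_ssat:
  assumes "Y \<in> SS" "A \<in> SS" "V \<in> SS" shows "EX S:SS. ssat (of_nat k) Y A V S"
proof -
  \<comment> \<open>This induction is over the natural numbers of the metatheory. It spends one
    instance of comprehension per step, with the previous \<open>S\<close> as parameter; the claim
    is not arithmetical and cannot be extended to all of \<open>N\<close> by
    \<open>N_induct\<close>.\<close>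
  have "EX S:SS. ALL q<of_nat k. ALL s. sassign s --> (pr q s \<in> S <-> satR q s Y A V S)" for k
  proof (induction k)
    case 0
    obtain S where "S \<in> SS" using assms by blast
    then show ?case by (intro bexI[of _ S]) simp
  next
    case (Suc k)
    then obtain S where S: "S \<in> SS" "!!q s. q < of_nat k ==> sassign s ==> pr q s \<in> S <-> satR q s Y A V S" by blast
    define S' where "S' = {p. EX q s. p = pr q s & (if q < of_nat k then p \<in> S else satR q s Y A V S)}"
    have S': "pr q s \<in> S' <-> (if q < of_nat k then pr q s \<in> S else satR q s Y A V S)" for q s unfolding S'_def by auto
    have "S' \<in> SS" unfolding S'_def if_bool_eq_conj by (rule dfm_SS) (intro dfm_intros dfm_mem dfm_satR assms S)
    moreover have "pr q s \<in> S' <-> satR q s Y A V S'" if q: "q < of_nat (Suc k)" and s: "sassign s" for q s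
    proof -
      have "q <= of_nat k" using q less_Suc[of q "of_nat k"] by (simp add: add.commute)
      then have "satR q s Y A V S' <-> satR q s Y A V S" by (intro satR_cong) (auto simp: S')
      then show ?thesis unfolding S' using S(2)[of q s] s by simp
    qed
    ultimately show ?case by blast
  qed
  from this[of "Suc k"] obtain S where S: "S \<in> SS" "ALL q<of_nat (Suc k). ALL s. sassign s --> (pr q s \<in> S <-> satR q s Y A V S)" by blast
  have "q < of_nat (Suc k) <-> q < of_nat k | q = of_nat k" for q :: N using less_Suc[of q "of_nat k"] by (auto simp: add.commute le_less)
  then have "ssat (of_nat k) Y A V S" unfolding ssat_iff using S(2) by blast
  then show ?thesis using S(1) by blast
qed

definition std :: "N => bool" where
  "std n <-> (EX k. n = of_nat k)"

lemma std_intros: "std 0" "std 1" "std m ==> std n ==> std (m + n)" "std m ==> std n ==> std (pr m n)"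
proof -
  show "std 0" unfolding std_def by (rule exI[of _ 0]) simp
  show "std 1" unfolding std_def by (rule exI[of _ 1]) simp
  assume "std m" "std n"
  then obtain k l where kl: "m = of_nat k" "n = of_nat l" unfolding std_def by blast
  show "std (m + n)" unfolding std_def kl by (rule exI[of _ "k + l"]) simp
  show "std (pr m n)" unfolding std_def pr_def kl by (rule exI[of _ "(k + l) * (k + l) + k"]) simp
qed

definition tvl :: "N set => N => N => N => bool" where
  "tvl V s t a <-> (ALL x. pr t (pr s x) \<in> V <-> x = a)"

lemma seval_iff: "seval V ==> sassign s ==> pr t (pr s x) \<in> V <-> vbase t s x
      | (EX u v y z. pr u (pr s y) \<in> V & pr v (pr s z) \<in> V & vstep t x u v y z)"
  unfolding seval_nnf by blast

lemma tvl_intros: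
  assumes V: "seval V" and s: "sassign s"
  shows "slookup s i a ==> tvl V s (cvar i) a"
    "tvl V s t a ==> tvl V s u b ==> tvl V s (cadd t u) (a + b)"
    "tvl V s t a ==> tvl V s u b ==> tvl V s (cmul t u) (a * b)"
proof -
  note eq = seval_iff[OF V s]
  show "slookup s i a ==> tvl V s (cvar i) a"
    unfolding tvl_def eq[of "cvar i"] using vbase_unique[OF s, of "cvar i"] by (auto simp: vbase_def vstep_def)
  have op: "tvl V s c d" if tu: "tvl V s t a" "tvl V s u b" and c: "!!x. ~ vbase c s x"
    "!!x u' v' y z. vstep c x u' v' y z <-> u' = t & v' = u & x = f y z" "d = f a b" for c d f
    unfolding tvl_def eq[of c] c(2,3) using c(1) tu[unfolded tvl_def] by metis
  show "tvl V s t a ==> tvl V s u b ==> tvl V s (cadd t u) (a + b)"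
    by (rule op[of _ "(+)"]) (auto simp: vbase_def vstep_def)
  show "tvl V s t a ==> tvl V s u b ==> tvl V s (cmul t u) (a * b)"
    by (rule op[of _ "(*)"]) (auto simp: vbase_def vstep_def)
qed

lemma tvl_pair: "seval V ==> sassign s ==> tvl V s t a ==> tvl V s u b ==> tvl V s (cpair t u) (pr a b)"
  unfolding pr_def[of a b] by (intro tvl_intros)

lemma ssat_simps:
  assumes S: "ssat p Y A V S" and s: "sassign s"
  shows "cfalse <= p ==> pr cfalse s \<notin> S"
    "cmem t 0 <= p ==> tvl V s t a ==> pr (cmem t 0) s \<in> S <-> a \<in> Y"
    "cmem t (i + 1) <= p ==> tvl V s t a ==> pr (cmem t (i + 1)) s \<in> S <-> pr i a \<in> A"
    "cimp r r' <= p ==> pr (cimp r r') s \<in> S <-> (pr r s \<in> S --> pr r' s \<in> S)"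
    "call r <= p ==> pr (call r) s \<in> S <-> (ALL x. pr r (push x s) \<in> S)"
proof -
  have eq: "pr q s \<in> S <-> satR q s Y A V S" if "q <= p" for q
    using S s that unfolding ssat_iff le_less by blast
  show "cfalse <= p ==> pr cfalse s \<notin> S" using eq[of cfalse] by (auto simp: satR_def sat1_def)
  show "cmem t 0 <= p ==> tvl V s t a ==> pr (cmem t 0) s \<in> S <-> a \<in> Y"
    using eq[of "cmem t 0"] by (auto simp: satR_def sat1_def tvl_def)
  show "cmem t (i + 1) <= p ==> tvl V s t a ==> pr (cmem t (i + 1)) s \<in> S <-> pr i a \<in> A"
    using eq[of "cmem t (i + 1)"] by (auto simp: satR_def sat1_def tvl_def)
  show "cimp r r' <= p ==> pr (cimp r r') s \<in> S <-> (pr r s \<in> S --> pr r' s \<in> S)"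
    using eq[of "cimp r r'"] by (auto simp: satR_def sat1_def)
  show "call r <= p ==> pr (call r) s \<in> S <-> (ALL x. pr r (push x s) \<in> S)"
    using eq[of "call r"] by (auto simp: satR_def sat1_def spush_iff)
qed

text \<open>Below both number quantifiers, variable 0 is \<open>y\<close>, variable 1 is
  \<open>m\<close> and variable 2 is the index \<open>x\<close>. Set variable 0 is the quantified
  set \<open>Y\<close>, and set variable 1 is the section of the parameter with index 0.\<close>

abbreviation cQ :: N where
  "cQ \<equiv> cmem (cpair (cvar N2) (cpair (cvar 0) (cvar (0 + 1)))) (0 + 1)"
abbreviation cB :: N where
  "cB \<equiv> call (cimp (cmem (cvar 0) 0) (cimp cQ cfalse))"
abbreviation cM :: N where
  "cM \<equiv> call (cimp (cmem (cvar 0) 0) (cimp cB cfalse))"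

text \<open>The matrix of a \<open>\<Pi>\<^sup>1\<^sub>1\<close>-formula that says: if \<open>Y\<close> has no minimal element with respect to the relation
  with index \<open>x\<close>, then \<open>Y\<close> is empty.\<close>

definition cwf :: N where
  "cwf = cimp cM (call (cimp (cmem (cvar 0) 0) cfalse))"

lemma sPi11_cwf: "sPi11 (pr (N4 + 1 + 1) cwf)"
proof -
  have "sarith cwf" unfolding cwf_def by (intro sarith_intros stm_intros)
  then show ?thesis unfolding sPi11_def by blast
qed

lemma std_cwf: "std cwf"
  unfolding cwf_def by (intro std_intros)

lemma pr_le: "r <= p ==> pr i q <= r ==> q <= p" "pr r q <= p ==> r <= p & q <= p"
  using pr_ge1 by (meson order_trans)+

lemma ssat_cwf:
  assumes V: "seval V" and S: "ssat cwf Y A V S" and s: "sassign s"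
  shows "pr cwf (push x s) \<in> S <-> ((ALL m. m \<in> Y --> ~ (ALL y. y \<in> Y --> pr 0 (pr x (pr y m)) \<notin> A)) --> (ALL n. n \<notin> Y))"
proof -
  \<comment> \<open>Tarski's clauses are available for codes up to \<open>cwf\<close> only, so each
    subformula has to be bounded.\<close>
  note le = order_trans[OF pr_ge1(2)] order_trans[OF pr_ge1(1)]
  have l1: "cwf <= cwf" "cM <= cwf" "call (cimp (cmem (cvar 0) 0) cfalse) <= cwf"
    unfolding cwf_def by (blast intro: order_refl le)+
  have l2: "cimp (cmem (cvar 0) 0) cfalse <= cwf" "cimp (cmem (cvar 0) 0) (cimp cB cfalse) <= cwf"
    using pr_le(2)[OF l1(2)] pr_le(2)[OF l1(3)] by blast+
  have l3: "cmem (cvar 0) 0 <= cwf" "cfalse <= cwf" "cimp cB cfalse <= cwf"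
    using pr_le(2)[OF l2(1)] pr_le(2)[OF l2(2)] pr_le(2) by blast+
  have l4: "cB <= cwf" using pr_le(2)[OF l3(3)] pr_le(2) by blast
  have l5: "cimp (cmem (cvar 0) 0) (cimp cQ cfalse) <= cwf" using pr_le(2)[OF l4] by blast
  have l6: "cimp cQ cfalse <= cwf" using pr_le(2)[OF l5] pr_le(2) by blast
  have l7: "cQ <= cwf" using pr_le(2)[OF l6] pr_le(2) by blast
  have sp: "sassign (push x s)" "sassign (push y (push x s))" "sassign (push z (push y (push x s)))" for x y z
    by (intro sassign_push s)+
  have v0: "tvl V (push n s) (cvar 0) n" if "sassign s" for n s
    by (rule tvl_intros(1)[OF V sassign_push[OF that]]) (simp add: slookup_push)
  have lk: "slookup (push y (push m (push x s))) N2 x" "slookup (push y (push m (push x s))) (0 + 1) m" for y m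
    unfolding slookup_push by simp_all
  have Q: "pr cQ (push y (push m (push x s))) \<in> S <-> pr 0 (pr x (pr y m)) \<in> A" for y m
    by (rule ssat_simps(3)[OF S sp(3) l7]) (intro tvl_pair V sp tvl_intros(1) lk slookup_push(1)[THEN iffD2] refl)
  note sat = ssat_simps[OF S]
  have B: "pr cB (push m (push x s)) \<in> S <-> (ALL y. y \<in> Y --> pr 0 (pr x (pr y m)) \<notin> A)" for m
    unfolding sat(5)[OF sp(2) l4] sat(4)[OF sp(3) l5] sat(4)[OF sp(3) l6] sat(2)[OF sp(3) l3(1) v0[OF sp(2)]] Q
    using sat(1)[OF sp(3) l3(2)] by blast
  have M: "pr cM (push x s) \<in> S <-> (ALL m. m \<in> Y --> ~ (ALL y. y \<in> Y --> pr 0 (pr x (pr y m)) \<notin> A))"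
    unfolding sat(5)[OF sp(1) l1(2)] sat(4)[OF sp(2) l2(2)] sat(4)[OF sp(2) l3(3)] sat(2)[OF sp(2) l3(1) v0[OF sp(1)]] B
    using sat(1)[OF sp(2) l3(2)] by blast
  have R: "pr (call (cimp (cmem (cvar 0) 0) cfalse)) (push x s) \<in> S <-> (ALL n. n \<notin> Y)"
    unfolding sat(5)[OF sp(1) l1(3)] sat(4)[OF sp(2) l2(1)] sat(2)[OF sp(2) l3(1) v0[OF sp(1)]]
    using sat(1)[OF sp(2) l3(2)] by blast
  have "cimp cM (call (cimp (cmem (cvar 0) 0) cfalse)) <= cwf" unfolding cwf_def by (rule order_refl)
  from sat(4)[OF sp(1)[of x] this] show ?thesis unfolding M R cwf_def[symmetric] .
qed

text \<open>Bar induction is applied to the formula \<open>cwf\<close>. Since its code is standard,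
  satisfaction sets exist, and its truth is equivalent to \<open>wfs\<close>.\<close>

theorem bar_imp_wfbar: assumes sbar shows wfbar
  unfolding wfbar_def
proof (intro ballI impI)
  fix X R Q x
  assume XR: "X \<in> SS" "R \<in> SS" "wellord X R" and Q: "Q \<in> SS" and x: "x \<in> X"
    and prog: "ALL x:X. (ALL y:X. pr y x \<in> R --> wfs Q y) --> wfs Q x"
  \<comment> \<open>The truth definition reads set parameters as sections of one set;
    \<open>Q\<close> is placed at index 0.\<close>
  define A where "A = {p. EX q. p = pr 0 q & q \<in> Q}"
  have A: "A \<in> SS" unfolding A_def by (rule dfm_SS) (intro dfm_intros dfm_mem Q)
  have Aq: "pr 0 q \<in> A <-> q \<in> Q" for q unfolding A_def by auto
  let ?s = "code {}"
  have s: "sassign ?s" unfolding sassign_def by simp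
  obtain k where k: "cwf = of_nat k" using std_cwf unfolding std_def by blast
  have tr: "strue (pr (N4 + 1 + 1) cwf) (push x ?s) A <-> wfs Q x" for x
  proof
    assume t: "strue (pr (N4 + 1 + 1) cwf) (push x ?s) A"
    show "wfs Q x" unfolding wfs_def mwf_def
    proof (intro ballI impI)
      fix Y :: "N set" assume Y: "Y \<in> SS" "Y ~= {}"
      obtain S where S: "S \<in> SS" "ssat cwf Y A VV S" using ex_ssat[OF Y(1) A VV_SS] k by metis
      then have "pr cwf (push x ?s) \<in> S" using t Y(1) VV_SS seval_VV unfolding strue_def by auto
      then have "(ALL m. m \<in> Y --> ~ (ALL y. y \<in> Y --> pr x (pr y m) \<notin> Q)) --> (ALL n. n \<notin> Y)"
        using ssat_cwf[OF seval_VV S(2) s, of x] unfolding Aq by simp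
      then show "EX m:Y. ALL y:Y. pr x (pr y m) \<notin> Q" using Y(2) by blast
    qed
  next
    assume w: "wfs Q x"
    have "pr cwf (push x ?s) \<in> S" if "Y \<in> SS" "seval V" "ssat cwf Y A V S" for Y V S
      unfolding ssat_cwf[OF that(2,3) s] Aq using w[unfolded wfs_def mwf_def, rule_format, OF that(1)] by blast
    then show "strue (pr (N4 + 1 + 1) cwf) (push x ?s) A" unfolding strue_def by blast
  qed
  have "strue (pr (N4 + 1 + 1) cwf) (push x ?s) A"
  proof (rule assms[unfolded sbar_def spush_iff, rule_format, OF XR A conjI[OF sPi11_cwf s] _ x refl])
    fix y s' assume y: "y \<in> X" "s' = push y ?s"
      and IH: "!!z s''. z \<in> X & pr z y \<in> R ==> s'' = push z ?s ==> strue (pr (N4 + 1 + 1) cwf) s'' A"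
    have "wfs Q z" if "z \<in> X" "pr z y \<in> R" for z using IH[of z, OF _ refl] that tr by blast
    then show "strue (pr (N4 + 1 + 1) cwf) s' A" using prog y tr by blast
  qed
  then show "wfs Q x" unfolding tr .
qed

section \<open>The collapse \<open>D\<^sup>T(D\<^sup>S(X)) \<rightarrow> D\<^sup>S(X)\<close> of an upper derivative\<close>

definition pr1 :: "N => N" where "pr1 p = the0 (%a. EX s. p = pr a s)"
definition pr2 :: "N => N" where "pr2 p = the0 (%s. EX a. p = pr a s)"

lemma pr12 [simp]: "pr1 (pr a s) = a" "pr2 (pr a s) = s"
  unfolding pr1_def pr2_def by (auto intro: the0_equality)

lemma dtm_pr1 [dfm_intros]: "dtm t ==> dtm (%e. pr1 (t e))"
  by (rule dtm_sub1[of pr1]) (unfold pr1_def, intro dfm_intros)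

lemma dtm_pr2 [dfm_intros]: "dtm t ==> dtm (%e. pr2 (t e))"
  by (rule dtm_sub1[of pr2]) (unfold pr2_def, intro dfm_intros)

lemma (in npdil) dtm_J:
  assumes L: "dp2 L" and t: "dtm a" "dtm c" "dtm s" shows "dtm (%e. J L (a e) (c e) (s e))"
  unfolding J_def act_def inc_def
  by (intro dfm_intros dfm_sdil(3) dtm_idx[OF L] dtm_enf[OF L] dtm_ren[OF t(1)] dtm_ren[OF t(2)] dtm_ren[OF t(3)])

lemma (in npdil) dtm_supp: assumes t: "dtm n" "dtm s" "dtm i" shows "dfm (%e. i e \<in> supp (n e) (s e))"
  unfolding supp_def by (intro dfm_intros dfm_sdil(4) dtm_ren[OF t(1)] dtm_ren[OF t(2)] t)

context npdil
begin

text \<open>The element of \<open>D(X)\<close> represented by \<open>\<sigma> \<in> T\<^bsub>|b|\<^esub>\<close>.\<close>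

definition wv :: "(N => N => bool) => N => N => N" where
  "wv L b s = the0 (%w. EX a t. w = pr a t & FinSet a & (ALL x. x \<in> elts a --> x \<in> elts b) & full a t & J L a b t = s)"

lemma dtm_wv: "dp2 L ==> dtm b ==> dtm s ==> dtm (%e. wv L (b e) (s e))"
  by (rule dtm_sub2[of "wv L"]) (unfold wv_def, intro dfm_intros dfm_full dtm_J)

lemma J_eq_imp_eq:
  assumes L: "dp2 L" "linord A L" and p: "Dfield T A (pr a s)" "Dfield T A (pr b t)"
    and c: "flin L c" "elts a \<subseteq> elts c" "elts b \<subseteq> elts c" and eq: "J L a c s = J L b c t"
  shows "pr a s = pr b t"
proof -
  have F: "Fld T (crd a) s" "Fld T (crd b) t" using p unfolding Dfield_iff full_def by auto
  have n: "~ Lss T (crd c) (J L b c t) (J L b c t)" using linordD(1)[OF lin J_fld[OF c(1,3) F(2)]] .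
  have "~ Dless T L (pr a s) (pr b t)" "~ Dless T L (pr b t) (pr a s)"
    using Dless_iff[OF c F] Dless_iff[OF c(1,3,2) F(2,1)] n unfolding eq by blast+
  then show ?thesis using linordD(3)[OF D_linord[OF L] p] by blast
qed

context
  fixes A L assumes L: "dp2 L" and lA: "linord A L"
begin

lemma wvI:
  assumes b: "!!x. x \<in> elts b ==> A x" and a: "FinSet a" "elts a \<subseteq> elts b" "full a t"
  shows "wv L b (J L a b t) = pr a t"
  unfolding wv_def
proof (rule the0_equality)
  have fl: "flin L b" by (rule flinI[OF L lA]) (rule b)
  fix w assume "EX a' t'. w = pr a' t' & FinSet a' & (ALL x. x \<in> elts a' --> x \<in> elts b) & full a' t' & J L a' b t' = J L a b t"
  then obtain a' t' where w: "w = pr a' t'" "FinSet a'" "elts a' \<subseteq> elts b" "full a' t'" "J L a' b t' = J L a b t" by blast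
  then show "w = pr a t"
    using J_eq_imp_eq[OF L lA _ _ fl w(3) a(2) w(5)] a b unfolding Dfield_iff by blast
qed (use a in blast)

text \<open>The support of \<open>s\<close> is a set of positions in \<open>b\<close>. The elements
  of \<open>b\<close> at these positions form \<open>a\<close>, and \<open>supp_range\<close> yields
  \<open>t\<close>.\<close>

lemma wv:
  assumes b: "!!x. x \<in> elts b ==> A x" and s: "Fld T (crd b) s"
  obtains a t where "wv L b s = pr a t" "FinSet a" "elts a \<subseteq> elts b" "full a t" "J L a b t = s"
proof -
  have fl: "flin L b" by (rule flinI[OF L lA]) (rule b)
  let ?c = "code (supp (crd b) s)"
  obtain t where t: "Fld T (crd ?c) t" "act (crd ?c) (crd b) (enf (<) ?c) t = s" "supp (crd ?c) t = {i. i < crd ?c}"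
    by (rule supp_range[OF s])
  define a where "a = code (enf L b ` supp (crd b) s)"
  have de: "df1 (enf L b)" by (intro dtm_enf[OF L] dfm_intros)
  have a: "FinSet a" "elts a = enf L b ` elts ?c" unfolding a_def using coded_set_image[OF coded_supp de] by simp_all
  have ab: "elts a \<subseteq> elts b" using a enf(1)[OF fl] supp_less[OF s] by auto
  have fla: "flin L a" by (rule flin_subset[OF fl ab])
  have mono: "x \<in> elts ?c ==> y \<in> elts ?c ==> x < y ==> L (enf L b x) (enf L b y)" for x y
    using enf(3)[OF fl] supp_less[OF s] by simp
  have e: "crd a = crd ?c" "!!i. i < crd ?c ==> enf L a i = enf L b (enf (<) ?c i)"
    using enf_image[OF flin_less fla de a(2) mono] by blast+
  have "inc L a b i = enf (<) ?c i" if i: "i < crd ?c" for i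
    unfolding inc_def e(2)[OF i] using idx_enf[OF fl] enf(1)[OF flin_less i] supp_less[OF s] by simp
  then have "J L a b t = s" unfolding J_def e(1) using act_cong[of "crd ?c" "inc L a b" "enf (<) ?c"] t(2) by simp
  moreover have "full a t" using t e(1) unfolding full_def by simp
  ultimately show ?thesis using that a(1) ab wvI[OF b a(1) ab] by blast
qed

lemma wv_field: assumes b: "!!x. x \<in> elts b ==> A x" and s: "Fld T (crd b) s" shows "Dfield T A (wv L b s)"
  by (rule wv[OF b s]) (use b in \<open>auto simp: Dfield_iff\<close>)

lemma wv_less:
  assumes b: "!!x. x \<in> elts b ==> A x" and s: "Fld T (crd b) s" "Fld T (crd b) t"
  shows "Dless T L (wv L b s) (wv L b t) <-> Lss T (crd b) s t"
proof -
  have fl: "flin L b" by (rule flinI[OF L lA]) (rule b)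
  obtain a s' where a: "wv L b s = pr a s'" "elts a \<subseteq> elts b" "full a s'" "J L a b s' = s" by (rule wv[OF b s(1)])
  obtain c t' where c: "wv L b t = pr c t'" "elts c \<subseteq> elts b" "full c t'" "J L c b t' = t" by (rule wv[OF b s(2)])
  show ?thesis using Dless_iff[OF fl a(2) c(2), of s' t'] a c by (simp add: full_def)
qed

lemma wv_J:
  assumes c: "!!x. x \<in> elts c ==> A x" and b: "elts b \<subseteq> elts c" and s: "Fld T (crd b) s"
  shows "wv L c (J L b c s) = wv L b s"
proof -
  have b': "x \<in> elts b ==> A x" for x using b c by blast
  have fl: "flin L c" by (rule flinI[OF L lA]) (rule c)
  obtain a t where a: "wv L b s = pr a t" "FinSet a" "elts a \<subseteq> elts b" "full a t" "J L a b t = s" by (rule wv[OF b' s])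
  have "J L b c s = J L a c t" using J_comp[OF fl a(3) b, of t] a(4,5) by (simp add: full_def)
  then show ?thesis using wvI[OF c a(2) order_trans[OF a(3) b] a(4)] a(1) by simp
qed

end

end

locale upder = T: npdil T + S: npdil S for T S +
  fixes Z :: "N set"
  assumes Z: "Z \<in> SS" and morph: "smorph (scomp T S) S Z"
begin

definition xs :: "N => N => N" where
  "xs n p = the0 (%y. pr n (pr p y) \<in> Z)"

lemma xs: "Dfield T (Fld S n) p ==> Fld S n (xs n p)" "Dfield T (Fld S n) p ==> pr n (pr p y) \<in> Z <-> y = xs n p"
proof -
  assume p: "Dfield T (Fld S n) p"
  have "Fld (scomp T S) n p" using p by (simp add: scomp_def)
  note m = morph[unfolded smorph_def, THEN conjunct1, rule_format, OF this]
  obtain y' where y: "pr n (pr p y') \<in> Z" "Fld S n y'" using m[THEN conjunct1] by blast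
  have u: "pr n (pr p z) \<in> Z ==> z = y'" for z using m[THEN conjunct2, rule_format, OF conjI[OF _ y(1)]] by simp
  have "xs n p = y'" unfolding xs_def by (rule the0_equality[of "%y. pr n (pr p y) \<in> Z"]) (rule y(1), erule u)
  then show "Fld S n (xs n p)" "pr n (pr p y) \<in> Z <-> y = xs n p" using y u[of y] by blast+
qed

lemma xs_less: "Dfield T (Fld S n) p ==> Dfield T (Fld S n) q ==> Dless T (Lss S n) p q ==> Lss S n (xs n p) (xs n q)"
  using morph[unfolded smorph_def, THEN conjunct2, THEN conjunct1, rule_format, of n p q "xs n p" "xs n q"] xs(2)
  by (simp add: scomp_def)

lemma flS: "(!!x. x \<in> elts a ==> Fld S n x) ==> flin (Lss S n) a"
  by (rule T.flinI[OF S.dfm_sdil(2)[OF dtm_const dtm_var dtm_var] S.lin])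

lemma df1_act: "df1 f ==> df1 (S.act n l f)"
  unfolding S.act_def by (intro dfm_intros S.dfm_sdil(3) dtm_sub1)

lemma xs_act:
  assumes f: "mmap f n l" and p: "Dfield T (Fld S n) (pr a t)"
  shows "Dfield T (Fld S l) (pr (code (S.act n l f ` elts a)) t)"
    "S.act n l f (xs n (pr a t)) = xs l (pr (code (S.act n l f ` elts a)) t)"
proof -
  let ?b = "code (S.act n l f ` elts a)"
  have da: "df1 (S.act n l f)" by (rule df1_act[OF mmapD(3)[OF f]])
  have b: "FinSet ?b" "elts ?b = S.act n l f ` elts a" using coded_set_image[OF _ da, of "elts a"] by simp_all
  have aF: "!!x. x \<in> elts a ==> Fld S n x" and ft: "T.full a t" using p unfolding T.Dfield_iff by auto
  have bF: "!!x. x \<in> elts ?b ==> Fld S l x" using b(2) S.act_fld[OF f aF] by auto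
  have fla: "flin (Lss S n) a" by (rule flS) (rule aF)
  have flb: "flin (Lss S l) ?b" by (rule flS) (rule bF)
  have "T.full ?b t" using T.full_image[OF fla flb da b(2), of t] S.act_mono[OF f aF aF] ft by blast
  then show q: "Dfield T (Fld S l) (pr ?b t)" unfolding T.Dfield_iff using b(1) bF by blast
  have "imf (Act S n l (gr n f)) a ?b" unfolding imf_def isc_iff b(2) using b(1) S.Act_iff[OF f aF] by auto
  then have "Act S n l (gr n f) (xs n (pr a t)) (xs l (pr ?b t))"
    using morph[unfolded smorph_def, THEN conjunct2, THEN conjunct2, THEN conjunct1, rule_format,
        of "gr n f" n l "pr a t" "pr ?b t" "xs n (pr a t)" "xs l (pr ?b t)"] smor_gr[OF f] p xs(2)[OF p] xs(2)[OF q]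
    by (simp add: scomp_def)
  then show "S.act n l f (xs n (pr a t)) = xs l (pr ?b t)" using S.Act_iff[OF f xs(1)[OF p]] by simp
qed

lemma xs_mu: assumes m: "m < n" shows "xs n (T.Dmu (S.mu n m)) = S.mu n m"
proof -
  have "Mu (scomp T S) n m (T.Dmu (S.mu n m))"
    unfolding scomp_def T.Dmu_def using S.Mu_iff[OF m] T.Mu1_iff isc_singleton by auto
  moreover have "Dfield T (Fld S n) (T.Dmu (S.mu n m))" by (rule T.Dfield_Dmu) (rule S.mu_fld[OF m])
  ultimately have "Mu S n m (xs n (T.Dmu (S.mu n m)))"
    using morph[unfolded smorph_def, THEN conjunct2, THEN conjunct2, THEN conjunct2, rule_format, of m n] m xs(2) by blast
  then show ?thesis using S.Mu_iff[OF m] by simp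
qed

definition jj :: "(N => N => bool) => N => N => N" where
  "jj L c w = S.J L (pr1 w) c (pr2 w)"

definition bse :: "N => N" where
  "bse p = code (\<Union>w\<in>elts (pr1 p). elts (pr1 w))"

text \<open>The collapse computed over a finite set \<open>c\<close> that contains the base
  \<open>bse p\<close>: the elements of \<open>D(X)\<close> that occur in \<open>p\<close> are moved
  to \<open>S\<close> at \<open>|c|\<close> by \<open>jj\<close>, the component \<open>xs\<close> of
  the morphism is applied there, and \<open>wv\<close> leads back.\<close>

definition Xc :: "(N => N => bool) => N => N => N" where
  "Xc L c p = S.wv L c (xs (crd c) (pr (code (jj L c ` elts (pr1 p))) (pr2 p)))"

definition Xi :: "(N => N => bool) => N => N" where
  "Xi L p = Xc L (bse p) p"

context
  fixes A L assumes A: "dp1 A" and L: "dp2 L" and lA: "linord A L"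
begin

lemma dtm_jj: "dtm c ==> dtm w ==> dtm (%e. jj L (c e) (w e))"
  unfolding jj_def by (intro S.dtm_J[OF L] dfm_intros)

lemma df1_Xi: "df1 (Xi L)"
proof -
  have "jj L c ` elts a = {x. EX w. w \<in> elts a & x = jj L c w}" for c a by auto
  moreover have "(\<Union>w\<in>elts a. elts (pr1 w)) = {x. EX w. w \<in> elts a & x \<in> elts (pr1 w)}" for a by auto
  ultimately show ?thesis
    unfolding Xi_def Xc_def bse_def xs_def by simp (intro S.dtm_wv[OF L] dfm_intros dtm_jj dfm_mem[OF Z])
qed

lemma dpW: "dp1 (Dfield S A)" "dp2 (Dless S L)"
  by (intro S.dfm_Dfield[OF A] S.dfm_Dless[OF L] dfm_intros)+

lemma W_linord: "linord (Dfield S A) (Dless S L)"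
  by (rule S.D_linord[OF L lA])

lemma WE: assumes "Dfield S A w" obtains b s where "w = pr b s" "FinSet b" "!!x. x \<in> elts b ==> A x" "S.full b s"
  using assms unfolding S.Dfield_iff by blast

lemma elts_bse: "elts (bse p) = (\<Union>w\<in>elts (pr1 p). elts (pr1 w))"
  unfolding bse_def by (intro elts_code coded_set_UN) (auto intro: dfm_intros)

lemma jj_props:
  assumes c: "!!x. x \<in> elts c ==> A x" and w: "Dfield S A w" "elts (pr1 w) \<subseteq> elts c"
  shows "Fld S (crd c) (jj L c w)"
    "Dfield S A v ==> elts (pr1 v) \<subseteq> elts c ==> Lss S (crd c) (jj L c w) (jj L c v) <-> Dless S L w v"
    "(!!x. x \<in> elts d ==> A x) ==> elts c \<subseteq> elts d ==> S.J L c d (jj L c w) = jj L d w"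
proof -
  have fl: "flin L c" by (rule T.flinI[OF L lA]) (rule c)
  obtain b s where b: "w = pr b s" "S.full b s" by (rule WE[OF w(1)])
  have s: "Fld S (crd b) s" "elts b \<subseteq> elts c" using b w(2) by (auto simp: S.full_def)
  show "Fld S (crd c) (jj L c w)" unfolding jj_def b using S.J_fld[OF fl s(2,1)] by simp
  show "Lss S (crd c) (jj L c w) (jj L c v) <-> Dless S L w v" if v: "Dfield S A v" "elts (pr1 v) \<subseteq> elts c"
  proof -
    obtain b' s' where b': "v = pr b' s'" "S.full b' s'" by (rule WE[OF v(1)])
    have "Fld S (crd b') s'" "elts b' \<subseteq> elts c" using b' v(2) by (auto simp: S.full_def)
    then show ?thesis unfolding jj_def using S.Dless_iff[OF fl s(2) _ s(1)] b b' by simp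
  qed
  assume d: "!!x. x \<in> elts d ==> A x" "elts c \<subseteq> elts d"
  have "flin L d" by (rule T.flinI[OF L lA]) (rule d(1))
  then show "S.J L c d (jj L c w) = jj L d w" unfolding jj_def b using S.J_comp[OF _ s(2) d(2) s(1)] by simp
qed

lemma elts_jj [simp]: "elts (code (jj L c ` elts a)) = jj L c ` elts a"
  using coded_set_image[of "elts a" "jj L c"] dtm_jj[OF dtm_const dtm_var, of c 0] by simp

lemma jj_image:
  assumes c: "!!x. x \<in> elts c ==> A x" and a: "!!w. w \<in> elts a ==> Dfield S A w" "!!w. w \<in> elts a ==> elts (pr1 w) \<subseteq> elts c"
  shows "flin (Dless S L) a" "flin (Lss S (crd c)) (code (jj L c ` elts a))" "elts (code (jj L c ` elts a)) = jj L c ` elts a"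
    "T.full (code (jj L c ` elts a)) t <-> T.full a t"
proof -
  have dj: "df1 (jj L c)" by (intro dtm_jj dfm_intros)
  show e: "elts (code (jj L c ` elts a)) = jj L c ` elts a" using coded_set_image[OF _ dj, of "elts a"] by simp
  show fa: "flin (Dless S L) a" by (rule T.flinI[OF dpW(2) W_linord]) (rule a(1))
  show fb: "flin (Lss S (crd c)) (code (jj L c ` elts a))"
    by (rule flS) (use e jj_props(1)[OF c a] in auto)
  show "T.full (code (jj L c ` elts a)) t <-> T.full a t"
    by (rule T.full_image[OF fa fb dj e]) (use jj_props(2)[OF c a a] in blast)
qed

lemma Xc_arg:
  assumes c: "!!x. x \<in> elts c ==> A x" and p: "Dfield T (Dfield S A) (pr a t)" and b: "elts (bse (pr a t)) \<subseteq> elts c"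
  shows "Dfield T (Fld S (crd c)) (pr (code (jj L c ` elts a)) t)"
proof -
  have a: "!!w. w \<in> elts a ==> Dfield S A w" "T.full a t" "!!w. w \<in> elts a ==> elts (pr1 w) \<subseteq> elts c"
    using p b unfolding T.Dfield_iff elts_bse by auto
  have "df1 (jj L c)" by (intro dtm_jj dfm_intros)
  then have "FinSet (code (jj L c ` elts a))" using coded_set_image[of "elts a"] by simp
  then show ?thesis
    unfolding T.Dfield_iff using jj_image(3,4)[OF c a(1,3), of a] a jj_props(1)[OF c a(1,3)] by auto
qed

text \<open>Naturality of the morphism. It allows two arguments to be compared over a common base,
  as \<open>Xi_less\<close> requires.\<close>

lemma Xc_indep:
  assumes d: "!!x. x \<in> elts d ==> A x" and p: "Dfield T (Dfield S A) (pr a t)"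
    and b: "elts (bse (pr a t)) \<subseteq> elts c" and cd: "elts c \<subseteq> elts d"
  shows "Xc L d (pr a t) = Xc L c (pr a t)"
proof -
  have c: "!!x. x \<in> elts c ==> A x" using d cd by blast
  have fl: "flin L d" by (rule T.flinI[OF L lA]) (rule d)
  have a: "!!w. w \<in> elts a ==> Dfield S A w" "!!w. w \<in> elts a ==> elts (pr1 w) \<subseteq> elts c"
    using p b unfolding T.Dfield_iff elts_bse by auto
  note arg = Xc_arg[OF c p b]
  note m = mmap_inc[OF fl cd]
  have "S.act (crd c) (crd d) (inc L c d) ` elts (code (jj L c ` elts a)) = S.J L c d ` jj L c ` elts a"
    unfolding S.J_def by simp
  also have "\<dots> = jj L d ` elts a" using jj_props(3)[OF c a d cd] by (auto simp: image_image)
  finally have "S.J L c d (xs (crd c) (pr (code (jj L c ` elts a)) t)) = xs (crd d) (pr (code (jj L d ` elts a)) t)"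
    using xs_act(2)[OF m arg] unfolding S.J_def by simp
  then show ?thesis unfolding Xc_def using S.wv_J[OF L lA d cd xs(1)[OF arg]] by simp
qed

lemma bse_A: "Dfield T (Dfield S A) (pr a t) ==> x \<in> elts (bse (pr a t)) ==> A x"
  unfolding elts_bse T.Dfield_iff S.Dfield_iff by auto

lemma Xi_field: assumes p: "Dfield T (Dfield S A) p" shows "Dfield S A (Xi L p)"
proof -
  obtain a t where at: "p = pr a t" using p unfolding T.Dfield_iff by blast
  note p = p[unfolded at]
  show ?thesis unfolding at Xi_def Xc_def pr12
    by (rule S.wv_field[OF L lA]) (use bse_A[OF p] xs(1)[OF Xc_arg[OF _ p order_refl]] in blast)+
qed

lemma Xi_less:
  assumes p: "Dfield T (Dfield S A) p" and q: "Dfield T (Dfield S A) q" and l: "Dless T (Dless S L) p q"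
  shows "Dless S L (Xi L p) (Xi L q)"
proof -
  obtain a s where a: "p = pr a s" using p unfolding T.Dfield_iff by blast
  obtain b t where b: "q = pr b t" using q unfolding T.Dfield_iff by blast
  note p = p[unfolded a] and q = q[unfolded b]
  define c where "c = code (elts (bse (pr a s)) \<union> elts (bse (pr b t)))"
  have c: "elts c = elts (bse (pr a s)) \<union> elts (bse (pr b t))" unfolding c_def by (simp add: coded_set_Un)
  have cA: "!!x. x \<in> elts c ==> A x" using c bse_A[OF p] bse_A[OF q] by blast
  have sub: "elts (bse (pr a s)) \<subseteq> elts c" "elts (bse (pr b t)) \<subseteq> elts c" using c by auto
  define d where "d = code (elts a \<union> elts b)"
  have d: "elts d = elts a \<union> elts b" unfolding d_def by (simp add: coded_set_Un)
  have dW: "!!w. w \<in> elts d ==> Dfield S A w" "!!w. w \<in> elts d ==> elts (pr1 w) \<subseteq> elts c"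
    using d p q sub unfolding T.Dfield_iff elts_bse by auto
  have im: "flin (Dless S L) d" "flin (Lss S (crd c)) (code (jj L c ` elts d))" "elts (code (jj L c ` elts d)) = jj L c ` elts d"
    by (rule jj_image[of c]; fact cA dW)+
  have jl: "x \<in> elts d ==> y \<in> elts d ==> Dless S L x y ==> Lss S (crd c) (jj L c x) (jj L c y)" for x y
    by (rule jj_props(2)[THEN iffD2]) (assumption | rule cA dW)+
  have F: "Fld T (crd a) s" "Fld T (crd b) t" using p q unfolding T.Dfield_iff T.full_def by auto
  have "Dless T (Lss S (crd c)) (pr (code (jj L c ` elts a)) s) (pr (code (jj L c ` elts b)) t) <->
      Dless T (Dless S L) (pr a s) (pr b t)"
  proof (rule T.Dless_image[OF im(1,2) dtm_jj[OF dtm_const dtm_var] im(3)])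
    show "x \<in> elts d ==> y \<in> elts d ==> Dless S L x y ==> Lss S (crd c) (jj L c x) (jj L c y)" for x y by (rule jl)
  qed (use d F in simp_all)
  then have "Dless S L (Xc L c (pr a s)) (Xc L c (pr b t))"
    unfolding Xc_def pr12 using S.wv_less[OF L lA cA] xs(1) xs_less Xc_arg[OF cA p sub(1)] Xc_arg[OF cA q sub(2)] l[unfolded a b] by blast
  then show ?thesis
    unfolding Xi_def a b using Xc_indep[OF cA p order_refl sub(1)] Xc_indep[OF cA q order_refl sub(2)] by simp
qed

text \<open>The reason is that the morphism preserves \<mu>. So \<open>S.Dmu x\<close> acts as a
  fixed point of the collapse, which will bound the ranks for indices below
  \<open>x\<close>.\<close>

lemma Xi_mu: assumes x: "A x" shows "Xi L (T.Dmu (S.Dmu x)) = S.Dmu x"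
proof -
  have m: "(0::N) < 1" by simp
  let ?c = "code {x}"
  have c: "!!y. y \<in> elts ?c ==> A y" using x by simp
  have fl: "flin L ?c" by (rule T.flinI[OF L lA]) (rule c)
  have J: "S.J L ?c ?c (S.mu 1 0) = S.mu 1 0"
    by (rule S.J_id[OF fl]) (simp add: S.crd_singleton S.mu_fld[OF m])
  have b: "bse (T.Dmu (S.Dmu x)) = ?c" unfolding bse_def T.Dmu_def S.Dmu_def by simp
  have "jj L ?c ` elts (code {S.Dmu x}) = {S.mu 1 0}" using J unfolding jj_def S.Dmu_def by simp
  then have "Xi L (T.Dmu (S.Dmu x)) = S.wv L ?c (xs 1 (T.Dmu (S.mu 1 0)))"
    unfolding Xi_def b Xc_def unfolding T.Dmu_def by (simp add: S.crd_singleton)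
  also have "\<dots> = S.wv L ?c (S.J L ?c ?c (S.mu 1 0))" unfolding xs_mu[OF m] J ..
  also have "\<dots> = S.Dmu x" unfolding S.Dmu_def by (rule S.wvI[OF L lA c]) (auto simp: S.full_singleton)
  finally show ?thesis .
qed

lemma S_Dmu_less: assumes "A x" "A y" "L x y" shows "Dless S L (S.Dmu x) (S.Dmu y)"
proof -
  have fl: "flin L (code {x, y})" by (rule T.flinI[OF L lA]) (use assms in auto)
  show ?thesis unfolding S.Dmu_def[of x]
    using S.Dless_Dmu_iff[OF fl, of "code {x}" y] S.full_singleton assms by simp
qed

end

end

section \<open>The dilator of approximations to ranking functions\<close>

lemma coded_pairs:
  assumes h: "dtm (%e. h (e 0) (e (Suc 0)))" and P: "dp2 P"
  shows "coded_set {q. EX i u. pr i u \<in> elts s & P i u & q = h i u}"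
proof -
  have "coded_set {p \<in> elts s. EX i u. p = pr i u & P i u}"
    by (intro coded_set_sub dfm_intros dfm_sub2[OF P]) simp
  then have "coded_set ((%p. h (pr1 p) (pr2 p)) ` {p \<in> elts s. EX i u. p = pr i u & P i u})"
    by (rule coded_set_image) (intro dtm_sub2[OF h] dfm_intros)
  moreover have "h i u \<in> (%p. h (pr1 p) (pr2 p)) ` {p \<in> elts s. EX i u. p = pr i u & P i u}" if "pr i u \<in> elts s" "P i u" for i u
    by (rule image_eqI[of _ _ "pr i u"]) (use that in auto)
  then have "(%p. h (pr1 p) (pr2 p)) ` {p \<in> elts s. EX i u. p = pr i u & P i u} = {q. EX i u. pr i u \<in> elts s & P i u & q = h i u}"
    by auto blast
  ultimately show ?thesis by simp
qed

section \<open>Positions and comparison at the first difference\<close>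

definition Zpos :: "N => bool" where "Zpos j <-> (EX i. j = i + i)"

lemma dfm_Zpos [dfm_intros]: "dtm t ==> dfm (%e. Zpos (t e))"
  by (rule dfm_sub1[of Zpos]) (unfold Zpos_def, intro dfm_intros)

lemma dbl_less: "i + i < k + k <-> i < (k::N)" and dbl_eq [simp]: "i + i = k + k <-> i = (k::N)"
proof -
  have m: "i < k ==> i + i < k + k" for i k :: N by (rule add_strict_mono)
  show "i + i < k + k <-> i < k" "i + i = k + k <-> i = k" using m[of i k] m[of k i] by (metis less_asym less_irrefl linorder_neqE)+
qed

lemma dbl_Suc: "i + 1 + (i + 1) = i + i + (N2::N)"
  by (simp add: add.assoc add.left_commute)

lemma odd_pos: "i + i + 1 ~= k + (k::N)"
proof
  assume eq: "i + i + 1 = k + k"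
  show False
  proof (cases "k <= i")
    case True
    then have "k + k <= i + i" by (rule add_mono) (rule True)
    then have "k + k < i + i + 1" by (simp only: less_Suc)
    then show False using eq by simp
  next
    case False
    then have "i + 1 <= k" by (simp only: Suc_le not_le)
    then have "i + 1 + (i + 1) <= k + k" by (intro add_mono)
    moreover have "i + 1 + (i + 1) = i + i + 1 + 1" by (simp only: ac_simps)
    moreover have "i + i + 1 < i + i + 1 + 1" by (simp only: less_Suc)
    ultimately show False unfolding eq by (simp only: leD)
  qed
qed

lemma pos_simps: "Zpos 0" "~ Zpos 1" "Zpos (i + i + N2)" "~ Zpos (i + i + N3)"
  "i + i + N2 = k + k + N2 <-> i = k" "i + i + N3 = k + k + N3 <-> i = k"
  "i + i + N2 ~= k + k + N3" "i + i + N3 ~= k + k + N2"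
proof -
  have 2: "i + i + N2 = i + 1 + (i + 1)" and 3: "i + i + N3 = i + 1 + (i + 1) + 1" for i
    unfolding dbl_Suc by (rule refl, rule add.assoc[symmetric])
  show "Zpos 0" "~ Zpos 1" unfolding Zpos_def using odd_pos[of 0] by (auto intro: exI[of _ 0])
  show "Zpos (i + i + N2)" "~ Zpos (i + i + N3)" unfolding Zpos_def 2 3 using odd_pos by blast+
  show "i + i + N2 = k + k + N2 <-> i = k" "i + i + N3 = k + k + N3 <-> i = k"
    unfolding add_right_cancel by (rule dbl_eq)+
  show "i + i + N2 ~= k + k + N3" "i + i + N3 ~= k + k + N2" unfolding 2 3 using odd_pos by metis+
qed

lemmas [simp] = pos_simps[simplified]

definition lab :: "(N => N => bool) => N => N => N => bool" where
  "lab L j z z' <-> (if Zpos j then L z z' else z < z')"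

text \<open>Finite partial functions on positions: the values at even positions belong to the linear order,
  those at odd positions are numbers. They are compared at the first difference, where undefined values are
  the largest ones (as in the Kleene-Brouwer order).\<close>

definition PF :: "(N => bool) => N => bool" where
  "PF A t <-> FinSet t & (ALL p. p \<in> elts t --> (EX j z. p = pr j z)) & (ALL j z z'. pr j z \<in> elts t & pr j z' \<in> elts t --> z = z')
     & (ALL j z. pr j z \<in> elts t & Zpos j --> A z)"

definition lca :: "(N => N => bool) => N => N => N => bool" where
  "lca L j s t <-> (ALL i<j. ALL z. pr i z \<in> elts s <-> pr i z \<in> elts t) &
     (EX z. pr j z \<in> elts s & ((ALL z'. pr j z' \<notin> elts t) | (EX z'. pr j z' \<in> elts t & lab L j z z')))"

definition lc :: "(N => N => bool) => N => N => bool" where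
  "lc L s t <-> (EX j. lca L j s t)"

lemma dfm_lab: assumes L: "dp2 L" and t: "dtm j" "dtm s" "dtm t" shows "dfm (%e. lab L (j e) (s e) (t e))"
  unfolding lab_def if_bool_eq_conj by (intro dfm_intros dfm_sub2[OF L] t)

lemma dfm_lc: "dp2 L ==> dtm s ==> dtm t ==> dfm (%e. lc L (s e) (t e))"
  by (rule dfm_sub2[of "lc L"]) (unfold lc_def lca_def, intro dfm_intros dfm_lab)

lemma PFD: "PF A t ==> FinSet t" "PF A t ==> p \<in> elts t ==> EX j z. p = pr j z"
  "PF A t ==> pr j z \<in> elts t ==> pr j z' \<in> elts t ==> z = z'" "PF A t ==> pr j z \<in> elts t ==> Zpos j ==> A z"
  unfolding PF_def by blast+

lemma lab_lin:
  assumes L: "linord A L" and A: "Zpos j ==> A x" "Zpos j ==> A y" "Zpos j ==> A z"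
  shows "~ lab L j x x" "lab L j x y | x = y | lab L j y x" "lab L j x y ==> lab L j y z ==> lab L j x z"
proof -
  have "~ lab L j x x & (lab L j x y | x = y | lab L j y x) & (lab L j x y --> lab L j y z --> lab L j x z)"
  proof (cases "Zpos j")
    case True
    then have a: "A x" "A y" "A z" using A by blast+
    show ?thesis using True linordD(1)[OF L a(1)] linordD(3)[OF L a(1,2)] linordD(2)[OF L a] unfolding lab_def by simp
  next
    case False
    then show ?thesis unfolding lab_def using less_linear[of x y] by auto
  qed
  note r = this
  show "~ lab L j x x" using r by (rule conjunct1)
  show "lab L j x y | x = y | lab L j y x" using r[THEN conjunct2] by (rule conjunct1)
  show "lab L j x y ==> lab L j y z ==> lab L j x z" using r[THEN conjunct2, THEN conjunct2] by simp
qed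

lemma linord_PF: assumes L: "linord A L" shows "linord (PF A) (lc L)"
proof (rule linordI)
  fix s assume s: "PF A s"
  have False if "lca L j s s" for j
  proof -
    obtain z z' where z: "pr j z \<in> elts s" "pr j z' \<in> elts s" "lab L j z z'" using \<open>lca L j s s\<close> unfolding lca_def by blast
    have "z = z'" using PFD(3)[OF s z(1,2)] .
    then show False using z lab_lin(1)[OF L] PFD(4)[OF s z(1)] by blast
  qed
  then show "~ lc L s s" unfolding lc_def by blast
next
  fix s t r assume P: "PF A s" "PF A t" "PF A r" and "lc L s t" "lc L t r"
  then obtain j k where j: "lca L j s t" and k: "lca L k t r" unfolding lc_def by blast
  consider "j < k" | "k < j" | "j = k" by (metis linorder_neqE)
  then show "lc L s r"
  proof cases
    case 1
    then have "pr i z \<in> elts t <-> pr i z \<in> elts r" if "i <= j" for i z using k that unfolding lca_def by (meson le_less_trans)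
    then have "lca L j s r" using j unfolding lca_def by simp
    then show ?thesis unfolding lc_def by blast
  next
    case 2
    then have "pr i z \<in> elts s <-> pr i z \<in> elts t" if "i <= k" for i z using j that unfolding lca_def by (meson le_less_trans)
    then have "lca L k s r" using k unfolding lca_def by simp
    then show ?thesis unfolding lc_def by blast
  next
    case 3
    obtain z y where z: "pr j z \<in> elts s" and y: "pr j y \<in> elts t" "lab L j z y"
      using j k PFD(3)[OF P(2)] unfolding lca_def 3 by meson
    obtain y' where y': "pr j y' \<in> elts t" "(ALL w. pr j w \<notin> elts r) | (EX w. pr j w \<in> elts r & lab L j y' w)"
      using k unfolding lca_def 3 by blast
    then have "(ALL w. pr j w \<notin> elts r) | (EX w. pr j w \<in> elts r & lab L j y w)"
      using PFD(3)[OF P(2) y(1) y'(1)] by simp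
    then have "(ALL w. pr j w \<notin> elts r) | (EX w. pr j w \<in> elts r & lab L j z w)"
      using lab_lin(3)[OF L, of j z y] y(2) PFD(4)[OF P(1) z] PFD(4)[OF P(2) y(1)] PFD(4)[OF P(3)] by meson
    moreover have "ALL i<j. ALL z. pr i z \<in> elts s <-> pr i z \<in> elts r" using j k unfolding lca_def 3 by simp
    ultimately have "lca L j s r" unfolding lca_def using z by blast
    then show ?thesis unfolding lc_def by blast
  qed
next
  fix s t assume P: "PF A s" "PF A t"
  show "lc L s t | s = t | lc L t s"
  proof (cases "s = t")
    case False
    then have "elts s ~= elts t" using FinSet_eqI P PFD(1) by blast
    then obtain p where "~ (p \<in> elts s <-> p \<in> elts t)" by blast
    then obtain j0 z0 where "p = pr j0 z0" using PFD(2)[OF P(1), of p] PFD(2)[OF P(2), of p] by blast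
    define Df where "Df j <-> (EX z. ~ (pr j z \<in> elts s <-> pr j z \<in> elts t))" for j
    have j0: "Df j0" unfolding Df_def using \<open>p = pr j0 z0\<close> \<open>~ (p \<in> elts s <-> p \<in> elts t)\<close> by blast
    have "dp1 Df" unfolding Df_def by (intro dfm_intros)
    then obtain j where j: "Df j" "!!k. k < j ==> ~ Df k" using N_least[of Df j0] j0 by blast
    have *: "lc L s t | lc L t s" if z: "pr j z \<in> elts s" "pr j z \<notin> elts t" and P: "PF A s" "PF A t"
      and a: "ALL k<j. ALL z. pr k z \<in> elts s <-> pr k z \<in> elts t" for s t z
    proof (cases "EX z'. pr j z' \<in> elts t")
      case True
      then obtain z' where z': "pr j z' \<in> elts t" by blast
      have "z ~= z'" using z z' by blast
      then have "lab L j z z' | lab L j z' z" using lab_lin(2)[OF L, of j z z' z] PFD(4)[OF P(1) z(1)] PFD(4)[OF P(2) z'] by blast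
      then have "lca L j s t | lca L j t s" unfolding lca_def using z(1) z' a by blast
      then show ?thesis unfolding lc_def by blast
    next
      case False
      then have "lca L j s t" unfolding lca_def using z(1) a by blast
      then show ?thesis unfolding lc_def by blast
    qed
    obtain z where "~ (pr j z \<in> elts s <-> pr j z \<in> elts t)" using j(1) unfolding Df_def by blast
    then consider "pr j z \<in> elts s" "pr j z \<notin> elts t" | "pr j z \<in> elts t" "pr j z \<notin> elts s" by blast
    then show ?thesis
    proof cases
      case 1 then show ?thesis using *[OF 1 P] j(2) unfolding Df_def by blast
    next
      case 2 then show ?thesis using *[OF 2 P(2,1)] j(2) unfolding Df_def by blast
    qed
  qed simp
qed

definition rnt :: "(N => N) => N => N" where
  "rnt f t = code {q. EX j z. pr j z \<in> elts t & True & q = pr j (if Zpos j then f z else z)}"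

definition spt :: "N => N" where
  "spt t = code {q. EX j z. pr j z \<in> elts t & Zpos j & q = z}"

text \<open>Position 1 holds 0 here but \<open>x + 1\<close> in all other elements of the functor
  below, so that \<open>mct m\<close> comes first among those with value \<open>m\<close> at
  position 0.\<close>

definition mct :: "N => N" where
  "mct m = code {pr 0 m, pr 1 0}"

lemma elts_rnt: "df1 f ==> elts (rnt f t) = {q. EX j z. pr j z \<in> elts t & q = pr j (if Zpos j then f z else z)}"
  and FinSet_rnt: "df1 f ==> FinSet (rnt f t)"
proof -
  assume f: "df1 f"
  have "coded_set {q. EX j z. pr j z \<in> elts t & True & q = pr j (if Zpos j then f z else z)}"
    by (rule coded_pairs) (intro dfm_intros dtm_sub1[OF f])+
  then show "elts (rnt f t) = {q. EX j z. pr j z \<in> elts t & q = pr j (if Zpos j then f z else z)}" "FinSet (rnt f t)"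
    unfolding rnt_def by simp_all
qed

lemma mem_rnt: "df1 f ==> pr j y \<in> elts (rnt f t) <-> (EX z. pr j z \<in> elts t & y = (if Zpos j then f z else z))"
  unfolding elts_rnt by auto

lemma elts_spt [simp]: "elts (spt t) = {z. EX j. pr j z \<in> elts t & Zpos j}" and FinSet_spt: "FinSet (spt t)"
proof -
  have "coded_set {q. EX j z. pr j z \<in> elts t & Zpos j & q = z}"
    by (rule coded_pairs) (intro dfm_intros)+
  then show "elts (spt t) = {z. EX j. pr j z \<in> elts t & Zpos j}" "FinSet (spt t)"
    unfolding spt_def by auto
qed

lemma elts_mct [simp]: "elts (mct m) = {pr 0 m, pr 1 0}"
  unfolding mct_def by simp

lemma rnt_eqI:
  assumes f: "df1 f" and s: "FinSet s" "!!p. p \<in> elts s ==> EX j z. p = pr j z"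
    and eq: "!!j y. pr j y \<in> elts s <-> (EX z. pr j z \<in> elts t & y = (if Zpos j then f z else z))"
  shows "rnt f t = s"
proof (rule FinSet_eqI[OF FinSet_rnt[OF f] s(1)])
  show "elts (rnt f t) = elts s"
  proof (rule set_eqI)
    fix p
    show "p \<in> elts (rnt f t) <-> p \<in> elts s"
    proof (cases "EX j y. p = pr j y")
      case True then show ?thesis using eq mem_rnt[OF f] by auto
    next
      case False then show ?thesis using s(2)[of p] elts_rnt[OF f] by auto
    qed
  qed
qed

section \<open>The functor of approximations\<close>

definition sq :: "N set => N => N => N => bool" where
  "sq Q y l t <-> t = gr l (fapp t) & (ALL i. i + 1 < l --> pr y (pr (fapp t (i + 1)) (fapp t i)) \<in> Q)"

locale tree =
  fixes X R Q :: "N set"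
  assumes X: "X \<in> SS" and R: "R \<in> SS" and Q: "Q \<in> SS"
begin

definition vld :: "N => N => bool" where
  "vld x i <-> (EX y t l. i = pr y t & y \<in> X & pr y x \<in> R & sq Q y l t)"

text \<open>\<open>l\<close> measures how far both the sequence and the ranking have been
  approximated. The last clause lets ranks decrease when a sequence is prolonged. Keeping all ranks
  below \<open>m\<close> makes \<open>m\<close> dominate the support, as normality demands.\<close>

definition br :: "(N => bool) => (N => N => bool) => N => N => N => N => bool" where
  "br A L m x l t <-> x \<in> X & pr 1 (x + 1) \<in> elts t
     & (ALL j z. pr j z \<in> elts t --> j = 0 | j = 1 | (EX i<l. j = i + i + N3 | (j = i + i + N2 & vld x i)))
     & (ALL i<l. EX z. pr (i + i + N3) z \<in> elts t) & (ALL i<l. vld x i --> (EX z. pr (i + i + N2) z \<in> elts t))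
     & (ALL i z z'. pr (i + i + N3) z \<in> elts t & pr (i + 1 + (i + 1) + N3) z' \<in> elts t --> pr x (pr z' z) \<in> Q)
     & (ALL i z. pr (i + i + N2) z \<in> elts t --> A z & L z m)
     & (ALL y s s' z z'. elts s \<subset> elts s' & pr (pr y s + pr y s + N2) z \<in> elts t & pr (pr y s' + pr y s' + N2) z' \<in> elts t --> L z' z)"

text \<open>Apart from the values \<open>mct m\<close> of \<open>\<mu>\<close>, the elements \<open>t\<close> consist of a value \<open>m\<close> at position \<open>0\<close>, an index
  \<open>x\<close> at position \<open>1\<close>, a sequence that is descending for the relation with index \<open>x\<close> at the positions \<open>2 i + 3\<close>,
  and part of a ranking function with values below \<open>m\<close> at the positions \<open>2 i + 2\<close>, namely for those \<open>i\<close> which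
  code descending sequences for smaller indices.\<close>

definition E :: "(N => bool) => (N => N => bool) => N => bool" where
  "E A L t <-> PF (%_. True) t & (EX m. pr 0 m \<in> elts t & A m & (t = mct m | (EX x l. br A L m x l t)))"

lemma dfm_sq [dfm_intros]: "dtm y ==> dtm l ==> dtm t ==> dfm (%e. sq Q (y e) (l e) (t e))"
  by (rule dfm_sub3[of "sq Q"]) (unfold sq_def, intro dfm_intros dfm_mem Q)

lemma dfm_vld [dfm_intros]: "dtm x ==> dtm i ==> dfm (%e. vld (x e) (i e))"
  by (rule dfm_sub2[of vld]) (unfold vld_def, intro dfm_intros dfm_mem X R)

lemma dtm_mct [dfm_intros]: "dtm m ==> dtm (%e. mct (m e))"
proof (rule dtm_sub1[of mct])
  have "mct m = code {p. p = pr 0 m | p = pr 1 0}" for m unfolding mct_def by (rule arg_cong[of _ _ code]) auto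
  then show "df1 mct" by simp (intro dfm_intros)
qed

lemma dfm_E_ctx:
  assumes A: "!!f. dfm (%e. A (e 0) (%i. e (Suc (f i))))" and L: "dp2 L" and t: "dtm t"
  shows "dfm (%e. E (%m. A m e) L (t e))"
proof -
  have ps: "elts s \<subset> elts s' <-> (ALL x. x \<in> elts s --> x \<in> elts s') & (EX x. x \<in> elts s' & x \<notin> elts s)" for s s' by auto
  have A': "dtm u ==> dfm (%e. A (u e) (%i. e (f i)))" for u f
    using dfm_sub[of "%m e. A m (%i. e (f i))" u] A[of f] by simp
  show ?thesis
    unfolding E_def br_def PF_def ps
    by (intro dfm_intros A' dfm_sub2[OF L] dfm_mem X Q dtm_ren[OF t])
qed

lemma dfm_E: "dp1 A ==> dp2 L ==> dtm t ==> dfm (%e. E A L (t e))"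
  using dfm_E_ctx[of "%m e. A m" L t] by simp

lemma br_pos:
  assumes P: "PF (%_. True) t" and b: "br A L m x l t" and z: "pr j z \<in> elts t" "Zpos j" "pr 0 m \<in> elts t"
  shows "z = m | (A z & L z m)"
proof -
  have "j = 0 | (EX i. j = i + i + N2)" using b z(1,2) unfolding br_def by (metis pos_simps(2,4))
  then show ?thesis using PFD(3)[OF P, of 0 z m] z b unfolding br_def by metis
qed

lemma E_PF: assumes "E A L t" shows "PF A t"
proof -
  obtain m where m: "pr 0 m \<in> elts t" "A m" "t = mct m | (EX x l. br A L m x l t)" and P: "PF (%_. True) t"
    using assms unfolding E_def by blast
  have "A z" if z: "pr j z \<in> elts t" "Zpos j" for j z
    using m(3)
  proof
    assume "t = mct m" then show ?thesis using z m(2) pos_simps(2) by auto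
  next
    assume "EX x l. br A L m x l t" then show ?thesis using br_pos[OF P _ z m(1)] m(2) by blast
  qed
  then show ?thesis using P unfolding PF_def by blast
qed

lemma br_rnt:
  assumes m: "mono_on_ord A K B L f" and b: "br A K m x l t" and Am: "A m" and P: "PF A t" shows "br B L (f m) x l (rnt f t)"
proof -
  have f: "df1 f" and fAB: "!!x. A x ==> B (f x)" and fm: "!!x y. A x ==> A y ==> K x y ==> L (f x) (f y)"
    using m unfolding mono_on_ord_def by blast+
  have 1: "pr 1 y \<in> elts (rnt f t) <-> pr 1 y \<in> elts t" for y unfolding mem_rnt[OF f] using pos_simps(2) by simp
  have 2: "pr (i + i + N2) y \<in> elts (rnt f t) <-> (EX z. pr (i + i + N2) z \<in> elts t & y = f z)" for i y
    unfolding mem_rnt[OF f] using pos_simps(3)[of i] by simp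
  have 3: "pr (i + i + N3) y \<in> elts (rnt f t) <-> pr (i + i + N3) y \<in> elts t" for i y
    unfolding mem_rnt[OF f] using pos_simps(4)[of i] by simp
  show ?thesis
    unfolding br_def
  proof (intro conjI allI impI)
    show "x \<in> X" "pr 1 (x + 1) \<in> elts (rnt f t)" using b unfolding br_def 1 by blast+
    show "j = 0 | j = 1 | (EX i<l. j = i + i + N3 | j = i + i + N2 & vld x i)" if y: "pr j y \<in> elts (rnt f t)" for j y
    proof -
      obtain z where "pr j z \<in> elts t" using y mem_rnt[OF f] by blast
      then show ?thesis using b unfolding br_def by blast
    qed
    show "EX z. pr (i + i + N3) z \<in> elts (rnt f t)" if "i < l" for i using b that unfolding br_def 3 by blast
    show "EX z. pr (i + i + N2) z \<in> elts (rnt f t)" if "i < l" "vld x i" for i using b that unfolding br_def 2 by blast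
    show "pr x (pr z' z) \<in> Q" if "pr (i + i + N3) z \<in> elts (rnt f t) & pr (i + 1 + (i + 1) + N3) z' \<in> elts (rnt f t)" for i z z'
      using b that unfolding br_def 3 by blast
    have Az: "A z & K z m" if "pr (i + i + N2) z \<in> elts t" for i z using b that unfolding br_def by blast
    show "B z" "L z (f m)" if "pr (i + i + N2) z \<in> elts (rnt f t)" for i z
      using that Az fAB fm Am unfolding 2 by blast+
    fix y s s' z z'
    assume "elts s \<subset> elts s' & pr (pr y s + pr y s + N2) z \<in> elts (rnt f t) & pr (pr y s' + pr y s' + N2) z' \<in> elts (rnt f t)"
    then obtain v v' where v: "elts s \<subset> elts s'" "pr (pr y s + pr y s + N2) v \<in> elts t" "z = f v"
        "pr (pr y s' + pr y s' + N2) v' \<in> elts t" "z' = f v'" unfolding 2 by blast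
    have "K v' v" using b v(1,2,4) unfolding br_def by blast
    then show "L z' z" using Az[OF v(2)] Az[OF v(4)] fm v(3,5) by blast
  qed
qed

lemma rnt_mct: "df1 f ==> rnt f (mct m) = mct (f m)"
proof (rule rnt_eqI)
  show "pr j y \<in> elts (mct (f m)) <-> (EX z. pr j z \<in> elts (mct m) & y = (if Zpos j then f z else z))" for j y
    by (cases "j = 0"; cases "j = 1") auto
qed (auto simp: mct_def)

lemma PF_rnt: assumes f: "df1 f" and P: "PF (%_. True) t" shows "PF (%_. True) (rnt f t)"
  unfolding PF_def mem_rnt[OF f] using FinSet_rnt[OF f] elts_rnt[OF f, of t] PFD(3)[OF P] by auto (metis, metis, metis)

lemma E_rnt:
  assumes m: "mono_on_ord A K B L f" and t: "E A K t" shows "E B L (rnt f t)"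
proof -
  have f: "df1 f" and fAB: "!!x. A x ==> B (f x)" using m unfolding mono_on_ord_def by blast+
  obtain k where k: "pr 0 k \<in> elts t" "A k" "t = mct k | (EX x l. br A K k x l t)" and P: "PF (%_. True) t"
    using t unfolding E_def by blast
  have "pr 0 (f k) \<in> elts (rnt f t)" unfolding mem_rnt[OF f] using k(1) by auto
  moreover have "rnt f t = mct (f k) | (EX x l. br B L (f k) x l (rnt f t))"
    using k(3) br_rnt[OF m _ k(2) E_PF[OF t]] rnt_mct[OF f] by blast
  ultimately show ?thesis unfolding E_def using PF_rnt[OF f P] fAB[OF k(2)] by blast
qed

lemma lc_rnt:
  assumes m: "mono_on_ord A K B L f" and st: "PF A s" "PF A t" and l: "lc K s t" shows "lc L (rnt f s) (rnt f t)"
proof -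
  have f: "df1 f" and fm: "!!x y. A x ==> A y ==> K x y ==> L (f x) (f y)" using m unfolding mono_on_ord_def by blast+
  obtain j where j: "lca K j s t" using l unfolding lc_def by blast
  let ?f = "%z. if Zpos j then f z else z"
  obtain z where z: "pr j z \<in> elts s" "(ALL z'. pr j z' \<notin> elts t) | (EX z'. pr j z' \<in> elts t & lab K j z z')"
    using j unfolding lca_def by blast
  have "lab L j (?f z) (?f z')" if z': "pr j z' \<in> elts t" "lab K j z z'" for z'
    using z'(2) fm PFD(4)[OF st(1) z(1)] PFD(4)[OF st(2) z'(1)] unfolding lab_def by auto
  then have "(ALL z'. pr j z' \<notin> elts (rnt f t)) | (EX z'. pr j z' \<in> elts (rnt f t) & lab L j (?f z) z')"
    unfolding mem_rnt[OF f] using z(2) by blast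
  moreover have "pr j (?f z) \<in> elts (rnt f s)" unfolding mem_rnt[OF f] using z(1) by blast
  moreover have "ALL i<j. ALL z. pr i z \<in> elts (rnt f s) <-> pr i z \<in> elts (rnt f t)"
    unfolding mem_rnt[OF f] using j unfolding lca_def by simp
  ultimately have "lca L j (rnt f s) (rnt f t)" unfolding lca_def by blast
  then show ?thesis unfolding lc_def by blast
qed

text \<open>Both sides say that the leading value \<open>k\<close> of \<open>t\<close> is below
  \<open>m\<close>: the other values in the support of \<open>t\<close> are below \<open>k\<close>,
  and no element with leading value \<open>m\<close> precedes \<open>mct m\<close>.\<close>

lemma lc_mct_iff:
  assumes L: "linord A L" and t: "E A L t" and m: "A m"
  shows "lc L t (mct m) <-> (ALL i:elts (spt t). L i m)"
proof -
  obtain k where k: "pr 0 k \<in> elts t" "A k" "t = mct k | (EX x l. br A L k x l t)" and P: "PF (%_. True) t"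
    using t unfolding E_def by blast
  have "L k m" if l: "lc L t (mct m)"
  proof -
    obtain j where j: "lca L j t (mct m)" using l unfolding lc_def by blast
    obtain z where z: "pr j z \<in> elts t" "(ALL z'. pr j z' \<notin> elts (mct m)) | (EX z'. pr j z' \<in> elts (mct m) & lab L j z z')"
      using j unfolding lca_def by blast
    have a: "i < j ==> pr i z \<in> elts t <-> pr i z \<in> elts (mct m)" for i z using j unfolding lca_def by blast
    show "L k m"
    proof (cases "j = 0")
      case True
      then have "z = k" using z(1) k(1) PFD(3)[OF P, of 0 z k] by simp
      then show ?thesis using z(2) True by (auto simp: lab_def)
    next
      case False
      then have j0: "0 < j" by (simp add: less_le)
      have km: "k = m" using a[OF j0, of k] k(1) by simp
      show ?thesis
      proof (cases "j = 1")
        case True then show ?thesis using z(2) by (auto simp: lab_def)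
      next
        case False
        then have "1 < j" using j0 Suc_le[of 0 j] by (simp add: less_le)
        then have "pr 1 0 \<in> elts t" using a by simp
        then have "~ br A L k x l t" for x l using PFD(3)[OF P, of 1 0 "x + 1"] unfolding br_def by auto
        then have "t = mct m" using k(3) km by blast
        then show ?thesis using z km by (auto simp: lab_def)
      qed
    qed
  qed
  moreover have "lc L t (mct m)" if "L k m"
  proof -
    have "lca L 0 t (mct m)" unfolding lca_def using k(1) that by (auto simp: lab_def)
    then show ?thesis unfolding lc_def by blast
  qed
  moreover have "k \<in> elts (spt t)" using k(1) by auto
  moreover have "L z m" if z: "z \<in> elts (spt t)" and km: "L k m" for z
  proof -
    obtain j where j: "pr j z \<in> elts t" "Zpos j" using z by auto
    have "z = k | (A z & L z k)" using k(3)
    proof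
      assume "t = mct k" then show ?thesis using j by auto
    next
      assume "EX x l. br A L k x l t" then show ?thesis using br_pos[OF P _ j k(1)] by blast
    qed
    then show ?thesis using km linordD(2)[OF L, of z k m] k(2) m by blast
  qed
  ultimately show ?thesis by blast
qed

lemma concrete_E: "concrete E lc rnt spt mct"
proof
  show "dfm (%e. E (%i. i < n e) (<) (t e))" if "dtm n" "dtm t" for n t
    by (rule dfm_E_ctx[OF _ dfm_less2 that(2)]) (intro dfm_intros dtm_ren[OF that(1)])
  show "dtm (%e. rnt (%m. f m e) (t e))" if f: "dtm (%e. f (e 0) (%i. e (Suc i)))" and t: "dtm t" for f t
  proof -
    have f': "dtm u ==> dtm (%e. f (u e) (%i. e (h i)))" for u h
      using dtm_sub[of "%m e. f m (%i. e (h i))" u] dtm_ren[OF f, of "%i. if i = 0 then 0 else Suc (h (i - 1))"] by simp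
    show ?thesis unfolding rnt_def by (intro dfm_intros f' dtm_ren[OF t])
  qed
  show "df1 spt" unfolding spt_def by (intro dfm_intros)
  show "df1 mct" by (intro dfm_intros)
  show "linord (E A L) (lc L)" if "linord A L" for A L
    by (rule linord_subset[OF linord_PF[OF that] E_PF])
  show "lc L (rnt f s) (rnt f t)" if "mono_on_ord A K B L f" "E A K s" "E A K t" "lc K s t" for A K B L f s t
    by (rule lc_rnt[OF that(1) E_PF[OF that(2)] E_PF[OF that(3)] that(4)])
  show "E A L (mct m)" if "A m" for A L m
    unfolding E_def PF_def using that by (auto simp: mct_def)
next
  fix A L t assume t: "E A L t"
  note P = E_PF[OF t]
  show "rnt f t = rnt g t" if f: "df1 f" "df1 g" "!!i. i \<in> elts (spt t) ==> f i = g i" for f g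
  proof (rule rnt_eqI[OF f(1) FinSet_rnt[OF f(2)]])
    have "(if Zpos j then g z else z) = (if Zpos j then f z else z)" if "pr j z \<in> elts t" for j z
    proof -
      have "Zpos j ==> f z = g z" by (rule f(3)) (use that in auto)
      then show ?thesis by simp
    qed
    then show "pr j y \<in> elts (rnt g t) <-> (EX z. pr j z \<in> elts t & y = (if Zpos j then f z else z))" for j y
      unfolding mem_rnt[OF f(2)] by metis
  qed (auto simp: elts_rnt[OF f(2)])
  show "rnt f t = t" if f: "df1 f" "!!i. A i ==> f i = i" for f
    by (rule rnt_eqI[OF f(1) PFD(1)[OF P] PFD(2)[OF P]]) (use f(2) PFD(4)[OF P] in auto)
  show "rnt g (rnt f t) = rnt (%i. g (f i)) t" if f: "df1 f" "df1 g" for f g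
  proof -
    have gf: "df1 (%i. g (f i))" by (rule dtm_sub1[OF f(2,1)])
    show ?thesis
      by (rule rnt_eqI[OF f(2) FinSet_rnt[OF gf]]) (auto simp: elts_rnt[OF f(1)] elts_rnt[OF gf])
  qed
  show "elts (spt (rnt f t)) = f ` elts (spt t)" if "df1 f" for f
    using that by (auto simp: elts_rnt)
  show "FinSet (spt t)" by (rule FinSet_spt)
  show "i \<in> elts (spt t) ==> A i" for i using PFD(4)[OF P] by auto
  show "E (%i. i \<in> elts (spt t)) L t"
  proof -
    have "pr (i + i + N2) z \<in> elts t ==> z \<in> elts (spt t)" for i z using pos_simps(3)[of i] by auto
    then have "br A L m x l t ==> br (%i. i \<in> elts (spt t)) L m x l t" for m x l
      unfolding br_def by blast
    moreover have "pr 0 m \<in> elts t ==> m \<in> elts (spt t)" for m by auto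
    ultimately show ?thesis using t unfolding E_def by blast
  qed
  show "lc L t (mct m) <-> (ALL i:elts (spt t). L i m)" if "linord A L" "A m" for m by (rule lc_mct_iff[OF that(1) t that(2)])
qed (auto intro: E_rnt dfm_lc rnt_mct)

section \<open>The leftmost path\<close>

lemma not_wfs:
  assumes n: "~ wfs Q x"
  obtains g where "df1 g" "!!i. pr x (pr (g (i + 1)) (g i)) \<in> Q"
proof -
  have d: "dp2 (%p q. pr x (pr p q) \<in> Q)" by (intro dfm_mem Q dfm_intros)
  have "~ wellf (%_. True) (%p q. pr x (pr p q) \<in> Q)" using n wellf_iff_mwf[OF d] unfolding wfs_def by blast
  then obtain G where G: "G \<in> SS" "ALL n. EX x. pr n x \<in> G" "ALL n x y. pr n x \<in> G & pr n y \<in> G --> x = y"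
    "ALL n p q. pr n p \<in> G & pr (n + 1) q \<in> G --> pr x (pr q p) \<in> Q"
    unfolding wellf_def by blast
  define g where "g n = the0 (%p. pr n p \<in> G)" for n
  have g: "pr n (g n) \<in> G" for n
  proof -
    obtain p where p: "pr n p \<in> G" using G(2) by blast
    have "g n = p" unfolding g_def by (rule the0_equality[of "%p. pr n p \<in> G", OF p]) (rule G(3)[rule_format, OF conjI[OF _ p]])
    then show ?thesis using p by simp
  qed
  show ?thesis
  proof (rule that)
    show "df1 g" unfolding g_def by (intro dfm_intros dfm_mem G(1))
    show "pr x (pr (g (i + 1)) (g i)) \<in> Q" for i by (rule G(4)[rule_format, OF conjI[OF g g]])
  qed
qed

lemma sq_gr: assumes g: "df1 g" "!!i. pr y (pr (g (i + 1)) (g i)) \<in> Q" shows "sq Q y n (gr n g)"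
proof -
  have "gr n g = gr n (fapp (gr n g))" by (rule gr_cong) (use g(1) in simp)
  moreover have "fapp (gr n g) (i + 1) = g (i + 1)" "fapp (gr n g) i = g i" if "i + 1 < n" for i
    using that g(1) less_trans[of i "i + 1" n] less_Suc[of i i] by simp_all
  ultimately show ?thesis unfolding sq_def using g(2) by simp
qed

lemma gr_mono: assumes "df1 g" shows "elts (gr n g) \<subset> elts (gr (n + 1) g)"
proof -
  have "i < n ==> i < n + 1" for i using less_Suc[of i n] by simp
  moreover have "pr n (g n) \<in> elts (gr (n + 1) g)" "pr n (g n) \<notin> elts (gr n g)"
    using pr_in_gr[OF assms] less_Suc[of n n] by auto
  moreover have "elts (gr n g) \<subseteq> elts (gr (n + 1) g)" using calculation(1) elts_gr[OF assms] by auto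
  ultimately show ?thesis by blast
qed

text \<open>The leftmost path through the elements of a set \<open>D\<close> without minimal element yields a sequence that is
  descending for the relation with index \<open>x\<close> together with ranking functions for all smaller indices.\<close>

lemma mwf_E:
  assumes prog: "!!x. x \<in> X ==> (!!y. y \<in> X ==> pr y x \<in> R ==> wfs Q y) ==> wfs Q x"
    and L: "dp2 L" "linord A L" and w: "mwf A L"
  shows "mwf (E A L) (lc L)"
  unfolding mwf_def
proof (intro ballI impI, rule ccontr)
  fix D assume D: "D \<in> SS" "ALL t:D. E A L t" "D ~= {}" and "~ (EX m:D. ALL y:D. ~ lc L y m)"
  then have nomin: "EX s:D. lc L s t" if "t \<in> D" for t using that by blast
  have PFt: "PF A t" if "t \<in> D" for t using E_PF D(2) that by blast
  \<comment> \<open>Values are shifted by one again, with 0 for an undefined position.\<close>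
  define lb where "lb t j = the0 (%w. EX z. pr j z \<in> elts t & w = z + 1)" for t j
  have dlb: "dtm t ==> dtm j ==> dtm (%e. lb (t e) (j e))" for t j
    by (rule dtm_sub2[of lb]) (unfold lb_def, intro dfm_intros)
  have lb: "lb t j = z + 1 <-> pr j z \<in> elts t" if "t \<in> D" for t j z
  proof -
    have u: "lb t j = z + 1" if z: "pr j z \<in> elts t" for z
    proof -
      have "y = z" if "pr j y \<in> elts t" for y using PFD(3)[OF PFt[OF \<open>t \<in> D\<close>] that z] .
      then show ?thesis unfolding lb_def using z by (intro the0_equality) blast+
    qed
    show ?thesis
    proof
      assume l: "lb t j = z + 1"
      have "lb t j = 0" if "ALL z. pr j z \<notin> elts t" unfolding lb_def the0_eq using that by blast
      then obtain z' where z': "pr j z' \<in> elts t" using l by fastforce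
      then show "pr j z \<in> elts t" using u[OF z'] l by simp
    qed (rule u)
  qed
  have lb0: "lb t j = 0 <-> (ALL z. pr j z \<notin> elts t)" if "t \<in> D" for t j
    using lb[OF that, of j] N_cases[of "lb t j"] by (metis numerals_distinct(2))
  \<comment> \<open>\<open>H\<close> continues the path by the least value that occurs at
    \<open>j\<close> among the elements of \<open>D\<close> that agree with the path so far. The
    default 0 of \<open>the0\<close> records that none of them is defined at
    \<open>j\<close>.\<close>
  define cH where "cH g j t <-> t \<in> D & (ALL i<j. lb t i = fapp g i)" for g j t
  define H where "H j g = the0 (%w. EX z. w = z + 1 & (EX t. cH g j t & pr j z \<in> elts t)
      & (ALL t z'. cH g j t & pr j z' \<in> elts t --> ~ lab L j z' z))" for j g
  have dH: "dtm (%e. H (e 0) (e (Suc 0)))"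
    unfolding H_def cH_def by (intro dfm_intros dfm_mem D dlb dfm_lab L)
  define G where "G = recur H"
  have dG: "dtm t ==> dtm (%e. G (t e))" for t unfolding G_def by (intro dfm_intros dH)
  define cm where "cm j t <-> t \<in> D & (ALL i<j. lb t i = G i)" for j t
  have dcm: "dtm j ==> dtm t ==> dfm (%e. cm (j e) (t e))" for j t
    by (rule dfm_sub2[of cm]) (unfold cm_def, intro dfm_intros dfm_mem D dlb dG)
  have cmD: "cm j t ==> t \<in> D" "cm j t ==> i < j ==> lb t i = G i" for i j t unfolding cm_def by blast+
  have cmI: "cm j t ==> lb t j = G j ==> cm (j + 1) t" for j t
    unfolding cm_def using less_Suc[of _ j] by (metis le_less)
  define P where "P j w <-> (EX z. w = z + 1 & (EX t. cm j t & pr j z \<in> elts t) & (ALL t z'. cm j t & pr j z' \<in> elts t --> ~ lab L j z' z))" for j w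
  have Geq: "G j = the0 (P j)" for j
  proof -
    have "fapp (gr j G) i = G i" if "i < j" for i using that by (intro fapp_gr dG dfm_intros)
    then have "cH (gr j G) j t <-> cm j t" for t unfolding cH_def cm_def by simp
    then have "H j (gr j G) = the0 (P j)" unfolding H_def P_def by simp
    then show ?thesis using recur_eq[OF dH, of j] unfolding G_def by simp
  qed
  have G1: "P j (G j)" if t0: "cm j t0" "pr j z0 \<in> elts t0" for j t0 z0
  proof -
    define C where "C z <-> (EX t. cm j t & pr j z \<in> elts t)" for z
    have dC: "dp1 C" unfolding C_def by (intro dfm_intros dcm)
    have CA: "A z" if "C z" "Zpos j" for z using that PFD(4)[OF PFt] cmD(1) unfolding C_def by blast
    have "C z0" unfolding C_def using t0 by blast
    \<comment> \<open>Values at even positions lie in the well-founded order, those at odd positions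
      are numbers.\<close>
    have "EX z. C z & (ALL z'. C z' --> ~ lab L j z' z)"
    proof (cases "Zpos j")
      case True
      then show ?thesis using mwfD[OF w dC CA \<open>C z0\<close>] unfolding lab_def by (metis (full_types))
    next
      case False
      then show ?thesis using N_least[OF dC \<open>C z0\<close>] unfolding lab_def by (metis (full_types))
    qed
    then obtain z where z: "C z" "!!z'. C z' ==> ~ lab L j z' z" by blast
    have Pz: "P j (z + 1)" unfolding P_def using z unfolding C_def by blast
    have "v = z + 1" if v: "P j v" for v
    proof -
      obtain y where y: "v = y + 1" "C y" "!!z'. C z' ==> ~ lab L j z' y" using v unfolding P_def C_def by blast
      have "y = z" using lab_lin(2)[OF L(2), of j y z y] CA z y by blast
      then show ?thesis using y by simp
    qed
    then have "the0 (P j) = z + 1" by (rule the0_equality[of "P j", OF Pz])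
    then show ?thesis using Pz unfolding Geq by simp
  qed
  have G2: "G j = 0" if "!!t z. cm j t ==> pr j z \<notin> elts t" for j
    unfolding Geq the0_eq using that unfolding P_def by blast
  have G3: "EX t. cm j t" for j
  proof (induction j rule: N_induct)
    case dfm show ?case by (intro dfm_intros dcm)
  next
    case 0 show ?case using D(3) unfolding cm_def by auto
  next
    case (Suc j)
    show ?case
    proof (cases "EX t z. cm j t & pr j z \<in> elts t")
      case True
      then obtain z t where "G j = z + 1" "cm j t" "pr j z \<in> elts t" using G1 unfolding P_def by blast
      then have "cm (j + 1) t" using cmI lb cmD(1) by metis
      then show ?thesis by blast
    next
      case False
      then have "G j = 0" by (intro G2) blast
      moreover obtain t where t: "cm j t" using Suc by blast
      ultimately have "lb t j = G j" using lb0[OF cmD(1)[OF t]] False t by metis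
      then show ?thesis using cmI t by blast
    qed
  qed
  \<comment> \<open>A smaller element that differs before \<open>k\<close> would offer a smaller
    value than the one chosen for the path.\<close>
  have G4: "k <= j" if t: "cm k t" and s: "s \<in> D" "lca L j s t" for k j s t
  proof (rule ccontr)
    assume "~ k <= j"
    then have jk: "j < k" by simp
    have "lb s i = lb t i" if "i < j" for i
      using s(2) that lb[OF s(1), of i] lb[OF cmD(1)[OF t], of i] N_cases[of "lb s i"] N_cases[of "lb t i"]
      unfolding lca_def by metis
    then have cs: "cm j s" unfolding cm_def using s(1) cmD(2)[OF t] jk less_trans by metis
    obtain z where z: "pr j z \<in> elts s" "(ALL z'. pr j z' \<notin> elts t) | (EX z'. pr j z' \<in> elts t & lab L j z z')"
      using s(2) unfolding lca_def by blast
    obtain y where y: "G j = y + 1" "ALL t z'. cm j t & pr j z' \<in> elts t --> ~ lab L j z' y"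
      using G1[OF cs z(1)] unfolding P_def by blast
    have "pr j y \<in> elts t" using lb[OF cmD(1)[OF t]] cmD(2)[OF t jk] y(1) by simp
    then show False using z y(2) cs PFD(3)[OF PFt[OF cmD(1)[OF t]]] by metis
  qed
  \<comment> \<open>As \<open>D\<close> has no minimal element, there are always elements that agree
    with the path up to \<open>k\<close> and are defined at some position from \<open>k\<close> on;
    this is what keeps the path going.\<close>
  have below: "EX s j. s \<in> D & k <= j & lca L j s t" if "cm k t" for k t
    using nomin[OF cmD(1)[OF that]] G4[OF that] unfolding lc_def by blast
  have Gd: "G j = z + 1 <-> pr j z \<in> elts t" if "cm k t" "j < k" for j k t z
    using lb[OF cmD(1)[OF that(1)]] cmD(2)[OF that] by metis
  have agree: "pr i z \<in> elts s <-> pr i z \<in> elts t" if "lca L j s t" "k <= j" "i < k" for i j k s t z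
    using that less_le_trans unfolding lca_def by blast
  have ED: "EX m. pr 0 m \<in> elts t & A m & (t = mct m | (EX x l. br A L m x l t))" if "t \<in> D" for t
    using D(2) that unfolding E_def by blast
  have lt2: "(0::N) < N2" "(1::N) < N2" by (simp_all add: less_Suc)
  \<comment> \<open>Otherwise some \<open>s\<close> below \<open>t\<close> that agrees with it at
    the positions 0 and 1 would be of the form \<open>mct m\<close>, which is defined nowhere
    else.\<close>
  have mct: "~ pr 1 0 \<in> elts t" if t: "cm N2 t" for t
  proof
    assume 0: "pr 1 0 \<in> elts t"
    obtain s j where s: "s \<in> D" "N2 <= j" "lca L j s t" using below[OF t] by blast
    obtain m where m: "pr 0 m \<in> elts s" "s = mct m | (EX x l. br A L m x l s)" using ED[OF s(1)] by blast
    have "pr 1 0 \<in> elts s" using 0 agree[OF s(3,2) lt2(2)] by blast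
    then have "~ br A L m x l s" for x l using PFD(3)[OF PFt[OF s(1)], of 1 0 "x + 1"] unfolding br_def by auto
    then have "s = mct m" using m by blast
    moreover obtain z where "pr j z \<in> elts s" using s(3) unfolding lca_def by blast
    ultimately have "j = 0 | j = 1" by auto
    then show False using s(2) lt2 by auto
  qed
  obtain t2 where t2: "cm N2 t2" using G3 by blast
  obtain m x l where m: "pr 0 m \<in> elts t2" and x: "br A L m x l t2" using ED[OF cmD(1)[OF t2]] mct[OF t2] by auto
  have Gm: "G 0 = m + 1" "G 1 = (x + 1) + 1" using Gd[OF t2] lt2 m x unfolding br_def by blast+
  have xX: "x \<in> X" using x unfolding br_def by blast
  have brD: "EX l. br A L m x l t" if t: "t \<in> D" "pr 0 m \<in> elts t" "pr 1 (x + 1) \<in> elts t" for t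
  proof -
    obtain m' where m': "pr 0 m' \<in> elts t" "t = mct m' | (EX x l. br A L m' x l t)" using ED[OF t(1)] by blast
    note u = PFD(3)[OF PFt[OF t(1)]]
    have "m' = m" using u m'(1) t(2) by blast
    moreover have "t ~= mct m'" using t(3) by auto
    moreover have "x' = x" if "br A L m x' l t" for x' l using u[of 1 "x' + 1" "x + 1"] that t(3) unfolding br_def by simp
    ultimately show ?thesis using m'(2) by metis
  qed
  have brc: "EX l. br A L m x l t" if t: "cm k t" "N2 <= k" for k t
    by (rule brD[OF cmD(1)[OF t(1)]]) (use Gd[OF t(1)] Gm lt2 t(2) less_le_trans in blast)+
  have pos2: "N2 <= i + i + N2" "N2 <= i + i + N3" for i
  proof -
    show "N2 <= i + i + N2" by (rule add_increasing) simp_all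
    have "N2 <= N3" by simp
    then show "N2 <= i + i + N3" by (rule add_increasing[rotated]) simp
  qed
  \<comment> \<open>If the path were undefined here, an element that agrees with it up to this
    position would have length at most \<open>i\<close> and thus no later values, against
    \<open>below\<close>.\<close>
  have G5: "EX z. G (i + i + N3) = z + 1" for i
  proof (rule ccontr)
    let ?j = "i + i + N3"
    assume "~ (EX z. G ?j = z + 1)"
    then have G0: "G ?j = 0" using N_cases[of "G ?j"] by metis
    obtain t where t: "cm (?j + 1) t" using G3 by blast
    obtain s j where s: "s \<in> D" "?j + 1 <= j" "lca L j s t" using below[OF t] by blast
    have j: "?j < j" using s(2) by (simp only: Suc_le)
    have 2: "N2 <= ?j + 1" by (rule order_trans[OF pos2(2)[of i]]) simp
    have ag: "pr k z \<in> elts s <-> G k = z + 1" if "k < ?j + 1" for k z using agree[OF s(3,2) that] Gd[OF t that] by blast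
    have "EX l. br A L m x l s"
      by (rule brD[OF s(1)]) (use ag[of 0 m] ag[of 1 "x + 1"] Gm lt2 2 less_le_trans in blast)+
    then obtain l where b: "br A L m x l s" by blast
    have "?j < ?j + 1" by (simp only: less_Suc)
    then have n: "pr ?j z \<notin> elts s" for z using ag G0 by simp
    have il: "l <= i"
    proof (rule ccontr)
      assume "~ l <= i" then have "i < l" by simp
      then show False using b n unfolding br_def by blast
    qed
    obtain z where "pr j z \<in> elts s" using s(3) unfolding lca_def by blast
    then consider "j = 0" | "j = 1" | k where "k < l" "j = k + k + N3 | j = k + k + N2" using b unfolding br_def by blast
    then show False
    proof cases
      case 3
      have "k < i" using 3(1) il by simp
      then have "k + k < i + i" by (simp only: dbl_less)
      then have "k + k + N2 < i + i + N2" "k + k + N3 < i + i + N3" by (simp_all only: add_less_cancel_right)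
      moreover have "i + i + N2 < i + i + N3" by simp
      ultimately show False using j 3(2) by (meson less_trans less_asym)
    qed (use j pos2(2)[of i] lt2 in \<open>meson less_le_trans less_asym\<close>)+
  qed
  define u where "u i = the0 (%z. G (i + i + N3) = z + 1)" for i
  have u: "G (i + i + N3) = u i + 1" for i
  proof -
    obtain z where z: "G (i + i + N3) = z + 1" using G5 by blast
    then have "u i = z" unfolding u_def by (intro the0_equality) auto
    then show ?thesis using z by simp
  qed
  have du: "dtm t ==> dtm (%e. u (t e))" for t
    by (rule dtm_sub1[of u]) (unfold u_def, intro dfm_intros dG)
  have uQ: "pr x (pr (u (i + 1)) (u i)) \<in> Q" for i
  proof -
    let ?k = "i + 1 + (i + 1) + N3"
    obtain t where t: "cm (?k + 1) t" using G3 by blast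
    have "i + i + N3 < ?k" "?k < ?k + 1" using dbl_less[of i "i + 1"] less_Suc[of i i] by (simp_all only: add_less_cancel_right less_Suc)
    then have "pr (i + i + N3) (u i) \<in> elts t" "pr ?k (u (i + 1)) \<in> elts t"
      using Gd[OF t] u[of i] u[of "i + 1"] less_trans by blast+
    moreover obtain l where "br A L m x l t" using brc[OF t] order_trans[OF pos2(2)[of "i + 1"]] by force
    ultimately show ?thesis unfolding br_def by blast
  qed
  have "~ wfs Q x"
  proof
    assume "wfs Q x"
    then have w: "mwf (%_. True) (%p q. pr x (pr p q) \<in> Q)" unfolding wfs_def .
    define C where "C v <-> (EX i. v = u i)" for v
    have dC: "dp1 C" unfolding C_def by (intro dfm_intros du)
    have "C (u 0)" unfolding C_def by blast
    then obtain v where v: "C v" "!!y. C y ==> pr x (pr y v) \<notin> Q" using mwfD[OF w dC] by blast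
    obtain i where "v = u i" using v(1) unfolding C_def by blast
    then show False using uQ[of i] v(2)[of "u (i + 1)"] unfolding C_def by blast
  qed
  \<comment> \<open>The sequence \<open>u\<close> refutes \<open>wfs Q x\<close>, so by
    progressiveness some \<open>y\<close> below \<open>x\<close> admits a descending sequence
    \<open>g\<close>. The ranks that the path assigns to the initial segments of \<open>g\<close>
    will descend in \<open>A\<close>, against \<open>w\<close>.\<close>
  then obtain y where y: "y \<in> X" "pr y x \<in> R" "~ wfs Q y" using prog xX by blast
  obtain g where g: "df1 g" "!!i. pr y (pr (g (i + 1)) (g i)) \<in> Q" using not_wfs[OF y(3)] by blast
  let ?p = "%n. pr y (gr n g)"
  have vld: "vld x (?p n)" for n unfolding vld_def using y(1,2) sq_gr[OF g] by blast
  have v: "EX z. G (?p n + ?p n + N2) = z + 1 & A z" for n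
  proof -
    let ?i = "?p n"
    obtain t where t: "cm (?i + ?i + N3 + 1) t" using G3 by blast
    have lt: "?i + ?i + N2 < ?i + ?i + N3 + 1" "?i + ?i + N3 < ?i + ?i + N3 + 1" by (simp_all add: less_Suc)
    \<comment> \<open>That \<open>t\<close> is defined at the odd position belonging to
      \<open>?i\<close> shows \<open>?i < l\<close>, so that \<open>?i\<close> is within reach of
      the ranking.\<close>
    have "pr (?i + ?i + N3) (u ?i) \<in> elts t" using Gd[OF t lt(2)] u by blast
    moreover obtain l where b: "br A L m x l t" using brc[OF t] order_trans[OF pos2(2)[of ?i]] by force
    ultimately have "EX i<l. ?i + ?i + N3 = i + i + N3 | ?i + ?i + N3 = i + i + N2"
      using pos2(2)[of ?i] lt2 unfolding br_def by (metis leD)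
    then have "?i < l" using pos_simps by metis
    then obtain z where z: "pr (?i + ?i + N2) z \<in> elts t" using b vld unfolding br_def by blast
    then have "A z" using b unfolding br_def by blast
    then show ?thesis using Gd[OF t lt(1)] z by blast
  qed
  have vless: "L z' z" if z: "G (?p n + ?p n + N2) = z + 1" "G (?p (n + 1) + ?p (n + 1) + N2) = z' + 1" for n z z'
  proof -
    let ?k = "max (?p n + ?p n + N2) (?p (n + 1) + ?p (n + 1) + N2)"
    obtain t where t: "cm (?k + 1) t" using G3 by blast
    have "?p n + ?p n + N2 < ?k + 1" "?p (n + 1) + ?p (n + 1) + N2 < ?k + 1" by (simp_all only: less_Suc max.cobounded1 max.cobounded2)
    then have "pr (?p n + ?p n + N2) z \<in> elts t" "pr (?p (n + 1) + ?p (n + 1) + N2) z' \<in> elts t" using Gd[OF t] z by blast+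
    moreover have "N2 <= ?k + 1" by (rule order_trans[OF pos2(1)[of "?p n"]]) (simp add: le_max_iff_disj add_increasing2)
    then obtain l where "br A L m x l t" using brc[OF t] by blast
    ultimately show ?thesis using gr_mono[OF g(1), of n] unfolding br_def by blast
  qed
  define C where "C z <-> (EX n. G (?p n + ?p n + N2) = z + 1)" for z
  have "dp1 C" unfolding C_def by (intro dfm_intros dG dtm_sub1[OF g(1)])
  moreover have "A z" if "C z" for z using v that unfolding C_def by (metis add_right_cancel)
  moreover obtain z0 where "C z0" using v unfolding C_def by blast
  ultimately obtain z where z: "C z" "!!y. C y ==> ~ L y z" using mwfD[OF w] by blast
  obtain n where n: "G (?p n + ?p n + N2) = z + 1" using z(1) unfolding C_def by blast
  obtain z' where z': "G (?p (n + 1) + ?p (n + 1) + N2) = z' + 1" using v by blast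
  show False using vless[OF n z'] z(2)[of z'] z' unfolding C_def by blast
qed

lemma spwf_E:
  assumes "!!x. x \<in> X ==> (!!y. y \<in> X ==> pr y x \<in> R ==> wfs Q y) ==> wfs Q x"
  shows "spwf (concrete.FD E lc rnt spt mct)"
  by (rule concrete.spwf_FD[OF concrete_E]) (rule mwf_E[OF assms])

end

section \<open>Ranking functions from an upper derivative\<close>

locale ranking = tree X R Q + upder "concrete.FD E lc rnt spt mct" S Z for X R Q :: "N set" and S Z +
  assumes lin: "linord (%x. x \<in> X) (%x y. pr x y \<in> R)"
begin

abbreviation "XA \<equiv> %x. x \<in> X"
abbreviation "XL \<equiv> %x y. pr x y \<in> R"
abbreviation "W \<equiv> Dfield S XA"
abbreviation "WL \<equiv> Dless S XL"

interpretation C: concrete E lc rnt spt mct by (rule concrete_E)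

lemma XA: "dp1 XA" and XL: "dp2 XL"
  by (intro dfm_mem X R dfm_intros)+

lemmas WW = dpW[OF XA XL lin] W_linord[OF XA XL lin]

text \<open>The collapse of \<open>D(W)\<close> into \<open>W\<close>, with \<open>D(W)\<close> read
  as \<open>E W WL\<close>.\<close>

definition Th :: "N => N" where "Th t = Xi XL (C.toD WL t)"

lemma dtm_Th: "dtm t ==> dtm (%e. Th (t e))"
  unfolding Th_def by (rule dtm_sub1[OF df1_Xi[OF XA XL lin]]) (rule C.dtm_toD[OF WW])

lemma Th: "E W WL t ==> W (Th t)"
  unfolding Th_def by (rule Xi_field[OF XA XL lin C.toD(1)[OF WW]])

lemma Th_less: "E W WL s ==> E W WL t ==> lc WL s t ==> WL (Th s) (Th t)"
  unfolding Th_def by (rule Xi_less[OF XA XL lin C.toD(1)[OF WW] C.toD(1)[OF WW] C.toD_less[OF WW]])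

lemma Th_mct: "x \<in> X ==> Th (mct (S.Dmu x)) = S.Dmu x"
  unfolding Th_def using C.toD_mc[OF WW S.Dfield_Dmu] Xi_mu[OF XA XL lin, of x] by simp

definition hF :: "(N => N) => N => N => N" where
  "hF f x s = code ({q. q = pr 0 (S.Dmu x) | q = pr 1 (x + 1)} \<union>
     ({q. EX i u. pr i u \<in> elts s & True & q = pr (i + i + N3) u} \<union> {q. EX i u. pr i u \<in> elts s & vld x i & q = pr (i + i + N2) (f i)}))"

text \<open>The rank of the descending sequence \<open>s\<close> for the index \<open>x\<close>, by
  recursion on the code \<open>pr x s\<close>. It refers to ranks of pairs \<open>i\<close> in the
  domain of \<open>s\<close> only; such an \<open>i\<close> is smaller than \<open>s\<close>,
  whatever the index in it is. In this way ranks for all indices are defined at once.\<close>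

definition rk :: "N => N" where
  "rk = recur (%p g. Th (hF (fapp g) (pr1 p) (pr2 p)))"

lemma dtm_Dmu: "dtm t ==> dtm (%e. S.Dmu (t e))"
  by (rule S.dtm_Dmu)

lemma elts_hF: "df1 f ==> elts (hF f x s) = {q. q = pr 0 (S.Dmu x) | q = pr 1 (x + 1) | (EX i u. pr i u \<in> elts s & q = pr (i + i + N3) u)
     | (EX i u. pr i u \<in> elts s & vld x i & q = pr (i + i + N2) (f i))}"
  and FinSet_hF: "df1 f ==> FinSet (hF f x s)"
proof -
  assume f: "df1 f"
  have "coded_set {q. EX i u. pr i u \<in> elts s & True & q = pr (i + i + N3) u}"
    "coded_set {q. EX i u. pr i u \<in> elts s & vld x i & q = pr (i + i + N2) (f i)}"
    by (intro coded_pairs dfm_intros dtm_sub1[OF f])+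
  moreover have "{q. q = pr 0 (S.Dmu x) | q = pr 1 (x + 1)} = {pr 0 (S.Dmu x), pr 1 (x + 1)}" by auto
  ultimately have c: "coded_set ({q. q = pr 0 (S.Dmu x) | q = pr 1 (x + 1)} \<union>
     ({q. EX i u. pr i u \<in> elts s & True & q = pr (i + i + N3) u} \<union> {q. EX i u. pr i u \<in> elts s & vld x i & q = pr (i + i + N2) (f i)}))"
    by (intro coded_set_Un) simp_all
  show "elts (hF f x s) = {q. q = pr 0 (S.Dmu x) | q = pr 1 (x + 1) | (EX i u. pr i u \<in> elts s & q = pr (i + i + N3) u)
     | (EX i u. pr i u \<in> elts s & vld x i & q = pr (i + i + N2) (f i))}" "FinSet (hF f x s)"
    unfolding hF_def elts_code[OF c] using c by (auto simp del: pr_inject)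
qed

lemma dtm_hF:
  assumes f: "!!u h. dtm u ==> dtm (%e. f (u e) (%i. e (h i)))" and t: "dtm x" "dtm s"
  shows "dtm (%e. hF (%i. f i e) (x e) (s e))"
proof -
  have eq: "A \<union> B = {q. q \<in> A | q \<in> B}" for A B :: "N set" by auto
  show ?thesis unfolding hF_def eq mem_Collect_eq by (intro dfm_intros f dtm_ren[OF t(1)] dtm_ren[OF t(2)] dtm_Dmu)
qed

lemma hF_cong: "(!!i u. pr i u \<in> elts s ==> f i = g i) ==> hF f x s = hF g x s"
  unfolding hF_def by (intro arg_cong[of _ _ code] arg_cong2[of _ _ _ _ "(\<union>)"] refl Collect_cong) metis

lemma dH: "dtm (%e. Th (hF (fapp (e (Suc 0))) (pr1 (e 0)) (pr2 (e 0))))"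
  by (intro dtm_Th dtm_hF[of "%i e. fapp (e (Suc 0)) i"] dfm_intros)

lemma dtm_rk: "dtm t ==> dtm (%e. rk (t e))"
  unfolding rk_def by (intro dfm_intros dH)

lemma rk: "rk (pr x s) = Th (hF rk x s)"
proof -
  have "fapp (gr (pr x s) rk) i = rk i" if "pr i u \<in> elts s" for i u
  proof -
    have "i < pr x s" using elts_less[OF that] pr_ge1(1)[of i u] pr_ge1(2)[of s x] by (meson le_less_trans less_le_trans)
    then show ?thesis by (intro fapp_gr dtm_rk dfm_intros)
  qed
  then have "hF (fapp (gr (pr x s) rk)) x s = hF rk x s" by (rule hF_cong)
  then show ?thesis using recur_eq[OF dH, of "pr x s"] unfolding rk_def[symmetric] by simp
qed

abbreviation "he \<equiv> hF rk"

lemma df1_rk: "df1 rk" by (intro dtm_rk dfm_intros)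

lemma mem_he: "pr 0 z \<in> elts (he x s) <-> z = S.Dmu x" "pr 1 z \<in> elts (he x s) <-> z = x + 1"
  "pr (i + i + N3) z \<in> elts (he x s) <-> pr i z \<in> elts s"
  "pr (i + i + N2) z \<in> elts (he x s) <-> (EX u. pr i u \<in> elts s) & vld x i & z = rk i"
proof -
  note e = elts_hF[OF df1_rk, of x s]
  have n: "0 ~= i + i + N3" "0 ~= i + i + N2" "1 ~= i + i + N3" "1 ~= i + i + N2" for i :: N
  proof -
    show "0 ~= i + i + N3" "0 ~= i + i + N2" unfolding add.assoc[symmetric] by (rule numerals_distinct(1))+
    show "1 ~= i + i + N2" using pos_simps(2,3) by metis
    show "1 ~= i + i + N3" unfolding add.assoc[symmetric] by (simp only: numerals_distinct(4)) (simp add: numerals_distinct)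
  qed
  note n' = n n[symmetric]
  show "pr 0 z \<in> elts (he x s) <-> z = S.Dmu x" "pr 1 z \<in> elts (he x s) <-> z = x + 1"
    "pr (i + i + N3) z \<in> elts (he x s) <-> pr i z \<in> elts s"
    "pr (i + i + N2) z \<in> elts (he x s) <-> (EX u. pr i u \<in> elts s) & vld x i & z = rk i"
    by (simp only: e mem_Collect_eq pr_inject n' pos_simps(5-8) zero_neq_one one_neq_zero simp_thms; blast)+
qed

lemma he_pos: "p \<in> elts (he x s) ==> EX j z. p = pr j z & (j = 0 | j = 1 | (EX i u. pr i u \<in> elts s & (j = i + i + N3 | (j = i + i + N2 & vld x i))))"
  unfolding elts_hF[OF df1_rk] by blast

lemma sq_dom: assumes "sq Q y l s" shows "pr i u \<in> elts s <-> i < l & u = fapp s i"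
proof -
  have "s = gr l (fapp s)" using assms unfolding sq_def by blast
  then show ?thesis using pr_in_gr[of "fapp s" i u l] by (simp add: dfm_intros)
qed

lemma PF_he: assumes "sq Q y l s" shows "PF (%_. True) (he x s)"
  unfolding PF_def
proof (intro conjI allI impI TrueI)
  show "FinSet (he x s)" by (rule FinSet_hF[OF df1_rk])
  show "EX j z. p = pr j z" if "p \<in> elts (he x s)" for p using he_pos[OF that] by blast
  fix j z z' assume z: "pr j z \<in> elts (he x s) & pr j z' \<in> elts (he x s)"
  then consider "j = 0" | "j = 1" | i where "j = i + i + N3" | i where "j = i + i + N2" using he_pos[of "pr j z" x s] by auto
  then show "z = z'" using z by cases (auto simp only: mem_he sq_dom[OF assms])
qed

text \<open>The elements agree below the positions that belong to the length \<open>l\<close> of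
  \<open>s\<close>. There only the longer one is defined, first at \<open>2 l + 2\<close> if
  \<open>vld x l\<close> and at \<open>2 l + 3\<close> otherwise, and defined values precede
  undefined ones.\<close>

lemma he_ext:
  assumes s: "sq Q y l s" and t: "sq Q y k t" and st: "elts s \<subset> elts t" shows "lc WL (he x t) (he x s)"
proof -
  have sub: "i < l ==> i < k & fapp s i = fapp t i" for i using st sq_dom[OF s] sq_dom[OF t] by blast
  obtain p where p: "p \<in> elts t" "p \<notin> elts s" using st by blast
  have "p \<in> elts (gr k (fapp t))" using p t unfolding sq_def by simp
  then obtain i0 where i0: "p = pr i0 (fapp t i0)" "i0 < k" using elts_gr[of "fapp t" k] by (auto simp: dfm_intros)
  have lk: "l < k"
  proof (rule ccontr)
    assume "~ l < k" then have "i0 < l" using i0(2) by (meson less_le_trans not_less)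
    then show False using p i0 sq_dom[OF s] sub by simp
  qed
  have ag: "pr j z \<in> elts (he x t) <-> pr j z \<in> elts (he x s)" if j: "j < l + l + N2" for j z
  proof -
    consider "j = 0 | j = 1" | i where "j = i + i + N3 | j = i + i + N2" | "ALL z. pr j z \<notin> elts (he x t)" "ALL z. pr j z \<notin> elts (he x s)"
      using he_pos[of "pr j z" for z] by (metis pr_inject)
    then show ?thesis
    proof cases
      case 1 then show ?thesis using mem_he(1,2) by auto
    next
      case (2 i)
      have "i < l"
      proof (rule ccontr)
        assume "~ i < l" then have "l <= i" by simp
        then have "l + l <= i + i" by (intro add_mono)
        then have "l + l + N2 <= i + i + N2" by (simp only: add_le_cancel_right)
        moreover have "i + i + N2 < i + i + N3" by simp
        ultimately show False using j 2 by (meson less_le_trans less_irrefl less_trans le_less_trans)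
      qed
      then have "pr i u \<in> elts t <-> pr i u \<in> elts s" for u using sub sq_dom[OF s] sq_dom[OF t] by auto
      then show ?thesis using 2 mem_he(3,4) by auto
    qed blast
  qed
  have nl: "pr l u \<notin> elts s" and ul: "pr l (fapp t l) \<in> elts t" for u using sq_dom[OF s] sq_dom[OF t] lk by auto
  have "lca WL (if vld x l then l + l + N2 else l + l + N3) (he x t) (he x s)"
  proof (cases "vld x l")
    case True
    have "pr (l + l + N2) (rk l) \<in> elts (he x t)" unfolding mem_he(4) using ul True by blast
    moreover have "pr (l + l + N2) z \<notin> elts (he x s)" for z unfolding mem_he(4) using nl by blast
    ultimately show ?thesis unfolding lca_def using ag True by auto
  next
    case False
    have "pr (l + l + N3) (fapp t l) \<in> elts (he x t)" unfolding mem_he(3) by (rule ul)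
    moreover have "pr (l + l + N3) z \<notin> elts (he x s)" for z unfolding mem_he(3) by (rule nl)
    moreover have "pr j z \<in> elts (he x t) <-> pr j z \<in> elts (he x s)" if j: "j < l + l + N3" for j z
    proof (cases "j = l + l + N2")
      case True then show ?thesis using mem_he(4) False by simp
    next
      case False
      have "j <= l + l + N2" using j less_Suc[of j "l + l + N2"] by (simp only: add.assoc)
      then show ?thesis using ag False by (simp add: le_less)
    qed
    ultimately show ?thesis unfolding lca_def using False by auto
  qed
  then show ?thesis unfolding lc_def by blast
qed

lemma E_mct: "x \<in> X ==> E W WL (mct (S.Dmu x))"
  by (rule C.mc(1)[OF WW(1)]) (rule S.Dfield_Dmu[of XA])

lemma he_less_mct:
  assumes y: "y \<in> X" "x \<in> X" "pr y x \<in> R" shows "lc WL (he y s) (mct (S.Dmu x))"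
proof -
  have "WL (S.Dmu y) (S.Dmu x)" using S_Dmu_less[OF XA XL lin] y by blast
  then have "lca WL 0 (he y s) (mct (S.Dmu x))" unfolding lca_def using mem_he(1)[of "S.Dmu y" y s] by (auto simp: lab_def)
  then show ?thesis unfolding lc_def by blast
qed

text \<open>The claim is arithmetical, so ordinary induction on the code suffices. The rank of
  \<open>pr y t\<close> is below \<open>S.Dmu x\<close> because its argument \<open>he y t\<close>
  is below \<open>mct (S.Dmu x)\<close>, which \<open>Th\<close> maps to \<open>S.Dmu x\<close>.
  Longer sequences get smaller ranks by \<open>he_ext\<close>.\<close>

lemma E_he: "ALL x s l. k = pr x s --> x \<in> X --> sq Q x l s --> E W WL (he x s)"
proof (induction k rule: N_less_induct)
  case dfm show ?case by (intro dfm_intros dfm_mem X dfm_E WW dtm_hF[of "%i e. rk i"] dtm_rk)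
next
  case (less k)
  show ?case
  proof (intro allI impI)
    fix x s l assume k: "k = pr x s" and x: "x \<in> X" and s: "sq Q x l s"
    have v: "EX y t l'. i = pr y t & y \<in> X & pr y x \<in> R & sq Q y l' t & E W WL (he y t)"
      if "pr i u \<in> elts s" "vld x i" for i u
    proof -
      obtain y t l' where i: "i = pr y t" "y \<in> X" "pr y x \<in> R" "sq Q y l' t" using \<open>vld x i\<close> unfolding vld_def by blast
      have "i < k" unfolding k using elts_less[OF that(1)] pr_ge1(1)[of i u] pr_ge1(2)[of s x] by (meson le_less_trans less_le_trans)
      then show ?thesis using less i by blast
    qed
    have b: "br W WL (S.Dmu x) x l (he x s)"
      unfolding br_def
    proof (intro conjI allI impI)
      show "x \<in> X" "pr 1 (x + 1) \<in> elts (he x s)" using x mem_he(2) by auto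
      show "j = 0 | j = 1 | (EX i<l. j = i + i + N3 | j = i + i + N2 & vld x i)" if "pr j z \<in> elts (he x s)" for j z
        using he_pos[OF that] sq_dom[OF s] by auto
      show "EX z. pr (i + i + N3) z \<in> elts (he x s)" if "i < l" for i unfolding mem_he(3) using sq_dom[OF s] that by blast
      show "EX z. pr (i + i + N2) z \<in> elts (he x s)" if "i < l" "vld x i" for i unfolding mem_he(4) using sq_dom[OF s] that by blast
      show "pr x (pr z' z) \<in> Q" if "pr (i + i + N3) z \<in> elts (he x s) & pr (i + 1 + (i + 1) + N3) z' \<in> elts (he x s)" for i z z'
        using that s unfolding mem_he(3) sq_dom[OF s] sq_def by blast
      show "W z" "WL z (S.Dmu x)" if z: "pr (i + i + N2) z \<in> elts (he x s)" for i z
      proof -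
        obtain u where u: "pr i u \<in> elts s" "vld x i" "z = rk i" using z unfolding mem_he(4) by blast
        obtain y t l' where y: "i = pr y t" "y \<in> X" "pr y x \<in> R" "E W WL (he y t)" using v[OF u(1,2)] by blast
        have z: "z = Th (he y t)" using u(3) y(1) rk by simp
        show "W z" unfolding z by (rule Th[OF y(4)])
        show "WL z (S.Dmu x)" using Th_less[OF y(4) E_mct[OF x] he_less_mct[OF y(2) x y(3)]] Th_mct[OF x] z by simp
      qed
      fix y t t' z z'
      assume *: "elts t \<subset> elts t' & pr (pr y t + pr y t + N2) z \<in> elts (he x s) & pr (pr y t' + pr y t' + N2) z' \<in> elts (he x s)"
      obtain u u' where u: "pr (pr y t) u \<in> elts s" "vld x (pr y t)" "z = rk (pr y t)" "pr (pr y t') u' \<in> elts s" "vld x (pr y t')" "z' = rk (pr y t')"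
        using * unfolding mem_he(4) by blast
      obtain l1 where 1: "sq Q y l1 t" "E W WL (he y t)" using v[OF u(1,2)] unfolding pr_inject by blast
      obtain l2 where 2: "sq Q y l2 t'" "E W WL (he y t')" using v[OF u(4,5)] unfolding pr_inject by blast
      have "lc WL (he y t') (he y t)" using he_ext[OF 1(1) 2(1)] * by blast
      then show "WL z' z" unfolding u(3,6) rk by (rule Th_less[OF 2(2) 1(2)])
    qed
    moreover have "W (S.Dmu x)" by (rule S.Dfield_Dmu[of XA, OF x])
    moreover have "pr 0 (S.Dmu x) \<in> elts (he x s)" unfolding mem_he(1) ..
    ultimately show "E W WL (he x s)" unfolding E_def using PF_he[OF s] by blast
  qed
qed

text \<open>The ranks of the initial segments of a descending sequence for \<open>x\<close> would
  descend in \<open>W\<close>.\<close>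

lemma wfs_all: assumes w: "mwf W WL" and x: "x \<in> X" shows "wfs Q x"
proof (rule ccontr)
  assume "~ wfs Q x"
  then obtain g where g: "df1 g" "!!i. pr x (pr (g (i + 1)) (g i)) \<in> Q" using not_wfs by blast
  note s = sq_gr[OF g]
  have e: "E W WL (he x (gr n g))" for n using E_he x s by blast
  have less: "WL (Th (he x (gr (n + 1) g))) (Th (he x (gr n g)))" for n
    by (rule Th_less[OF e e he_ext[OF s s gr_mono[OF g(1)]]])
  define P where "P z <-> (EX n. z = rk (pr x (gr n g)))" for z
  have dP: "dp1 P" unfolding P_def by (intro dfm_intros dtm_rk dtm_sub1[OF g(1)])
  have PW: "W z" if "P z" for z using that Th[OF e] unfolding P_def rk by blast
  have "P (rk (pr x (gr 0 g)))" unfolding P_def by blast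
  then obtain z where z: "P z" "!!y. P y ==> ~ WL y z" using mwfD[OF w dP PW] by blast
  then show False using less unfolding P_def rk by blast
qed

end

theorem upper_imp_wfbar: assumes supper_statement shows wfbar
  unfolding wfbar_def
proof (intro ballI impI)
  fix X R Q x
  assume XR: "X \<in> SS" "R \<in> SS" "Q \<in> SS" "wellord X R" and x: "x \<in> X"
    and prog: "ALL x:X. (ALL y:X. pr y x \<in> R --> wfs Q y) --> wfs Q x"
  interpret tree X R Q by unfold_locales (rule XR)+
  let ?T = "concrete.FD E lc rnt spt mct"
  have T: "npdil ?T" by (rule concrete.npdil_FD[OF concrete_E])
  have "sndil ?T" unfolding sndil_def
    using concrete.snpd_FD[OF concrete_E] spwf_E prog by blast
  moreover obtain P where P: "P \<in> SS" "scoded P = ?T" using scoded_surj[OF concrete.defdil_FD[OF concrete_E]] by blast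
  ultimately obtain S Z where S: "S \<in> SS" "Z \<in> SS" "sup_der ?T (scoded S) Z" "spwf (scoded S)"
    using assms unfolding supper_statement_def by metis
  have nS: "npdil (scoded S)" using S(1,3) unfolding sup_der_def by unfold_locales (auto intro: defdil_scoded)
  have lin: "linord (%x. x \<in> X) (%x y. pr x y \<in> R)" using XR(4) unfolding wellord_def by blast
  interpret ranking X R Q "scoded S" Z
    using T nS S(2,3) lin unfolding sup_der_def ranking_def upder_def upder_axioms_def ranking_axioms_def
    by (intro conjI tree_axioms) blast+
  have "mwf (%x. x \<in> X) (%x y. pr x y \<in> R)" using XR(4) wellf_iff_mwf[OF XL] unfolding wellord_def by blast
  then show "wfs Q x" using wfs_all[OF S.spwf_mwf[OF S(4) XA XL lin] x] by blast
qed

theorem theorem5p9: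
  shows "ACA0 \<turnstile> sentence
    ((derivative_statement \<^bold>\<longleftrightarrow> upper_derivative_statement)
     \<^bold>\<and> (upper_derivative_statement \<^bold>\<longleftrightarrow> Pi11_bar_induction))"
  \<comment> \<open>The implications from (1) to (2), from (2) to \<open>wfbar\<close> and from
    \<open>wfbar\<close> to (1) form a cycle, and \<open>wfbar\<close> is equivalent to (3).\<close>
  using derivable_if_equivalent derivative_imp_upper wfbar_imp_derivative wfbar_imp_bar bar_imp_wfbar upper_imp_wfbar
  unfolding statement_def by blast

end
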